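(* Let $\beta\in(0,1/2)$, let $(L_t)_{t\in\mathbb{R}}$ be a two-sided Lévy process with $\mathbb{E}[L_1]=0$ and $\mathbb{E}[L_1^2]=1$, and let $\eta$ be a finite signed measure on $[0,\infty)$ with $\int_{[0,\infty)}u\,|\eta|(du)<\infty$. Set $h(z)=(-z)^{1-\beta}-\int_{[0,\infty)}e^{zu}\,\eta(du)$ for $\mathrm{Re}(z)\le0$, and suppose that $h(z)\ne0$ for every $z\in\mathbb{C}$ with $\mathrm{Re}(z)\le0$. Let $g:\mathbb{R}\to\mathbb{R}$ be the function in $L^2$, vanishing on $(-\infty,0)$, with $\mathcal{F}[g](y)=(-iy)^{-\beta}/h(iy)$, and let $X_t=\int_{-\infty}^t g(t-u)\,dL_u$, $t\in\mathbb{R}$ (the unique purely non-deterministic solution to the associated stochastic fractional delay differential equation). Then for any $s<t$, it holds that $$\mathbb{E}[X_t\mid X_u,\,u\le s]=g(t-s)X_s+\int_{[0,t-s)}\int_{-\infty}^sX_w\int_{[0,\infty)}\big(D^\beta_-\mathds{1}_{(s,t-u]}\big)(v+w)\,\eta(dv)\,dw\,g(du),$$ where $g(du)=\delta_0(du)+(D^\beta g)\ast\eta(u)\,du$ is the Lebesgue–Stieltjes measure (on $[0,\infty)$) induced by $g$.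
   Context: Complex powers: $z^\gamma=r^\gamma e^{i\gamma\theta}$ for $z=re^{i\theta}$, $r>0$, $\theta\in(-\pi,\pi]$ (principal branch). Write $x_+=\max\{x,0\}$, with $x_+^{-\beta}=0$ for $x\le 0$. $\delta_0$ is the Dirac measure at $0$. The Fourier transform is $\mathcal{F}[f](y)=\int_{\mathbb{R}}e^{iyu}f(u)\,du$ for $f\in L^1$ and is extended to $L^2$ by Plancherel's theorem. Under the stated condition on $h$ such a real-valued $g$ exists and is unique in $L^2$. For a suitable representative, the Marchaud fractional derivative $$D^\beta g(t)=\frac{\beta}{\Gamma(1-\beta)}\lim_{\delta\downarrow0}\int_\delta^\infty\frac{g(t)-g(t-u)}{u^{1+\beta}}\,du$$ exists for every $t>0$, and (extended by $0$ to $t\le0$) $D^\beta g\in L^1\cap L^2$ with $\mathcal{F}[D^\beta g](y)=1/h(iy)$; moreover $g(t)=1+\int_0^t(D^\beta g)\ast\eta(u)\,du$ for $t\ge0$. Here $f\ast\mu(t)=\int_{\mathbb{R}}f(t-u)\,\mu(du)$. For $a<b$, $\big(D^\beta_-\mathds{1}_{(a,b]}\big)(u)=\frac{1}{\Gamma(1-\beta)}\big[(b-u)_+^{-\beta}-(a-u)_+^{-\beta}\big]$, $u\in\mathbb{R}$. A two-sided Lévy process is $L_t=L^1_t$ for $t\ge0$ and $L_t=-L^2_{(-t)-}$ for $t<0$, where $(L^1_t)_{t\ge0}$ is a one-sided Lévy process and $L^2$ is an independent copy of it. For $f\in L^2$, $\int_{\mathbb{R}}f\,dL$ is the $L^2(\mathbb{P})$-limit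 of integrals of step functions, with $\mathbb{E}[(\int f\,dL)^2]=\mathbb{E}[L_1^2]\int f(u)^2\,du$. The stochastic fractional delay differential equation is: $X_t-X_s=\int_{-\infty}^t\big(D^\beta_-\mathds{1}_{(s,t]}\big)(u)\int_{[0,\infty)}X_{u-v}\,\eta(dv)\,du+L_t-L_s$ almost surely for each $s<t$; $(X_t)$ is a stationary process satisfying it. *)

theory Defs
  imports "HOL-Probability.Probability"
begin

section \<open>Square-integrable functions and the Fourier transform\<close>

definition square_integrable ::
    "'a measure \<Rightarrow> ('a \<Rightarrow> 'b::{real_normed_vector, second_countable_topology}) \<Rightarrow> bool" where
  "square_integrable M f \<longleftrightarrow> f \<in> borel_measurable M \<and> integrable M (\<lambda>x. (norm (f x))\<^sup>2)"

definition tendsto_L2 ::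
    "'a measure \<Rightarrow> (nat \<Rightarrow> 'a \<Rightarrow> 'b::real_normed_vector) \<Rightarrow> ('a \<Rightarrow> 'b) \<Rightarrow> bool" where
  "tendsto_L2 M \<phi> f \<longleftrightarrow> (\<lambda>n. \<integral>\<^sup>+x. ennreal ((norm (\<phi> n x - f x))\<^sup>2) \<partial>M) \<longlonglongrightarrow> 0"

definition fourier :: "(real \<Rightarrow> complex) \<Rightarrow> real \<Rightarrow> complex" where
  "fourier f y = (\<integral>u. exp (\<i> * of_real (y * u)) * f u \<partial>lborel)"

text \<open>
  The Fourier transform on \<open>L\<^sup>2\<close> is the continuous extension of \<^const>\<open>fourier\<close> from
  \<open>L\<^sup>1 \<inter> L\<^sup>2\<close>. It is determined only almost everywhere, hence a relation.
\<close>

definition has_L2_fourier :: "(real \<Rightarrow> complex) \<Rightarrow> (real \<Rightarrow> complex) \<Rightarrow> bool" where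
  "has_L2_fourier f F \<longleftrightarrow>
     square_integrable lborel f \<and> square_integrable lborel F \<and>
     (\<exists>\<phi>. (\<forall>n. integrable lborel (\<phi> n) \<and> square_integrable lborel (\<phi> n)) \<and>
          tendsto_L2 lborel \<phi> f \<and> tendsto_L2 lborel (\<lambda>n. fourier (\<phi> n)) F)"


section \<open>Finite signed measures\<close>

text \<open>
  A finite signed measure on the \<open>\<sigma>\<close>-algebra \<open>sets N\<close> is a real-valued set function; only
  the space and the sets of \<open>N\<close> are used. Integrals are taken with respect to the Jordan decomposition.
\<close>

definition finite_signed_measure :: "'a measure \<Rightarrow> ('a set \<Rightarrow> real) \<Rightarrow> bool" where
  "finite_signed_measure N \<nu> \<longleftrightarrow>
     \<nu> {} = 0 \<and>
     (\<forall>A :: nat \<Rightarrow> 'a set. range A \<subseteq> sets N \<longrightarrow> disjoint_family A \<longrightarrow>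
        (\<lambda>i. \<nu> (A i)) sums \<nu> (\<Union>i. A i))"

definition positive_variation :: "'a measure \<Rightarrow> ('a set \<Rightarrow> real) \<Rightarrow> 'a measure" where
  "positive_variation N \<nu> =
     measure_of (space N) (sets N) (\<lambda>A. SUP B\<in>{B \<in> sets N. B \<subseteq> A}. ennreal (\<nu> B))"

definition negative_variation :: "'a measure \<Rightarrow> ('a set \<Rightarrow> real) \<Rightarrow> 'a measure" where
  "negative_variation N \<nu> = positive_variation N (\<lambda>A. - \<nu> A)"

definition total_variation :: "'a measure \<Rightarrow> ('a set \<Rightarrow> real) \<Rightarrow> 'a measure" where
  "total_variation N \<nu> =
     measure_of (space N) (sets N)
       (\<lambda>A. emeasure (positive_variation N \<nu>) A + emeasure (negative_variation N \<nu>) A)"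

definition signed_integral ::
    "'a measure \<Rightarrow> ('a set \<Rightarrow> real) \<Rightarrow> ('a \<Rightarrow> 'b::{banach, second_countable_topology}) \<Rightarrow> 'b" where
  "signed_integral N \<nu> f =
     (\<integral>x. f x \<partial>positive_variation N \<nu>) - (\<integral>x. f x \<partial>negative_variation N \<nu>)"

abbreviation borel_nonneg :: "real measure" where
  "borel_nonneg \<equiv> restrict_space borel {0..}"

definition convolution :: "(real \<Rightarrow> real) \<Rightarrow> (real set \<Rightarrow> real) \<Rightarrow> real \<Rightarrow> real" where
  "convolution f \<eta> t = signed_integral borel_nonneg \<eta> (\<lambda>v. f (t - v))"


section \<open>Fractional derivatives\<close>

definition marchaud_derivative :: "real \<Rightarrow> (real \<Rightarrow> real) \<Rightarrow> real \<Rightarrow> real" where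
  "marchaud_derivative \<beta> g t =
     (if t \<le> 0 then 0
      else \<beta> / Gamma (1 - \<beta>) *
        Lim (at_right 0) (\<lambda>\<delta>. LINT u:{\<delta><..}|lborel. (g t - g (t - u)) / u powr (1 + \<beta>)))"

text \<open>
  \<open>D\<^sup>\<beta>\<^sub>- 1\<^bsub>(a,b]\<^esub>\<close>. Since \<^term>\<open>0 powr c = (0::real)\<close>, the terms vanish as soon as the
  positive part does.
\<close>

definition right_derivative_indicator :: "real \<Rightarrow> real \<Rightarrow> real \<Rightarrow> real \<Rightarrow> real" where
  "right_derivative_indicator \<beta> a b u =
     (max (b - u) 0 powr (- \<beta>) - max (a - u) 0 powr (- \<beta>)) / Gamma (1 - \<beta>)"


section \<open>The kernel\<close>

definition sfdde_h :: "real \<Rightarrow> (real set \<Rightarrow> real) \<Rightarrow> complex \<Rightarrow> complex" where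
  "sfdde_h \<beta> \<eta> z =
     (- z) powr of_real (1 - \<beta>) - signed_integral borel_nonneg \<eta> (\<lambda>u. exp (z * of_real u))"

text \<open>
  The kernel is an \<open>L\<^sup>2\<close>-class; continuity on \<open>[0,\<infinity>)\<close> together with vanishing on \<open>(-\<infinity>,0)\<close>
  selects the representative for which the pointwise values of the kernel and of its
  fractional derivative are meaningful.
\<close>

definition sfdde_kernel :: "real \<Rightarrow> (real set \<Rightarrow> real) \<Rightarrow> (real \<Rightarrow> real) \<Rightarrow> bool" where
  "sfdde_kernel \<beta> \<eta> g \<longleftrightarrow>
     square_integrable lborel g \<and>
     (\<forall>u<0. g u = 0) \<and>
     continuous_on {0..} g \<and>
     has_L2_fourier (\<lambda>u. complex_of_real (g u))
       (\<lambda>y. (- (\<i> * of_real y)) powr of_real (- \<beta>) / sfdde_h \<beta> \<eta> (\<i> * of_real y))"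

text \<open>\<open>\<integral>\<^sub>A F(u) g(du)\<close> for \<open>g(du) = \<delta>\<^sub>0(du) + (D\<^sup>\<beta> g) * \<eta>(u) du\<close>.\<close>

definition kernel_integral ::
    "real \<Rightarrow> (real set \<Rightarrow> real) \<Rightarrow> (real \<Rightarrow> real) \<Rightarrow> real set \<Rightarrow> (real \<Rightarrow> real) \<Rightarrow> real" where
  "kernel_integral \<beta> \<eta> g A F =
     (LINT u:A|return borel 0. F u) +
     (LINT u:A|lborel. F u * convolution (marchaud_derivative \<beta> g) \<eta> u)"


section \<open>L\'evy processes and integration with respect to them\<close>

text \<open>One-sided processes: only the values at times \<open>t \<ge> 0\<close> matter.\<close>

definition levy_process :: "'a measure \<Rightarrow> (real \<Rightarrow> 'a \<Rightarrow> real) \<Rightarrow> bool" where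
  "levy_process M Z \<longleftrightarrow>
     (\<forall>t\<ge>0. Z t \<in> borel_measurable M) \<and>
     (AE \<omega> in M. Z 0 \<omega> = 0) \<and>
     (\<forall>n (t :: nat \<Rightarrow> real). 0 \<le> t 0 \<longrightarrow> (\<forall>i<n. t i \<le> t (Suc i)) \<longrightarrow>
        prob_space.indep_vars M (\<lambda>_. borel) (\<lambda>i \<omega>. Z (t (Suc i)) \<omega> - Z (t i) \<omega>) {..<n}) \<and>
     (\<forall>s\<ge>0. \<forall>r\<ge>0. distr M borel (\<lambda>\<omega>. Z (s + r) \<omega> - Z s \<omega>) = distr M borel (Z r)) \<and>
     (AE \<omega> in M.
        (\<forall>t\<ge>0. ((\<lambda>r. Z r \<omega>) \<longlongrightarrow> Z t \<omega>) (at_right t)) \<and>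
        (\<forall>t>0. \<exists>l. ((\<lambda>r. Z r \<omega>) \<longlongrightarrow> l) (at_left t)))"

definition path :: "(real \<Rightarrow> 'a \<Rightarrow> real) \<Rightarrow> 'a \<Rightarrow> real \<Rightarrow> real" where
  "path Z \<omega> = (\<lambda>t\<in>{0..}. Z t \<omega>)"

abbreviation path_space :: "(real \<Rightarrow> real) measure" where
  "path_space \<equiv> PiM {0..} (\<lambda>_. borel)"

definition two_sided_levy_process :: "'a measure \<Rightarrow> (real \<Rightarrow> 'a \<Rightarrow> real) \<Rightarrow> bool" where
  "two_sided_levy_process M L \<longleftrightarrow>
     (\<forall>t. L t \<in> borel_measurable M) \<and>
     (\<exists>L1 L2. levy_process M L1 \<and> levy_process M L2 \<and>
        prob_space.indep_var M path_space (path L1) path_space (path L2) \<and>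
        distr M path_space (path L1) = distr M path_space (path L2) \<and>
        (AE \<omega> in M. \<forall>t. L t \<omega> =
           (if 0 \<le> t then L1 t \<omega> else - Lim (at_left (- t)) (\<lambda>r. L2 r \<omega>))))"

text \<open>A list of triples \<open>(c, a, b)\<close> with \<open>a \<le> b\<close> encodes the step function \<open>\<Sum> c 1\<^bsub>(a,b]\<^esub>\<close>.\<close>

definition step_fun :: "(real \<times> real \<times> real) list \<Rightarrow> real \<Rightarrow> real" where
  "step_fun xs u = (\<Sum>(c, a, b)\<leftarrow>xs. c * indicator {a<..b} u)"

definition step_integral ::
    "(real \<Rightarrow> 'a \<Rightarrow> real) \<Rightarrow> (real \<times> real \<times> real) list \<Rightarrow> 'a \<Rightarrow> real" where
  "step_integral L xs \<omega> = (\<Sum>(c, a, b)\<leftarrow>xs. c * (L b \<omega> - L a \<omega>))"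

text \<open>\<open>Y = \<integral> f dL\<close>; a relation, since the integral is defined only almost surely.\<close>

definition has_levy_integral ::
    "'a measure \<Rightarrow> (real \<Rightarrow> 'a \<Rightarrow> real) \<Rightarrow> (real \<Rightarrow> real) \<Rightarrow> ('a \<Rightarrow> real) \<Rightarrow> bool" where
  "has_levy_integral M L f Y \<longleftrightarrow>
     square_integrable lborel f \<and> square_integrable M Y \<and>
     (\<exists>\<phi>. (\<forall>n. \<forall>(c, a, b)\<in>set (\<phi> n). a \<le> b) \<and>
          tendsto_L2 lborel (\<lambda>n. step_fun (\<phi> n)) f \<and>
          tendsto_L2 M (\<lambda>n. step_integral L (\<phi> n)) Y)"

definition past_algebra :: "'a measure \<Rightarrow> (real \<Rightarrow> 'a \<Rightarrow> real) \<Rightarrow> real \<Rightarrow> 'a measure" where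
  "past_algebra M X s =
     sigma (space M) (\<Union>u\<in>{..s}. {X u -` A \<inter> space M | A. A \<in> sets borel})"

end

theory Submission
  imports Defs "HOL-Real_Asymp.Real_Asymp"
begin

text \<open>
  Let \<open>\<eta> = P - N\<close> be the Jordan decomposition and \<open>e = (x\<^sub>+\<^sup>-\<^sup>\<beta> * \<eta>) / \<Gamma>(1 - \<beta>)\<close>. Pairing the equation for the
  Fourier transform of \<open>g\<close> with Gaussian test functions, rather than inverting the transform, shows
  \<open>g = 1 + e * g\<close> on \<open>[0,\<infinity>)\<close>. The primitive of \<open>D\<^sup>\<beta> g\<close> is \<open>(x\<^sub>+\<^sup>-\<^sup>\<beta> * g) / \<Gamma>(1 - \<beta>)\<close>, so that
  \<open>\<rho> = (D\<^sup>\<beta> g) * \<eta>\<close> has the primitive \<open>e * g = g - 1\<close>, and \<open>\<delta>\<^sub>0 + \<rho>\<close> is the resolvent of \<open>e\<close>. This turns the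
  Volterra equation into
  \<open>g(T) g(x) + \<integral>\<^bsub>w\<le>0\<^esub> K\<^sub>T(w) g(w + x) dw = g(x + T)\<close> for \<open>x \<ge> 0\<close>, where \<open>K\<^bsub>t-s\<^esub>(w - s)\<close> is the factor of \<open>X\<^sub>w\<close> in the
  prediction formula. By the isometry the predictor is therefore the integral \<open>\<integral> 1\<^bsub>u\<le>s\<^esub> g(t - u) dL\<^sub>u\<close>, which
  differs from \<open>X\<^sub>t\<close> by an integral over increments of \<open>L\<close> after time \<open>s\<close>; these are orthogonal to the
  \<open>\<sigma>\<close>-algebra of the increments up to time \<open>s\<close>, which contains the \<open>\<sigma>\<close>-algebra of \<open>X\<close> up to null sets.
\<close>

section \<open>Jordan decomposition\<close>

text \<open>The obstacle on the analytic side is that \<open>x powr (- \<beta>)\<close>, and with it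
  \<open>e\<close>, need not be integrable on the half-line, while a square-integrable transform
  determines \<open>g\<close> only almost everywhere. The weight \<open>exp (- x)\<close> therefore
  replaces global integrability: being multiplicative it is respected by convolution, and Gaussians
  decay fast enough to be paired with every weighted function; continuity of \<open>g\<close> then
  upgrades the resulting identity to a pointwise one. The density \<open>\<rho>\<close> is
  controlled only locally and is cut off at a finite horizon, which by causality changes nothing
  before that horizon. The condition \<open>\<beta> < 1 / 2\<close> enters through the Marchaud
  integral: apart from its jump at 0 the kernel is Hoelder of order \<open>1 - \<beta>\<close>, so
  the integrand has size \<open>u powr (- 2 * \<beta>)\<close> near 0. On the probabilistic side a
  mixture of the \<open>X w\<close> is not built as a limit but recognised as a stochastic integral
  by its inner products, which reduces stochastic Fubini to Fubini for ordinary integrals.\<close>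

lemma finite_signed_measure_Un:
  assumes "finite_signed_measure N \<nu>" "A \<in> sets N" "B \<in> sets N" "A \<inter> B = {}"
  shows "\<nu> (A \<union> B) = \<nu> A + \<nu> B"
proof -
  have "(\<lambda>i. \<nu> (binaryset A B i)) sums \<nu> (\<Union>i. binaryset A B i)"
  proof -
    have "range (binaryset A B) \<subseteq> sets N" using assms by (simp add: range_binaryset_eq)
    moreover have "disjoint_family (binaryset A B)"
      unfolding disjoint_family_on_def binaryset_def using assms(4) by (simp add: Int_commute)
    ultimately show ?thesis using assms(1) unfolding finite_signed_measure_def by blast
  qed
  moreover have "(\<lambda>i. \<nu> (binaryset A B i)) sums (\<nu> A + \<nu> B)"
    using assms(1) by (intro binaryset_sums) (simp add: finite_signed_measure_def)
  ultimately show ?thesis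
    using sums_unique2 unfolding UN_binaryset_eq by blast
qed

text \<open>If \<open>\<nu>\<close> were unbounded, repeatedly splitting off a piece of size at least one while keeping
  \<open>\<nu>\<close> unbounded on the rest would give a divergent disjoint sum.\<close>

lemma finite_signed_measure_bounded:
  assumes \<nu>: "finite_signed_measure N \<nu>"
  shows "\<exists>C. \<forall>B\<in>sets N. \<bar>\<nu> B\<bar> \<le> C"
proof (rule ccontr)
  define U where "U A \<longleftrightarrow> A \<in> sets N \<and> (\<forall>C. \<exists>B\<in>sets N. B \<subseteq> A \<and> \<bar>\<nu> B\<bar> > C)" for A
  assume "\<not> ?thesis"
  then have top: "U (space N)"
    unfolding U_def using sets.sets_into_space by (metis not_le sets.top)
  have split: "\<exists>A'. U A' \<and> A' \<subseteq> A \<and> \<bar>\<nu> (A - A')\<bar> \<ge> 1" if A: "U A" for A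
  proof -
    \<comment> \<open>The threshold \<open>\<bar>\<nu> A\<bar> + 1\<close> makes both pieces large:
      \<open>\<nu> (A - B) = \<nu> A - \<nu> B\<close> also has absolute value at least 1, so
      whichever piece is bounded can be split off.\<close>
    obtain B where B: "B \<in> sets N" "B \<subseteq> A" "\<bar>\<nu> B\<bar> > \<bar>\<nu> A\<bar> + 1"
      using A unfolding U_def by blast
    have AN: "A \<in> sets N" using A by (simp add: U_def)
    have AB: "B \<union> (A - B) = A" using B(2) by blast
    have D: "\<nu> A = \<nu> B + \<nu> (A - B)"
      using finite_signed_measure_Un[OF \<nu> B(1) sets.Diff[OF AN B(1)] Diff_disjoint] unfolding AB .
    have "U B \<or> U (A - B)"
    proof (rule ccontr)
      assume "\<not> ?thesis"
      then obtain c d where c: "\<And>E. E \<in> sets N \<Longrightarrow> E \<subseteq> B \<Longrightarrow> \<bar>\<nu> E\<bar> \<le> c"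
        and d: "\<And>E. E \<in> sets N \<Longrightarrow> E \<subseteq> A - B \<Longrightarrow> \<bar>\<nu> E\<bar> \<le> d"
        unfolding U_def using AN B(1) sets.Diff[OF AN B(1)] by (meson not_less)
      obtain E where E: "E \<in> sets N" "E \<subseteq> A" "\<bar>\<nu> E\<bar> > c + d"
        using A unfolding U_def by blast
      have "\<nu> E = \<nu> (E \<inter> B) + \<nu> (E - B)"
        using finite_signed_measure_Un[OF \<nu> sets.Int[OF E(1) B(1)] sets.Diff[OF E(1) B(1)]
            Int_Diff_disjoint] unfolding Int_Diff_Un .
      moreover have "\<bar>\<nu> (E \<inter> B)\<bar> \<le> c" "\<bar>\<nu> (E - B)\<bar> \<le> d"
        using E B by (auto intro!: c d)
      ultimately show False using E(3) by linarith
    qed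
    then show ?thesis
    proof
      assume "U B" then show ?thesis using B D by (intro exI[of _ B]) auto
    next
      assume "U (A - B)"
      moreover have "A - (A - B) = B" using B(2) by blast
      ultimately show ?thesis using B D by (intro exI[of _ "A - B"]) auto
    qed
  qed
  define nxt where "nxt A = (SOME A'. U A' \<and> A' \<subseteq> A \<and> \<bar>\<nu> (A - A')\<bar> \<ge> 1)" for A
  have nxt: "U (nxt A)" "nxt A \<subseteq> A" "\<bar>\<nu> (A - nxt A)\<bar> \<ge> 1" if "U A" for A
    using someI_ex[OF split[OF that]] unfolding nxt_def by auto
  define S where "S n = (nxt ^^ n) (space N)" for n
  have US: "U (S n)" for n by (induction n) (auto simp: S_def top nxt)
  have Sdec: "S (Suc n) \<subseteq> S n" for n using nxt(2)[OF US[of n]] by (simp add: S_def)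
  have "disjoint_family (\<lambda>n. S n - S (Suc n))"
  proof -
    have "(S m - S (Suc m)) \<inter> (S n - S (Suc n)) = {}" if "m < n" for m n
      using lift_Suc_antimono_le[of S, OF Sdec, of "Suc m" n] that by auto
    then show ?thesis
      unfolding disjoint_family_on_def by (metis inf_commute linorder_neqE_nat)
  qed
  then have "(\<lambda>n. \<nu> (S n - S (Suc n))) sums \<nu> (\<Union>n. S n - S (Suc n))"
    using \<nu>[unfolded finite_signed_measure_def, THEN conjunct2, rule_format, of "\<lambda>n. S n - S (Suc n)"] US
    by (auto simp: U_def)
  then have "(\<lambda>n. \<nu> (S n - S (Suc n))) \<longlonglongrightarrow> 0"
    using summable_LIMSEQ_zero sums_summable by blast
  then have "\<forall>\<^sub>F n in sequentially. \<bar>\<nu> (S n - S (Suc n))\<bar> < 1"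
    by (auto dest: order_tendstoD(2)[OF tendsto_rabs, of _ _ _ 1])
  moreover have "\<bar>\<nu> (S n - S (Suc n))\<bar> \<ge> 1" for n
    using nxt(3)[OF US[of n]] by (simp add: S_def)
  ultimately show False by (auto simp: eventually_sequentially not_less[symmetric])
qed

text \<open>The mass of the whole space is at most the supremum whether or not the supremum is
  countably additive, because \<open>measure_of\<close> gives the zero measure when its set function
  is not a measure.\<close>

lemma finite_measure_positive_variation:
  assumes "finite_signed_measure N \<nu>"
  shows "finite_measure (positive_variation N \<nu>)"
proof
  obtain C where C: "\<And>B. B \<in> sets N \<Longrightarrow> \<bar>\<nu> B\<bar> \<le> C"
    using finite_signed_measure_bounded[OF assms] by blast
  let ?\<mu> = "\<lambda>A. SUP B\<in>{B \<in> sets N. B \<subseteq> A}. ennreal (\<nu> B)"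
  have "emeasure (positive_variation N \<nu>) (space N) \<le> ?\<mu> (space N)"
    unfolding positive_variation_def emeasure_measure_of_conv by auto
  also have "\<dots> \<le> ennreal C"
    by (intro SUP_least) (use C in \<open>auto intro!: ennreal_leI dest: abs_le_D1\<close>)
  finally show "emeasure (positive_variation N \<nu>) (space (positive_variation N \<nu>)) \<noteq> \<infinity>"
    unfolding positive_variation_def space_measure_of_conv by (metis ennreal_less_top infinity_ennreal_def leD)
qed

lemma finite_signed_measure_uminus:
  "finite_signed_measure N \<nu> \<Longrightarrow> finite_signed_measure N (\<lambda>A. - \<nu> A)"
  by (auto simp: finite_signed_measure_def intro!: sums_minus)

lemma sets_positive_variation [simp]: "sets (positive_variation N \<nu>) = sets N"
  by (simp add: positive_variation_def sets.sigma_sets_eq sets_measure_of_conv sets.space_closed)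

text \<open>The Jordan decomposition is transported to \<open>borel\<close>, so that no integrand has to be restricted
  to the half-line.\<close>

lemma signed_integral_borel_nonneg:
  assumes "finite_signed_measure borel_nonneg \<eta>"
  obtains P N where
    "finite_measure P" "finite_measure N" "sets P = sets borel" "sets N = sets borel"
    "AE v in P. 0 \<le> v" "AE v in N. 0 \<le> v"
    "\<And>f :: real \<Rightarrow> 'b :: {banach, second_countable_topology}. f \<in> borel_measurable borel \<Longrightarrow>
       signed_integral borel_nonneg \<eta> f = (\<integral>v. f v \<partial>P) - (\<integral>v. f v \<partial>N)"
    "\<And>f :: real \<Rightarrow> 'c :: {banach, second_countable_topology}. f \<in> borel_measurable borel \<Longrightarrow>
       signed_integral borel_nonneg \<eta> f = (\<integral>v. f v \<partial>P) - (\<integral>v. f v \<partial>N)"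
proof -
  let ?P = "positive_variation borel_nonneg \<eta>" and ?N = "negative_variation borel_nonneg \<eta>"
  have sN: "sets ?N = sets borel_nonneg" by (simp add: negative_variation_def)
  have mid: "(\<lambda>v. v) \<in> K \<rightarrow>\<^sub>M borel" if "sets K = sets borel_nonneg" for K :: "real measure"
    unfolding measurable_cong_sets[OF that refl] by (rule measurable_restrict_space1) simp
  have sp: "space K = {0..}" if "sets K = sets borel_nonneg" for K :: "real measure"
    using sets_eq_imp_space_eq[OF that] by (simp add: space_restrict_space)
  have fin: "finite_measure ?P" "finite_measure ?N"
    using assms finite_measure_positive_variation finite_signed_measure_uminus
    by (auto simp: negative_variation_def)
  \<comment> \<open>Proved for an arbitrary value type because it serves both integral formulas:
    real and complex integrands have to share the same pair \<open>P\<close>,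
    \<open>N\<close>.\<close>
  have I: "(\<integral>v. f v \<partial>distr K borel (\<lambda>v. v)) = (\<integral>v. f v \<partial>K)"
    if "sets K = sets borel_nonneg" "f \<in> borel_measurable borel"
    for K :: "real measure" and f :: "real \<Rightarrow> 'd :: {banach, second_countable_topology}"
    using that mid by (simp add: integral_distr)
  have ae: "AE v in distr K borel (\<lambda>v. v). 0 \<le> v" if "sets K = sets borel_nonneg" for K :: "real measure"
    using mid[OF that] sp[OF that] by (subst AE_distr_iff) (auto intro!: AE_I2)
  show thesis
  proof (rule that[of "distr ?P borel (\<lambda>v. v)" "distr ?N borel (\<lambda>v. v)"])
    show "finite_measure (distr ?P borel (\<lambda>v. v))" "finite_measure (distr ?N borel (\<lambda>v. v))"
      using fin sN mid by (simp_all add: finite_measure.finite_measure_distr)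
    show "AE v in distr ?P borel (\<lambda>v. v). 0 \<le> v" "AE v in distr ?N borel (\<lambda>v. v). 0 \<le> v"
      using ae sN by simp_all
  qed (simp_all add: signed_integral_def I sN)
qed

section \<open>Square-integrable functions\<close>

lemma square_integrable_measurable [measurable_dest]:
  "square_integrable M f \<Longrightarrow> f \<in> borel_measurable M"
  by (simp add: square_integrable_def)

lemma square_integrable_mult:
  fixes f g :: "'a \<Rightarrow> 'b :: {real_normed_field, banach, second_countable_topology}"
  assumes f: "square_integrable M f" and g: "square_integrable M g"
  shows "integrable M (\<lambda>x. f x * g x)"
proof (rule Bochner_Integration.integrable_bound)
  show "integrable M (\<lambda>x. (norm (f x))\<^sup>2 + (norm (g x))\<^sup>2)"
    using f g by (auto simp: square_integrable_def)
  show "(\<lambda>x. f x * g x) \<in> borel_measurable M" using f g by measurable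
  show "AE x in M. norm (f x * g x) \<le> norm ((norm (f x))\<^sup>2 + (norm (g x))\<^sup>2)"
  proof (rule AE_I2)
    fix x
    have "2 * (norm (f x) * norm (g x)) \<le> (norm (f x))\<^sup>2 + (norm (g x))\<^sup>2"
      using sum_squares_bound[of "norm (f x)" "norm (g x)"] by (simp add: mult.assoc)
    moreover have "0 \<le> norm (f x) * norm (g x)" by simp
    ultimately have "norm (f x) * norm (g x) \<le> (norm (f x))\<^sup>2 + (norm (g x))\<^sup>2"
      by linarith
    then show "norm (f x * g x) \<le> norm ((norm (f x))\<^sup>2 + (norm (g x))\<^sup>2)"
      by (simp add: norm_mult)
  qed
qed

lemma square_integrable_add:
  fixes f g :: "'a \<Rightarrow> 'b :: {real_normed_vector, second_countable_topology}"
  assumes f: "square_integrable M f" and g: "square_integrable M g"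
  shows "square_integrable M (\<lambda>x. f x + g x)"
  unfolding square_integrable_def
proof (intro conjI, goal_cases)
  case 2
  show ?case
  proof (rule Bochner_Integration.integrable_bound)
  show "integrable M (\<lambda>x. 2 * (norm (f x))\<^sup>2 + 2 * (norm (g x))\<^sup>2)"
    using f g by (auto simp: square_integrable_def)
  show "AE x in M. norm ((norm (f x + g x))\<^sup>2) \<le> norm (2 * (norm (f x))\<^sup>2 + 2 * (norm (g x))\<^sup>2)"
  proof (rule AE_I2)
    fix x
    have "(norm (f x + g x))\<^sup>2 \<le> (norm (f x) + norm (g x))\<^sup>2"
      by (intro power_mono norm_triangle_ineq) simp
    also have "\<dots> \<le> 2 * (norm (f x))\<^sup>2 + 2 * (norm (g x))\<^sup>2"
      using sum_squares_bound[of "norm (f x)" "norm (g x)"] by (simp add: power2_sum)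
    finally show "norm ((norm (f x + g x))\<^sup>2) \<le> norm (2 * (norm (f x))\<^sup>2 + 2 * (norm (g x))\<^sup>2)"
      by simp
  qed
  qed (use f g in measurable)
qed (use f g in measurable)

lemma square_integrable_mult_left:
  fixes f :: "'a \<Rightarrow> 'b :: {real_normed_field, second_countable_topology}"
  assumes "square_integrable M f"
  shows "square_integrable M (\<lambda>x. c * f x)"
  using assms by (auto simp: square_integrable_def norm_mult power_mult_distrib)

lemma square_integrable_diff:
  fixes f g :: "'a \<Rightarrow> 'b :: {real_normed_field, second_countable_topology}"
  assumes "square_integrable M f" and "square_integrable M g"
  shows "square_integrable M (\<lambda>x. f x - g x)"
  using square_integrable_add[OF assms(1) square_integrable_mult_left[OF assms(2), of "-1"]] by simp

lemma square_integrable_0 [simp]: "square_integrable M (\<lambda>x. 0)"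
  by (simp add: square_integrable_def)

lemma Cauchy_Schwarz_square_integrable:
  fixes f g :: "'a \<Rightarrow> 'b :: {real_normed_field, banach, second_countable_topology}"
  assumes f: "square_integrable M f" and g: "square_integrable M g"
  shows "(norm (\<integral>x. f x * g x \<partial>M))\<^sup>2 \<le> (\<integral>x. (norm (f x))\<^sup>2 \<partial>M) * (\<integral>x. (norm (g x))\<^sup>2 \<partial>M)"
proof -
  have [measurable]: "f \<in> borel_measurable M" "g \<in> borel_measurable M" using f g by measurable
  have "ennreal ((norm (\<integral>x. f x * g x \<partial>M))\<^sup>2) = (ennreal (norm (\<integral>x. f x * g x \<partial>M)))\<^sup>2"
    by (simp add: ennreal_power)
  also have "\<dots> \<le> (\<integral>\<^sup>+x. ennreal (norm (f x)) * ennreal (norm (g x)) \<partial>M)\<^sup>2"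
    using integral_norm_bound_ennreal[OF square_integrable_mult[OF f g]]
    by (intro power_mono) (auto simp: norm_mult ennreal_mult)
  also have "\<dots> \<le> (\<integral>\<^sup>+x. (ennreal (norm (f x)))\<^sup>2 \<partial>M) * (\<integral>\<^sup>+x. (ennreal (norm (g x)))\<^sup>2 \<partial>M)"
    by (rule Cauchy_Schwarz_nn_integral) auto
  also have "\<dots> = ennreal (\<integral>x. (norm (f x))\<^sup>2 \<partial>M) * ennreal (\<integral>x. (norm (g x))\<^sup>2 \<partial>M)"
    using f g by (simp add: ennreal_power nn_integral_eq_integral square_integrable_def)
  finally show ?thesis
    by (simp add: ennreal_mult[symmetric] mult_nonneg_nonneg)
qed

text \<open>By Cauchy-Schwarz the error is at most the mean square distance times the norm of
  \<open>g\<close>. This turns approximation, by integrable functions on the Fourier side or by step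
  functions on the stochastic side, into identities between pairings.\<close>

lemma tendsto_L2_integral_mult:
  fixes f g :: "'a \<Rightarrow> 'b :: {real_normed_field, banach, second_countable_topology}"
  assumes \<phi>: "\<And>n. square_integrable M (\<phi> n)" and f: "square_integrable M f"
    and g: "square_integrable M g" and lim: "tendsto_L2 M \<phi> f"
  shows "(\<lambda>n. \<integral>x. \<phi> n x * g x \<partial>M) \<longlonglongrightarrow> (\<integral>x. f x * g x \<partial>M)"
proof -
  define d where "d n = (\<integral>x. (norm (\<phi> n x - f x))\<^sup>2 \<partial>M)" for n
  define c where "c = (\<integral>x. (norm (g x))\<^sup>2 \<partial>M)"
  have sd: "square_integrable M (\<lambda>x. \<phi> n x - f x)" for n by (rule square_integrable_diff[OF \<phi> f])
  have "ennreal (d n) = (\<integral>\<^sup>+x. ennreal ((norm (\<phi> n x - f x))\<^sup>2) \<partial>M)" for n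
    using sd[of n] by (simp add: d_def nn_integral_eq_integral square_integrable_def)
  then have "(\<lambda>n. ennreal (d n)) \<longlonglongrightarrow> ennreal 0" using lim by (simp add: tendsto_L2_def)
  moreover have "0 \<le> d n" for n by (simp add: d_def)
  ultimately have d: "d \<longlonglongrightarrow> 0" by (subst (asm) tendsto_ennreal_iff) auto
  have "(norm ((\<integral>x. \<phi> n x * g x \<partial>M) - (\<integral>x. f x * g x \<partial>M)))\<^sup>2 \<le> d n * c" for n
  proof -
    have "(\<integral>x. \<phi> n x * g x \<partial>M) - (\<integral>x. f x * g x \<partial>M) = (\<integral>x. (\<phi> n x - f x) * g x \<partial>M)"
      by (subst Bochner_Integration.integral_diff[symmetric])
         (auto intro!: square_integrable_mult \<phi> f g simp: algebra_simps)
    then show ?thesis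
      using Cauchy_Schwarz_square_integrable[OF sd[of n] g] by (simp add: d_def c_def)
  qed
  then have "norm ((\<integral>x. \<phi> n x * g x \<partial>M) - (\<integral>x. f x * g x \<partial>M)) \<le> sqrt (d n * c)" for n
    by (intro real_le_rsqrt)
  moreover have "(\<lambda>n. sqrt (d n * c)) \<longlonglongrightarrow> 0"
    using tendsto_real_sqrt[OF tendsto_mult_right[OF d, of c]] by simp
  ultimately have "(\<lambda>n. (\<integral>x. \<phi> n x * g x \<partial>M) - (\<integral>x. f x * g x \<partial>M)) \<longlonglongrightarrow> 0"
    by - (rule Lim_null_comparison[OF always_eventually[OF allI]])
  then show ?thesis by (rule LIM_zero_cancel)
qed

text \<open>Cauchy-Schwarz with respect to the finite measure \<open>\<bar>K w\<bar> dw\<close>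
  keeps a mixture of a family bounded in mean square inside the square-integrable functions. Since
  \<open>M\<close> is arbitrary, the same statement covers the random variables \<open>X w\<close>
  and their deterministic kernels, so both sides of the isometry can be mixed in parallel.\<close>

lemma square_integrable_integral_bound:
  fixes X :: "real \<Rightarrow> 'a \<Rightarrow> real"
  assumes M: "sigma_finite_measure M"
    and X[measurable]: "(\<lambda>(w, x). X w x) \<in> borel_measurable (borel \<Otimes>\<^sub>M M)"
    and XB: "\<And>w. (\<integral>\<^sup>+x. ennreal ((X w x)\<^sup>2) \<partial>M) \<le> ennreal B"
    and K: "integrable lborel K"
    and Z: "square_integrable M Z"
  shows "square_integrable M (\<lambda>x. \<integral>w. X w x * K w \<partial>lborel)" (is ?A)
    and "(\<integral>x. (\<integral>w. X w x * K w \<partial>lborel) * Z x \<partial>M) = (\<integral>w. (\<integral>x. X w x * Z x \<partial>M) * K w \<partial>lborel)" (is ?B)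
    and "AE x in M. integrable lborel (\<lambda>w. X w x * K w)" (is ?C)
proof -
  interpret M: sigma_finite_measure M by fact
  interpret LM: pair_sigma_finite lborel M ..
  have Km[measurable]: "K \<in> borel_measurable borel" using K by simp
  have Zm[measurable]: "Z \<in> borel_measurable M" using Z by measurable
  define k where "k = (\<integral>\<^sup>+w. ennreal \<bar>K w\<bar> \<partial>lborel)"
  have k: "k < \<infinity>" using K unfolding k_def by (simp add: integrable_iff_bounded)
  have Xw[measurable]: "X w \<in> borel_measurable M" for w by measurable
  have Xx[measurable]: "x \<in> space M \<Longrightarrow> (\<lambda>w. X w x) \<in> borel_measurable borel" for x by measurable
  have E1: "(\<integral>\<^sup>+x. (\<integral>\<^sup>+w. ennreal (\<bar>K w\<bar> * (X w x)\<^sup>2) \<partial>lborel) \<partial>M) \<le> k * ennreal B"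
  proof -
    have "(\<integral>\<^sup>+x. (\<integral>\<^sup>+w. ennreal (\<bar>K w\<bar> * (X w x)\<^sup>2) \<partial>lborel) \<partial>M)
        = (\<integral>\<^sup>+w. (\<integral>\<^sup>+x. ennreal (\<bar>K w\<bar> * (X w x)\<^sup>2) \<partial>M) \<partial>lborel)"
      by (rule LM.Fubini') measurable
    also have "\<dots> = (\<integral>\<^sup>+w. ennreal \<bar>K w\<bar> * (\<integral>\<^sup>+x. ennreal ((X w x)\<^sup>2) \<partial>M) \<partial>lborel)"
      by (simp add: ennreal_mult nn_integral_cmult)
    also have "\<dots> \<le> (\<integral>\<^sup>+w. ennreal \<bar>K w\<bar> * ennreal B \<partial>lborel)"
      by (intro nn_integral_mono mult_left_mono XB) simp
    finally show ?thesis by (simp add: nn_integral_multc k_def)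
  qed
  \<comment> \<open>Half of the weight, \<open>sqrt \<bar>K w\<bar>\<close>, goes to each factor, so
    that only one factor contains \<open>X\<close>.\<close>
  have Y2: "(\<integral>\<^sup>+w. ennreal \<bar>X w x * K w\<bar> \<partial>lborel)\<^sup>2
      \<le> k * (\<integral>\<^sup>+w. ennreal (\<bar>K w\<bar> * (X w x)\<^sup>2) \<partial>lborel)" if "x \<in> space M" for x
  proof -
    have "(\<integral>\<^sup>+w. ennreal \<bar>X w x * K w\<bar> \<partial>lborel)
        = (\<integral>\<^sup>+w. ennreal (sqrt \<bar>K w\<bar>) * ennreal (sqrt \<bar>K w\<bar> * \<bar>X w x\<bar>) \<partial>lborel)"
      by (intro nn_integral_cong) (auto simp: ennreal_mult'[symmetric] abs_mult mult.assoc[symmetric])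
    moreover have "(\<integral>\<^sup>+w. ennreal (sqrt \<bar>K w\<bar>) * ennreal (sqrt \<bar>K w\<bar> * \<bar>X w x\<bar>) \<partial>lborel)\<^sup>2
        \<le> (\<integral>\<^sup>+w. (ennreal (sqrt \<bar>K w\<bar>))\<^sup>2 \<partial>lborel) * (\<integral>\<^sup>+w. (ennreal (sqrt \<bar>K w\<bar> * \<bar>X w x\<bar>))\<^sup>2 \<partial>lborel)"
      using that by (intro Cauchy_Schwarz_nn_integral) auto
    ultimately show ?thesis
      by (simp add: k_def ennreal_power power_mult_distrib)
  qed
  have E2: "(\<integral>\<^sup>+x. (\<integral>\<^sup>+w. ennreal \<bar>X w x * K w\<bar> \<partial>lborel)\<^sup>2 \<partial>M) \<le> k * (k * ennreal B)"
  proof -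
    have "(\<integral>\<^sup>+x. (\<integral>\<^sup>+w. ennreal \<bar>X w x * K w\<bar> \<partial>lborel)\<^sup>2 \<partial>M)
        \<le> (\<integral>\<^sup>+x. k * (\<integral>\<^sup>+w. ennreal (\<bar>K w\<bar> * (X w x)\<^sup>2) \<partial>lborel) \<partial>M)"
      by (intro nn_integral_mono Y2)
    also have "\<dots> = k * (\<integral>\<^sup>+x. (\<integral>\<^sup>+w. ennreal (\<bar>K w\<bar> * (X w x)\<^sup>2) \<partial>lborel) \<partial>M)"
      by (intro nn_integral_cmult) measurable
    finally show ?thesis by (rule order_trans) (intro mult_left_mono E1, simp)
  qed
  then have E2': "(\<integral>\<^sup>+x. (\<integral>\<^sup>+w. ennreal \<bar>X w x * K w\<bar> \<partial>lborel)\<^sup>2 \<partial>M) < \<infinity>"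
    by (rule order_le_less_trans) (use k in \<open>simp add: ennreal_mult_less_top\<close>)
  have Ym[measurable]: "(\<lambda>x. \<integral>w. X w x * K w \<partial>lborel) \<in> borel_measurable M"
    by measurable
  have pw: "ennreal (norm ((norm y)\<^sup>2)) = (ennreal (norm y))\<^sup>2" for y :: real
    by (simp add: ennreal_power)
  show A: ?A
    unfolding square_integrable_def
  proof (intro conjI Ym, unfold integrable_iff_bounded, intro conjI)
    have "(\<integral>\<^sup>+x. ennreal (norm ((norm (\<integral>w. X w x * K w \<partial>lborel))\<^sup>2)) \<partial>M)
       \<le> (\<integral>\<^sup>+x. (\<integral>\<^sup>+w. ennreal \<bar>X w x * K w\<bar> \<partial>lborel)\<^sup>2 \<partial>M)"
    proof (intro nn_integral_mono)
      fix x
      have "ennreal (norm ((norm (\<integral>w. X w x * K w \<partial>lborel))\<^sup>2)) = (ennreal (norm (\<integral>w. X w x * K w \<partial>lborel)))\<^sup>2"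
        by (rule pw)
      \<comment> \<open>Where the inner integral diverges its value is 0, so the estimate holds at
        every point and not only almost everywhere.\<close>
      also have "\<dots> \<le> (\<integral>\<^sup>+w. ennreal \<bar>X w x * K w\<bar> \<partial>lborel)\<^sup>2"
      proof (intro power_mono, cases "integrable lborel (\<lambda>w. X w x * K w)")
        case True
        from integral_norm_bound_ennreal[OF this]
        show "ennreal (norm (\<integral>w. X w x * K w \<partial>lborel)) \<le> (\<integral>\<^sup>+w. ennreal \<bar>X w x * K w\<bar> \<partial>lborel)"
          unfolding real_norm_def .
      qed (auto simp: not_integrable_integral_eq)
      finally show "ennreal (norm ((norm (\<integral>w. X w x * K w \<partial>lborel))\<^sup>2)) \<le> (\<integral>\<^sup>+w. ennreal \<bar>X w x * K w\<bar> \<partial>lborel)\<^sup>2" .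
    qed
    then show "(\<integral>\<^sup>+x. ennreal (norm ((norm (\<integral>w. X w x * K w \<partial>lborel))\<^sup>2)) \<partial>M) < \<infinity>"
      using E2' by (rule order_le_less_trans)
  qed measurable
  show ?C
  proof -
    have "AE x in M. (\<integral>\<^sup>+w. ennreal \<bar>X w x * K w\<bar> \<partial>lborel)\<^sup>2 \<noteq> \<infinity>"
      using E2' by (intro nn_integral_PInf_AE) auto
    then show ?thesis
    proof (rule AE_mp, intro AE_I2 impI)
      fix x assume x: "x \<in> space M" and "(\<integral>\<^sup>+w. ennreal \<bar>X w x * K w\<bar> \<partial>lborel)\<^sup>2 \<noteq> \<infinity>"
      then have "(\<integral>\<^sup>+w. ennreal \<bar>X w x * K w\<bar> \<partial>lborel) < \<infinity>"
        by (auto simp: power_eq_top_ennreal less_top)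
      then show "integrable lborel (\<lambda>w. X w x * K w)"
        using x by (simp add: integrable_iff_bounded)
    qed
  qed
  have "integrable (lborel \<Otimes>\<^sub>M M) (\<lambda>(w, x). X w x * K w * Z x)"
    unfolding integrable_iff_bounded
  proof
    have "(\<integral>\<^sup>+p. ennreal (norm (case p of (w, x) \<Rightarrow> X w x * K w * Z x)) \<partial>(lborel \<Otimes>\<^sub>M M))
        = (\<integral>\<^sup>+x. (\<integral>\<^sup>+w. ennreal \<bar>X w x * K w * Z x\<bar> \<partial>lborel) \<partial>M)"
      by (subst LM.nn_integral_snd[symmetric]) auto
    also have "\<dots> \<le> (\<integral>\<^sup>+x. (\<integral>\<^sup>+w. ennreal (\<bar>K w\<bar> * (X w x)\<^sup>2) + ennreal \<bar>K w\<bar> * ennreal ((Z x)\<^sup>2) \<partial>lborel) \<partial>M)"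
    proof (intro nn_integral_mono)
      fix x w
      have "2 * (\<bar>X w x\<bar> * \<bar>Z x\<bar>) \<le> (X w x)\<^sup>2 + (Z x)\<^sup>2"
        using sum_squares_bound[of "\<bar>X w x\<bar>" "\<bar>Z x\<bar>"] by (simp add: mult.assoc)
      moreover have "0 \<le> \<bar>X w x\<bar> * \<bar>Z x\<bar>" by simp
      ultimately have "\<bar>X w x\<bar> * \<bar>Z x\<bar> \<le> (X w x)\<^sup>2 + (Z x)\<^sup>2" by linarith
      then have "\<bar>K w\<bar> * (\<bar>X w x\<bar> * \<bar>Z x\<bar>) \<le> \<bar>K w\<bar> * ((X w x)\<^sup>2 + (Z x)\<^sup>2)"
        by (intro mult_left_mono) auto
      then have "\<bar>X w x * K w * Z x\<bar> \<le> \<bar>K w\<bar> * (X w x)\<^sup>2 + \<bar>K w\<bar> * (Z x)\<^sup>2"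
        by (simp add: abs_mult algebra_simps)
      then show "ennreal \<bar>X w x * K w * Z x\<bar> \<le> ennreal (\<bar>K w\<bar> * (X w x)\<^sup>2) + ennreal \<bar>K w\<bar> * ennreal ((Z x)\<^sup>2)"
        by (simp add: ennreal_mult'[symmetric] ennreal_plus[symmetric] ennreal_leI del: ennreal_plus)
    qed
    also have "\<dots> = (\<integral>\<^sup>+x. (\<integral>\<^sup>+w. ennreal (\<bar>K w\<bar> * (X w x)\<^sup>2) \<partial>lborel) + k * ennreal ((Z x)\<^sup>2) \<partial>M)"
      by (intro nn_integral_cong) (simp add: nn_integral_add nn_integral_multc k_def)
    also have "\<dots> = (\<integral>\<^sup>+x. (\<integral>\<^sup>+w. ennreal (\<bar>K w\<bar> * (X w x)\<^sup>2) \<partial>lborel) \<partial>M) + k * (\<integral>\<^sup>+x. ennreal ((Z x)\<^sup>2) \<partial>M)"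
      by (simp add: nn_integral_add nn_integral_cmult)
    also have "\<dots> < \<infinity>"
    proof -
      have "(\<integral>\<^sup>+x. ennreal ((Z x)\<^sup>2) \<partial>M) < \<infinity>"
        using Z unfolding square_integrable_def integrable_iff_bounded by simp
      moreover have "(\<integral>\<^sup>+x. (\<integral>\<^sup>+w. ennreal (\<bar>K w\<bar> * (X w x)\<^sup>2) \<partial>lborel) \<partial>M) < \<infinity>"
        by (rule order_le_less_trans[OF E1]) (use k in \<open>simp add: ennreal_mult_less_top\<close>)
      ultimately show ?thesis using k by (simp add: ennreal_mult_less_top ennreal_add_less_top)
    qed
    finally show "(\<integral>\<^sup>+p. ennreal (norm (case p of (w, x) \<Rightarrow> X w x * K w * Z x)) \<partial>(lborel \<Otimes>\<^sub>M M)) < \<infinity>" .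
  qed measurable
  from LM.Fubini_integral[OF this]
  have "(\<integral>x. (\<integral>w. X w x * K w * Z x \<partial>lborel) \<partial>M) = (\<integral>w. (\<integral>x. X w x * K w * Z x \<partial>M) \<partial>lborel)"
    by simp
  moreover have "(\<integral>w. X w x * K w * Z x \<partial>lborel) = (\<integral>w. X w x * K w \<partial>lborel) * Z x" for x by simp
  moreover have "(\<integral>x. X w x * K w * Z x \<partial>M) = (\<integral>x. X w x * Z x \<partial>M) * K w" for w
    by (simp add: mult.assoc mult.commute[of "K w"]  flip: integral_mult_left_zero)
  ultimately show ?B by simp
qed

section \<open>Fractional powers and convolutions\<close>

text \<open>As \<open>0 powr s = 0\<close> also for negative \<open>s\<close>, this is the power of
  the positive part with value 0 on the whole nonpositive half-line; singular kernels can then be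
  integrated over the line without indicators.\<close>

definition pos_powr :: "real \<Rightarrow> real \<Rightarrow> real" where
  "pos_powr s x = max x 0 powr s"

lemma pos_powr_pos [simp]: "0 < x \<Longrightarrow> pos_powr s x = x powr s"
  and pos_powr_nonpos [simp]: "x \<le> 0 \<Longrightarrow> pos_powr s x = 0"
  and pos_powr_nonneg [simp]: "0 \<le> pos_powr s x"
  by (auto simp: pos_powr_def)

lemma measurable_pos_powr [measurable]: "pos_powr s \<in> borel_measurable borel"
  unfolding pos_powr_def by measurable

lemma pos_powr_mult_power: "pos_powr s x * x ^ n = pos_powr (s + real n) x"
  by (cases "0 < x") (auto simp: powr_add powr_realpow)

lemma Gamma_integral_pos_powr:
  assumes "0 < a"
  shows "has_bochner_integral lborel (\<lambda>x. pos_powr (a - 1) x * exp (- x)) (Gamma a)"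
proof (rule has_bochner_integral_nn_integral)
  have "(\<integral>\<^sup>+x. ennreal (pos_powr (a - 1) x * exp (- x)) \<partial>lborel)
      = (\<integral>\<^sup>+x. ennreal (indicator {0..} x * x powr (a - 1) / exp x) \<partial>lborel)"
    by (intro nn_integral_cong) (auto simp: indicator_def exp_minus field_simps not_le pos_powr_def)
  then show "(\<integral>\<^sup>+x. ennreal (pos_powr (a - 1) x * exp (- x)) \<partial>lborel) = ennreal (Gamma a)"
    using Gamma_conv_nn_integral_real[OF assms] by simp
  show "0 \<le> Gamma a" using assms by (simp add: less_imp_le Gamma_real_pos)
qed auto

text \<open>Expanding \<open>exp (c * x)\<close> and integrating term by term yields the binomial
  series of \<open>(1 - c) powr (- a)\<close>, because \<open>Gamma (a + n)\<close> is a Pochhammer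
  symbol times \<open>Gamma a\<close>. The condition on \<open>c\<close> is the disc of convergence
  of that series.\<close>

lemma Gamma_integral_cexp_disc:
  fixes c :: complex
  assumes a: "0 < a" and c: "norm c < 1"
  shows "has_bochner_integral lborel (\<lambda>x. of_real (pos_powr (a - 1) x * exp (- x)) * exp (c * of_real x))
           (of_real (Gamma a) * (1 - c) powr (- of_real a))"
proof -
  define f where "f n x = of_real (pos_powr (a + real n - 1) x * exp (- x)) * (c ^ n / fact n)" for n and x :: real
  have G: "Gamma (a + real n) = pochhammer a n * Gamma a" for n
  proof -
    have "a \<notin> \<int>\<^sub>\<le>\<^sub>0" using a nonpos_Ints_nonpos[of a] by linarith
    then show ?thesis using pochhammer_Gamma[of a n] Gamma_real_pos[OF a] by simp
  qed
  have binom: "(\<lambda>n. of_real (pochhammer a n) / fact n * z ^ n) sums (1 - z) powr (- of_real a)"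
    if "norm z < 1" for z :: complex
  proof -
    have "(- of_real a gchoose n) * (- z) ^ n = of_real (pochhammer a n) / fact n * z ^ n" for n
    proof -
      have "(- of_real a gchoose n) * (- z) ^ n
          = ((- 1) ^ n * (- 1) ^ n) * (pochhammer (of_real a) n / fact n * z ^ n)"
        unfolding gbinomial_pochhammer power_minus[of z] by simp
      also have "(- 1) ^ n * (- 1) ^ n = (1 :: complex)"
        by (simp flip: power_mult_distrib)
      finally show ?thesis by (simp add: pochhammer_of_real)
    qed
    then show ?thesis using gen_binomial_complex[of "- z" "- of_real a"] that by simp
  qed
  have fi: "has_bochner_integral lborel (f n) (of_real (Gamma (a + real n)) * (c ^ n / fact n))" for n
    unfolding f_def using a Gamma_integral_pos_powr[of "a + real n"]
    by (intro has_bochner_integral_mult_left has_bochner_integral_of_real) auto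
  have nf: "norm (f n x) = (pos_powr (a + real n - 1) x * exp (- x)) * (norm c ^ n / fact n)" for n x
    by (simp add: f_def norm_mult norm_divide norm_power)
  have nfi: "(\<integral>x. norm (f n x) \<partial>lborel) = Gamma (a + real n) * (norm c ^ n / fact n)" for n
    unfolding nf using a Gamma_integral_pos_powr[of "a + real n"]
    by (intro has_bochner_integral_integral_eq has_bochner_integral_mult_left) auto
  \<comment> \<open>The integrals of the absolute values form the same binomial series at the real
    point \<open>norm c\<close>, so its convergence justifies the exchange.\<close>
  have "summable (\<lambda>n. complex_of_real (pochhammer a n / fact n * norm c ^ n))"
    using sums_summable[OF binom[of "of_real (norm c)"]] c by simp
  then have "summable (\<lambda>n. pochhammer a n / fact n * norm c ^ n)"
    unfolding summable_of_real_iff .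
  then have sum1: "summable (\<lambda>n. \<integral>x. norm (f n x) \<partial>lborel)"
    unfolding nfi G by (auto dest: summable_mult[of _ "Gamma a"] simp: field_simps)
  have expf: "(\<lambda>n. f n x) sums (of_real (pos_powr (a - 1) x * exp (- x)) * exp (c * of_real x))" for x
  proof -
    have "f n x = of_real (pos_powr (a - 1) x * exp (- x)) * ((c * of_real x) ^ n /\<^sub>R fact n)" for n
      using pos_powr_mult_power[of "a - 1" x n]
      by (simp add: f_def algebra_simps power_mult_distrib scaleR_conv_of_real divide_simps flip: of_real_power
          of_real_mult)
    then show ?thesis using sums_mult[OF exp_converges[of "c * of_real x"]] by simp
  qed
  have sumn: "summable (\<lambda>n. norm (f n x))" for x
  proof -
    have "norm (f n x) = (pos_powr (a - 1) x * exp (- x)) * ((norm c * x) ^ n /\<^sub>R fact n)" for n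
      using pos_powr_mult_power[of "a - 1" x n]
      by (simp add: nf algebra_simps power_mult_distrib divide_simps)
    then show ?thesis using summable_mult[OF sums_summable[OF exp_converges[of "norm c * x"]]] by simp
  qed
  have int: "integrable lborel (f n)" for n using fi by (rule integrable.intros)
  have "(\<lambda>n. \<integral>x. f n x \<partial>lborel) sums (\<integral>x. (\<Sum>n. f n x) \<partial>lborel)"
    by (rule sums_integral[OF int _ sum1]) (use sumn in auto)
  moreover have "integrable lborel (\<lambda>x. \<Sum>n. f n x)"
    by (rule integrable_suminf[OF int _ sum1]) (use sumn in auto)
  moreover have "(\<lambda>n. \<integral>x. f n x \<partial>lborel) sums (of_real (Gamma a) * (1 - c) powr (- of_real a))"
    using sums_mult[OF binom[OF c], of "of_real (Gamma a)"]
    by (simp add: has_bochner_integral_integral_eq[OF fi] G field_simps)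
  ultimately show ?thesis
    using sums_unique[OF expf] sums_unique2 by (fastforce simp: has_bochner_integral_iff)
qed

text \<open>Rescaling \<open>x\<close> by a positive factor \<open>l\<close> replaces
  \<open>w\<close> by \<open>w / l\<close>, and every point of the open right half-plane can be
  brought into the unit disc around 1 in this way. The series case is then enough, without contour
  rotation or analytic continuation.\<close>

lemma Gamma_integral_cexp:
  fixes w :: complex
  assumes a: "0 < a" and w: "0 < Re w"
  shows "has_bochner_integral lborel (\<lambda>x. of_real (pos_powr (a - 1) x) * exp (- w * of_real x))
           (of_real (Gamma a) * w powr (- of_real a))"
proof -
  \<comment> \<open>This \<open>l\<close> minimises \<open>norm (1 - w / l)\<close>, with minimal
    square \<open>1 - (Re w / norm w)\<close> squared as the deviation from 1, hence a value below
    1.\<close>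
  define l where "l = (norm w)\<^sup>2 / Re w"
  have w0: "w \<noteq> 0" using w by auto
  then have l: "0 < l" using w by (simp add: l_def)
  define c where "c = 1 - w / of_real l"
  have "(norm c)\<^sup>2 = 1 - (Re w)\<^sup>2 / (norm w)\<^sup>2"
  proof -
    have "norm (w / of_real l) = norm w / l"
      using l by (simp add: norm_divide)
    also have "\<dots> = Re w / norm w"
      using w0 w by (simp add: l_def power2_eq_square)
    finally have "(norm (w / of_real l))\<^sup>2 = (Re w)\<^sup>2 / (norm w)\<^sup>2"
      by (simp add: power_divide)
    moreover have "Re (w / of_real l) = (Re w)\<^sup>2 / (norm w)\<^sup>2"
      using w0 w by (simp add: l_def power2_eq_square)
    moreover have "(norm (1 - z))\<^sup>2 = 1 - 2 * Re z + (norm z)\<^sup>2" for z :: complex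
      by (simp add: cmod_power2 power2_diff algebra_simps)
    ultimately show ?thesis unfolding c_def by simp
  qed
  also have "\<dots> < 1" using w w0 by simp
  finally have c: "norm c < 1" by (simp add: power2_less_1_iff abs_square_less_1)
  have "has_bochner_integral lborel (\<lambda>x. (of_real (pos_powr (a - 1) (0 + l * x) * exp (- (0
      + l * x))) * exp (c * of_real (0 + l * x))))
           ((of_real (Gamma a) * (1 - c) powr (- of_real a)) /\<^sub>R \<bar>l\<bar>)"
    using l Gamma_integral_cexp_disc[OF a c] by (subst lborel_has_bochner_integral_real_affine_iff[symmetric]) auto
  then have "has_bochner_integral lborel (\<lambda>x. of_real (l powr (1 - a)) * (of_real (pos_powr (a - 1) (0
      + l * x) * exp (- (0 + l * x))) * exp (c * of_real (0 + l * x))))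
           (of_real (l powr (1 - a)) * ((of_real (Gamma a) * (1 - c) powr (- of_real a)) /\<^sub>R \<bar>l\<bar>))"
    by (rule has_bochner_integral_mult_right)
  moreover have "of_real (l powr (1 - a)) * (of_real (pos_powr (a - 1) (0 + l * x) * exp (- (0
      + l * x))) * exp (c * of_real (0 + l * x)))
     = of_real (pos_powr (a - 1) x) * exp (- w * of_real x)" for x
  proof -
    have "l powr (1 - a) * pos_powr (a - 1) (l * x) = pos_powr (a - 1) x"
      using l by (cases "0 < x") (auto simp: powr_mult powr_add[symmetric] mult_le_0_iff not_less mult.assoc[symmetric])
    moreover have "complex_of_real (exp (- (l * x))) * exp (c * of_real (l * x)) = exp (- w * of_real x)"
      using l by (simp add: c_def exp_of_real[symmetric] mult_exp_exp algebra_simps)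
    ultimately show ?thesis
      by (metis (no_types, lifting) add_0 mult.assoc of_real_mult)
  qed
  moreover have "of_real (l powr (1 - a)) * ((of_real (Gamma a) * (1 - c) powr (- of_real a)) /\<^sub>R \<bar>l\<bar>)
      = of_real (Gamma a) * w powr (- of_real a)"
  proof -
    have "w powr (- of_real a) = (of_real l * (1 - c)) powr (- of_real a)"
      using l by (simp add: c_def)
    also have "\<dots> = of_real (l powr (- a)) * (1 - c) powr (- of_real a)"
      using l powr_of_real[of l "- a"] by (subst powr_times_real_left) auto
    also have "l powr (- a) = l powr (1 - a) / l"
      using l by (simp add: powr_diff powr_minus field_simps)
    finally show ?thesis using l by (simp add: scaleR_conv_of_real field_simps)
  qed
  ultimately show ?thesis by simp
qed


section \<open>Power integrals and complex powers on the imaginary axis\<close>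

lemma has_bochner_integral_pos_powr_from_0:
  assumes "-1 < s" "0 \<le> c"
  shows "has_bochner_integral lborel (\<lambda>x. indicator {..c} x * pos_powr s x) (c powr (s + 1) / (s + 1))"
proof (rule has_bochner_integral_nn_integral)
  have "(\<integral>\<^sup>+x. ennreal (indicator {..c} x * pos_powr s x) \<partial>lborel)
      = (\<integral>\<^sup>+x. ennreal (indicator {0..c} x * x powr s) \<partial>lborel)"
    by (intro nn_integral_cong) (auto simp: indicator_def pos_powr_def max_def)
  then show "(\<integral>\<^sup>+x. ennreal (indicator {..c} x * pos_powr s x) \<partial>lborel) = ennreal (c powr (s + 1) / (s + 1))"
    using nn_integral_has_integral_lebesgue[OF _ has_integral_powr_from_0[OF assms]] by simp
qed (use assms in auto)

lemma has_bochner_integral_pos_powr_to_inf: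
  assumes "s < -1" "0 < c"
  shows "has_bochner_integral lborel (\<lambda>x. indicator {c..} x * pos_powr s x) (- (c powr (s + 1)) / (s + 1))"
proof (rule has_bochner_integral_nn_integral)
  have "(\<integral>\<^sup>+x. ennreal (indicator {c..} x * pos_powr s x) \<partial>lborel)
      = (\<integral>\<^sup>+x. ennreal (indicator {c..} x * x powr s) \<partial>lborel)"
    using assms by (intro nn_integral_cong) (auto simp: indicator_def pos_powr_def max_def)
  then show "(\<integral>\<^sup>+x. ennreal (indicator {c..} x * pos_powr s x) \<partial>lborel) = ennreal (- (c powr (s + 1)) / (s + 1))"
    using nn_integral_has_integral_lebesgue[OF _ has_integral_powr_to_inf[OF assms]] by simp
qed (use assms in \<open>auto simp: divide_nonneg_neg divide_nonpos_neg\<close>)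

text \<open>The common majorant for all difference quotients of fractional order:
  \<open>min 1 x\<close> weakens the singularity at 0 to \<open>x powr (- b)\<close> and leaves
  \<open>x powr (- b - 1)\<close> at infinity.\<close>

lemma integrable_pos_powr_min:
  assumes "0 < b" "b < 1"
  shows "integrable lborel (\<lambda>x. pos_powr (- b - 1) x * min 1 x)"
proof (rule Bochner_Integration.integrable_bound)
  show "integrable lborel (\<lambda>x. indicator {..1} x * pos_powr (- b) x + indicator {1..} x * pos_powr (- b - 1) x)"
    using has_bochner_integral_pos_powr_from_0[of "- b" 1] has_bochner_integral_pos_powr_to_inf[of "- b - 1" 1] assms
    by (auto simp: has_bochner_integral_iff)
  show "AE x in lborel. norm (pos_powr (- b - 1) x * min 1 x)
      \<le> norm (indicator {..1} x * pos_powr (- b) x + indicator {1..} x * pos_powr (- b - 1) x)"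
  proof (rule AE_I2)
    fix x :: real
    consider "x \<le> 0" | "0 < x" "x \<le> 1" | "1 < x" by linarith
    then show "norm (pos_powr (- b - 1) x * min 1 x)
      \<le> norm (indicator {..1} x * pos_powr (- b) x + indicator {1..} x * pos_powr (- b - 1) x)"
    proof cases
      case 2
      then have "x powr (- b - 1) * x = x powr (- b)"
        using powr_add[of x "- b - 1" 1] by simp
      then show ?thesis using 2 by (simp add: min_def abs_mult)
    qed auto
  qed
qed measurable

lemma norm_one_minus_cexp_le:
  fixes z :: complex
  assumes "0 \<le> Re z"
  shows "norm (1 - exp (- z)) \<le> norm z" and "norm (1 - exp (- z)) \<le> 2"
proof -
  have "norm (exp (- 0) - exp (- z)) \<le> 1 * norm (0 - z)"
  proof (rule field_differentiable_bound[of "{z. 0 \<le> Re z}" "\<lambda>z. exp (- z)" "\<lambda>z. - exp (- z)"])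
    show "convex {z. 0 \<le> Re z}" by (rule convex_halfspace_Re_ge)
  qed (use assms in \<open>auto intro!: derivative_eq_intros\<close>)
  then show "norm (1 - exp (- z)) \<le> norm z" by simp
  have "exp (- Re z) \<le> 1" using assms by simp
  then show "norm (1 - exp (- z)) \<le> 2" using norm_triangle_ineq4[of 1 "exp (- z)"]
    unfolding norm_exp_eq_Re norm_one uminus_complex.sel by linarith
qed

lemma norm_one_minus_cexp_min:
  fixes w :: complex
  assumes "0 \<le> Re w" "0 \<le> x" "norm w \<le> C" "2 \<le> C"
  shows "norm (1 - exp (- w * of_real x)) \<le> C * min 1 x"
proof -
  have "norm (1 - exp (- (w * of_real x))) \<le> norm w * x"
    using norm_one_minus_cexp_le(1)[of "w * of_real x"] assms by (simp add: norm_mult)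
  also have "\<dots> \<le> C * x" using assms by (intro mult_right_mono) auto
  finally show ?thesis
    using norm_one_minus_cexp_le(2)[of "w * of_real x"] assms by (auto simp: min_def)
qed

lemma integrable_one_minus_cexp:
  fixes w :: complex
  assumes b: "0 < b" "b < 1" and w: "0 \<le> Re w"
  shows "integrable lborel (\<lambda>x. of_real (pos_powr (- b - 1) x) * (1 - exp (- w * of_real x)))"
proof (rule Bochner_Integration.integrable_bound)
  let ?C = "2 + norm w"
  show "integrable lborel (\<lambda>x. ?C * (pos_powr (- b - 1) x * min 1 x))"
    using integrable_pos_powr_min[OF b] by simp
  show "AE x in lborel. norm (of_real (pos_powr (- b - 1) x) * (1 - exp (- w * of_real x)))
      \<le> norm (?C * (pos_powr (- b - 1) x * min 1 x))"
  proof (rule AE_I2)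
    fix x :: real
    show "norm (of_real (pos_powr (- b - 1) x) * (1 - exp (- w * of_real x)))
      \<le> norm (?C * (pos_powr (- b - 1) x * min 1 x))"
    proof (cases "0 < x")
      case True
      have "norm (of_real (pos_powr (- b - 1) x) * (1 - exp (- w * of_real x)))
         = pos_powr (- b - 1) x * norm (1 - exp (- w * of_real x))"
        by (simp add: norm_mult)
      also have "\<dots> \<le> pos_powr (- b - 1) x * (?C * min 1 x)"
        using True w by (intro mult_left_mono norm_one_minus_cexp_min) auto
      also have "\<dots> \<le> norm (?C * (pos_powr (- b - 1) x * min 1 x))"
        using True by (simp add: abs_mult mult_ac)
      finally show ?thesis .
    qed auto
  qed
qed measurable

text \<open>Integration by parts: the derivative of \<open>F\<close> is the difference of the
  present integrand and the Gamma integrand of exponent \<open>1 - b\<close>, and \<open>F\<close>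
  vanishes at both ends of the half-line.\<close>

lemma integral_one_minus_cexp_Re_pos:
  fixes w :: complex
  assumes b: "0 < b" "b < 1" and w: "0 < Re w"
  shows "of_real b * (\<integral>x. of_real (pos_powr (- b - 1) x) * (1 - exp (- w * of_real x)) \<partial>lborel)
           = of_real (Gamma (1 - b)) * w powr (of_real b)"
proof -
  define f1 where "f1 x = of_real b * (of_real (pos_powr (- b - 1) x) * (1 - exp (- w * of_real x)))" for x :: real
  define f2 where "f2 x = w * (of_real (pos_powr (- b) x) * exp (- w * of_real x))" for x :: real
  define F where "F x = - (of_real (x powr (- b)) * (1 - exp (- w * of_real x)))" for x :: real
  have i1: "integrable lborel f1"
    unfolding f1_def using integrable_one_minus_cexp[OF b, of w] w by (intro integrable_mult_right) auto
  have w0: "w \<noteq> 0" using w by auto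
  have i2: "has_bochner_integral lborel f2 (of_real (Gamma (1 - b)) * w powr (of_real b))"
  proof -
    have "w * (of_real (Gamma (1 - b)) * w powr (of_real b - 1)) = of_real (Gamma (1 - b)) * w powr (of_real b)"
      using w0 by (simp add: powr_diff)
    moreover have "has_bochner_integral lborel f2 (w * (of_real (Gamma (1 - b)) * w powr (of_real b - 1)))"
      using has_bochner_integral_mult_right[OF Gamma_integral_cexp[of "1 - b" w], of w] b w
      unfolding f2_def by simp
    ultimately show ?thesis by argo
  qed
  have "(LBINT x=0..\<infinity>. f1 x - f2 x) = 0 - 0"
  proof (rule interval_integral_FTC_integrable[where F=F])
    fix x :: real assume "0 < ereal x"
    then have x: "0 < x" by simp
    have "((\<lambda>x. complex_of_real (x powr (- b))) has_vector_derivative of_real (- b * x powr (- b - 1))) (at x)"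
      using x by (intro has_vector_derivative_of_real) (auto intro!: derivative_eq_intros simp:
          has_real_derivative_iff_has_vector_derivative[symmetric])
    moreover have "((\<lambda>x. 1 - exp (- w * of_real x)) has_vector_derivative (w * exp (- w * of_real x))) (at x)"
      by (intro has_vector_derivative_real_field) (auto intro!: derivative_eq_intros)
    ultimately have "(F has_vector_derivative - (of_real (x powr (- b)) * (w * exp (- w * of_real x)) +
        of_real (- b * x powr (- b - 1)) * (1 - exp (- w * of_real x)))) (at x)"
      unfolding F_def by (intro has_vector_derivative_minus has_vector_derivative_mult)
    moreover have "- (of_real (x powr (- b)) * (w * exp (- w * of_real x)) +
        of_real (- b * x powr (- b - 1)) * (1 - exp (- w * of_real x))) = f1 x - f2 x"
      using x by (simp add: f1_def f2_def algebra_simps)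
    ultimately show "(F has_vector_derivative f1 x - f2 x) (at x)" by simp
    have "isCont (\<lambda>x. of_real b * (of_real (x powr (- b - 1)) * (1 - exp (- w * of_real x))) -
       w * (of_real (x powr (- b)) * exp (- w * of_real x))) x"
      using x by (intro continuous_intros) auto
    moreover have "\<forall>\<^sub>F y in nhds x. of_real b * (of_real (y powr (- b - 1)) * (1 - exp (- w * of_real y))) -
       w * (of_real (y powr (- b)) * exp (- w * of_real y)) = f1 y - f2 y"
      using eventually_nhds_in_open[of "{0<..}" x] x
      by (auto elim!: eventually_mono simp: f1_def f2_def)
    ultimately show "isCont (\<lambda>x. f1 x - f2 x) x"
      using isCont_cong by fast
  next
    show "set_integrable lborel (einterval 0 \<infinity>) (\<lambda>x. f1 x - f2 x)"
      unfolding set_integrable_def using i1 i2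
      by (intro integrable_mult_indicator Bochner_Integration.integrable_diff) (auto simp: has_bochner_integral_iff)
    \<comment> \<open>The factor \<open>min 1 x\<close> makes \<open>F\<close> of order
      \<open>x powr (1 - b)\<close> at 0 and \<open>x powr (- b)\<close> at infinity, so both
      boundary terms disappear.\<close>
    have nF: "norm (F x) \<le> (2 + norm w) * (x powr (- b) * min 1 x)" if "0 < x" for x
    proof -
      have "norm (F x) = x powr (- b) * norm (1 - exp (- w * of_real x))"
        by (simp add: F_def norm_mult)
      also have "\<dots> \<le> x powr (- b) * ((2 + norm w) * min 1 x)"
        using that w by (intro mult_left_mono norm_one_minus_cexp_min) auto
      finally show ?thesis by (simp add: mult_ac)
    qed
    have "((\<lambda>x. (2 + norm w) * x powr (1 - b)) \<longlongrightarrow> (2 + norm w) * 0) (at_right 0)"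
      using b by (intro tendsto_mult tendsto_const tendsto_zero_powrI[where b="1 - b"] tendsto_ident_at)
        (auto intro: eventually_at_right_less eventually_mono)
    moreover have "\<forall>\<^sub>F x in at_right 0. norm (F x) \<le> (2 + norm w) * x powr (1 - b)"
      using eventually_at_right_less[of "0::real"]
    proof eventually_elim
      case (elim x)
      have "x powr (- b) * min 1 x \<le> x powr (- b) * x" by (intro mult_left_mono) auto
      also have "\<dots> = x powr (1 - b)" using elim powr_add[of x "- b" 1] by simp
      finally have "(2 + norm w) * (x powr (- b) * min 1 x) \<le> (2 + norm w) * x powr (1 - b)"
        by (intro mult_left_mono) auto
      then show ?case using nF[OF elim] by linarith
    qed
    ultimately have "(F \<longlongrightarrow> 0) (at_right 0)"
      using Lim_null_comparison by fastforce
    then show "((F \<circ> real_of_ereal) \<longlongrightarrow> 0) (at_right 0)"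
      by (simp add: zero_ereal_def ereal_tendsto_simps)
    have "((\<lambda>x. (2 + norm w) * x powr (- b)) \<longlongrightarrow> (2 + norm w) * 0) at_top"
      using b by (intro tendsto_mult tendsto_const tendsto_neg_powr filterlim_ident) auto
    moreover have "\<forall>\<^sub>F x in at_top. norm (F x) \<le> (2 + norm w) * x powr (- b)"
      using eventually_gt_at_top[of "0::real"]
    proof eventually_elim
      case (elim x)
      have "(2 + norm w) * (x powr (- b) * min 1 x) \<le> (2 + norm w) * (x powr (- b) * 1)"
        by (intro mult_left_mono) auto
      then show ?case using nF[OF elim] by simp
    qed
    ultimately have "(F \<longlongrightarrow> 0) at_top"
      using Lim_null_comparison by fastforce
    then show "((F \<circ> real_of_ereal) \<longlongrightarrow> 0) (at_left \<infinity>)"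
      by (simp add: ereal_tendsto_simps)
  qed auto
  also have "(LBINT x=0..\<infinity>. f1 x - f2 x) = (\<integral>x. f1 x - f2 x \<partial>lborel)"
  proof -
    have "indicator {0<..} x *\<^sub>R (f1 x - f2 x) = f1 x - f2 x" for x
      by (cases "0 < x") (auto simp: f1_def f2_def)
    then show ?thesis
      unfolding interval_lebesgue_integral_0_infty set_lebesgue_integral_def by simp
  qed
  also have "\<dots> = (\<integral>x. f1 x \<partial>lborel) - (\<integral>x. f2 x \<partial>lborel)"
    using i1 i2 by (intro Bochner_Integration.integral_diff) (auto simp: has_bochner_integral_iff)
  finally show ?thesis
    using has_bochner_integral_integral_eq[OF i2] by (simp add: f1_def)
qed

text \<open>Boundary value of the half-plane identity along
  \<open>w n = 1 / (n + 1) - \<i> * y\<close>. Subtracting 1 keeps the integrand dominated by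
  \<open>min 1 x\<close> uniformly in \<open>n\<close>, whereas the plain Gamma integral does not
  converge absolutely on the axis. The point \<open>y = 0\<close> is separate, being the branch
  point of the power.\<close>

lemma integral_one_minus_iexp:
  assumes b: "0 < b" "b < 1"
  shows "of_real b * (\<integral>x. of_real (pos_powr (- b - 1) x) * (1 - exp (\<i> * of_real (y * x))) \<partial>lborel)
           = of_real (Gamma (1 - b)) * (- (\<i> * of_real y)) powr (of_real b)"
proof (cases "y = 0")
  case True
  then show ?thesis using b by simp
next
  case False
  define w where "w n = of_real (1 / real (Suc n)) - \<i> * of_real y" for n
  define w' where "w' = - (\<i> * of_real y)"
  have Rew: "0 < Re (w n)" for n by (simp add: w_def)
  have w: "w \<longlonglongrightarrow> w'"
  proof -
    have "(\<lambda>n. complex_of_real (1 / real (Suc n)) - \<i> * of_real y) \<longlonglongrightarrow> of_real 0 - \<i> * of_real y"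
      by (intro tendsto_intros LIMSEQ_Suc lim_1_over_n)
    then show ?thesis unfolding w_def[abs_def] w'_def by simp
  qed
  \<comment> \<open>It bounds \<open>norm (w n)\<close>, which is at most
    \<open>1 + \<bar>y\<bar>\<close>, and also the constant 2 required by
    \<open>norm_one_minus_cexp_min\<close>.\<close>
  let ?C = "3 + \<bar>y\<bar>"
  have wC: "norm (w n) \<le> ?C" for n
  proof -
    have "norm (w n) \<le> norm (complex_of_real (1 / real (Suc n))) + norm (\<i> * complex_of_real y)"
      unfolding w_def by (rule norm_triangle_ineq4)
    moreover have "norm (complex_of_real (1 / real (Suc n))) \<le> 1"
      by (simp add: norm_divide del: of_nat_Suc)
    ultimately show ?thesis by (simp add: norm_mult)
  qed
  have "(\<lambda>n. \<integral>x. of_real (pos_powr (- b - 1) x) * (1 - exp (- w n * of_real x)) \<partial>lborel)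
     \<longlonglongrightarrow> (\<integral>x. of_real (pos_powr (- b - 1) x) * (1 - exp (- w' * of_real x)) \<partial>lborel)"
  proof (rule integral_dominated_convergence[where w="\<lambda>x. ?C * (pos_powr (- b - 1) x * min 1 x)"])
    show "integrable lborel (\<lambda>x. ?C * (pos_powr (- b - 1) x * min 1 x))"
      using integrable_pos_powr_min[OF b] by simp
    show "AE x in lborel. (\<lambda>n. of_real (pos_powr (- b - 1) x) * (1 - exp (- w n * of_real x)))
      \<longlonglongrightarrow> of_real (pos_powr (- b - 1) x) * (1 - exp (- w' * of_real x))"
      by (intro AE_I2 tendsto_intros w)
    show "AE x in lborel. norm (of_real (pos_powr (- b - 1) x) * (1 - exp (- w n * of_real x)))
         \<le> ?C * (pos_powr (- b - 1) x * min 1 x)" for n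
    proof (rule AE_I2)
      fix x :: real
      show "norm (of_real (pos_powr (- b - 1) x) * (1 - exp (- w n * of_real x)))
         \<le> ?C * (pos_powr (- b - 1) x * min 1 x)"
      proof (cases "0 < x")
        case True
        have "norm (of_real (pos_powr (- b - 1) x) * (1 - exp (- w n * of_real x)))
           = pos_powr (- b - 1) x * norm (1 - exp (- w n * of_real x))"
          by (simp add: norm_mult)
        also have "\<dots> \<le> pos_powr (- b - 1) x * (?C * min 1 x)"
          using True Rew[of n] wC[of n] by (intro mult_left_mono norm_one_minus_cexp_min) auto
        finally show ?thesis by (simp add: mult_ac)
      qed auto
    qed
  qed auto
  then have "(\<lambda>n. of_real b * (\<integral>x. of_real (pos_powr (- b - 1) x) * (1 - exp (- w n * of_real x)) \<partial>lborel))
     \<longlonglongrightarrow> of_real b * (\<integral>x. of_real (pos_powr (- b - 1) x) * (1 - exp (- w' * of_real x)) \<partial>lborel)"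
    by (intro tendsto_mult tendsto_const)
  moreover have "(\<lambda>n. of_real (Gamma (1 - b)) * w n powr (of_real b)) \<longlonglongrightarrow> of_real (Gamma (1 - b)) * w' powr (of_real b)"
  proof (intro tendsto_mult tendsto_const tendsto_powr_complex w)
    show "w' \<notin> \<real>\<^sub>\<le>\<^sub>0" using False by (auto simp: w'_def complex_nonpos_Reals_iff)
  qed
  ultimately have "of_real b * (\<integral>x. of_real (pos_powr (- b - 1) x) * (1 - exp (- w' * of_real x)) \<partial>lborel)
     = of_real (Gamma (1 - b)) * w' powr (of_real b)"
    using integral_one_minus_cexp_Re_pos[OF b Rew] LIMSEQ_unique by fastforce
  moreover have "- w' * of_real x = \<i> * of_real (y * x)" for x by (simp add: w'_def mult.assoc)
  ultimately show ?thesis unfolding w'_def by (simp add: mult.assoc)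
qed

section \<open>Convolution of causal functions with an exponential weight\<close>

definition real_convolution :: "(real \<Rightarrow> real) \<Rightarrow> (real \<Rightarrow> real) \<Rightarrow> real \<Rightarrow> real" (infixl "\<circledast>" 70) where
  "(f \<circledast> g) t = (\<integral>u. f (t - u) * g u \<partial>lborel)"

text \<open>The weight admits \<open>x powr (- b)\<close> and other functions that are not
  integrable on the half-line. Because \<open>exp (- (u + z))\<close> factorises and causality
  leaves only nonnegative \<open>u\<close> and \<open>z\<close>, the class is closed under
  convolution.\<close>

definition causal_exp :: "(real \<Rightarrow> real) \<Rightarrow> bool" where
  "causal_exp f \<longleftrightarrow> f \<in> borel_measurable borel \<and> (\<forall>u<0. f u = 0) \<and> integrable lborel (\<lambda>u. exp (- u) * f u)"

lemma causal_expD: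
  assumes "causal_exp f"
  shows "f \<in> borel_measurable borel" "\<And>u. u < 0 \<Longrightarrow> f u = 0" "integrable lborel (\<lambda>u. exp (- u) * f u)"
  using assms by (auto simp: causal_exp_def)

lemma nn_integral_shift:
  fixes c :: real
  assumes "f \<in> borel_measurable borel"
  shows "(\<integral>\<^sup>+x. f (x + c) \<partial>lborel) = (\<integral>\<^sup>+x. f x \<partial>lborel)"
    and "(\<integral>\<^sup>+x. f (c + x) \<partial>lborel) = (\<integral>\<^sup>+x. f x \<partial>lborel)"
    and "(\<integral>\<^sup>+x. f (x - c) \<partial>lborel) = (\<integral>\<^sup>+x. f x \<partial>lborel)"
    and "(\<integral>\<^sup>+x. f (c - x) \<partial>lborel) = (\<integral>\<^sup>+x. f x \<partial>lborel)"
  using nn_integral_real_affine[OF assms, of 1 c] nn_integral_real_affine[OF assms, of 1 "- c"]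
    nn_integral_real_affine[OF assms, of "- 1" c] by (simp_all add: add.commute)

lemma integral_shift:
  fixes c :: real and f :: "real \<Rightarrow> 'a :: {banach, second_countable_topology}"
  shows "(\<integral>x. f (x + c) \<partial>lborel) = (\<integral>x. f x \<partial>lborel)"
    and "(\<integral>x. f (c + x) \<partial>lborel) = (\<integral>x. f x \<partial>lborel)"
    and "(\<integral>x. f (x - c) \<partial>lborel) = (\<integral>x. f x \<partial>lborel)"
    and "(\<integral>x. f (c - x) \<partial>lborel) = (\<integral>x. f x \<partial>lborel)"
  using lborel_integral_real_affine[of 1 f c] lborel_integral_real_affine[of 1 f "- c"]
    lborel_integral_real_affine[of "- 1" f c] by (simp_all add: add.commute)

lemma integrable_shift:
  fixes c :: real and f :: "real \<Rightarrow> 'a :: {banach, second_countable_topology}"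
  shows "integrable lborel (\<lambda>x. f (x + c)) \<longleftrightarrow> integrable lborel f"
    and "integrable lborel (\<lambda>x. f (c + x)) \<longleftrightarrow> integrable lborel f"
    and "integrable lborel (\<lambda>x. f (x - c)) \<longleftrightarrow> integrable lborel f"
    and "integrable lborel (\<lambda>x. f (c - x)) \<longleftrightarrow> integrable lborel f"
  using lborel_integrable_real_affine_iff[of 1 f c] lborel_integrable_real_affine_iff[of 1 f "- c"]
    lborel_integrable_real_affine_iff[of "- 1" f c] by (simp_all add: add.commute)

lemma real_convolution_commute: "f \<circledast> g = g \<circledast> f"
proof
  fix t
  have "(f \<circledast> g) t = (\<integral>u. f (t - (t - u)) * g (t - u) \<partial>lborel)"
    unfolding real_convolution_def by (rule integral_shift(4)[symmetric])
  then show "(f \<circledast> g) t = (g \<circledast> f) t" by (simp add: real_convolution_def mult.commute)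
qed

lemma real_convolution_measurable [measurable (raw)]:
  assumes "f \<in> borel_measurable borel" "g \<in> borel_measurable borel"
  shows "(f \<circledast> g) \<in> borel_measurable borel"
  unfolding real_convolution_def using assms by measurable

lemma real_convolution_causal:
  assumes "\<And>u. u < 0 \<Longrightarrow> f u = 0" "\<And>u. u < 0 \<Longrightarrow> g u = 0" "t < 0"
  shows "(f \<circledast> g) t = 0"
proof -
  have z: "f (t - u) * g u = 0" for u using assms(1)[of "t - u"] assms(2)[of u] assms(3) by (cases "u < 0") auto
  show ?thesis unfolding real_convolution_def z by simp
qed

text \<open>For \<open>k x = h (T - x)\<close> this is the associativity of the convolution.\<close>

lemma causal_exp_convolution:
  assumes f: "causal_exp f" and g: "causal_exp g"
    and k: "k \<in> borel_measurable borel" "\<And>x. 0 \<le> x \<Longrightarrow> \<bar>k x\<bar> \<le> C * exp (- x)"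
  shows "integrable (lborel \<Otimes>\<^sub>M lborel) (\<lambda>(u, t). g u * f (t - u) * k t)"
    and "integrable lborel (\<lambda>t. (f \<circledast> g) t * k t)"
    and "(\<integral>u. g u * (\<integral>z. f z * k (u + z) \<partial>lborel) \<partial>lborel) = (\<integral>t. (f \<circledast> g) t * k t \<partial>lborel)"
    and "AE t in lborel. integrable lborel (\<lambda>u. f (t - u) * g u * k t)"
proof -
  note [measurable] = causal_expD(1)[OF f] causal_expD(1)[OF g] k(1)
  have C: "0 \<le> C" using k(2)[of 0] by (simp add: order_trans[OF abs_ge_zero])
  have fin: "(\<integral>\<^sup>+z. ennreal (exp (- z) * \<bar>f z\<bar>) \<partial>lborel) < \<infinity>" "(\<integral>\<^sup>+z. ennreal (exp (- z) * \<bar>g z\<bar>) \<partial>lborel) < \<infinity>"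
    using causal_expD(3)[OF f] causal_expD(3)[OF g] by (simp_all add: integrable_iff_bounded abs_mult)
  show int: "integrable (lborel \<Otimes>\<^sub>M lborel) (\<lambda>(u, t). g u * f (t - u) * k t)"
    unfolding integrable_iff_bounded
  proof
    have "(\<integral>\<^sup>+p. ennreal (norm (case p of (u, t) \<Rightarrow> g u * f (t - u) * k t)) \<partial>(lborel \<Otimes>\<^sub>M lborel))
        = (\<integral>\<^sup>+u. (\<integral>\<^sup>+t. ennreal \<bar>g u * f (t - u) * k t\<bar> \<partial>lborel) \<partial>lborel)"
      by (subst lborel.nn_integral_fst[symmetric]) auto
    also have "\<dots> = (\<integral>\<^sup>+u. (\<integral>\<^sup>+z. ennreal \<bar>g u * f z * k (u + z)\<bar> \<partial>lborel) \<partial>lborel)"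
    proof (rule nn_integral_cong)
      fix u
      show "(\<integral>\<^sup>+t. ennreal \<bar>g u * f (t - u) * k t\<bar> \<partial>lborel) = (\<integral>\<^sup>+z. ennreal \<bar>g u * f z * k (u + z)\<bar> \<partial>lborel)"
        by (subst nn_integral_shift(2)[of _ u, symmetric]) auto
    qed
    also have "\<dots> \<le> (\<integral>\<^sup>+u. (\<integral>\<^sup>+z. ennreal (C * (exp (- u) * \<bar>g u\<bar>)) * ennreal (exp (- z) * \<bar>f z\<bar>) \<partial>lborel) \<partial>lborel)"
    proof (intro nn_integral_mono)
      fix u z
      \<comment> \<open>Only nonnegative \<open>u\<close> and \<open>z\<close> contribute, and there
        the decay of \<open>k\<close> at \<open>u + z\<close> splits into the two weights.\<close>
      have "\<bar>g u * f z * k (u + z)\<bar> \<le> C * (exp (- u) * \<bar>g u\<bar>) * (exp (- z) * \<bar>f z\<bar>)"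
      proof (cases "u < 0 \<or> z < 0")
        case True
        then show ?thesis using causal_expD(2)[OF f] causal_expD(2)[OF g] C by auto
      next
        case False
        then have "\<bar>g u\<bar> * \<bar>f z\<bar> * \<bar>k (u + z)\<bar> \<le> \<bar>g u\<bar> * \<bar>f z\<bar> * (C * exp (- (u + z)))"
          by (intro mult_left_mono k(2)) auto
        then show ?thesis by (simp add: abs_mult mult_ac exp_add exp_diff exp_minus field_simps)
      qed
      then show "ennreal \<bar>g u * f z * k (u + z)\<bar> \<le> ennreal (C * (exp (- u) * \<bar>g u\<bar>)) * ennreal (exp (- z) * \<bar>f z\<bar>)"
        using C by (subst ennreal_mult[symmetric]) (auto intro!: ennreal_leI)
    qed
    also have "\<dots> = (ennreal C * (\<integral>\<^sup>+u. ennreal (exp (- u) * \<bar>g u\<bar>) \<partial>lborel)) * (\<integral>\<^sup>+z. ennreal (exp (- z)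
        * \<bar>f z\<bar>) \<partial>lborel)"
    proof -
      have "(\<integral>\<^sup>+u. ennreal (C * (exp (- u) * \<bar>g u\<bar>)) \<partial>lborel) = ennreal C * (\<integral>\<^sup>+u. ennreal (exp (- u) * \<bar>g u\<bar>) \<partial>lborel)"
        using C by (subst nn_integral_cmult[symmetric]) (auto simp: ennreal_mult)
      then show ?thesis by (simp add: nn_integral_cmult nn_integral_multc)
    qed
    also have "\<dots> < \<infinity>" using fin by (simp add: ennreal_mult_less_top)
    finally show "(\<integral>\<^sup>+p. ennreal (norm (case p of (u, t) \<Rightarrow> g u * f (t - u) * k t)) \<partial>(lborel \<Otimes>\<^sub>M lborel)) < \<infinity>" .
  qed measurable
  have eq: "(\<integral>u. g u * f (t - u) * k t \<partial>lborel) = (f \<circledast> g) t * k t" for t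
    by (simp add: real_convolution_def mult.commute[of "g _"])
  show "integrable lborel (\<lambda>t. (f \<circledast> g) t * k t)"
    using lborel_pair.integrable_snd[of "\<lambda>u t. g u * f (t - u) * k t"] int unfolding eq by simp
  have "(\<integral>u. (\<integral>t. g u * f (t - u) * k t \<partial>lborel) \<partial>lborel) = (\<integral>t. (\<integral>u. g u * f (t - u) * k t \<partial>lborel) \<partial>lborel)"
    using lborel_pair.Fubini_integral[OF int] by simp
  also have "(\<lambda>u. \<integral>t. g u * f (t - u) * k t \<partial>lborel) = (\<lambda>u. g u * (\<integral>z. f z * k (u + z) \<partial>lborel))"
  proof
    fix u
    have "(\<integral>t. g u * f (t - u) * k t \<partial>lborel) = (\<integral>z. g u * f (u + z - u) * k (u + z) \<partial>lborel)"
      by (rule integral_shift(2)[symmetric])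
    then show "(\<integral>t. g u * f (t - u) * k t \<partial>lborel) = g u * (\<integral>z. f z * k (u + z) \<partial>lborel)"
      by (simp add: mult.assoc)
  qed
  finally show "(\<integral>u. g u * (\<integral>z. f z * k (u + z) \<partial>lborel) \<partial>lborel) = (\<integral>t. (f \<circledast> g) t * k t \<partial>lborel)"
    unfolding eq .
  show "AE t in lborel. integrable lborel (\<lambda>u. f (t - u) * g u * k t)"
    using lborel_pair.AE_integrable_snd[of "\<lambda>u t. g u * f (t - u) * k t"] int by (simp add: mult.commute[of "g _"])
qed

lemma causal_exp_real_convolution:
  assumes "causal_exp f" "causal_exp g"
  shows "causal_exp (f \<circledast> g)"
  using causal_exp_convolution(2)[OF assms, of "\<lambda>x. exp (- x)" 1] real_convolution_causal[of f g]
    causal_expD[OF assms(1)] causal_expD[OF assms(2)]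
  by (auto simp: causal_exp_def mult.commute)

lemma causal_exp_diff:
  assumes "causal_exp f" "causal_exp g" shows "causal_exp (\<lambda>x. f x - g x)"
  using assms by (auto simp: causal_exp_def right_diff_distrib)

lemma causal_exp_cmult:
  assumes "causal_exp f" shows "causal_exp (\<lambda>x. c * f x)"
  using assms unfolding causal_exp_def by (auto simp: mult.left_commute[of _ c])

text \<open>From \<open>\<bar>g\<bar> \<le> 1 + g^2\<close>: the weight integrates the constant and
  square-integrability the rest.\<close>

lemma causal_exp_square_integrable:
  fixes g :: "real \<Rightarrow> real"
  assumes g: "square_integrable lborel g" and "\<And>u. u < 0 \<Longrightarrow> g u = 0"
  shows "causal_exp g"
  unfolding causal_exp_def
proof (intro conjI)
  have [measurable]: "g \<in> borel_measurable borel" using g by (simp add: square_integrable_def)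
  show "g \<in> borel_measurable borel" by fact
  show "integrable lborel (\<lambda>u. exp (- u) * g u)"
  proof (rule Bochner_Integration.integrable_bound)
    have "integrable lborel (\<lambda>x. indicator {0..} x * exp (- x) :: real)"
    proof (rule integrableI_nn_integral_finite)
      have "(\<integral>\<^sup>+x. ennreal (exp (- x)) * indicator {0..} x \<partial>lborel) = ennreal (0 - - exp (- 0))"
      proof (rule nn_integral_FTC_atLeast)
        have "((\<lambda>x::real. exp (- x)) \<longlongrightarrow> 0) at_top"
          by (intro filterlim_compose[OF exp_at_bot] filterlim_uminus_at_bot_at_top)
        then show "((\<lambda>x::real. - exp (- x)) \<longlongrightarrow> 0) at_top" using tendsto_minus by fastforce
      qed (auto intro!: derivative_eq_intros)
      moreover have "(\<integral>\<^sup>+x. ennreal (indicator {0..} x * exp (- x)) \<partial>lborel)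
          = (\<integral>\<^sup>+x. ennreal (exp (- x)) * indicator {0..} x \<partial>lborel)"
        by (intro nn_integral_cong) (auto simp: indicator_def)
      ultimately show "(\<integral>\<^sup>+x. ennreal (indicator {0..} x * exp (- x)) \<partial>lborel) = ennreal 1"
        by simp
    qed auto
    then show "integrable lborel (\<lambda>u. indicator {0..} u * exp (- u) + (norm (g u))\<^sup>2)"
      using g by (simp add: square_integrable_def)
    show "AE u in lborel. norm (exp (- u) * g u) \<le> norm (indicator {0..} u * exp (- u) + (norm (g u))\<^sup>2)"
    proof (rule AE_I2)
      fix u :: real
      show "norm (exp (- u) * g u) \<le> norm (indicator {0..} u * exp (- u) + (norm (g u))\<^sup>2)"
      proof (cases "u < 0")
        case False
        then have e: "exp (- u) \<le> 1" by simp
        have "exp (- u) * \<bar>g u\<bar> \<le> exp (- u) * (1 + (g u)\<^sup>2)"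
        proof (intro mult_left_mono)
          have "0 \<le> (\<bar>g u\<bar> - 1)\<^sup>2" by simp
          then have "2 * \<bar>g u\<bar> \<le> (g u)\<^sup>2 + 1" by (simp add: power2_diff)
          then show "\<bar>g u\<bar> \<le> 1 + (g u)\<^sup>2" using abs_ge_zero[of "g u"] by linarith
        qed simp
        also have "\<dots> \<le> exp (- u) + 1 * (g u)\<^sup>2"
          using e using mult_right_mono[OF e, of "(g u)\<^sup>2"] by (simp add: distrib_left)
        finally show ?thesis using False by (simp add: abs_mult)
      qed (simp add: assms)
    qed
  qed measurable
qed (use assms in auto)

section \<open>From the Fourier transform to a Volterra equation\<close>

lemma square_integrable_bounded:
  fixes f :: "'a \<Rightarrow> 'b :: {banach, second_countable_topology}"
  assumes f: "integrable M f" and B: "\<And>x. x \<in> space M \<Longrightarrow> norm (f x) \<le> B"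
  shows "square_integrable M f"
  unfolding square_integrable_def
proof
  show [measurable]: "f \<in> borel_measurable M" using f by simp
  show "integrable M (\<lambda>x. (norm (f x))\<^sup>2)"
  proof (rule Bochner_Integration.integrable_bound)
    show "integrable M (\<lambda>x. B * norm (f x))" using f by simp
    show "AE x in M. norm ((norm (f x))\<^sup>2) \<le> norm (B * norm (f x))"
    proof (rule AE_I2)
      fix x assume "x \<in> space M"
      then have "norm (f x) * norm (f x) \<le> B * norm (f x)"
        by (intro mult_right_mono B) auto
      then show "norm ((norm (f x))\<^sup>2) \<le> norm (B * norm (f x))"
        using mult_right_mono[OF abs_ge_self[of B] norm_ge_zero[of "f x"]]
        by (simp add: power2_eq_square abs_mult)
    qed
  qed measurable
qed

lemma integrable_pair_mult:
  fixes f :: "'a \<Rightarrow> 'c :: {real_normed_field, banach, second_countable_topology}"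
  assumes "sigma_finite_measure M" "sigma_finite_measure N" "integrable M f" "integrable N g"
  shows "integrable (M \<Otimes>\<^sub>M N) (\<lambda>(x, y). f x * g y)"
proof -
  interpret M: sigma_finite_measure M by fact
  interpret N: sigma_finite_measure N by fact
  interpret pair_sigma_finite M N ..
  have [measurable]: "f \<in> borel_measurable M" "g \<in> borel_measurable N" using assms by auto
  show ?thesis
  proof (rule Fubini_integrable)
    have "(\<integral>y. norm (case (x, y) of (x, y) \<Rightarrow> f x * g y) \<partial>N) = norm (f x) * (\<integral>y. norm (g y) \<partial>N)" for x
      by (simp add: norm_mult)
    then show "integrable M (\<lambda>x. \<integral>y. norm (case (x, y) of (x, y) \<Rightarrow> f x * g y) \<partial>N)"
      using assms by simp
  qed (use assms in auto)
qed

lemma square_integrable_of_real: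
  assumes "square_integrable M f" shows "square_integrable M (\<lambda>x. complex_of_real (f x))"
proof -
  have [measurable]: "f \<in> borel_measurable M" using assms by (simp add: square_integrable_def)
  have "(\<lambda>x. complex_of_real (f x)) \<in> borel_measurable M" by measurable
  then show ?thesis using assms by (simp add: square_integrable_def)
qed

section \<open>Pairings with the Fourier transform of a square-integrable function\<close>

lemma fourier_multiplication:
  assumes f: "integrable lborel f" and p: "integrable lborel p"
  shows "(\<integral>u. f u * fourier p u \<partial>lborel) = (\<integral>y. fourier f y * p y \<partial>lborel)"
proof -
  have [measurable]: "f \<in> borel_measurable borel" "p \<in> borel_measurable borel" using f p by auto
  have "integrable (lborel \<Otimes>\<^sub>M lborel) (\<lambda>(u, y). f u * p y)"
    using f p by (intro integrable_pair_mult lborel.sigma_finite_measure_axioms)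
  then have int: "integrable (lborel \<Otimes>\<^sub>M lborel) (\<lambda>(u, y). f u * (exp (\<i> * of_real (u * y)) * p y))"
    by (rule Bochner_Integration.integrable_bound) (auto simp: norm_mult)
  have "(\<integral>u. f u * fourier p u \<partial>lborel) = (\<integral>u. (\<integral>y. f u * (exp (\<i> * of_real (u * y)) * p y) \<partial>lborel) \<partial>lborel)"
    by (simp add: fourier_def)
  also have "\<dots> = (\<integral>y. (\<integral>u. f u * (exp (\<i> * of_real (u * y)) * p y) \<partial>lborel) \<partial>lborel)"
    using lborel_pair.Fubini_integral[OF int] by simp
  also have "\<dots> = (\<integral>y. fourier f y * p y \<partial>lborel)"
  proof (rule Bochner_Integration.integral_cong[OF refl])
    fix y
    have "(\<integral>u. f u * (exp (\<i> * of_real (u * y)) * p y) \<partial>lborel) = (\<integral>u. exp (\<i> * of_real (y * u)) * f u * p y \<partial>lborel)"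
      by (intro Bochner_Integration.integral_cong) (auto simp: mult_ac)
    then show "(\<integral>u. f u * (exp (\<i> * of_real (u * y)) * p y) \<partial>lborel) = fourier f y * p y"
      by (simp add: fourier_def)
  qed
  finally show ?thesis .
qed

lemma measurable_fourier [measurable (raw)]:
  assumes [measurable]: "f \<in> borel_measurable borel" shows "fourier f \<in> borel_measurable borel"
  unfolding fourier_def by measurable

text \<open>Both sides are continuous in the mean square sense, so the formula passes from
  integrable approximations to the extended transform. No inversion theorem is involved.\<close>

lemma has_L2_fourier_multiplication:
  assumes fF: "has_L2_fourier f F" and p: "integrable lborel p" "square_integrable lborel p"
    and fp: "square_integrable lborel (fourier p)"
  shows "(\<integral>u. f u * fourier p u \<partial>lborel) = (\<integral>y. F y * p y \<partial>lborel)"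
proof -
  obtain \<phi> where f: "square_integrable lborel f" and F: "square_integrable lborel F"
    and \<phi>: "\<And>n. integrable lborel (\<phi> n)" "\<And>n. square_integrable lborel (\<phi> n)"
    and l1: "tendsto_L2 lborel \<phi> f" and l2: "tendsto_L2 lborel (\<lambda>n. fourier (\<phi> n)) F"
    using fF unfolding has_L2_fourier_def by blast
  have [measurable]: "\<phi> n \<in> borel_measurable borel" "F \<in> borel_measurable borel" for n
    using \<phi>(1)[of n] F by (auto simp: square_integrable_def)
  have "\<forall>\<^sub>F n in sequentially. (\<integral>\<^sup>+x. ennreal ((norm (fourier (\<phi> n) x - F x))\<^sup>2) \<partial>lborel) < 1"
    using l2 unfolding tendsto_L2_def by (rule order_tendstoD) simp
  then obtain k where k: "\<And>n. k \<le> n \<Longrightarrow> (\<integral>\<^sup>+x. ennreal ((norm (fourier (\<phi> n) x - F x))\<^sup>2) \<partial>lborel) < 1"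
    by (auto simp: eventually_sequentially)
  \<comment> \<open>A single \<open>fourier (\<phi> n)\<close> is not assumed square integrable.
    From index \<open>k\<close> on its distance to \<open>F\<close> is finite, which gives it; hence
    the shift of the sequence by \<open>k\<close>.\<close>
  have sq: "square_integrable lborel (fourier (\<phi> (n + k)))" for n
  proof -
    have "square_integrable lborel (\<lambda>x. fourier (\<phi> (n + k)) x - F x)"
      unfolding square_integrable_def integrable_iff_bounded
      using order_less_trans[OF k[of "n + k"] ennreal_one_less_top] by auto
    from square_integrable_add[OF this F] show ?thesis by simp
  qed
  have "(\<lambda>n. \<integral>u. \<phi> (n + k) u * fourier p u \<partial>lborel) \<longlonglongrightarrow> (\<integral>u. f u * fourier p u \<partial>lborel)"
    using l1 unfolding tendsto_L2_def
    by (intro tendsto_L2_integral_mult \<phi> f fp) (auto simp: tendsto_L2_def dest: LIMSEQ_ignore_initial_segment)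
  moreover have "(\<lambda>n. \<integral>u. fourier (\<phi> (n + k)) u * p u \<partial>lborel) \<longlonglongrightarrow> (\<integral>u. F u * p u \<partial>lborel)"
    using l2 unfolding tendsto_L2_def
    by (intro tendsto_L2_integral_mult sq F p) (auto simp: tendsto_L2_def dest: LIMSEQ_ignore_initial_segment)
  ultimately show ?thesis
    using fourier_multiplication[OF \<phi>(1) p(1)] LIMSEQ_unique by fastforce
qed

text \<open>Written through \<open>1 - exp (\<i> * y * x)\<close>, the complex power is visibly
  measurable in \<open>y\<close> and a superposition of translations, so multiplying by it on the
  frequency side produces differences on the other side.\<close>

lemma powr_minus_ii_conv_integral:
  assumes b: "0 < b" "b < 1"
  shows "(- (\<i> * of_real y)) powr (of_real b) = of_real (b / Gamma (1 - b)) *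
    (\<integral>x. of_real (pos_powr (- b - 1) x) * (1 - exp (\<i> * of_real (y * x))) \<partial>lborel)"
proof -
  have "0 < Gamma (1 - b)" using b by (intro Gamma_real_pos) auto
  then have "(- (\<i> * of_real y)) powr (of_real b)
      = inverse (of_real (Gamma (1 - b))) * (of_real (Gamma (1 - b)) * (- (\<i> * of_real y)) powr (of_real b))"
    by simp
  then show ?thesis
    unfolding integral_one_minus_iexp[OF b, symmetric] by (simp add: divide_inverse mult_ac)
qed

lemma measurable_powr_minus_ii [measurable]:
  assumes b: "0 < b" "b < 1"
  shows "(\<lambda>y. (- (\<i> * complex_of_real y)) powr (of_real b)) \<in> borel_measurable borel"
  unfolding powr_minus_ii_conv_integral[OF b] by measurable

lemma norm_powr_minus_ii: "norm ((- (\<i> * complex_of_real y)) powr (of_real b)) = \<bar>y\<bar> powr b"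
  by (subst norm_powr_real_powr') (auto simp: norm_mult)

lemma abs_powr_le: "0 < b \<Longrightarrow> b < 1 \<Longrightarrow> \<bar>y\<bar> powr b \<le> 1 + \<bar>y :: real\<bar>"
proof (cases "\<bar>y\<bar> \<le> 1")
  case True
  assume b: "0 < b" "b < 1"
  have "\<bar>y\<bar> powr b \<le> 1 powr b" using True b by (intro powr_mono2) auto
  then show ?thesis by simp
next
  case False
  assume b: "0 < b" "b < 1"
  have "\<bar>y\<bar> powr b \<le> \<bar>y\<bar> powr 1" using False b by (intro powr_mono) auto
  then show ?thesis by simp
qed

text \<open>Here \<open>\<psi>\<close> lives on the frequency side, \<open>m\<close> is its
  transform and \<open>m'\<close> the transform of \<open>\<i> * y * \<psi> y\<close>, the
  derivative of \<open>m\<close>. Both transforms are real, so that the identity obtained for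
  \<open>g\<close> is real. The factor \<open>1 + \<bar>y\<bar>\<close> pays for multiplication by
  \<open>\<i> * y\<close> and by the power of order \<open>b < 1\<close>.\<close>

locale test_function =
  fixes b :: real and \<psi> :: "real \<Rightarrow> complex" and m m' :: "real \<Rightarrow> real" and B :: real
  assumes b: "0 < b" "b < 1"
    and \<psi>_measurable [measurable]: "\<psi> \<in> borel_measurable borel"
    and \<psi>_integrable: "integrable lborel (\<lambda>y. (1 + \<bar>y\<bar>) * norm (\<psi> y))"
    and \<psi>_bounded: "\<And>y. (1 + \<bar>y\<bar>) * norm (\<psi> y) \<le> B"
    and fourier_\<psi>: "\<And>u. fourier \<psi> u = of_real (m u)"
    and fourier_\<psi>': "\<And>u. fourier (\<lambda>y. \<i> * of_real y * \<psi> y) u = of_real (m' u)"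
    and m_deriv: "\<And>u. (m has_real_derivative m' u) (at u)"
    and m'_cont: "continuous_on UNIV m'"
    and m_integrable: "integrable lborel m" and m'_integrable: "integrable lborel m'"
    and m_bounded: "\<And>u. \<bar>m u\<bar> \<le> B" and m'_bounded: "\<And>u. \<bar>m' u\<bar> \<le> B"
begin

lemma m_measurable [measurable]: "m \<in> borel_measurable borel" "m' \<in> borel_measurable borel"
  using m_integrable m'_integrable by auto

lemma B_nonneg: "0 \<le> B"
  using m_bounded[of 0] by linarith

text \<open>Up to the factor \<open>- 1 / Gamma (1 - b)\<close>, this is the right-sided Marchaud
  derivative of \<open>m\<close>, that is, the transform of \<open>\<psi>\<close> multiplied by the
  power \<open>b\<close> of \<open>- \<i> * y\<close>. The difference form converges
  absolutely.\<close>

definition W :: "real \<Rightarrow> real" where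
  "W u = (\<integral>x. b * (pos_powr (- b - 1) x * (m (u + x) - m u)) \<partial>lborel)"

lemma m_diff: "0 \<le> x \<Longrightarrow> m (u + x) - m u = (\<integral>t. indicator {0..x} t * m' (u + t) \<partial>lborel)"
proof -
  assume x: "0 \<le> x"
  have "(\<integral>t. indicator {0..x} t *\<^sub>R m' (u + t) \<partial>lborel) = m (u + x) - m (u + 0)"
  proof (rule integral_FTC_atLeastAtMost[OF x])
    fix t
    have "((\<lambda>t. m (u + t)) has_real_derivative m' (u + t) * (0 + 1)) (at t)"
      by (rule DERIV_chain2[OF m_deriv]) (auto intro!: derivative_eq_intros)
    then show "((\<lambda>t. m (u + t)) has_vector_derivative m' (u + t)) (at t within {0..x})"
      by (simp add: has_real_derivative_iff_has_vector_derivative has_vector_derivative_at_within)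
  qed (auto intro!: continuous_intros continuous_on_compose2[OF m'_cont])
  then show ?thesis by simp
qed

lemma m_diff_bound: "0 \<le> x \<Longrightarrow> \<bar>m (u + x) - m u\<bar> \<le> (2 * B) * min 1 x"
proof -
  assume x: "0 \<le> x"
  have "\<bar>m (u + x) - m u\<bar> \<le> B * \<bar>(u + x) - u\<bar>"
    using field_differentiable_bound[of UNIV m m' B "u + x" u] m_deriv m'_bounded by simp
  moreover have "B * x \<le> 2 * B * x" using x B_nonneg by (simp add: mult_right_mono)
  moreover have "\<bar>m (u + x) - m u\<bar> \<le> 2 * B" using m_bounded[of u] m_bounded[of "u + x"] by linarith
  ultimately show ?thesis using x by (auto simp: min_def)
qed

text \<open>For small \<open>x\<close> the difference is an integral of \<open>m'\<close> over an
  interval of length \<open>x\<close>, for large \<open>x\<close> twice the norm of \<open>m\<close>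
  is better. The combination \<open>min 1 x\<close> is exactly what the singular weight in
  \<open>W\<close> can integrate.\<close>

lemma m_diff_L1: "0 \<le> x \<Longrightarrow> (\<integral>\<^sup>+u. ennreal \<bar>m (u + x) - m u\<bar> \<partial>lborel)
    \<le> (2 * (\<integral>\<^sup>+u. ennreal \<bar>m u\<bar> \<partial>lborel) + (\<integral>\<^sup>+u. ennreal \<bar>m' u\<bar> \<partial>lborel)) * ennreal (min 1 x)"
  (is "_ \<Longrightarrow> ?L \<le> (2 * ?m + ?m') * _")
proof -
  assume x: "0 \<le> x"
  have "?L \<le> (\<integral>\<^sup>+u. ennreal \<bar>m (u + x)\<bar> + ennreal \<bar>m u\<bar> \<partial>lborel)"
    by (intro nn_integral_mono) (simp flip: ennreal_plus)
  also have "\<dots> = 2 * ?m"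
    by (simp add: nn_integral_add nn_integral_shift(1)[of "\<lambda>u. ennreal \<bar>m u\<bar>"] mult_2)
  finally have 1: "?L \<le> 2 * ?m" .
  have "?L \<le> (\<integral>\<^sup>+u. (\<integral>\<^sup>+t. ennreal (indicator {0..x} t) * ennreal \<bar>m' (u + t)\<bar> \<partial>lborel) \<partial>lborel)"
  proof (intro nn_integral_mono)
    fix u
    have "ennreal \<bar>m (u + x) - m u\<bar> \<le> (\<integral>\<^sup>+t. ennreal \<bar>indicator {0..x} t * m' (u + t)\<bar> \<partial>lborel)"
    proof -
      have "integrable lborel (\<lambda>t. indicator {0..x} t *\<^sub>R m' (u + t))"
        using integrable_shift(2)[of m' u] m'_integrable by (intro integrable_mult_indicator) auto
      from integral_norm_bound_ennreal[OF this] show ?thesis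
        by (simp add: m_diff[OF x])
    qed
    then show "ennreal \<bar>m (u + x) - m u\<bar> \<le> (\<integral>\<^sup>+t. ennreal (indicator {0..x} t) * ennreal \<bar>m' (u + t)\<bar> \<partial>lborel)"
      by (simp add: abs_mult ennreal_mult)
  qed
  also have "\<dots> = (\<integral>\<^sup>+t. (\<integral>\<^sup>+u. ennreal (indicator {0..x} t) * ennreal \<bar>m' (u + t)\<bar> \<partial>lborel) \<partial>lborel)"
    by (rule lborel_pair.Fubini') measurable
  also have "\<dots> = (\<integral>\<^sup>+t. ennreal (indicator {0..x} t) * ?m' \<partial>lborel)"
    by (simp add: nn_integral_cmult nn_integral_shift(1)[of "\<lambda>u. ennreal \<bar>m' u\<bar>"])
  also have "\<dots> = ennreal x * ?m'"
    using x by (simp add: nn_integral_multc ennreal_indicator)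
  finally have 2: "?L \<le> ?m' * ennreal x" by (simp add: mult.commute)
  show ?thesis
  proof (cases "x \<le> 1")
    case True
    have "?m' * ennreal x \<le> (2 * ?m + ?m') * ennreal x" by (intro mult_right_mono) auto
    then show ?thesis using True 2 by (auto simp: min_def)
  next
    case False
    have "2 * ?m \<le> 2 * ?m + ?m'" by simp
    then have "?L \<le> 2 * ?m + ?m'" by (rule order_trans[OF 1])
    then show ?thesis using False by (simp add: min_def)
  qed
qed

lemma W_integrand_integrable:
  "integrable lborel (\<lambda>x. b * (pos_powr (- b - 1) x * (m (u + x) - m u)))"
proof (rule Bochner_Integration.integrable_bound)
  show "integrable lborel (\<lambda>x. b * (2 * B) * (pos_powr (- b - 1) x * min 1 x))"
    using integrable_pos_powr_min[OF b] by simp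
  show "AE x in lborel. norm (b * (pos_powr (- b - 1) x * (m (u + x) - m u)))
     \<le> norm (b * (2 * B) * (pos_powr (- b - 1) x * min 1 x))"
  proof (rule AE_I2)
    fix x :: real
    show "norm (b * (pos_powr (- b - 1) x * (m (u + x) - m u)))
     \<le> norm (b * (2 * B) * (pos_powr (- b - 1) x * min 1 x))"
    proof (cases "0 < x")
      case True
      then have "b * (pos_powr (- b - 1) x * \<bar>m (u + x) - m u\<bar>) \<le> b * (pos_powr (- b - 1) x * ((2 * B) * min 1 x))"
        using b by (intro mult_left_mono m_diff_bound) auto
      then show ?thesis using b True B_nonneg by (simp add: abs_mult mult_ac)
    qed simp
  qed
qed measurable

lemma W_measurable [measurable]: "W \<in> borel_measurable borel"
  unfolding W_def by measurable

lemma W_bounded: "\<bar>W u\<bar> \<le> b * (2 * B) * (\<integral>x. pos_powr (- b - 1) x * min 1 x \<partial>lborel)"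
proof -
  have "\<bar>W u\<bar> \<le> (\<integral>x. \<bar>b * (pos_powr (- b - 1) x * (m (u + x) - m u))\<bar> \<partial>lborel)"
    unfolding W_def by (rule integral_abs_bound)
  also have "\<dots> \<le> (\<integral>x. b * (2 * B) * (pos_powr (- b - 1) x * min 1 x) \<partial>lborel)"
  proof (rule integral_mono)
    show "integrable lborel (\<lambda>x. \<bar>b * (pos_powr (- b - 1) x * (m (u + x) - m u))\<bar>)"
      using W_integrand_integrable by (rule integrable_abs)
    show "integrable lborel (\<lambda>x. b * (2 * B) * (pos_powr (- b - 1) x * min 1 x))"
      using integrable_pos_powr_min[OF b] by simp
    fix x :: real
    show "\<bar>b * (pos_powr (- b - 1) x * (m (u + x) - m u))\<bar> \<le> b * (2 * B) * (pos_powr (- b - 1) x * min 1 x)"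
    proof (cases "0 < x")
      case True
      then have "b * (pos_powr (- b - 1) x * \<bar>m (u + x) - m u\<bar>) \<le> b * (pos_powr (- b - 1) x * ((2 * B) * min 1 x))"
        using b by (intro mult_left_mono m_diff_bound) auto
      then show ?thesis using b True B_nonneg by (simp add: abs_mult mult_ac)
    qed simp
  qed
  finally show ?thesis by simp
qed

lemma W_integrable: "integrable lborel W"
  unfolding integrable_iff_bounded
proof
  let ?K = "2 * (\<integral>\<^sup>+u. ennreal \<bar>m u\<bar> \<partial>lborel) + (\<integral>\<^sup>+u. ennreal \<bar>m' u\<bar> \<partial>lborel)"
  have "(\<integral>\<^sup>+u. ennreal (norm (W u)) \<partial>lborel)
     \<le> (\<integral>\<^sup>+u. (\<integral>\<^sup>+x. ennreal (b * pos_powr (- b - 1) x) * ennreal \<bar>m (u + x) - m u\<bar> \<partial>lborel) \<partial>lborel)"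
  proof (intro nn_integral_mono)
    fix u
    have "ennreal (norm (W u)) \<le> (\<integral>\<^sup>+x. ennreal (norm (b * (pos_powr (- b - 1) x * (m (u + x) - m u)))) \<partial>lborel)"
      unfolding W_def by (rule integral_norm_bound_ennreal[OF W_integrand_integrable])
    then show "ennreal (norm (W u)) \<le> (\<integral>\<^sup>+x. ennreal (b * pos_powr (- b - 1) x) * ennreal \<bar>m (u + x) - m u\<bar> \<partial>lborel)"
      using b by (simp add: abs_mult ennreal_mult[symmetric] mult.assoc)
  qed
  also have "\<dots> = (\<integral>\<^sup>+x. (\<integral>\<^sup>+u. ennreal (b * pos_powr (- b - 1) x) * ennreal \<bar>m (u + x) - m u\<bar> \<partial>lborel) \<partial>lborel)"
    by (rule lborel_pair.Fubini') measurable
  also have "\<dots> \<le> (\<integral>\<^sup>+x. ennreal b * (?K * ennreal (pos_powr (- b - 1) x * min 1 x)) \<partial>lborel)"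
  proof (intro nn_integral_mono)
    fix x :: real
    show "(\<integral>\<^sup>+u. ennreal (b * pos_powr (- b - 1) x) * ennreal \<bar>m (u + x) - m u\<bar> \<partial>lborel)
      \<le> ennreal b * (?K * ennreal (pos_powr (- b - 1) x * min 1 x))"
    proof (cases "0 < x")
      case True
      have "(\<integral>\<^sup>+u. ennreal (b * pos_powr (- b - 1) x) * ennreal \<bar>m (u + x) - m u\<bar> \<partial>lborel)
         = ennreal (b * pos_powr (- b - 1) x) * (\<integral>\<^sup>+u. ennreal \<bar>m (u + x) - m u\<bar> \<partial>lborel)"
        by (rule nn_integral_cmult) measurable
      also have "\<dots> \<le> ennreal (b * pos_powr (- b - 1) x) * (?K * ennreal (min 1 x))"
        using True by (intro mult_left_mono m_diff_L1) auto
      finally show ?thesis using b True by (simp add: ennreal_mult mult_ac)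
    qed simp
  qed
  also have "\<dots> = ennreal b * (?K * (\<integral>\<^sup>+x. ennreal (pos_powr (- b - 1) x * min 1 x) \<partial>lborel))"
    by (simp add: nn_integral_cmult)
  also have "\<dots> < \<infinity>"
  proof -
    have "(\<integral>\<^sup>+x. ennreal (pos_powr (- b - 1) x * min 1 x) \<partial>lborel)
        \<le> (\<integral>\<^sup>+x. ennreal (norm (pos_powr (- b - 1) x * min 1 x)) \<partial>lborel)"
      by (intro nn_integral_mono ennreal_leI) simp
    also have "\<dots> < \<infinity>"
      using integrable_pos_powr_min[OF b] unfolding integrable_iff_bounded by blast
    finally have "(\<integral>\<^sup>+x. ennreal (pos_powr (- b - 1) x * min 1 x) \<partial>lborel) < \<infinity>" .
    moreover have "?K < \<infinity>"
      using m_integrable m'_integrable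
      by (simp add: integrable_iff_bounded ennreal_mult_less_top ennreal_add_less_top)
    ultimately show ?thesis by (simp add: ennreal_mult_less_top)
  qed
  finally show "(\<integral>\<^sup>+u. ennreal (norm (W u)) \<partial>lborel) < \<infinity>" .
qed measurable

lemma W_kernel_integrable: "integrable lborel (\<lambda>x. pos_powr (- b) x * m' (u + x))"
proof (rule Bochner_Integration.integrable_bound)
  show "integrable lborel (\<lambda>x. B * (indicator {..1} x * pos_powr (- b) x) + \<bar>m' (u + x)\<bar>)"
    using has_bochner_integral_pos_powr_from_0[of "- b" 1] b integrable_shift(2)[of m' u] m'_integrable
    by (auto simp: has_bochner_integral_iff)
  show "AE x in lborel. norm (pos_powr (- b) x * m' (u + x))
      \<le> norm (B * (indicator {..1} x * pos_powr (- b) x) + \<bar>m' (u + x)\<bar>)"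
  proof (rule AE_I2)
    fix x :: real
    have "pos_powr (- b) x * \<bar>m' (u + x)\<bar> \<le> B * (indicator {..1} x * pos_powr (- b) x) + \<bar>m' (u + x)\<bar>"
    proof (cases "x \<le> 1")
      case True
      have "pos_powr (- b) x * \<bar>m' (u + x)\<bar> \<le> pos_powr (- b) x * B"
        by (intro mult_left_mono m'_bounded) simp
      then show ?thesis using True by (simp add: mult.commute)
    next
      case False
      then have "x powr (- b) \<le> x powr 0" using b by (intro powr_mono) auto
      then have "pos_powr (- b) x * \<bar>m' (u + x)\<bar> \<le> 1 * \<bar>m' (u + x)\<bar>"
        using False by (intro mult_right_mono) auto
      then show ?thesis using False by simp
    qed
    then show "norm (pos_powr (- b) x * m' (u + x)) \<le> norm (B * (indicator {..1} x * pos_powr (- b) x) + \<bar>m' (u + x)\<bar>)"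
      by (simp add: abs_mult)
  qed
qed measurable

text \<open>The Marchaud and the Weyl form agree: \<open>x\<^sup>-\<^sup>b = \<integral>\<^bsub>z>x\<^esub> b z\<^sup>-\<^sup>b\<^sup>-\<^sup>1 dz\<close>.\<close>

lemma W_eq: "W u = (\<integral>x. pos_powr (- b) x * m' (u + x) \<partial>lborel)"
proof -
  let ?f = "\<lambda>x z. (indicator {0<..} x * indicator {0..} (z - x) * (b * pos_powr (- b - 1) z)) * m' (u + x)"
  have tail: "has_bochner_integral lborel (\<lambda>z. indicator {0<..} x * indicator {0..} (z - x) * (b * pos_powr (- b
      - 1) z)) (pos_powr (- b) x)" for x :: real
  proof (cases "0 < x")
    case True
    have "indicator {0..} (z - x) = (indicator {x..} z :: real)" for z
      by (auto simp: indicator_def)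
    then show ?thesis
      using True has_bochner_integral_mult_right[OF has_bochner_integral_pos_powr_to_inf[of "- b - 1" x], of b] b
      by (simp add: mult_ac)
  qed (simp add: has_bochner_integral_zero)
  have int: "integrable (lborel \<Otimes>\<^sub>M lborel) (\<lambda>(x, z). ?f x z)"
  proof (rule lborel_pair.Fubini_integrable)
    have "(\<integral>z. norm (?f x z) \<partial>lborel) = \<bar>pos_powr (- b) x * m' (u + x)\<bar>" for x
    proof -
      have "(\<integral>z. norm (?f x z) \<partial>lborel) = (\<integral>z. (indicator {0<..} x * indicator {0..} (z - x) * (b * pos_powr (- b
          - 1) z)) * \<bar>m' (u + x)\<bar> \<partial>lborel)"
        using b by (intro Bochner_Integration.integral_cong) (auto simp: abs_mult)
      then show ?thesis
        using has_bochner_integral_integral_eq[OF tail[of x]] by (simp add: abs_mult)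
    qed
    then show "integrable lborel (\<lambda>x. \<integral>z. norm (case (x, z) of (x, z) \<Rightarrow> ?f x z) \<partial>lborel)"
      using integrable_abs[OF W_kernel_integrable[of u]] by simp
    show "AE x in lborel. integrable lborel (\<lambda>z. case (x, z) of (x, z) \<Rightarrow> ?f x z)"
      using tail by (auto simp: has_bochner_integral_iff)
  qed measurable
  have "(\<integral>x. pos_powr (- b) x * m' (u + x) \<partial>lborel) = (\<integral>x. (\<integral>z. ?f x z \<partial>lborel) \<partial>lborel)"
    using has_bochner_integral_integral_eq[OF tail] by simp
  also have "\<dots> = (\<integral>z. (\<integral>x. ?f x z \<partial>lborel) \<partial>lborel)"
    using lborel_pair.Fubini_integral[OF int] by simp
  also have "\<dots> = W u"
    unfolding W_def
  proof (rule Bochner_Integration.integral_cong[OF refl])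
    fix z :: real
    show "(\<integral>x. ?f x z \<partial>lborel) = b * (pos_powr (- b - 1) z * (m (u + z) - m u))"
    proof (cases "0 < z")
      case True
      have "(\<integral>x. ?f x z \<partial>lborel) = (\<integral>x. b * pos_powr (- b - 1) z * (indicator {0..z} x * m' (u + x)) \<partial>lborel)"
      proof (rule integral_cong_AE)
        have "AE x in lborel. x \<noteq> (0::real)" by (rule AE_lborel_singleton)
        then show "AE x in lborel. ?f x z = b * pos_powr (- b - 1) z * (indicator {0..z} x * m' (u + x))"
          by eventually_elim (auto simp: indicator_def)
      qed measurable
      then show ?thesis using True by (simp add: m_diff[of z u])
    next
      case False
      then have "?f x z = 0" for x by (auto simp: indicator_def)
      then show ?thesis using False by simp
    qed
  qed
  finally show ?thesis ..
qed

text \<open>Multiplication by \<open>exp (\<i> * y * x)\<close> shifts the transform by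
  \<open>x\<close>; inserting the integral representation of the power and exchanging the integrals
  leaves the differences \<open>m u - m (u + x)\<close>.\<close>

lemma fourier_powr_\<psi>:
  "integrable lborel (\<lambda>y. (- (\<i> * of_real y)) powr (of_real b) * \<psi> y)"
  "fourier (\<lambda>y. (- (\<i> * of_real y)) powr (of_real b) * \<psi> y) u = of_real (- W u / Gamma (1 - b))"
proof -
  show "integrable lborel (\<lambda>y. (- (\<i> * of_real y)) powr (of_real b) * \<psi> y)"
  proof (rule Bochner_Integration.integrable_bound[OF \<psi>_integrable])
    show "(\<lambda>y. (- (\<i> * of_real y)) powr (of_real b) * \<psi> y) \<in> borel_measurable lborel"
      using measurable_powr_minus_ii[OF b] by measurable
    show "AE y in lborel. norm ((- (\<i> * of_real y)) powr (of_real b) * \<psi> y) \<le> norm ((1 + \<bar>y\<bar>) * norm (\<psi> y))"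
      by (intro AE_I2) (auto simp: norm_mult norm_powr_minus_ii abs_powr_le[OF b] intro!: mult_right_mono)
  qed
  let ?K = "\<lambda>y x. of_real (pos_powr (- b - 1) x) * (1 - exp (\<i> * of_real (y * x))) * (exp (\<i> * of_real (u * y)) * \<psi> y)"
  have int: "integrable (lborel \<Otimes>\<^sub>M lborel) (\<lambda>(y, x). ?K y x)"
  proof (rule Bochner_Integration.integrable_bound)
    show "integrable (lborel \<Otimes>\<^sub>M lborel) (\<lambda>(y, x). 2 * ((1 + \<bar>y\<bar>) * norm (\<psi> y)) * (pos_powr (- b - 1) x * min 1 x))"
      using \<psi>_integrable integrable_pos_powr_min[OF b]
      by (intro integrable_pair_mult lborel.sigma_finite_measure_axioms integrable_mult_right)
    show "AE p in lborel \<Otimes>\<^sub>M lborel. norm (case p of (y, x) \<Rightarrow> ?K y x)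
       \<le> norm (case p of (y, x) \<Rightarrow> 2 * ((1 + \<bar>y\<bar>) * norm (\<psi> y)) * (pos_powr (- b - 1) x * min 1 x))"
    proof (rule AE_I2, clarify)
      fix y x :: real
      show "norm (?K y x) \<le> norm (2 * ((1 + \<bar>y\<bar>) * norm (\<psi> y)) * (pos_powr (- b - 1) x * min 1 x))"
      proof (cases "0 < x")
        case True
        \<comment> \<open>Twice this quantity bounds both \<open>\<bar>y\<bar>\<close> and the
          constant 2, as the estimate for \<open>1 - exp\<close> demands.\<close>
        define Y where "Y = 1 + \<bar>y\<bar>"
        have Y: "1 \<le> Y" "\<bar>y\<bar> \<le> Y" by (auto simp: Y_def)
        have "norm (1 - exp (\<i> * of_real (y * x))) \<le> 2 * Y * min 1 x"
          using norm_one_minus_cexp_min[of "- (\<i> * of_real y)" x "2 * Y"] True Y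
          by (simp add: norm_mult mult.assoc)
        then have "pos_powr (- b - 1) x * norm (1 - exp (\<i> * of_real (y * x))) * norm (\<psi> y)
            \<le> pos_powr (- b - 1) x * (2 * Y * min 1 x) * norm (\<psi> y)"
          by (intro mult_right_mono mult_left_mono) auto
        then show ?thesis unfolding Y_def[symmetric] using True Y by (simp add: norm_mult abs_mult mult_ac)
      qed simp
    qed
  qed measurable
  have K: "(\<integral>x. ?K y x \<partial>lborel) = (\<integral>x. of_real (pos_powr (- b - 1) x) * (1 - exp (\<i> * of_real (y * x))) \<partial>lborel)
      * (exp (\<i> * of_real (u * y)) * \<psi> y)" for y
    by (rule integral_mult_left_zero)
  have "fourier (\<lambda>y. (- (\<i> * of_real y)) powr (of_real b) * \<psi> y) u
     = (\<integral>y. of_real (b / Gamma (1 - b)) * (\<integral>x. ?K y x \<partial>lborel) \<partial>lborel)"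
    unfolding fourier_def powr_minus_ii_conv_integral[OF b] K
    by (intro Bochner_Integration.integral_cong refl) (simp add: mult_ac)
  also have "\<dots> = of_real (b / Gamma (1 - b)) * (\<integral>x. (\<integral>y. ?K y x \<partial>lborel) \<partial>lborel)"
    using lborel_pair.Fubini_integral[OF int] by simp
  also have "(\<lambda>x. \<integral>y. ?K y x \<partial>lborel) = (\<lambda>x. of_real (pos_powr (- b - 1) x * (m u - m (u + x))))"
  proof
    fix x
    have \<psi>i: "integrable lborel \<psi>"
      by (rule Bochner_Integration.integrable_bound[OF \<psi>_integrable]) (auto simp: distrib_right)
    have \<psi>ie: "integrable lborel (\<lambda>y. exp (\<i> * of_real (c * y)) * \<psi> y)" for c :: real
      by (rule Bochner_Integration.integrable_bound[OF \<psi>i]) (auto simp: norm_mult)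
    have "(\<integral>y. ?K y x \<partial>lborel)
       = (\<integral>y. of_real (pos_powr (- b - 1) x) * (exp (\<i> * of_real (u * y)) * \<psi> y - exp (\<i> * of_real ((u
           + x) * y)) * \<psi> y) \<partial>lborel)"
      by (intro Bochner_Integration.integral_cong refl) (simp add: algebra_simps exp_add)
    also have "\<dots> = of_real (pos_powr (- b - 1) x) * (fourier \<psi> u - fourier \<psi> (u + x))"
      unfolding fourier_def using \<psi>ie[of u] \<psi>ie[of "u + x"] by simp
    finally show "(\<integral>y. ?K y x \<partial>lborel) = of_real (pos_powr (- b - 1) x * (m u - m (u + x)))"
      by (simp add: fourier_\<psi>)
  qed
  also have "of_real (b / Gamma (1 - b)) * (\<integral>x. of_real (pos_powr (- b - 1) x * (m u - m (u + x))) \<partial>lborel)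
     = complex_of_real (b / Gamma (1 - b) * (\<integral>x. pos_powr (- b - 1) x * (m u - m (u + x)) \<partial>lborel))"
    by (subst integral_complex_of_real) simp
  also have "b / Gamma (1 - b) * (\<integral>x. pos_powr (- b - 1) x * (m u - m (u + x)) \<partial>lborel) = - W u / Gamma (1 - b)"
  proof -
    have "W u = b * (\<integral>x. - (pos_powr (- b - 1) x * (m u - m (u + x))) \<partial>lborel)"
    proof -
      have "W u = (\<integral>x. b * - (pos_powr (- b - 1) x * (m u - m (u + x))) \<partial>lborel)"
        unfolding W_def by (intro Bochner_Integration.integral_cong refl) (simp add: algebra_simps)
      then show ?thesis by (simp only: integral_mult_right_zero)
    qed
    then show ?thesis by simp
  qed
  finally show "fourier (\<lambda>y. (- (\<i> * of_real y)) powr (of_real b) * \<psi> y) u = of_real (- W u / Gamma (1 - b))" .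
qed

text \<open>The additional factor is the characteristic function of \<open>P\<close>. Since
  \<open>exp (\<i> * y * u) * exp (\<i> * y * v)\<close> depends on \<open>u + v\<close>, on the
  transform side it averages the translates of \<open>W\<close>. The statement concerns one positive
  measure and is applied to each Jordan part.\<close>

lemma W_convolution:
  assumes P: "finite_measure P" "sets P = sets borel"
  shows "integrable lborel (\<lambda>u. \<integral>v. W (u + v) \<partial>P)"
    and "\<exists>C. \<forall>u. \<bar>\<integral>v. W (u + v) \<partial>P\<bar> \<le> C"
    and "integrable lborel (\<lambda>y. (- (\<i> * of_real y)) powr (of_real b) * \<psi> y * (\<integral>v. exp (\<i> * of_real (y * v)) \<partial>P))"
    and "fourier (\<lambda>y. (- (\<i> * of_real y)) powr (of_real b) * \<psi> y * (\<integral>v. exp (\<i> * of_real (y * v)) \<partial>P)) u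
      = of_real (- (\<integral>v. W (u + v) \<partial>P) / Gamma (1 - b))"
    and "\<And>y. norm (\<integral>v. exp (\<i> * of_real (y * v)) \<partial>P) \<le> measure P UNIV"
proof -
  interpret finite_measure P by fact
  interpret LP: pair_sigma_finite lborel P ..
  note [measurable_cong] = P(2)
  have sp: "space P = UNIV" using sets_eq_imp_space_eq[OF P(2)] by simp
  obtain C where C: "\<And>u. \<bar>W u\<bar> \<le> C" using W_bounded by blast
  have "integrable (P \<Otimes>\<^sub>M lborel) (\<lambda>(v, u). W (u + v))"
  proof -
    interpret PL: pair_sigma_finite P lborel ..
    show ?thesis
    proof (rule PL.Fubini_integrable)
      have "(\<integral>u. norm (W (u + v)) \<partial>lborel) = (\<integral>u. norm (W u) \<partial>lborel)" for v
        by (rule integral_shift(1)[of "\<lambda>u. norm (W u)"])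
      then show "integrable P (\<lambda>v. \<integral>u. norm (case (v, u) of (v, u) \<Rightarrow> W (u + v)) \<partial>lborel)" by simp
    qed (auto simp: integrable_shift W_integrable)
  qed
  then have int: "integrable (lborel \<Otimes>\<^sub>M P) (\<lambda>(u, v). W (u + v))"
    using LP.integrable_product_swap_iff[of "\<lambda>(u, v). W (u + v)"] by simp
  show "integrable lborel (\<lambda>u. \<integral>v. W (u + v) \<partial>P)"
    using LP.integrable_fst[of "\<lambda>u v. W (u + v)"] int by simp
  have bd: "norm (\<integral>v. f v \<partial>P) \<le> c * measure P UNIV"
    if "f \<in> borel_measurable borel" "\<And>v. norm (f v) \<le> c"
    for f :: "real \<Rightarrow> 'd :: {banach, second_countable_topology}" and c
  proof -
    have "norm (\<integral>v. f v \<partial>P) \<le> (\<integral>v. norm (f v) \<partial>P)" by simp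
    also have "\<dots> \<le> (\<integral>v. c \<partial>P)"
      using that order_trans[OF norm_ge_zero that(2)]
      by (intro integral_mono integrable_norm integrable_const_bound[of _ c]) auto
    finally show ?thesis by (simp add: sp mult.commute)
  qed
  show "\<exists>C. \<forall>u. \<bar>\<integral>v. W (u + v) \<partial>P\<bar> \<le> C"
    using bd[of "\<lambda>v. W (u + v)" C for u] C by (intro exI[of _ "C * measure P UNIV"]) auto
  show eb: "norm (\<integral>v. exp (\<i> * of_real (y * v)) \<partial>P) \<le> measure P UNIV" for y
    using bd[of "\<lambda>v. exp (\<i> * of_real (y * v))" 1] by simp
  let ?p = "\<lambda>y. (- (\<i> * of_real y)) powr (of_real b) * \<psi> y"
  have [measurable]: "?p \<in> borel_measurable borel"
    using measurable_powr_minus_ii[OF b] by measurable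
  show "integrable lborel (\<lambda>y. ?p y * (\<integral>v. exp (\<i> * of_real (y * v)) \<partial>P))"
  proof (rule Bochner_Integration.integrable_bound)
    show "integrable lborel (\<lambda>y. of_real (measure P UNIV) * ?p y)"
      using fourier_powr_\<psi>(1) by (rule integrable_mult_right)
    show "AE y in lborel. norm (?p y * (\<integral>v. exp (\<i> * of_real (y * v)) \<partial>P)) \<le> norm (of_real (measure P UNIV) * ?p y)"
      using eb by (intro AE_I2) (auto simp: norm_mult mult.commute[of "measure P UNIV"] intro!: mult_left_mono)
  qed measurable
  have "integrable (lborel \<Otimes>\<^sub>M P) (\<lambda>(y, v). ?p y * 1)"
    using fourier_powr_\<psi>(1)
    by (intro integrable_pair_mult lborel.sigma_finite_measure_axioms sigma_finite_measure_axioms) auto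
  then have int2: "integrable (lborel \<Otimes>\<^sub>M P) (\<lambda>(y, v). exp (\<i> * of_real ((u + v) * y)) * ?p y)"
    by (rule Bochner_Integration.integrable_bound) (auto simp: norm_mult)
  have "fourier (\<lambda>y. ?p y * (\<integral>v. exp (\<i> * of_real (y * v)) \<partial>P)) u
     = (\<integral>y. (\<integral>v. exp (\<i> * of_real ((u + v) * y)) * ?p y \<partial>P) \<partial>lborel)"
    unfolding fourier_def
  proof (intro Bochner_Integration.integral_cong refl)
    fix y
    have "exp (\<i> * of_real (u * y)) * (?p y * (\<integral>v. exp (\<i> * of_real (y * v)) \<partial>P))
       = (\<integral>v. exp (\<i> * of_real (u * y)) * ?p y * exp (\<i> * of_real (y * v)) \<partial>P)"
      by simp
    also have "\<dots> = (\<integral>v. exp (\<i> * of_real ((u + v) * y)) * ?p y \<partial>P)"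
      by (intro Bochner_Integration.integral_cong refl) (simp add: algebra_simps exp_add)
    finally show "exp (\<i> * of_real (u * y)) * (?p y * (\<integral>v. exp (\<i> * of_real (y * v)) \<partial>P))
       = (\<integral>v. exp (\<i> * of_real ((u + v) * y)) * ?p y \<partial>P)" .
  qed
  also have "\<dots> = (\<integral>v. fourier ?p (u + v) \<partial>P)"
    using LP.Fubini_integral[of "\<lambda>y v. exp (\<i> * of_real ((u + v) * y)) * ?p y"] int2 by (simp add: fourier_def)
  also have "\<dots> = (\<integral>v. complex_of_real (- W (u + v) / Gamma (1 - b)) \<partial>P)"
    by (simp only: fourier_powr_\<psi>(2))
  also have "\<dots> = of_real (\<integral>v. - W (u + v) / Gamma (1 - b) \<partial>P)"
    by (rule integral_complex_of_real)
  finally show "fourier (\<lambda>y. ?p y * (\<integral>v. exp (\<i> * of_real (y * v)) \<partial>P)) u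
      = of_real (- (\<integral>v. W (u + v) \<partial>P) / Gamma (1 - b))" by simp
qed

text \<open>The weak form of \<open>g' = delta_0 + (D^b g) * eta\<close>, with all derivatives moved
  to the test function. On the frequency side the test function \<open>q\<close> equals minus
  \<open>\<psi>\<close> times the power \<open>b\<close> of \<open>- \<i> * y\<close> times the
  denominator of \<open>F\<close>, so that \<open>F * q = - \<psi>\<close> and the unknown transform
  disappears; the integral of \<open>- \<psi>\<close> is \<open>- m 0\<close>, the contribution of
  \<open>delta_0\<close>.\<close>

lemma weak_equation:
  fixes F :: "real \<Rightarrow> complex" and g :: "real \<Rightarrow> real"
  assumes P: "finite_measure P" "sets P = sets borel" and N: "finite_measure N" "sets N = sets borel"
    and fF: "has_L2_fourier (\<lambda>u. of_real (g u)) F"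
    and F: "\<And>y. y \<noteq> 0 \<Longrightarrow> F y * ((- (\<i> * of_real y)) powr (of_real (1 - b))
       - ((\<integral>v. exp (\<i> * of_real (y * v)) \<partial>P) - (\<integral>v. exp (\<i> * of_real (y * v)) \<partial>N)))
       = (- (\<i> * of_real y)) powr (- of_real b)"
  shows "(\<integral>u. g u * (m' u - ((\<integral>v. W (u + v) \<partial>P) - (\<integral>v. W (u + v) \<partial>N)) / Gamma (1 - b)) \<partial>lborel) = - m 0"
proof -
  define p where "p y = (- (\<i> * complex_of_real y)) powr (of_real b) * \<psi> y" for y
  define eP where "eP y = (\<integral>v. exp (\<i> * of_real (y * v)) \<partial>P)" for y
  define eN where "eN y = (\<integral>v. exp (\<i> * of_real (y * v)) \<partial>N)" for y
  define q where "q y = \<i> * of_real y * \<psi> y + (p y * eP y - p y * eN y)" for y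
  note WP = W_convolution[OF P, folded eP_def p_def] and WN = W_convolution[OF N, folded eN_def p_def]
  have i1: "integrable lborel (\<lambda>y. \<i> * of_real y * \<psi> y)"
    by (rule Bochner_Integration.integrable_bound[OF \<psi>_integrable]) (auto simp: norm_mult intro!: mult_right_mono)
  have q: "integrable lborel q"
    unfolding q_def using i1 WP(3) WN(3) by auto
  have fi: "integrable lborel (\<lambda>y. exp (\<i> * of_real (u * y)) * f y)" if "integrable lborel f" for f u
    by (rule Bochner_Integration.integrable_bound[OF that]) (use that in \<open>auto simp: norm_mult\<close>)
  have fq: "fourier q u = of_real (m' u - ((\<integral>v. W (u + v) \<partial>P) - (\<integral>v. W (u + v) \<partial>N)) / Gamma (1 - b))" for u
  proof -
    have "fourier q u = fourier (\<lambda>y. \<i> * of_real y * \<psi> y) u + (fourier (\<lambda>y. p y * eP y) u - fourier (\<lambda>y. p y * eN y) u)"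
      unfolding fourier_def q_def distrib_left right_diff_distrib
      using fi[OF i1, of u] fi[OF WP(3), of u] fi[OF WN(3), of u] by simp
    then show ?thesis
      unfolding fourier_\<psi>' WP(4) WN(4) by (simp add: diff_divide_distrib)
  qed
  have nq: "norm (q y) \<le> B * (1 + measure P UNIV + measure N UNIV)" for y
  proof -
    have py: "norm (p y) \<le> B"
      using \<psi>_bounded[of y] mult_right_mono[OF abs_powr_le[OF b, of y] norm_ge_zero[of "\<psi> y"]]
      by (simp add: p_def norm_mult norm_powr_minus_ii)
    have "norm (p y * eP y - p y * eN y) \<le> norm (p y) * norm (eP y) + norm (p y) * norm (eN y)"
      by (metis norm_mult norm_triangle_ineq4)
    also have "\<dots> \<le> B * measure P UNIV + B * measure N UNIV"
      using py WP(5)[of y] WN(5)[of y] B_nonneg by (intro add_mono mult_mono) auto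
    finally have "norm (p y * eP y - p y * eN y) \<le> B * measure P UNIV + B * measure N UNIV" .
    moreover have "norm (\<i> * of_real y * \<psi> y) \<le> B"
      using \<psi>_bounded[of y] mult_right_mono[of "\<bar>y\<bar>" "1 + \<bar>y\<bar>" "norm (\<psi> y)"] by (simp add: norm_mult)
    ultimately show ?thesis
      unfolding q_def by (intro norm_triangle_le) (simp add: distrib_left)
  qed
  have q2: "square_integrable lborel q"
    using square_integrable_bounded[OF q] nq by blast
  obtain CP CN where CP: "\<And>u. \<bar>\<integral>v. W (u + v) \<partial>P\<bar> \<le> CP" and CN: "\<And>u. \<bar>\<integral>v. W (u + v) \<partial>N\<bar> \<le> CN"
    using WP(2) WN(2) by blast
  have sm: "square_integrable lborel m'" using m'_bounded by (intro square_integrable_bounded[OF m'_integrable]) auto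
  have sP: "square_integrable lborel (\<lambda>u. \<integral>v. W (u + v) \<partial>P)" "square_integrable lborel (\<lambda>u. \<integral>v. W (u + v) \<partial>N)"
    using CP CN by (auto intro!: square_integrable_bounded WP(1) WN(1))
  have "square_integrable lborel (\<lambda>u. m' u - ((\<integral>v. W (u + v) \<partial>P) - (\<integral>v. W (u + v) \<partial>N)) / Gamma (1 - b))"
    using square_integrable_diff[OF sm square_integrable_mult_left[OF square_integrable_diff[OF sP], of "1
        / Gamma (1 - b)"]]
    by simp
  then have fq2: "square_integrable lborel (fourier q)"
    unfolding fq[abs_def] by (rule square_integrable_of_real)
  have "complex_of_real (\<integral>u. g u * (m' u - ((\<integral>v. W (u + v) \<partial>P) - (\<integral>v. W (u + v) \<partial>N)) / Gamma (1 - b)) \<partial>lborel)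
     = (\<integral>u. of_real (g u) * fourier q u \<partial>lborel)"
    unfolding fq of_real_mult[symmetric] integral_complex_of_real ..
  also have "\<dots> = (\<integral>y. F y * q y \<partial>lborel)"
    by (rule has_L2_fourier_multiplication[OF fF q q2 fq2])
  also have "\<dots> = (\<integral>y. - \<psi> y \<partial>lborel)"
  proof (rule integral_cong_AE)
    have "F \<in> borel_measurable lborel" using fF by (simp add: has_L2_fourier_def square_integrable_def)
    then show "(\<lambda>y. F y * q y) \<in> borel_measurable lborel" using q by auto
    have "AE y in lborel. y \<noteq> (0::real)" by (rule AE_lborel_singleton)
    then show "AE y in lborel. F y * q y = - \<psi> y"
    proof eventually_elim
      case (elim y)
      define w where "w = - (\<i> * complex_of_real y)"
      have w: "w \<noteq> 0" using elim by (simp add: w_def)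
      have py: "p y = w powr of_real b * \<psi> y" by (simp add: p_def w_def)
      have ii: "\<i> * of_real y = - (w powr of_real b * w powr of_real (1 - b))"
        using w by (simp add: powr_add[symmetric] w_def)
      have "q y = - (w powr of_real b * w powr of_real (1 - b)) * \<psi> y
          + (w powr of_real b * \<psi> y * eP y - w powr of_real b * \<psi> y * eN y)"
        by (simp only: q_def py ii)
      then have "q y = - (w powr of_real b * \<psi> y * (w powr of_real (1 - b) - (eP y - eN y)))"
        by (simp add: algebra_simps)
      then have "F y * q y = - (w powr of_real b * \<psi> y * (F y * (w powr of_real (1 - b) - (eP y - eN y))))"
        by simp
      also have "F y * (w powr of_real (1 - b) - (eP y - eN y)) = w powr (- of_real b)"
        using F[OF elim] by (simp add: w_def eP_def eN_def)
      also have "w powr of_real b * \<psi> y * w powr (- of_real b) = \<psi> y"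
        using w by (simp add: powr_minus)
      finally show ?case .
    qed
  qed auto
  also have "\<dots> = - fourier \<psi> 0" by (simp add: fourier_def)
  also have "\<dots> = of_real (- m 0)" by (simp add: fourier_\<psi>)
  finally show ?thesis by (simp only: of_real_eq_iff)
qed

end

section \<open>Gaussians as test functions\<close>

definition gauss :: "real \<Rightarrow> real \<Rightarrow> real \<Rightarrow> real" where
  "gauss s a u = exp (- ((u - a) / s)\<^sup>2 / 2)"

definition gauss' :: "real \<Rightarrow> real \<Rightarrow> real \<Rightarrow> real" where
  "gauss' s a u = - ((u - a) / s) * exp (- ((u - a) / s)\<^sup>2 / 2) / s"

text \<open>The inverse transform of \<open>gauss s a\<close>: a normal density of width
  \<open>1 / s\<close>, whose phase moves the centre to \<open>a\<close>. The normalising constant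
  sits in \<open>std_normal_density\<close>.\<close>

definition gauss_hat :: "real \<Rightarrow> real \<Rightarrow> real \<Rightarrow> complex" where
  "gauss_hat s a y = of_real (s * std_normal_density (s * y)) * exp (- (\<i> * of_real (a * y)))"

lemma integral_std_normal_iexp:
  "(\<integral>x. exp (\<i> * of_real (t * x)) * of_real (std_normal_density x) \<partial>lborel) = of_real (exp (- t\<^sup>2 / 2))"
proof -
  have "char std_normal_distribution t = (\<integral>x. std_normal_density x *\<^sub>R exp (\<i> * of_real (t * x)) \<partial>lborel)"
    unfolding char_def by (subst integral_density) (auto simp: normal_density_nonneg)
  then show ?thesis
    by (simp add: char_std_normal_distribution scaleR_conv_of_real mult.commute)
qed

lemma integrable_std_normal_density: "integrable lborel std_normal_density"
  by simp

lemma integrable_std_normal_density_abs: "integrable lborel (\<lambda>x. \<bar>x\<bar> * std_normal_density x)"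
  using integrable_abs[OF integrable_std_normal_moment[of 1]] by (simp add: abs_mult mult.commute normal_density_nonneg)

lemma abs_exp_bound: "\<bar>t\<bar> * exp (- t\<^sup>2 / 2) \<le> (1 :: real)"
proof -
  have "0 \<le> (\<bar>t\<bar> - 1)\<^sup>2" by simp
  then have "2 * \<bar>t\<bar> \<le> t\<^sup>2 + 1" by (simp add: power2_diff)
  then have "\<bar>t\<bar> \<le> 1 + t\<^sup>2 / 2" by simp
  also have "\<dots> \<le> exp (t\<^sup>2 / 2)" by (rule exp_ge_add_one_self)
  finally have "\<bar>t\<bar> * exp (- t\<^sup>2 / 2) \<le> exp (t\<^sup>2 / 2) * exp (- t\<^sup>2 / 2)"
    by (intro mult_right_mono) auto
  then show ?thesis by (simp flip: exp_add)
qed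

lemma tendsto_std_normal_density:
  "(std_normal_density \<longlongrightarrow> 0) at_top" "(std_normal_density \<longlongrightarrow> 0) at_bot"
proof -
  have f: "std_normal_density = (\<lambda>x. 1 / sqrt (2 * pi) * exp (- x\<^sup>2 / 2))"
    by (rule ext) (simp add: std_normal_density_def)
  have "((\<lambda>x::real. exp (- x\<^sup>2 / 2)) \<longlongrightarrow> 0) at_top" by real_asymp
  then show "(std_normal_density \<longlongrightarrow> 0) at_top" unfolding f by (rule tendsto_mult_right_zero)
  have "((\<lambda>x::real. exp (- x\<^sup>2 / 2)) \<longlongrightarrow> 0) at_bot" by real_asymp
  then show "(std_normal_density \<longlongrightarrow> 0) at_bot" unfolding f by (rule tendsto_mult_right_zero)
qed

text \<open>The function \<open>exp (\<i> * t * x)\<close> times the density vanishes at both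
  infinities, so its derivative integrates to 0. As the density has derivative \<open>- x\<close>
  times itself, the first moment is reduced to the characteristic function without differentiating
  under the integral.\<close>

lemma integral_std_normal_id_iexp:
  "(\<integral>x. exp (\<i> * of_real (t * x)) * of_real (x * std_normal_density x) \<partial>lborel) = \<i> * of_real (t * exp (- t\<^sup>2 / 2))"
proof -
  define f1 where "f1 x = \<i> * of_real t * (exp (\<i> * of_real (t * x)) * of_real (std_normal_density x))" for x
  define f2 where "f2 x = exp (\<i> * of_real (t * x)) * of_real (x * std_normal_density x)" for x
  define F where "F x = exp (\<i> * of_real (t * x)) * of_real (std_normal_density x)" for x
  have i1: "integrable lborel f1"
    unfolding f1_def by (intro integrable_mult_right Bochner_Integration.integrable_bound[OF
        integrable_std_normal_density])
      (auto simp: norm_mult normal_density_nonneg)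
  have i2: "integrable lborel f2"
    unfolding f2_def by (rule Bochner_Integration.integrable_bound[OF integrable_std_normal_density_abs])
      (auto simp: norm_mult normal_density_nonneg)
  have "(LBINT x=-\<infinity>..\<infinity>. f1 x - f2 x) = 0 - 0"
  proof (rule interval_integral_FTC_integrable[where F=F])
    fix x :: real
    have "(std_normal_density has_real_derivative - x * std_normal_density x) (at x)"
    proof -
      define c where "c = 1 / sqrt (2 * pi)"
      have f: "std_normal_density = (\<lambda>x. c * exp (- x\<^sup>2 / 2))"
        by (rule ext) (simp add: std_normal_density_def c_def)
      show ?thesis unfolding f by (auto intro!: derivative_eq_intros)
    qed
    then have "((\<lambda>x. complex_of_real (std_normal_density x)) has_vector_derivative of_real (- x
        * std_normal_density x)) (at x)"
      by (intro has_vector_derivative_of_real) (simp add: has_real_derivative_iff_has_vector_derivative[symmetric])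
    moreover have "((\<lambda>x. exp (\<i> * of_real (t * x))) has_vector_derivative (\<i> * of_real t * exp (\<i> * of_real (t
        * x)))) (at x)"
    proof -
      have "((\<lambda>z. exp (\<i> * (of_real t * z))) has_field_derivative (\<i> * of_real t * exp (\<i> * (of_real t
          * of_real x)))) (at (of_real x))"
        by (auto intro!: derivative_eq_intros)
      from has_vector_derivative_real_field[OF this] show ?thesis by simp
    qed
    ultimately have "(F has_vector_derivative exp (\<i> * of_real (t * x)) * of_real (- x * std_normal_density x)
        + \<i> * of_real t * exp (\<i> * of_real (t * x)) * of_real (std_normal_density x)) (at x)"
      unfolding F_def by (intro has_vector_derivative_mult)
    then show "(F has_vector_derivative f1 x - f2 x) (at x)"
      by (simp add: f1_def f2_def algebra_simps)
    show "isCont (\<lambda>x. f1 x - f2 x) x"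
      unfolding f1_def f2_def std_normal_density_def by (intro continuous_intros) auto
  next
    show "set_integrable lborel (einterval (- \<infinity>) \<infinity>) (\<lambda>x. f1 x - f2 x)"
      using i1 i2 by (simp add: set_integrable_def)
    have nF: "norm (F x) \<le> std_normal_density x" for x by (simp add: F_def norm_mult normal_density_nonneg)
    have "(F \<longlongrightarrow> 0) at_top" "(F \<longlongrightarrow> 0) at_bot"
      by (rule Lim_null_comparison[OF always_eventually[OF allI[OF nF]]], rule tendsto_std_normal_density)+
    then show "((F \<circ> real_of_ereal) \<longlongrightarrow> 0) (at_left \<infinity>)" "((F \<circ> real_of_ereal) \<longlongrightarrow> 0) (at_right (- \<infinity>))"
      by (simp_all add: ereal_tendsto_simps)
  qed auto
  also have "(LBINT x=-\<infinity>..\<infinity>. f1 x - f2 x) = (\<integral>x. f1 x \<partial>lborel) - (\<integral>x. f2 x \<partial>lborel)"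
    using i1 i2 by (simp add: interval_lebesgue_integral_def set_lebesgue_integral_def)
  finally have "(\<integral>x. f2 x \<partial>lborel) = (\<integral>x. f1 x \<partial>lborel)" by simp
  also have "\<dots> = \<i> * of_real t * of_real (exp (- t\<^sup>2 / 2))"
    unfolding f1_def using integral_std_normal_iexp[of t] by simp
  finally show ?thesis by (simp add: f2_def)
qed

lemma fourier_gauss_hat:
  assumes "0 < s"
  shows "fourier (gauss_hat s a) u = of_real (gauss s a u)"
    and "fourier (\<lambda>y. \<i> * of_real y * gauss_hat s a y) u = of_real (gauss' s a u)"
proof -
  let ?t = "(u - a) / s"
  \<comment> \<open>Substituting \<open>x = s * y\<close> absorbs both phases into the single
    frequency \<open>(u - a) / s\<close>; the form \<open>0 + s * y\<close> is the affine map of the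
    change of variables.\<close>
  have e: "exp (\<i> * of_real (u * y)) * gauss_hat s a y
     = of_real s * (exp (\<i> * of_real (?t * (0 + s * y))) * of_real (std_normal_density (0 + s * y)))" for y
  proof -
    have "exp (\<i> * of_real (u * y)) * exp (- (\<i> * of_real (a * y))) = exp (\<i> * of_real (?t * (0 + s * y)))"
    proof -
      have "?t * (0 + s * y) = u * y - a * y" using assms by (simp add: field_simps)
      then show ?thesis by (simp add: exp_add[symmetric] right_diff_distrib)
    qed
    then show ?thesis by (simp add: gauss_hat_def algebra_simps)
  qed
  have sc: "(\<integral>x. f x \<partial>lborel) = of_real s * (\<integral>y. f (0 + s * y) \<partial>lborel)" for f :: "real \<Rightarrow> complex"
    using lborel_integral_real_affine[of s f 0] assms by (simp add: scaleR_conv_of_real)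
  show "fourier (gauss_hat s a) u = of_real (gauss s a u)"
    unfolding fourier_def e using sc[of "\<lambda>x. exp (\<i> * of_real (?t * x)) * of_real (std_normal_density x)"]
    unfolding integral_std_normal_iexp by (simp add: gauss_def)
  have e2: "exp (\<i> * of_real (u * y)) * (\<i> * of_real y * gauss_hat s a y)
     = \<i> / of_real s * (of_real s * (exp (\<i> * of_real (?t * (0 + s * y))) * of_real ((0
         + s * y) * std_normal_density (0 + s * y))))" for y
  proof -
    have "exp (\<i> * of_real (u * y)) * (\<i> * of_real y * gauss_hat s a y)
        = \<i> * of_real y * (exp (\<i> * of_real (u * y)) * gauss_hat s a y)"
      by simp
    then show ?thesis unfolding e using assms by (simp add: mult_ac)
  qed
  show "fourier (\<lambda>y. \<i> * of_real y * gauss_hat s a y) u = of_real (gauss' s a u)"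
  proof -
    define f where "f x = exp (\<i> * of_real (?t * x)) * of_real (x * std_normal_density x)" for x
    have "fourier (\<lambda>y. \<i> * of_real y * gauss_hat s a y) u = \<i> / of_real s * (of_real s * (\<integral>y. f (0 + s * y) \<partial>lborel))"
      unfolding fourier_def e2 f_def[symmetric] by (simp only: integral_mult_right_zero)
    also have "\<dots> = \<i> / of_real s * (\<integral>x. f x \<partial>lborel)"
      by (simp only: sc[of f])
    also have "\<dots> = of_real (gauss' s a u)"
      unfolding f_def integral_std_normal_id_iexp by (simp add: gauss'_def)
    finally show ?thesis .
  qed
qed

lemma gauss_deriv: "0 < s \<Longrightarrow> (gauss s a has_real_derivative gauss' s a u) (at u)"
  unfolding gauss_def gauss'_def by (auto intro!: derivative_eq_intros simp: power2_eq_square field_simps)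

lemma gauss_integrable:
  assumes "0 < s"
  shows "integrable lborel (gauss s a)" "integrable lborel (gauss' s a)"
proof -
  have "integrable lborel (\<lambda>x. sqrt (2 * pi) * std_normal_density ((- a / s) + (1 / s) * x))"
    using assms by (intro integrable_mult_right lborel_integrable_real_affine) auto
  then show "integrable lborel (gauss s a)"
    by (rule Bochner_Integration.integrable_cong[THEN iffD1, rotated 2])
       (auto simp: gauss_def std_normal_density_def diff_divide_distrib)
  have "integrable lborel (\<lambda>x. - sqrt (2 * pi) / s * (((- a / s) + (1 / s) * x) * std_normal_density ((- a / s)
      + (1 / s) * x)))"
    using assms integrable_std_normal_moment[of 1]
    by (intro integrable_mult_right lborel_integrable_real_affine[of "\<lambda>x. x
        * std_normal_density x"]) (auto simp: mult.commute)
  moreover have "(- a / s) + (1 / s) * x = (x - a) / s" for x by (simp add: diff_divide_distrib)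
  moreover have "- sqrt (2 * pi) / s * (t * std_normal_density t) = - t * exp (- t\<^sup>2 / 2) / s" for t
    by (simp add: std_normal_density_def)
  ultimately show "integrable lborel (gauss' s a)"
    unfolding gauss'_def[abs_def] by (simp only:)
qed

lemma gauss_bounded: "\<bar>gauss s a u\<bar> \<le> 1" "0 < s \<Longrightarrow> \<bar>gauss' s a u\<bar> \<le> 1 / s"
proof -
  show "\<bar>gauss s a u\<bar> \<le> 1" by (simp add: gauss_def)
  assume s: "0 < s"
  have "\<bar>- t * exp (- t\<^sup>2 / 2) / s\<bar> \<le> 1 / s" for t
  proof -
    have "\<bar>- t * exp (- t\<^sup>2 / 2) / s\<bar> = \<bar>t\<bar> * exp (- t\<^sup>2 / 2) / s" using s by (simp add: abs_mult)
    also have "\<dots> \<le> 1 / s" using s abs_exp_bound by (intro divide_right_mono) auto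
    finally show ?thesis .
  qed
  then show "\<bar>gauss' s a u\<bar> \<le> 1 / s" unfolding gauss'_def .
qed

section \<open>Convolution of causal functions with a finite measure\<close>

definition measure_convolution :: "(real \<Rightarrow> real) \<Rightarrow> real measure \<Rightarrow> real \<Rightarrow> real" where
  "measure_convolution f P t = (\<integral>v. f (t - v) \<partial>P)"

lemma measure_convolution_measurable:
  assumes "finite_measure P" "sets P = sets borel" "f \<in> borel_measurable borel"
  shows "measure_convolution f P \<in> borel_measurable borel"
proof -
  interpret finite_measure P by fact
  note [measurable] = assms(3) and [measurable_cong] = assms(2)
  show ?thesis unfolding measure_convolution_def by measurable
qed

text \<open>A delay \<open>v \<ge> 0\<close> does not increase the weighted norm because
  \<open>exp (- v) \<le> 1\<close>, so finite mass suffices. The last two claims are the Fubini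
  identity for pairings with an exponentially decaying \<open>k\<close>, in which the delay is moved
  to the argument of \<open>k\<close>.\<close>

lemma causal_exp_measure_convolution:
  assumes f: "causal_exp f" and P: "finite_measure P" "sets P = sets borel" "AE v in P. 0 \<le> v"
  shows "causal_exp (measure_convolution f P)"
    and "AE t in lborel. integrable P (\<lambda>v. f (t - v))"
    and "\<lbrakk>k \<in> borel_measurable borel; \<And>x. 0 \<le> x \<Longrightarrow> \<bar>k x\<bar> \<le> C * exp (- x)\<rbrakk> \<Longrightarrow>
      (\<integral>v. (\<integral>x. f x * k (v + x) \<partial>lborel) \<partial>P) = (\<integral>z. measure_convolution f P z * k z \<partial>lborel)"
    and "\<lbrakk>k \<in> borel_measurable borel; \<And>x. 0 \<le> x \<Longrightarrow> \<bar>k x\<bar> \<le> C * exp (- x)\<rbrakk> \<Longrightarrow>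
      integrable P (\<lambda>v. \<integral>x. f x * k (v + x) \<partial>lborel)"
proof -
  interpret finite_measure P by fact
  interpret PL: pair_sigma_finite P lborel ..
  note [measurable] = causal_expD(1)[OF f] and [measurable_cong] = P(2)
  have int: "integrable (P \<Otimes>\<^sub>M lborel) (\<lambda>(v, z). f (z - v) * k z)"
    if k[measurable]: "k \<in> borel_measurable borel" and kb: "\<And>x. 0 \<le> x \<Longrightarrow> \<bar>k x\<bar> \<le> C * exp (- x)" for k C
    unfolding integrable_iff_bounded
  proof
    have C: "0 \<le> C" using kb[of 0] by (simp add: order_trans[OF abs_ge_zero])
    have "(\<integral>\<^sup>+p. ennreal (norm (case p of (v, z) \<Rightarrow> f (z - v) * k z)) \<partial>(P \<Otimes>\<^sub>M lborel))
        = (\<integral>\<^sup>+v. (\<integral>\<^sup>+z. ennreal \<bar>f (z - v) * k z\<bar> \<partial>lborel) \<partial>P)"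
      by (subst lborel.nn_integral_fst[symmetric]) auto
    also have "\<dots> \<le> (\<integral>\<^sup>+v. ennreal C * (\<integral>\<^sup>+x. ennreal (norm (exp (- x) * f x)) \<partial>lborel) \<partial>P)"
    proof (rule nn_integral_mono_AE)
      show "AE v in P. (\<integral>\<^sup>+z. ennreal \<bar>f (z - v) * k z\<bar> \<partial>lborel)
          \<le> ennreal C * (\<integral>\<^sup>+x. ennreal (norm (exp (- x) * f x)) \<partial>lborel)"
        using P(3)
      proof eventually_elim
        case (elim v)
        have "(\<integral>\<^sup>+z. ennreal \<bar>f (z - v) * k z\<bar> \<partial>lborel) = (\<integral>\<^sup>+x. ennreal \<bar>f x * k (v + x)\<bar> \<partial>lborel)"
          by (subst nn_integral_shift(2)[of _ v, symmetric]) auto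
        also have "\<dots> \<le> (\<integral>\<^sup>+x. ennreal C * ennreal (norm (exp (- x) * f x)) \<partial>lborel)"
        proof (rule nn_integral_mono)
          fix x
          have "\<bar>f x * k (v + x)\<bar> \<le> C * norm (exp (- x) * f x)"
          proof (cases "x < 0")
            case False
            have "\<bar>f x\<bar> * \<bar>k (v + x)\<bar> \<le> \<bar>f x\<bar> * (C * exp (- (v + x)))"
              using False elim by (intro mult_left_mono kb) auto
            also have "\<dots> \<le> \<bar>f x\<bar> * (C * exp (- x))"
              using elim C by (intro mult_left_mono) auto
            finally show ?thesis by (simp add: abs_mult mult_ac)
          qed (simp add: causal_expD(2)[OF f])
          then show "ennreal \<bar>f x * k (v + x)\<bar> \<le> ennreal C * ennreal (norm (exp (- x) * f x))"
            using C by (subst ennreal_mult[symmetric]) (auto intro!: ennreal_leI)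
        qed
        also have "\<dots> = ennreal C * (\<integral>\<^sup>+x. ennreal (norm (exp (- x) * f x)) \<partial>lborel)"
          by (rule nn_integral_cmult) measurable
        finally show ?case .
      qed
    qed
    also have "\<dots> < \<infinity>"
      using causal_expD(3)[OF f] emeasure_finite[of "space P"]
      by (simp add: integrable_iff_bounded ennreal_mult_less_top less_top[symmetric] ennreal_mult_eq_top_iff)
    finally show "(\<integral>\<^sup>+p. ennreal (norm (case p of (v, z) \<Rightarrow> f (z - v) * k z)) \<partial>(P \<Otimes>\<^sub>M lborel)) < \<infinity>" .
  qed measurable
  have mc: "(\<integral>v. f (z - v) * k z \<partial>P) = measure_convolution f P z * k z" for k z
    by (simp add: measure_convolution_def)
  have sh: "(\<integral>z. f (z - v) * k z \<partial>lborel) = (\<integral>x. f x * k (v + x) \<partial>lborel)" for v k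
    using integral_shift(2)[of "\<lambda>z. f (z - v) * k z" v] by simp
  have eb: "0 \<le> x \<Longrightarrow> \<bar>exp (- x)\<bar> \<le> 1 * exp (- x)" for x :: real by simp
  show "causal_exp (measure_convolution f P)"
    unfolding causal_exp_def
  proof (intro conjI allI impI)
    show "measure_convolution f P \<in> borel_measurable borel"
      by (rule measure_convolution_measurable[OF P(1,2)]) measurable
    show "measure_convolution f P u = 0" if "u < 0" for u
      unfolding measure_convolution_def
      by (rule integral_eq_zero_AE) (use P(3) that causal_expD(2)[OF f] in \<open>auto elim!: eventually_mono\<close>)
    show "integrable lborel (\<lambda>u. exp (- u) * measure_convolution f P u)"
      using PL.integrable_snd[OF int[OF _ eb]] by (simp add: measure_convolution_def mult.commute)
  qed
  show "AE t in lborel. integrable P (\<lambda>v. f (t - v))"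
    using PL.AE_integrable_snd[OF int[OF _ eb]] by simp
  assume k: "k \<in> borel_measurable borel" "\<And>x. 0 \<le> x \<Longrightarrow> \<bar>k x\<bar> \<le> C * exp (- x)"
  show "(\<integral>v. (\<integral>x. f x * k (v + x) \<partial>lborel) \<partial>P) = (\<integral>z. measure_convolution f P z * k z \<partial>lborel)"
    using PL.Fubini_integral[OF int[OF k]] by (simp add: measure_convolution_def sh)
  show "integrable P (\<lambda>v. \<integral>x. f x * k (v + x) \<partial>lborel)"
    using PL.integrable_fst[OF int[OF k]] by (simp add: sh)
qed

text \<open>Reflection at \<open>t\<close> turns causality into vanishing beyond \<open>t\<close>,
  hence into any decay; the constant \<open>exp t\<close> makes up for \<open>exp (- x)\<close> on
  the remaining bounded interval. Convolutions evaluated at a fixed time thereby become pairings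
  with a decaying function.\<close>

lemma causal_locally_bounded_exp:
  fixes h :: "real \<Rightarrow> real"
  assumes h0: "\<And>u. u < 0 \<Longrightarrow> h u = 0" and hB: "\<And>u. u \<le> t \<Longrightarrow> \<bar>h u\<bar> \<le> B" and x: "0 \<le> x"
  shows "\<bar>h (t - x)\<bar> \<le> (B * exp t) * exp (- x)"
proof -
  have B: "0 \<le> B" using hB[of t] by (simp add: order_trans[OF abs_ge_zero])
  show ?thesis
  proof (cases "t < x")
    case True then show ?thesis using h0[of "t - x"] B by simp
  next
    case False
    have "\<bar>h (t - x)\<bar> \<le> B * 1" using hB[of "t - x"] x by simp
    also have "\<dots> \<le> B * exp (t - x)" using B False by (intro mult_left_mono) auto
    finally show ?thesis by (simp add: mult.assoc flip: exp_add)
  qed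
qed

lemma continuous_on_nonneg_bounded:
  fixes g :: "real \<Rightarrow> real"
  assumes "continuous_on {0..} g" "\<And>u. u < 0 \<Longrightarrow> g u = 0"
  obtains B where "\<And>u. u \<le> t \<Longrightarrow> \<bar>g u\<bar> \<le> B"
proof -
  have "compact (g ` {0..t})"
    by (intro compact_continuous_image continuous_on_subset[OF assms(1)]) auto
  then have "bounded (g ` {0..t})" by (rule compact_imp_bounded)
  then obtain B where B: "\<And>u. u \<in> {0..t} \<Longrightarrow> norm (g u) \<le> B" unfolding bounded_iff by blast
  show thesis
  proof
    fix u assume "u \<le> t"
    then show "\<bar>g u\<bar> \<le> max B 0"
      using B[of u] assms(2)[of u] by (cases "u < 0") (auto simp: le_max_iff_disj)
  qed
qed

lemma isCont_causal:
  fixes g :: "real \<Rightarrow> real"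
  assumes g: "continuous_on {0..} g" "\<And>u. u < 0 \<Longrightarrow> g u = 0" and x: "x \<noteq> 0"
  shows "isCont g x"
proof (cases "0 < x")
  case True
  have "continuous_on {0<..} g" by (rule continuous_on_subset[OF g(1)]) auto
  then show ?thesis using True by (simp add: continuous_on_eq_continuous_at)
next
  case False
  then have "\<forall>\<^sub>F y in nhds x. g y = 0"
    using x g(2) eventually_nhds_in_open[of "{..<0}" x] by (auto elim!: eventually_mono)
  then show ?thesis using isCont_cong[of g "\<lambda>_. 0" x] by simp
qed

text \<open>The shift is carried by \<open>g\<close>, whose only possible discontinuity is the jump
  at 0. That point is met for \<open>z = t\<close> alone, a null set, so dominated convergence
  applies although \<open>e\<close> itself may be singular.\<close>

lemma isCont_real_convolution:
  assumes e: "causal_exp e" and g: "continuous_on {0..} g" "\<And>u. u < 0 \<Longrightarrow> g u = 0" "g \<in> borel_measurable borel"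
  shows "isCont (e \<circledast> g) t"
proof (rule continuous_at_sequentiallyI)
  fix X :: "nat \<Rightarrow> real" assume X: "X \<longlonglongrightarrow> t"
  note [measurable] = causal_expD(1)[OF e] g(3)
  obtain T where T: "\<And>n. X n \<le> T" "t \<le> T"
  proof -
    obtain K where K: "\<And>n. norm (X n) \<le> K" using convergent_imp_Bseq[of X] X by (auto simp: convergent_def Bseq_def)
    show thesis using that[of "max K t"] K by (auto simp: abs_le_iff le_max_iff_disj)
  qed
  obtain B where B: "\<And>u. u \<le> T \<Longrightarrow> \<bar>g u\<bar> \<le> B" using continuous_on_nonneg_bounded[OF g(1,2), of T] by blast
  have bd: "\<bar>g (y - z)\<bar> \<le> B * exp T * exp (- z)" if "y \<le> T" "0 \<le> z" for y z
  proof -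
    have "\<bar>g (y - z)\<bar> \<le> (B * exp y) * exp (- z)"
      using that by (intro causal_locally_bounded_exp g(2) B) auto
    also have "\<dots> \<le> (B * exp T) * exp (- z)"
      using that B[of T] by (intro mult_right_mono mult_left_mono) auto
    finally show ?thesis .
  qed
  have "(\<lambda>n. \<integral>z. e z * g (X n - z) \<partial>lborel) \<longlonglongrightarrow> (\<integral>z. e z * g (t - z) \<partial>lborel)"
  proof (rule integral_dominated_convergence[where w="\<lambda>z. B * exp T * \<bar>exp (- z) * e z\<bar>"])
    show "integrable lborel (\<lambda>z. B * exp T * \<bar>exp (- z) * e z\<bar>)"
      using causal_expD(3)[OF e] by (intro integrable_mult_right integrable_abs)
    show "AE z in lborel. norm (e z * g (X n - z)) \<le> B * exp T * \<bar>exp (- z) * e z\<bar>" for n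
    proof (rule AE_I2)
      fix z
      show "norm (e z * g (X n - z)) \<le> B * exp T * \<bar>exp (- z) * e z\<bar>"
      proof (cases "z < 0")
        case False
        then have "\<bar>e z\<bar> * \<bar>g (X n - z)\<bar> \<le> \<bar>e z\<bar> * (B * exp T * exp (- z))"
          by (intro mult_left_mono bd T) auto
        then show ?thesis by (simp add: abs_mult mult_ac)
      qed (simp add: causal_expD(2)[OF e])
    qed
    have "AE z in lborel. z \<noteq> t" by (rule AE_lborel_singleton)
    then show "AE z in lborel. (\<lambda>n. e z * g (X n - z)) \<longlonglongrightarrow> e z * g (t - z)"
    proof eventually_elim
      case (elim z)
      have "isCont g (t - z)" using elim by (intro isCont_causal g) auto
      then show ?case
        by (intro tendsto_mult tendsto_const isCont_tendsto_compose[of _ g] tendsto_diff X)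
    qed
  qed measurable
  then show "(\<lambda>n. (e \<circledast> g) (X n)) \<longlonglongrightarrow> (e \<circledast> g) t"
    unfolding real_convolution_commute[of e g] by (simp add: real_convolution_def mult.commute)
qed

text \<open>Completing the square trades the Gaussian factor for \<open>exp (- x)\<close>. For the
  derivative one half of the exponent first absorbs the linear factor. This decay is what permits
  pairing with every weighted causal function.\<close>

lemma gauss_exp_bound:
  assumes "0 < s"
  shows "\<bar>gauss s a x\<bar> \<le> exp (a + s\<^sup>2 / 2) * exp (- x)"
    and "\<bar>gauss' s a x\<bar> \<le> exp (a + s\<^sup>2) / s * exp (- x)"
proof -
  define t where "t = (x - a) / s"
  have x: "x = a + s * t" using assms by (simp add: t_def)
  have "2 * (s * t) \<le> s\<^sup>2 + t\<^sup>2" using sum_squares_bound[of s t] by (simp add: mult.assoc)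
  then have "- t\<^sup>2 / 2 \<le> (a + s\<^sup>2 / 2) + (- x)" unfolding x by simp
  then have "exp (- t\<^sup>2 / 2) \<le> exp ((a + s\<^sup>2 / 2) + (- x))" by simp
  then show "\<bar>gauss s a x\<bar> \<le> exp (a + s\<^sup>2 / 2) * exp (- x)"
    unfolding exp_add by (simp add: gauss_def t_def)
  have "0 \<le> (\<bar>t\<bar> / 2 - 1)\<^sup>2" by simp
  then have "\<bar>t\<bar> \<le> 1 + t\<^sup>2 / 4" by (simp add: power2_diff power_divide)
  also have "\<dots> \<le> exp (t\<^sup>2 / 4)" by (rule exp_ge_add_one_self)
  finally have "\<bar>t\<bar> * exp (- t\<^sup>2 / 2) \<le> exp (t\<^sup>2 / 4) * exp (- t\<^sup>2 / 2)" by (intro mult_right_mono) auto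
  also have "\<dots> = exp (- t\<^sup>2 / 4)" by (simp flip: exp_add)
  also have "\<dots> \<le> exp ((a + s\<^sup>2) + (- x))"
  proof -
    have "2 * s * (t / 2) \<le> s\<^sup>2 + (t / 2)\<^sup>2" by (rule sum_squares_bound)
    then have "- t\<^sup>2 / 4 \<le> (a + s\<^sup>2) + (- x)" unfolding x by (simp add: power_divide)
    then show ?thesis by simp
  qed
  finally have "\<bar>t\<bar> * exp (- t\<^sup>2 / 2) / s \<le> exp ((a + s\<^sup>2) + (- x)) / s"
    using assms by (intro divide_right_mono) auto
  moreover have "\<bar>gauss' s a x\<bar> = \<bar>t\<bar> * exp (- t\<^sup>2 / 2) / s"
    unfolding gauss'_def t_def[symmetric] using assms by (simp add: abs_mult)
  ultimately show "\<bar>gauss' s a x\<bar> \<le> exp (a + s\<^sup>2) / s * exp (- x)"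
    by (simp add: mult_exp_exp)
qed

lemma gauss_measurable [measurable]:
  "(\<lambda>(a, x). gauss s a x) \<in> borel_measurable (borel \<Otimes>\<^sub>M borel)"
  "(\<lambda>(a, x). gauss' s a x) \<in> borel_measurable (borel \<Otimes>\<^sub>M borel)"
  "gauss s a \<in> borel_measurable borel" "gauss' s a \<in> borel_measurable borel"
  unfolding gauss_def gauss'_def by measurable

section \<open>Gaussians separate causal functions\<close>

lemma causal_exp_mult_integrable:
  assumes q: "causal_exp q" and k: "k \<in> borel_measurable borel" "\<And>x. 0 \<le> x \<Longrightarrow> \<bar>k x\<bar> \<le> C * exp (- x)"
  shows "integrable lborel (\<lambda>t. q t * k t)"
    and "\<bar>\<integral>t. q t * k t \<partial>lborel\<bar> \<le> C * (\<integral>t. \<bar>exp (- t) * q t\<bar> \<partial>lborel)"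
proof -
  note [measurable] = causal_expD(1)[OF q] k(1)
  have C: "0 \<le> C" using k(2)[of 0] by (simp add: order_trans[OF abs_ge_zero])
  have i: "integrable lborel (\<lambda>t. C * \<bar>exp (- t) * q t\<bar>)"
    using causal_expD(3)[OF q] by (intro integrable_mult_right integrable_abs)
  have b: "\<bar>q t * k t\<bar> \<le> C * \<bar>exp (- t) * q t\<bar>" for t
  proof (cases "t < 0")
    case False
    then have "\<bar>q t\<bar> * \<bar>k t\<bar> \<le> \<bar>q t\<bar> * (C * exp (- t))" by (intro mult_left_mono k) auto
    then show ?thesis by (simp add: abs_mult mult_ac)
  qed (simp add: causal_expD(2)[OF q])
  show int: "integrable lborel (\<lambda>t. q t * k t)"
    by (rule Bochner_Integration.integrable_bound[OF i]) (use b order_trans[OF _ abs_ge_self] in auto)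
  have "\<bar>\<integral>t. q t * k t \<partial>lborel\<bar> \<le> (\<integral>t. \<bar>q t * k t\<bar> \<partial>lborel)" by (rule integral_abs_bound)
  also have "\<dots> \<le> (\<integral>t. C * \<bar>exp (- t) * q t\<bar> \<partial>lborel)"
    using i int b by (intro integral_mono integrable_abs) auto
  finally show "\<bar>\<integral>t. q t * k t \<partial>lborel\<bar> \<le> C * (\<integral>t. \<bar>exp (- t) * q t\<bar> \<partial>lborel)" by simp
qed

lemma gauss'_integral:
  assumes s: "0 < s" and "a1 \<le> a2"
  shows "(\<integral>a. indicator {a1..a2} a * gauss' s a t \<partial>lborel) = gauss s a1 t - gauss s a2 t"
proof -
  \<comment> \<open>The integration is over the centre. Exchanging the roles of centre and argument
    reduces the derivative in \<open>a\<close> to the known one, with the sign coming from the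
    reflection.\<close>
  have sym: "gauss s a t = gauss s (- t) (- a)" "gauss' s a t = gauss' s (- t) (- a)" for a
    by (simp_all add: gauss_def gauss'_def)
  have "(\<integral>a. indicator {a1..a2} a *\<^sub>R gauss' s a t \<partial>lborel) = - gauss s a2 t - - gauss s a1 t"
  proof (rule integral_FTC_atLeastAtMost[OF assms(2)])
    fix a
    have "((\<lambda>a. gauss s (- t) (- a)) has_real_derivative gauss' s (- t) (- a) * (- 1)) (at a)"
      by (rule DERIV_chain2[OF gauss_deriv[OF s]]) (auto intro!: derivative_eq_intros)
    then have "((\<lambda>a. - gauss s a t) has_real_derivative gauss' s a t) (at a)"
      unfolding sym by (auto dest: DERIV_minus)
    then show "((\<lambda>a. - gauss s a t) has_vector_derivative gauss' s a t) (at a within {a1..a2})"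
      by (simp add: has_real_derivative_iff_has_vector_derivative has_vector_derivative_at_within)
    show "continuous_on {a1..a2} (\<lambda>a. gauss' s a t)"
      unfolding gauss'_def using s by (intro continuous_intros) auto
  qed
  then show ?thesis by simp
qed

text \<open>Pairing with the derivative vanishes, so the pairing with \<open>gauss s a\<close> does
  not depend on \<open>a\<close>. Since \<open>q\<close> lives on the nonnegative half-line, moving
  the centre to minus infinity sends the pairing to 0: no constant of integration survives.\<close>

lemma gauss_orthogonal:
  assumes q: "causal_exp q" and s: "0 < s"
    and z: "\<And>a. (\<integral>t. q t * gauss' s a t \<partial>lborel) = 0"
  shows "(\<integral>t. q t * gauss s a t \<partial>lborel) = 0"
proof -
  note [measurable] = causal_expD(1)[OF q]
  define H where "H a = (\<integral>t. q t * gauss s a t \<partial>lborel)" for a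
  define K where "K = (\<integral>t. \<bar>exp (- t) * q t\<bar> \<partial>lborel)"
  have const: "H a1 = H a2" if "a1 \<le> a2" for a1 a2
  proof -
    let ?f = "\<lambda>a t. indicator {a1..a2} a * (q t * gauss' s a t)"
    have int: "integrable (lborel \<Otimes>\<^sub>M lborel) (\<lambda>(a, t). ?f a t)"
    proof (rule Bochner_Integration.integrable_bound)
      show "integrable (lborel \<Otimes>\<^sub>M lborel) (\<lambda>(a, t). (indicator {a1..a2} a * (exp (a2 + s\<^sup>2) / s)) * (exp (- t) * q t))"
        by (intro integrable_pair_mult lborel.sigma_finite_measure_axioms integrable_mult_left
            integrable_real_indicator causal_expD(3)[OF q]) (auto simp: emeasure_lborel_Icc_eq)
      show "AE p in lborel \<Otimes>\<^sub>M lborel. norm (case p of (a, t) \<Rightarrow> ?f a t)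
         \<le> norm (case p of (a, t) \<Rightarrow> (indicator {a1..a2} a * (exp (a2 + s\<^sup>2) / s)) * (exp (- t) * q t))"
      proof (rule AE_I2, clarify)
        fix a t
        show "norm (?f a t) \<le> norm ((indicator {a1..a2} a * (exp (a2 + s\<^sup>2) / s)) * (exp (- t) * q t))"
        proof (cases "a \<in> {a1..a2}")
          case True
          have "\<bar>gauss' s a t\<bar> \<le> exp (a + s\<^sup>2) / s * exp (- t)" by (rule gauss_exp_bound[OF s])
          also have "\<dots> \<le> exp (a2 + s\<^sup>2) / s * exp (- t)"
            using True s by (intro mult_right_mono divide_right_mono) auto
          finally have "\<bar>q t\<bar> * \<bar>gauss' s a t\<bar> \<le> \<bar>q t\<bar> * (exp (a2 + s\<^sup>2) / s * exp (- t))"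
            by (intro mult_left_mono) auto
          then show ?thesis using True s by (simp add: abs_mult mult_ac)
        qed simp
      qed
    qed measurable
    have "H a1 - H a2 = (\<integral>t. q t * gauss s a1 t - q t * gauss s a2 t \<partial>lborel)"
      unfolding H_def
      by (intro Bochner_Integration.integral_diff[symmetric] causal_exp_mult_integrable(1)[OF q _
          gauss_exp_bound(1)[OF s]]) auto
    also have "\<dots> = (\<integral>t. (\<integral>a. ?f a t \<partial>lborel) \<partial>lborel)"
    proof (rule Bochner_Integration.integral_cong[OF refl])
      fix t
      have "(\<integral>a. ?f a t \<partial>lborel) = (\<integral>a. q t * (indicator {a1..a2} a * gauss' s a t) \<partial>lborel)"
        by (simp add: mult_ac)
      then show "q t * gauss s a1 t - q t * gauss s a2 t = (\<integral>a. ?f a t \<partial>lborel)"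
        using gauss'_integral[OF s that, of t] by (simp add: right_diff_distrib)
    qed
    also have "\<dots> = (\<integral>a. (\<integral>t. ?f a t \<partial>lborel) \<partial>lborel)"
      using lborel_pair.Fubini_integral[OF int] by simp
    finally show ?thesis using z by simp
  qed
  have bd: "\<bar>H a\<bar> \<le> exp (a + s\<^sup>2 / 2) * K" for a
    unfolding H_def K_def by (rule causal_exp_mult_integrable(2)[OF q]) (auto intro: gauss_exp_bound[OF s])
  have "((\<lambda>x. exp x * exp (s\<^sup>2 / 2) * K) \<longlongrightarrow> 0 * exp (s\<^sup>2 / 2) * K) at_bot"
    by (intro tendsto_mult tendsto_const exp_at_bot)
  then have "((\<lambda>x. exp (x + s\<^sup>2 / 2) * K) \<longlongrightarrow> 0) at_bot" by (simp add: exp_add)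
  moreover have "\<forall>\<^sub>F x in at_bot. \<bar>H a\<bar> \<le> exp (x + s\<^sup>2 / 2) * K"
    using eventually_le_at_bot[of a] by eventually_elim (use bd const in metis)
  ultimately have "\<bar>H a\<bar> \<le> 0"
    by (intro tendsto_lowerbound[of _ _ at_bot]) auto
  then show ?thesis by (simp add: H_def)
qed

text \<open>The Gaussian is a product of two equal factors. One supplies the decay in
  \<open>t\<close>, the other is of order \<open>s^2\<close> away from the centre, which is smaller
  than the mass of order \<open>s\<close> near it.\<close>

lemma gauss_far_bound:
  assumes s: "0 < s" "s \<le> 1" and d: "0 < d" "d \<le> \<bar>t - a\<bar>"
  shows "gauss s a t \<le> (4 * s\<^sup>2 / d\<^sup>2 * exp (a + 1)) * exp (- t)"
proof -
  define r where "r = t - a"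
  have r: "r \<noteq> 0" "d\<^sup>2 \<le> r\<^sup>2"
    using d by (auto simp: r_def) (metis abs_le_square_iff abs_of_pos)
  have "- (r / s)\<^sup>2 / 4 \<le> 1 - r"
  proof -
    have "0 \<le> (r / s / 2 - s)\<^sup>2" by simp
    then have "- (r / s)\<^sup>2 / 4 \<le> s\<^sup>2 - r" using s by (simp add: power2_diff power_divide)
    also have "\<dots> \<le> 1 - r" using s by (simp add: power_le_one)
    finally show ?thesis .
  qed
  then have e1: "exp (- (r / s)\<^sup>2 / 4) \<le> exp (1 - r)" by simp
  have "(r / s)\<^sup>2 / 4 \<le> exp ((r / s)\<^sup>2 / 4)"
    using exp_ge_add_one_self[of "(r / s)\<^sup>2 / 4"] by linarith
  then have "(r / s)\<^sup>2 / 4 * exp (- (r / s)\<^sup>2 / 4) \<le> exp ((r / s)\<^sup>2 / 4) * exp (- (r / s)\<^sup>2 / 4)"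
    by (intro mult_right_mono) auto
  then have "(r / s)\<^sup>2 / 4 * exp (- (r / s)\<^sup>2 / 4) \<le> 1" by (simp flip: exp_add)
  then have "exp (- (r / s)\<^sup>2 / 4) \<le> 4 * s\<^sup>2 / r\<^sup>2"
    using r s by (simp add: power_divide field_simps)
  also have "\<dots> \<le> 4 * s\<^sup>2 / d\<^sup>2" using r d by (intro divide_left_mono) auto
  finally have e2: "exp (- (r / s)\<^sup>2 / 4) \<le> 4 * s\<^sup>2 / d\<^sup>2" .
  have "gauss s a t = exp (- (r / s)\<^sup>2 / 4) * exp (- (r / s)\<^sup>2 / 4)"
    unfolding gauss_def r_def[symmetric] by (simp flip: exp_add)
  also have "\<dots> \<le> 4 * s\<^sup>2 / d\<^sup>2 * exp (1 - r)"
    using e1 e2 by (intro mult_mono) auto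
  also have "exp (1 - r) = exp (a + 1) * exp (- t)" by (simp add: r_def flip: exp_add)
  finally show ?thesis by (simp add: mult_ac)
qed

lemma causal_exp_indicator:
  assumes "causal_exp q" "A \<in> sets borel"
  shows "causal_exp (\<lambda>t. indicator A t * q t)"
proof -
  have "integrable lborel (\<lambda>t. (exp (- t) * q t) * indicator A t)"
    using assms by (intro integrable_real_mult_indicator) (auto simp: causal_exp_def)
  then show ?thesis using assms by (auto simp: causal_exp_def mult_ac)
qed

text \<open>Gaussians act as an unnormalised approximate identity: if \<open>q a\<close> were
  positive, the part near \<open>a\<close> would contribute at least a multiple of \<open>s\<close>,
  while the far part is at most of order \<open>s^2\<close>. The two have to cancel, which fails as
  \<open>s\<close> tends to 0.\<close>

lemma gauss_orthogonal_nonpos: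
  assumes q: "causal_exp q" and z: "\<And>s a. 0 < s \<Longrightarrow> (\<integral>t. q t * gauss s a t \<partial>lborel) = 0"
    and cont: "isCont q a"
  shows "q a \<le> 0"
proof (rule ccontr)
  assume "\<not> q a \<le> 0"
  then have qa: "0 < q a" by simp
  note [measurable] = causal_expD(1)[OF q]
  define K where "K = (\<integral>t. \<bar>exp (- t) * q t\<bar> \<partial>lborel)"
  obtain d where d: "0 < d" "\<And>t. \<bar>t - a\<bar> < d \<Longrightarrow> \<bar>q t - q a\<bar> < q a / 2"
    using cont qa unfolding continuous_at_eps_delta dist_real_def by (metis half_gt_zero)
  define q1 where "q1 t = indicator {t. \<bar>t - a\<bar> < d} t * q t" for t
  define q2 where "q2 t = indicator {t. d \<le> \<bar>t - a\<bar>} t * q t" for t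
  have q12: "q t = q1 t + q2 t" for t by (auto simp: q1_def q2_def indicator_def)
  have ce: "causal_exp q1" "causal_exp q2"
    unfolding q1_def q2_def by (intro causal_exp_indicator q; measurable)+
  have key: "q a * exp (- 1 / 2) \<le> s * (4 / d\<^sup>2 * exp (a + 1) * K)" if s: "0 < s" "s \<le> 1" "s < d" for s
  proof -
    have i: "integrable lborel (\<lambda>t. q1 t * gauss s a t)" "integrable lborel (\<lambda>t. q2 t * gauss s a t)"
      using causal_exp_mult_integrable(1)[OF ce(1) _ gauss_exp_bound(1)[OF s(1)]]
        causal_exp_mult_integrable(1)[OF ce(2) _ gauss_exp_bound(1)[OF s(1)]] by auto
    have "(\<integral>t. q1 t * gauss s a t \<partial>lborel) = - (\<integral>t. q2 t * gauss s a t \<partial>lborel)"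
      using z[OF s(1), of a] i by (simp add: q12 distrib_right)
    moreover have "\<bar>\<integral>t. q2 t * gauss s a t \<partial>lborel\<bar> \<le> (4 * s\<^sup>2 / d\<^sup>2 * exp (a + 1)) * K"
    proof -
      let ?k = "\<lambda>t. indicator {t. d \<le> \<bar>t - a\<bar>} t * gauss s a t"
      have "(\<lambda>t. q2 t * gauss s a t) = (\<lambda>t. q t * ?k t)" by (auto simp: q2_def)
      moreover have "\<bar>\<integral>t. q t * ?k t \<partial>lborel\<bar> \<le> (4 * s\<^sup>2 / d\<^sup>2 * exp (a + 1)) * K"
        unfolding K_def
      proof (rule causal_exp_mult_integrable(2)[OF q])
        fix x :: real
        show "\<bar>?k x\<bar> \<le> (4 * s\<^sup>2 / d\<^sup>2 * exp (a + 1)) * exp (- x)"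
          using gauss_far_bound[OF s(1,2) d(1), of x a] by (auto simp: indicator_def gauss_def)
      qed measurable
      ultimately show ?thesis by simp
    qed
    \<comment> \<open>Within distance \<open>s\<close> of \<open>a\<close> the Gaussian is at least
      \<open>exp (- 1 / 2)\<close> and \<open>q1\<close> at least \<open>q a / 2\<close>; the
      interval has length \<open>2 * s\<close>.\<close>
    moreover have "q a * s * exp (- 1 / 2) \<le> (\<integral>t. q1 t * gauss s a t \<partial>lborel)"
    proof -
      have "(\<integral>t. (q a / 2 * exp (- 1 / 2)) * indicator {a - s..a + s} t \<partial>lborel) \<le> (\<integral>t. q1 t * gauss s a t \<partial>lborel)"
      proof (rule integral_mono[OF _ i(1)])
        show "integrable lborel (\<lambda>t. q a / 2 * exp (- 1 / 2) * indicator {a - s..a + s} t)"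
          by (intro integrable_mult_right integrable_real_indicator) (auto simp: emeasure_lborel_Icc_eq)
        fix t
        show "(q a / 2 * exp (- 1 / 2)) * indicator {a - s..a + s} t \<le> q1 t * gauss s a t"
        proof (cases "\<bar>t - a\<bar> < d")
          case True
          then have q: "q a / 2 \<le> q1 t" using d(2)[OF True] unfolding q1_def by (simp add: abs_if split: if_splits)
          show ?thesis
          proof (cases "t \<in> {a - s..a + s}")
            case True
            then have "\<bar>(t - a) / s\<bar> \<le> 1" using s by (auto simp: abs_le_iff field_simps)
            then have "((t - a) / s)\<^sup>2 \<le> 1" by (simp only: abs_square_le_1)
            then have "exp (- 1 / 2) \<le> gauss s a t" by (simp add: gauss_def)
            then have "(q a / 2) * exp (- 1 / 2) \<le> q1 t * gauss s a t"
              using q qa by (intro mult_mono) auto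
            then show ?thesis using True by simp
          next
            case False
            then show ?thesis using q qa by (simp add: gauss_def)
          qed
        next
          case False
          then have "t \<notin> {a - s..a + s}" using s by auto
          then show ?thesis using False by (simp add: q1_def)
        qed
      qed
      then show ?thesis using s by (simp add: mult_ac)
    qed
    ultimately have "q a * s * exp (- 1 / 2) \<le> (4 * s\<^sup>2 / d\<^sup>2 * exp (a + 1)) * K" by linarith
    then have "s * (q a * exp (- 1 / 2)) \<le> s * (s * (4 / d\<^sup>2 * exp (a + 1) * K))"
      by (simp add: power2_eq_square mult_ac)
    then show ?thesis using s by (simp only: mult_le_cancel_left_pos)
  qed
  have "q a * exp (- 1 / 2) \<le> 0 * (4 / d\<^sup>2 * exp (a + 1) * K)"
  proof (rule tendsto_lowerbound)
    show "((\<lambda>s. s * (4 / d\<^sup>2 * exp (a + 1) * K)) \<longlongrightarrow> 0 * (4 / d\<^sup>2 * exp (a + 1) * K)) (at_right 0)"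
      by (intro tendsto_intros)
    show "\<forall>\<^sub>F s in at_right 0. q a * exp (- 1 / 2) \<le> s * (4 / d\<^sup>2 * exp (a + 1) * K)"
    proof -
      have "\<forall>\<^sub>F s in at_right 0. s \<in> {0<..<min 1 d}"
        using d(1) by (intro eventually_at_right_real) auto
      then show ?thesis by eventually_elim (rule key, auto)
    qed
  qed simp
  then show False using qa by (simp add: mult_le_0_iff not_le)
qed

lemma gauss_orthogonal_eq_0:
  assumes q: "causal_exp q" and z: "\<And>s a. 0 < s \<Longrightarrow> (\<integral>t. q t * gauss' s a t \<partial>lborel) = 0"
    and cont: "isCont q a"
  shows "q a = 0"
proof -
  have 0: "(\<integral>t. q t * gauss s a t \<partial>lborel) = 0" if "0 < s" for s a
    by (rule gauss_orthogonal[OF q that z[OF that]])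
  have "q a \<le> 0" by (rule gauss_orthogonal_nonpos[OF q 0 cont])
  moreover have "- q a \<le> 0"
  proof (rule gauss_orthogonal_nonpos[where q="\<lambda>t. - q t"])
    show "causal_exp (\<lambda>t. - q t)" using causal_exp_cmult[OF q, of "-1"] by simp
  qed (use 0 cont in auto)
  ultimately show ?thesis by simp
qed

text \<open>One constant serves three bounds: \<open>s + 1\<close> for the weighted
  \<open>gauss_hat\<close>, 1 for the Gaussian and \<open>1 / s\<close> for its derivative.\<close>

lemma test_function_gauss:
  assumes b: "0 < b" "b < 1" and s: "0 < s"
  shows "test_function b (gauss_hat s a) (gauss s a) (gauss' s a) (1 + s + 1 / s)"
proof
  have n: "norm (gauss_hat s a y) = s * std_normal_density (s * y)" for y
    using s by (simp add: gauss_hat_def norm_mult normal_density_nonneg)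
  have n1: "(1 + \<bar>y\<bar>) * norm (gauss_hat s a y)
      = s * std_normal_density (0 + s * y) + \<bar>0 + s * y\<bar> * std_normal_density (0 + s * y)" for y
    using s unfolding n by (simp add: abs_mult algebra_simps)
  show "gauss_hat s a \<in> borel_measurable borel"
    unfolding gauss_hat_def by measurable
  show "integrable lborel (\<lambda>y. (1 + \<bar>y\<bar>) * norm (gauss_hat s a y))"
    unfolding n1
    using s lborel_integrable_real_affine[OF integrable_std_normal_density, of s 0]
      lborel_integrable_real_affine[OF integrable_std_normal_density_abs, of s 0] by simp
  have sb: "std_normal_density x \<le> exp (- x\<^sup>2 / 2)" for x
  proof -
    have "1 / sqrt (2 * pi) \<le> 1" using pi_ge_two by (simp add: real_le_lsqrt)
    then have "1 / sqrt (2 * pi) * exp (- x\<^sup>2 / 2) \<le> 1 * exp (- x\<^sup>2 / 2)" by (intro mult_right_mono) auto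
    then show ?thesis by (simp add: std_normal_density_def)
  qed
  show "(1 + \<bar>y\<bar>) * norm (gauss_hat s a y) \<le> 1 + s + 1 / s" for y
  proof -
    have "std_normal_density (s * y) \<le> 1" using order_trans[OF sb[of "s * y"], of 1] by simp
    moreover have "\<bar>s * y\<bar> * std_normal_density (s * y) \<le> 1"
      using mult_left_mono[OF sb[of "s * y"], of "\<bar>s * y\<bar>"] abs_exp_bound[of "s * y"] by simp
    ultimately have "s * std_normal_density (0 + s * y) + \<bar>0 + s * y\<bar> * std_normal_density (0 + s * y) \<le> s * 1 + 1"
      using s by (intro add_mono mult_left_mono) auto
    moreover have "0 \<le> 1 / s" using s by simp
    ultimately show ?thesis unfolding n1 by linarith
  qed
  show "\<bar>gauss s a u\<bar> \<le> 1 + s + 1 / s" for u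
    using gauss_bounded(1)[of s a u] s by (intro order_trans[OF gauss_bounded(1)]) auto
  show "\<bar>gauss' s a u\<bar> \<le> 1 + s + 1 / s" for u
    using s by (intro order_trans[OF gauss_bounded(2)[OF s]]) auto
  show "continuous_on UNIV (gauss' s a)"
    unfolding gauss'_def using s by (intro continuous_intros) auto
qed (use b s in \<open>auto intro: fourier_gauss_hat gauss_deriv gauss_integrable\<close>)

lemma causal_exp_pos_powr:
  assumes "b < 1" shows "causal_exp (pos_powr (- b))"
  using Gamma_integral_pos_powr[of "1 - b"] assms
  by (auto simp: causal_exp_def has_bochner_integral_iff mult.commute)

text \<open>Point evaluation at 0 becomes a pairing of the derivative with the indicator of the
  half-line. In this way the \<open>delta_0\<close> of the weak equation turns into the constant 1
  of the Volterra equation.\<close>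

lemma integral_gauss'_nonneg:
  assumes s: "0 < s"
  shows "(\<integral>t. indicator {0..} t * gauss' s a t \<partial>lborel) = - gauss s a 0"
proof -
  have lim: "(gauss s a \<longlongrightarrow> 0) at_top"
  proof (rule Lim_null_comparison)
    show "\<forall>\<^sub>F x in at_top. norm (gauss s a x) \<le> exp (a + s\<^sup>2 / 2) * exp (- x)"
      using gauss_exp_bound(1)[OF s] by simp
    show "((\<lambda>x. exp (a + s\<^sup>2 / 2) * exp (- x)) \<longlongrightarrow> 0) at_top"
      by (intro tendsto_mult_right_zero filterlim_compose[OF exp_at_bot] filterlim_uminus_at_bot_at_top)
  qed
  have "(LBINT t=0..\<infinity>. gauss' s a t) = 0 - gauss s a 0"
  proof (rule interval_integral_FTC_integrable[where F="gauss s a"])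
    show "(gauss s a has_vector_derivative gauss' s a x) (at x)" for x
      using gauss_deriv[OF s] by (simp add: has_real_derivative_iff_has_vector_derivative)
    show "isCont (gauss' s a) x" for x
      unfolding gauss'_def using s by (intro continuous_intros) auto
    show "set_integrable lborel (einterval 0 \<infinity>) (gauss' s a)"
      unfolding set_integrable_def by (intro integrable_mult_indicator gauss_integrable(2)[OF s]) auto
    have "isCont (gauss s a) 0" using gauss_deriv[OF s] by (rule DERIV_isCont)
    then show "((gauss s a \<circ> real_of_ereal) \<longlongrightarrow> gauss s a 0) (at_right 0)"
      by (simp add: zero_ereal_def ereal_tendsto_simps continuous_within filterlim_at_split)
    show "((gauss s a \<circ> real_of_ereal) \<longlongrightarrow> 0) (at_left \<infinity>)"
      using lim by (simp add: ereal_tendsto_simps)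
  qed auto
  moreover have "(LBINT t=0..\<infinity>. gauss' s a t) = (\<integral>t. indicator {0..} t * gauss' s a t \<partial>lborel)"
    unfolding interval_lebesgue_integral_0_infty set_lebesgue_integral_def
  proof (rule integral_cong_AE)
    have "AE t in lborel. t \<noteq> (0::real)" by (rule AE_lborel_singleton)
    then show "AE t in lborel. indicator {0<..} t *\<^sub>R gauss' s a t = indicator {0..} t * gauss' s a t"
      by eventually_elim (auto simp: indicator_def)
  qed measurable
  ultimately show ?thesis by simp
qed

section \<open>The convolution kernel of the delay equation and the Volterra equation\<close>

locale sfdde_measures =
  fixes b :: real and P N :: "real measure"
  assumes b: "0 < b" "b < 1 / 2"
    and P: "finite_measure P" "sets P = sets borel" "AE v in P. 0 \<le> v"
    and N: "finite_measure N" "sets N = sets borel" "AE v in N. 0 \<le> v"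
begin

lemma b1: "b < 1" using b by simp

lemma Gamma_pos: "0 < Gamma (1 - b)" using b by (intro Gamma_real_pos) auto

text \<open>Integrating the fractional derivative of order \<open>b\<close> once leaves the
  fractional integral of order \<open>1 - b\<close>, whose kernel is the normalised power; averaging
  over the delays gives \<open>e\<close>. On the null set where one of the two integrals diverges,
  that integral counts as 0.\<close>

definition e :: "real \<Rightarrow> real" where
  "e z = (measure_convolution (pos_powr (- b)) P z - measure_convolution (pos_powr (- b)) N z) / Gamma (1 - b)"

lemma causal_exp_e: "causal_exp e"
proof -
  have "causal_exp (\<lambda>z. 1 / Gamma (1 - b) * (measure_convolution (pos_powr (- b)) P z
      - measure_convolution (pos_powr (- b)) N z))"
    by (intro causal_exp_cmult causal_exp_diff causal_exp_measure_convolution(1) causal_exp_pos_powr b1 P N)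
  then show ?thesis by (simp add: e_def[abs_def])
qed

lemma integral_e:
  assumes k: "k \<in> borel_measurable borel" "\<And>x. 0 \<le> x \<Longrightarrow> \<bar>k x\<bar> \<le> C * exp (- x)"
  shows "(\<integral>z. e z * k z \<partial>lborel)
    = ((\<integral>v. (\<integral>x. pos_powr (- b) x * k (v + x) \<partial>lborel) \<partial>P) - (\<integral>v. (\<integral>x. pos_powr (- b) x * k (v
        + x) \<partial>lborel) \<partial>N)) / Gamma (1 - b)"
proof -
  note pc = causal_exp_pos_powr[OF b1]
  have "(\<integral>z. e z * k z \<partial>lborel) = (\<integral>z. (measure_convolution (pos_powr (- b)) P z * k z
      - measure_convolution (pos_powr (- b)) N z * k z) / Gamma (1 - b) \<partial>lborel)"
    by (simp add: e_def left_diff_distrib)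
  also have "\<dots> = ((\<integral>z. measure_convolution (pos_powr (- b)) P z * k z \<partial>lborel)
      - (\<integral>z. measure_convolution (pos_powr (- b)) N z * k z \<partial>lborel)) / Gamma (1 - b)"
    using causal_exp_mult_integrable(1)[OF causal_exp_measure_convolution(1)[OF pc P] k]
      causal_exp_mult_integrable(1)[OF causal_exp_measure_convolution(1)[OF pc N] k] by simp
  finally show ?thesis
    using causal_exp_measure_convolution(3)[OF pc P k] causal_exp_measure_convolution(3)[OF pc N k] by simp
qed

end

locale sfdde_kernel_fun = sfdde_measures +
  fixes g :: "real \<Rightarrow> real"
  assumes g_sq: "square_integrable lborel g" and g_neg: "\<And>u. u < 0 \<Longrightarrow> g u = 0"
    and g_cont: "continuous_on {0..} g"
begin

lemma g_measurable [measurable]: "g \<in> borel_measurable borel"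
  using g_sq by (simp add: square_integrable_def)

lemma causal_exp_g: "causal_exp g"
  by (rule causal_exp_square_integrable[OF g_sq g_neg])

text \<open>The defect of the equation is a weighted causal function that annihilates the
  derivatives of all Gaussians, so it vanishes wherever it is continuous, in particular on the open
  half-line; the value at 0 follows by taking limits from the right.\<close>

lemma Volterra_fourier:
  assumes fF: "has_L2_fourier (\<lambda>u. of_real (g u)) F"
  assumes F: "\<And>y. y \<noteq> 0 \<Longrightarrow> F y * ((- (\<i> * of_real y)) powr (of_real (1 - b))
       - ((\<integral>v. exp (\<i> * of_real (y * v)) \<partial>P) - (\<integral>v. exp (\<i> * of_real (y * v)) \<partial>N)))
       = (- (\<i> * of_real y)) powr (- of_real b)"
  assumes t: "0 \<le> t"
  shows "g t = 1 + (e \<circledast> g) t"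
proof -
  \<comment> \<open>The constant 1 appears as the indicator of the half-line, so that the defect is
    causal as a whole.\<close>
  define q where "q t = (g t - (e \<circledast> g) t) - indicator {0..} t" for t
  have ind: "causal_exp (indicator {0..})"
  proof -
    have "causal_exp (pos_powr (- 0))" by (rule causal_exp_pos_powr) simp
    then have "causal_exp (\<lambda>x. indicator {0<..} x)"
      by (rule back_subst[of causal_exp]) (auto simp: fun_eq_iff indicator_def pos_powr_def)
    moreover have "integrable lborel (\<lambda>u::real. exp (- u) * indicator {0..} u)
        \<longleftrightarrow> integrable lborel (\<lambda>u::real. exp (- u) * indicator {0<..} u)"
    proof (rule Bochner_Integration.integrable_cong_AE)
      have "AE t in lborel. t \<noteq> (0::real)" by (rule AE_lborel_singleton)
      then show "AE u in lborel. exp (- u) * indicator {0..} u = exp (- u) * indicator {0<..} (u::real)"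
        by eventually_elim (auto simp: indicator_def)
    qed auto
    ultimately show ?thesis by (auto simp: causal_exp_def)
  qed
  have q: "causal_exp q"
    unfolding q_def by (intro causal_exp_diff causal_exp_g causal_exp_real_convolution causal_exp_e ind)
  have orth: "(\<integral>t. q t * gauss' s a t \<partial>lborel) = 0" if s: "0 < s" for s a
  proof -
    interpret G: test_function b "gauss_hat s a" "gauss s a" "gauss' s a" "1 + s + 1 / s"
      by (rule test_function_gauss) (use b s in auto)
    let ?k = "gauss' s a"
    note kb = gauss_exp_bound(2)[OF s, of a]
    have int: "integrable lborel (\<lambda>t. f t * ?k t)" if "causal_exp f" for f
      by (rule causal_exp_mult_integrable(1)[OF that _ kb]) auto
    \<comment> \<open>The Weyl form of \<open>W\<close> has the power as its kernel. Averaging over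
      the delays therefore reproduces a pairing with \<open>e\<close>; the decay needed for this is
      available where \<open>u \<ge> 0\<close>, and elsewhere \<open>g u\<close> vanishes.\<close>
    have "g u * (((\<integral>v. G.W (u + v) \<partial>P) - (\<integral>v. G.W (u + v) \<partial>N)) / Gamma (1 - b))
        = g u * (\<integral>z. e z * ?k (u + z) \<partial>lborel)" for u
    proof (cases "u < 0")
      case False
      have "(\<integral>z. e z * ?k (u + z) \<partial>lborel) = ((\<integral>v. (\<integral>x. pos_powr (- b) x * ?k (u + (v + x)) \<partial>lborel) \<partial>P)
          - (\<integral>v. (\<integral>x. pos_powr (- b) x * ?k (u + (v + x)) \<partial>lborel) \<partial>N)) / Gamma (1 - b)"
      proof (rule integral_e)
        fix x :: real
        have "\<bar>?k (u + x)\<bar> \<le> exp (a + s\<^sup>2) / s * exp (- (u + x))" by (rule kb)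
        also have "\<dots> \<le> exp (a + s\<^sup>2) / s * exp (- x)" using False s by (intro mult_left_mono) auto
        finally show "\<bar>?k (u + x)\<bar> \<le> exp (a + s\<^sup>2) / s * exp (- x)" .
      qed measurable
      then show ?thesis unfolding G.W_eq by (simp add: add.assoc)
    qed (simp add: g_neg)
    moreover have "(\<integral>u. g u * (?k u - ((\<integral>v. G.W (u + v) \<partial>P) - (\<integral>v. G.W (u + v) \<partial>N)) / Gamma (1 - b)) \<partial>lborel)
        = - gauss s a 0"
      by (rule G.weak_equation[OF P(1,2) N(1,2) fF F])
    ultimately have "(\<integral>u. g u * ?k u - g u * (\<integral>z. e z * ?k (u + z) \<partial>lborel) \<partial>lborel) = - gauss s a 0"
      by (simp only: right_diff_distrib)
    moreover have "integrable lborel (\<lambda>u. g u * (\<integral>z. e z * ?k (u + z) \<partial>lborel))"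
    proof -
      have "integrable lborel (\<lambda>u. \<integral>t. g u * e (t - u) * ?k t \<partial>lborel)"
        using lborel_pair.integrable_fst[OF causal_exp_convolution(1)[OF causal_exp_e causal_exp_g _ kb]] by simp
      moreover have "(\<integral>t. g u * e (t - u) * ?k t \<partial>lborel) = g u * (\<integral>z. e z * ?k (u + z) \<partial>lborel)" for u
        using integral_shift(2)[of "\<lambda>t. g u * e (t - u) * ?k t" u] by (auto simp: mult.assoc)
      ultimately show ?thesis by simp
    qed
    ultimately have "(\<integral>u. g u * ?k u \<partial>lborel) - (\<integral>t. (e \<circledast> g) t * ?k t \<partial>lborel) = - gauss s a 0"
      using int[OF causal_exp_g] causal_exp_convolution(3)[OF causal_exp_e causal_exp_g _ kb] by simp
    moreover have "(\<integral>t. q t * ?k t \<partial>lborel) = (\<integral>u. g u * ?k u \<partial>lborel) - (\<integral>t. (e \<circledast> g) t * ?k t \<partial>lborel)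
        - (\<integral>t. indicator {0..} t * ?k t \<partial>lborel)"
      unfolding q_def left_diff_distrib
      using int[OF causal_exp_g] int[OF causal_exp_real_convolution[OF causal_exp_e causal_exp_g]] int[OF ind]
      by simp
    ultimately show ?thesis using integral_gauss'_nonneg[OF s, of a] by simp
  qed
  have Q: "isCont (e \<circledast> g) x" for x
    by (rule isCont_real_convolution[OF causal_exp_e g_cont g_neg]) auto
  have pos: "g x = 1 + (e \<circledast> g) x" if "0 < x" for x
  proof -
    have "isCont (indicator {0..} :: real \<Rightarrow> real) x"
    proof (rule isCont_causal)
      show "continuous_on {0..} (indicator {0..} :: real \<Rightarrow> real)"
        by (rule continuous_on_eq[OF continuous_on_const[of _ 1]]) simp
    qed (use that in auto)
    then have "isCont q x"
      unfolding q_def using that Q isCont_causal[OF g_cont g_neg] by (intro continuous_diff) auto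
    then have "q x = 0" using orth by (intro gauss_orthogonal_eq_0[OF q]) auto
    then show ?thesis using that by (simp add: q_def)
  qed
  \<comment> \<open>At 0 the function \<open>g\<close> is continuous only from the right, hence the
    one-sided limit.\<close>
  show ?thesis
  proof (cases "t = 0")
    case True
    have "(g \<longlongrightarrow> g 0) (at 0 within {0..})"
      using g_cont by (simp add: continuous_on_def)
    then have "(g \<longlongrightarrow> g 0) (at_right 0)"
      by (simp add: at_within_Ici_at_right)
    moreover have "((\<lambda>x. 1 + (e \<circledast> g) x) \<longlongrightarrow> 1 + (e \<circledast> g) 0) (at_right 0)"
      using Q[of 0] by (intro tendsto_intros) (simp add: continuous_at_imp_continuous_at_within isContD
          continuous_within filterlim_at_split)
    moreover have "\<forall>\<^sub>F x in at_right 0. g x = 1 + (e \<circledast> g) x"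
      using eventually_at_right_less[of "0::real"] by eventually_elim (rule pos)
    ultimately have "g 0 = 1 + (e \<circledast> g) 0"
      by (intro tendsto_unique[of "at_right 0" g]) (auto simp: tendsto_cong)
    then show ?thesis using True by simp
  qed (use t pos in simp)
qed

end

section \<open>The Marchaud derivative of the kernel\<close>

text \<open>The modulus of continuity in mean of the power is of order
  \<open>c powr (1 - b)\<close>, the origin of the Hoelder exponent below. To the right of 0 the
  difference has one sign and the explicit antiderivative \<open>F\<close> vanishes at infinity; on
  the stretch of length \<open>c\<close> to the left of 0 only the shifted power is present. Each
  part gives \<open>c powr (1 - b) / (1 - b)\<close>.\<close>

lemma pos_powr_shift_L1:
  assumes b: "0 < b" "b < 1" and c: "0 \<le> c"
  shows "(\<integral>\<^sup>+z. ennreal \<bar>pos_powr (- b) (z + c) - pos_powr (- b) z\<bar> \<partial>lborel) \<le> ennreal (2 * (c powr (1 - b) / (1 - b)))"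
proof (cases "c = 0")
  case False
  then have c: "0 < c" using c by simp
  let ?a = "1 - b"
  have a: "0 < ?a" using b by simp
  define F where "F z = (z powr ?a - (z + c) powr ?a) / ?a" for z
  define f where "f z = pos_powr (- b) z - pos_powr (- b) (z + c)" for z
  have pos: "0 \<le> f z" if "0 < z" for z
    using that c b by (auto simp: f_def intro: powr_mono2')
  have deriv: "(F has_real_derivative f z) (at z)" and cont: "isCont f z" if z: "0 < z" for z
  proof -
    have "(F has_real_derivative (?a * z powr (?a - 1) - ?a * (z + c) powr (?a - 1)) / ?a) (at z)"
      unfolding F_def using z c a by (auto intro!: derivative_eq_intros)
    moreover have "(?a * z powr (?a - 1) - ?a * (z + c) powr (?a - 1)) / ?a = f z"
      using a z c by (simp add: f_def flip: right_diff_distrib)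
    ultimately show "(F has_real_derivative f z) (at z)" by simp
    have "isCont (\<lambda>z. z powr (- b) - (z + c) powr (- b)) z"
      using z c by (intro continuous_intros) auto
    moreover have "\<forall>\<^sub>F y in nhds z. y powr (- b) - (y + c) powr (- b) = f y"
      using eventually_nhds_in_open[of "{0<..}" z] z c by (auto elim!: eventually_mono simp: f_def)
    ultimately show "isCont f z" using isCont_cong by fast
  qed
  have lim0: "((F \<circ> real_of_ereal) \<longlongrightarrow> - (c powr ?a) / ?a) (at_right 0)"
  proof -
    have "((\<lambda>z. (z powr ?a - (z + c) powr ?a) / ?a) \<longlongrightarrow> (0 - (0 + c) powr ?a) / ?a) (at_right 0)"
      using a c by (intro tendsto_intros tendsto_zero_powrI[where b="?a"])
        (auto intro: eventually_at_right_less eventually_mono)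
    then show ?thesis
      by (simp add: zero_ereal_def ereal_tendsto_simps F_def[abs_def])
  qed
  have lim_inf: "((F \<circ> real_of_ereal) \<longlongrightarrow> 0) (at_left \<infinity>)"
  proof -
    have "(F \<longlongrightarrow> 0) at_top"
    proof (rule Lim_null_comparison)
      show "\<forall>\<^sub>F z in at_top. norm (F z) \<le> c / ?a * z powr (- b)"
        using eventually_gt_at_top[of 0]
      proof eventually_elim
        case (elim z)
        \<comment> \<open>After factoring out \<open>z\<close>, the base \<open>1 + c / z\<close> is
          at least 1 and the exponent below 1, so the power is at most the base itself.\<close>
        have "z + c = z * (1 + c / z)" using elim by (simp add: distrib_left)
        then have "(z + c) powr ?a = (z * (1 + c / z)) powr ?a" by (simp only:)
        also have "\<dots> = z powr ?a * (1 + c / z) powr ?a" using elim c by (subst powr_mult) auto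
        also have "\<dots> \<le> z powr ?a * (1 + c / z) powr 1"
          using elim c b by (intro mult_left_mono powr_mono) auto
        also have "\<dots> = z powr ?a + c * (z powr ?a / z powr 1)" using elim c by (simp add: field_simps)
        also have "z powr ?a / z powr 1 = z powr (- b)" by (subst powr_diff[symmetric]) simp
        finally have "(z + c) powr ?a - z powr ?a \<le> c * z powr (- b)" by simp
        moreover have "z powr ?a \<le> (z + c) powr ?a" using elim c a by (intro powr_mono2) auto
        ultimately have "\<bar>z powr ?a - (z + c) powr ?a\<bar> \<le> c * z powr (- b)" by simp
        then have "\<bar>z powr ?a - (z + c) powr ?a\<bar> / ?a \<le> c * z powr (- b) / ?a"
          using a by (intro divide_right_mono) auto
        then show ?case using a by (simp add: F_def)
      qed
      show "((\<lambda>z. c / ?a * z powr (- b)) \<longlongrightarrow> 0) at_top"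
        using b by (intro tendsto_mult_right_zero tendsto_neg_powr filterlim_ident) auto
    qed
    then show ?thesis by (simp add: ereal_tendsto_simps)
  qed
  have ftc: "set_integrable lborel (einterval 0 \<infinity>) f" "(LBINT z=0..\<infinity>. f z) = 0 - - (c powr ?a) / ?a"
    using interval_integral_FTC_nonneg[of 0 \<infinity> F f, OF _ _ _ _ lim0 lim_inf] deriv cont pos by auto
  have 1: "(\<integral>\<^sup>+z. ennreal (indicator {0<..} z * f z) \<partial>lborel) = ennreal (c powr ?a / ?a)"
  proof -
    have "einterval 0 \<infinity> = {0<..}" by (auto simp: einterval_def)
    then have "has_bochner_integral lborel (\<lambda>z. indicator {0<..} z * f z) (c powr ?a / ?a)"
      using ftc by (auto simp: has_bochner_integral_iff set_integrable_def interval_lebesgue_integral_0_infty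
          set_lebesgue_integral_def)
    then show ?thesis
      using pos by (subst nn_integral_eq_integral) (auto simp: has_bochner_integral_iff indicator_def)
  qed
  have 2: "(\<integral>\<^sup>+z. ennreal (indicator {..c} (z + c) * pos_powr (- b) (z + c)) \<partial>lborel) = ennreal (c powr ?a / ?a)"
  proof -
    have "(\<integral>\<^sup>+z. ennreal (indicator {..c} z * pos_powr (- b) z) \<partial>lborel) = ennreal (c powr ?a / ?a)"
      using has_bochner_integral_pos_powr_from_0[of "- b" c] b c
      by (subst nn_integral_eq_integral) (auto simp: has_bochner_integral_iff)
    then show ?thesis
      using nn_integral_shift(1)[of "\<lambda>z. ennreal (indicator {..c} z * pos_powr (- b) z)" c] by simp
  qed
  have "(\<integral>\<^sup>+z. ennreal \<bar>pos_powr (- b) (z + c) - pos_powr (- b) z\<bar> \<partial>lborel)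
     \<le> (\<integral>\<^sup>+z. ennreal (indicator {..c} (z + c) * pos_powr (- b) (z + c)) + ennreal (indicator {0<..} z * f z) \<partial>lborel)"
  proof (rule nn_integral_mono)
    fix z :: real
    show "ennreal \<bar>pos_powr (- b) (z + c) - pos_powr (- b) z\<bar>
       \<le> ennreal (indicator {..c} (z + c) * pos_powr (- b) (z + c)) + ennreal (indicator {0<..} z * f z)"
      using pos[of z] by (cases "0 < z") (auto simp: f_def abs_minus_commute)
  qed
  also have "\<dots> = ennreal (c powr ?a / ?a) + ennreal (c powr ?a / ?a)"
    by (subst nn_integral_add) (auto simp: 1 2, auto simp: f_def)
  also have "\<dots> = ennreal (2 * (c powr ?a / ?a))"
    using a c by (subst ennreal_plus[symmetric]) auto
  finally show ?thesis .
qed simp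

lemma pos_powr_tail:
  assumes "0 < b" "0 < x"
  shows "has_bochner_integral lborel (\<lambda>z. indicator {x..} z * (b * pos_powr (- b - 1) z)) (pos_powr (- b) x)"
  using has_bochner_integral_mult_right[OF has_bochner_integral_pos_powr_to_inf[of "- b - 1" x], of b] assms
  by (simp add: mult_ac)

context sfdde_measures
begin

text \<open>Translation commutes with averaging over delays, so the estimate for the power is
  multiplied by the total masses. Linearity of the two averages holds only for almost every
  \<open>z\<close>, once at \<open>z\<close> and once at \<open>z + c\<close>.\<close>

lemma e_shift_L1:
  assumes c: "0 \<le> c"
  shows "(\<integral>\<^sup>+z. ennreal \<bar>e (z + c) - e z\<bar> \<partial>lborel)
    \<le> ennreal ((measure P UNIV + measure N UNIV) * (2 / (1 - b)) / Gamma (1 - b) * c powr (1 - b))"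
proof -
  have b1': "0 < 1 - b" using b1 by simp
  have m: "(\<integral>\<^sup>+z. ennreal \<bar>measure_convolution (pos_powr (- b)) K (z + c)
      - measure_convolution (pos_powr (- b)) K z\<bar> \<partial>lborel)
     \<le> ennreal (measure K UNIV * (2 * (c powr (1 - b) / (1 - b))))"
    if K: "finite_measure K" "sets K = sets borel" "AE v in K. 0 \<le> v" for K
  proof -
    interpret finite_measure K by fact
    interpret KL: pair_sigma_finite K lborel ..
    note [measurable_cong] = K(2)
    have sp: "space K = UNIV" using sets_eq_imp_space_eq[OF K(2)] by simp
    have ae: "AE z in lborel. integrable K (\<lambda>v. pos_powr (- b) (z - v))"
      by (rule causal_exp_measure_convolution(2)[OF causal_exp_pos_powr[OF b1] K])
    have ae': "AE z in lborel. integrable K (\<lambda>v. pos_powr (- b) (z + c - v))"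
    proof -
      have "AE z in lborel. integrable K (\<lambda>v. pos_powr (- b) (c + 1 * z - v))"
        by (rule AE_borel_affine[OF _ _ ae]) auto
      then show ?thesis by (simp add: add.commute)
    qed
    have "(\<integral>\<^sup>+z. ennreal \<bar>measure_convolution (pos_powr (- b)) K (z + c)
        - measure_convolution (pos_powr (- b)) K z\<bar> \<partial>lborel)
       \<le> (\<integral>\<^sup>+z. (\<integral>\<^sup>+v. ennreal \<bar>pos_powr (- b) (z - v + c) - pos_powr (- b) (z - v)\<bar> \<partial>K) \<partial>lborel)"
    proof (rule nn_integral_mono_AE, use ae ae' in eventually_elim)
      fix z assume i: "integrable K (\<lambda>v. pos_powr (- b) (z - v))" "integrable K (\<lambda>v. pos_powr (- b) (z + c - v))"
      have "ennreal \<bar>measure_convolution (pos_powr (- b)) K (z + c) - measure_convolution (pos_powr (- b)) K z\<bar>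
         = ennreal (norm (\<integral>v. pos_powr (- b) (z + c - v) - pos_powr (- b) (z - v) \<partial>K))"
        using i by (simp add: measure_convolution_def)
      also have "\<dots> \<le> (\<integral>\<^sup>+v. ennreal (norm (pos_powr (- b) (z + c - v) - pos_powr (- b) (z - v))) \<partial>K)"
        using i by (intro integral_norm_bound_ennreal) auto
      finally show "ennreal \<bar>measure_convolution (pos_powr (- b)) K (z + c) - measure_convolution (pos_powr (- b)) K z\<bar>
        \<le> (\<integral>\<^sup>+v. ennreal \<bar>pos_powr (- b) (z - v + c) - pos_powr (- b) (z - v)\<bar> \<partial>K)"
        by (simp add: algebra_simps)
    qed
    also have "\<dots> = (\<integral>\<^sup>+v. (\<integral>\<^sup>+z. ennreal \<bar>pos_powr (- b) (z - v + c) - pos_powr (- b) (z - v)\<bar> \<partial>lborel) \<partial>K)"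
      by (rule KL.Fubini') measurable
    also have "\<dots> = (\<integral>\<^sup>+v. (\<integral>\<^sup>+z. ennreal \<bar>pos_powr (- b) (z + c) - pos_powr (- b) z\<bar> \<partial>lborel) \<partial>K)"
      by (intro nn_integral_cong nn_integral_shift(3)[of "\<lambda>z. ennreal \<bar>pos_powr (- b) (z + c)
          - pos_powr (- b) z\<bar>"]) auto
    also have "\<dots> \<le> (\<integral>\<^sup>+v. ennreal (2 * (c powr (1 - b) / (1 - b))) \<partial>K)"
      using b c by (intro nn_integral_mono pos_powr_shift_L1) auto
    also have "\<dots> = ennreal (2 * (c powr (1 - b) / (1 - b))) * ennreal (measure K UNIV)"
      by (simp add: sp emeasure_eq_measure)
    also have "\<dots> = ennreal (2 * (c powr (1 - b) / (1 - b)) * measure K UNIV)"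
      by (rule ennreal_mult''[symmetric]) simp
    finally show ?thesis by (simp only: mult.commute)
  qed
  have [measurable]: "measure_convolution (pos_powr (- b)) P \<in> borel_measurable borel"
    "measure_convolution (pos_powr (- b)) N \<in> borel_measurable borel"
    using measure_convolution_measurable P N by auto
  have "(\<integral>\<^sup>+z. ennreal \<bar>e (z + c) - e z\<bar> \<partial>lborel)
     \<le> (\<integral>\<^sup>+z. ennreal (1 / Gamma (1 - b)) *
        (ennreal \<bar>measure_convolution (pos_powr (- b)) P (z + c) - measure_convolution (pos_powr (- b)) P z\<bar>
       + ennreal \<bar>measure_convolution (pos_powr (- b)) N (z + c) - measure_convolution (pos_powr (- b)) N z\<bar>) \<partial>lborel)"
  proof (rule nn_integral_mono)
    fix z
    let ?p = "measure_convolution (pos_powr (- b)) P (z + c) - measure_convolution (pos_powr (- b)) P z"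
    let ?n = "measure_convolution (pos_powr (- b)) N (z + c) - measure_convolution (pos_powr (- b)) N z"
    have "e (z + c) - e z = (?p - ?n) / Gamma (1 - b)"
      by (simp add: e_def diff_divide_distrib)
    then have "\<bar>e (z + c) - e z\<bar> = 1 / Gamma (1 - b) * \<bar>?p - ?n\<bar>"
      using Gamma_pos by (simp add: abs_mult)
    also have "\<dots> \<le> 1 / Gamma (1 - b) * (\<bar>?p\<bar> + \<bar>?n\<bar>)"
      using Gamma_pos by (intro mult_left_mono) auto
    finally show "ennreal \<bar>e (z + c) - e z\<bar> \<le> ennreal (1 / Gamma (1 - b)) * (ennreal \<bar>?p\<bar> + ennreal \<bar>?n\<bar>)"
      using Gamma_pos by (simp add: ennreal_leI ennreal_mult[symmetric] ennreal_plus[symmetric] del: ennreal_plus)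
  qed
  also have "\<dots> = ennreal (1 / Gamma (1 - b)) *
        ((\<integral>\<^sup>+z. ennreal \<bar>measure_convolution (pos_powr (- b)) P (z + c)
            - measure_convolution (pos_powr (- b)) P z\<bar> \<partial>lborel)
       + (\<integral>\<^sup>+z. ennreal \<bar>measure_convolution (pos_powr (- b)) N (z + c)
           - measure_convolution (pos_powr (- b)) N z\<bar> \<partial>lborel))"
    by (simp add: nn_integral_cmult nn_integral_add)
  also have "\<dots> \<le> ennreal (1 / Gamma (1 - b)) * (ennreal (measure P UNIV * (2 * (c powr (1 - b) / (1 - b))))
      + ennreal (measure N UNIV * (2 * (c powr (1 - b) / (1 - b)))))"
    by (intro mult_left_mono add_mono m P N) simp
  also have "\<dots> = ennreal ((measure P UNIV + measure N UNIV) * (2 / (1 - b)) / Gamma (1 - b) * c powr (1 - b))"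
  proof -
    define w where "w = 2 * (c powr (1 - b) / (1 - b))"
    have w: "0 \<le> measure P UNIV * w" "0 \<le> measure N UNIV * w" using b1' by (simp_all add: w_def)
    have "ennreal (1 / Gamma (1 - b)) * (ennreal (measure P UNIV * w) + ennreal (measure N UNIV * w))
       = ennreal (1 / Gamma (1 - b) * (measure P UNIV * w + measure N UNIV * w))"
      unfolding ennreal_plus[OF w, symmetric] using w Gamma_pos by (intro ennreal_mult[symmetric]) auto
    also have "1 / Gamma (1 - b) * (measure P UNIV * w + measure N UNIV * w)
       = (measure P UNIV + measure N UNIV) * (2 / (1 - b)) / Gamma (1 - b) * c powr (1 - b)"
      by (simp add: w_def add_divide_distrib distrib_right)
    finally show ?thesis unfolding w_def .
  qed
  finally show ?thesis .
qed

lemma integrable_e_mult: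
  assumes h: "h \<in> borel_measurable borel" "\<And>u. u < 0 \<Longrightarrow> h u = 0" "\<And>u. u \<le> t \<Longrightarrow> \<bar>h u\<bar> \<le> B" and f: "causal_exp f"
  shows "integrable lborel (\<lambda>y. f (t - y) * h y)"
proof -
  have "integrable lborel (\<lambda>z. f z * h (t - z))"
    by (rule causal_exp_mult_integrable(1)[OF f _ causal_locally_bounded_exp[OF h(2,3)]]) (use h(1) in auto)
  then show ?thesis
    using integrable_shift(4)[of "\<lambda>y. f (t - y) * h y" t] by simp
qed

end

context sfdde_kernel_fun
begin

text \<open>The increment is placed on \<open>e\<close>, where the modulus in mean is known, and
  \<open>g\<close> only has to be bounded. Both values of \<open>e\<close> vanish for
  \<open>y > T\<close>, so a bound of \<open>g\<close> up to \<open>T\<close> is enough.\<close>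

lemma convolution_Hoelder:
  assumes B: "\<And>u. u \<le> T \<Longrightarrow> \<bar>g u\<bar> \<le> B" and t: "t \<le> T" and u: "0 \<le> u"
  shows "\<bar>(e \<circledast> g) t - (e \<circledast> g) (t - u)\<bar>
    \<le> B * ((measure P UNIV + measure N UNIV) * (2 / (1 - b)) / Gamma (1 - b) * u powr (1 - b))"
proof -
  let ?C = "(measure P UNIV + measure N UNIV) * (2 / (1 - b)) / Gamma (1 - b) * u powr (1 - b)"
  have C: "0 \<le> ?C" using b1 Gamma_pos by simp
  have B0: "0 \<le> B" using B[of T] by (simp add: order_trans[OF abs_ge_zero])
  note [measurable] = causal_expD(1)[OF causal_exp_e]
  have i: "integrable lborel (\<lambda>y. e (s - y) * g y)" if "s \<le> T" for s
    by (rule integrable_e_mult[of _ _ B]) (use that B g_neg causal_exp_e in auto)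
  have "(e \<circledast> g) t - (e \<circledast> g) (t - u) = (\<integral>y. (e (t - y) - e (t - u - y)) * g y \<partial>lborel)"
    unfolding real_convolution_def left_diff_distrib using i[of t] i[of "t - u"] t u by simp
  moreover
  have "ennreal (norm (\<integral>y. (e (t - y) - e (t - u - y)) * g y \<partial>lborel)) \<le> ennreal (B * ?C)"
  proof -
    have "integrable lborel (\<lambda>y. (e (t - y) - e (t - u - y)) * g y)"
      unfolding left_diff_distrib using i[of t] i[of "t - u"] t u by simp
    then have "ennreal (norm (\<integral>y. (e (t - y) - e (t - u - y)) * g y \<partial>lborel))
       \<le> (\<integral>\<^sup>+y. ennreal (norm ((e (t - y) - e (t - u - y)) * g y)) \<partial>lborel)"
      by (rule integral_norm_bound_ennreal)
    also have "\<dots> \<le> (\<integral>\<^sup>+y. ennreal B * ennreal \<bar>e (t - u - y + u) - e (t - u - y)\<bar> \<partial>lborel)"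
    proof (rule nn_integral_mono)
      fix y
      have "\<bar>e (t - y) - e (t - u - y)\<bar> * \<bar>g y\<bar> \<le> \<bar>e (t - y) - e (t - u - y)\<bar> * B"
      proof (cases "y \<le> T")
        case False
        then have "e (t - y) = 0" "e (t - u - y) = 0" using t u by (auto intro: causal_expD(2)[OF causal_exp_e])
        then show ?thesis by simp
      qed (auto intro!: mult_left_mono B)
      then show "ennreal (norm ((e (t - y) - e (t - u - y)) * g y))
          \<le> ennreal B * ennreal \<bar>e (t - u - y + u) - e (t - u - y)\<bar>"
        using B0 by (subst ennreal_mult[symmetric]) (auto simp: abs_mult mult.commute intro!: ennreal_leI)
    qed
    also have "\<dots> = ennreal B * (\<integral>\<^sup>+z. ennreal \<bar>e (z + u) - e z\<bar> \<partial>lborel)"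
      using nn_integral_shift(4)[of "\<lambda>z. ennreal \<bar>e (z + u) - e z\<bar>" "t - u"]
      by (subst nn_integral_cmult) auto
    also have "\<dots> \<le> ennreal B * ennreal ?C"
      by (intro mult_left_mono e_shift_L1 u) auto
    also have "\<dots> = ennreal (B * ?C)" by (rule ennreal_mult[OF B0 C, symmetric])
    finally show ?thesis .
  qed
  then have "norm (\<integral>y. (e (t - y) - e (t - u - y)) * g y \<partial>lborel) \<le> B * ?C"
    using ennreal_le_iff[OF mult_nonneg_nonneg[OF B0 C]] by blast
  ultimately show ?thesis by (simp only: real_norm_def)
qed

end

section \<open>Absolute convergence of the Marchaud integral and its primitive\<close>

locale sfdde_volterra = sfdde_kernel_fun +
  assumes volterra: "0 \<le> t \<Longrightarrow> g t = 1 + (e \<circledast> g) t"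
begin

definition marchaud_integrand :: "real \<Rightarrow> real \<Rightarrow> real" where
  "marchaud_integrand t u = (g t - g (t - u)) * pos_powr (- b - 1) u"

text \<open>Three effects: the jump of \<open>g\<close> at 0 is seen only by steps
  \<open>u \<ge> t\<close>; for \<open>u \<le> 1\<close> the Hoelder bound times
  \<open>u powr (- b - 1)\<close> is \<open>u powr (- 2 * b)\<close>, integrable at 0 because
  \<open>b < 1 / 2\<close>; for \<open>u \<ge> 1\<close> boundedness suffices.\<close>

definition marchaud_bound :: "real \<Rightarrow> real \<Rightarrow> real \<Rightarrow> real" where
  "marchaud_bound C t u = indicator {t..} u * pos_powr (- b - 1) u
     + C * (indicator {..1} u * pos_powr (- 2 * b) u + indicator {1..} u * pos_powr (- b - 1) u)"

lemma marchaud_integrand_measurable [measurable]: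
  "(\<lambda>(t, u). marchaud_integrand t u) \<in> borel_measurable (borel \<Otimes>\<^sub>M borel)"
  unfolding marchaud_integrand_def by measurable

text \<open>The Volterra equation splits \<open>g\<close> into the indicator of the half-line, which
  carries the jump, and the Hoelder continuous \<open>e \<circledast> g\<close>. The constant is
  uniform in \<open>t \<le> T\<close>, as needed for the double integral over \<open>t\<close> and
  \<open>u\<close>.\<close>

lemma marchaud_integrand_bound:
  "\<exists>C\<ge>0. \<forall>t u. 0 < t \<longrightarrow> t \<le> T \<longrightarrow> \<bar>marchaud_integrand t u\<bar> \<le> marchaud_bound C t u"
proof -
  obtain B where B: "\<And>u. u \<le> T \<Longrightarrow> \<bar>g u\<bar> \<le> B"
    using continuous_on_nonneg_bounded[OF g_cont g_neg, of T] by blast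
  have B0: "0 \<le> B" using B[of T] by (simp add: order_trans[OF abs_ge_zero])
  define D where "D = B * ((measure P UNIV + measure N UNIV) * (2 / (1 - b)) / Gamma (1 - b))"
  have D: "0 \<le> D" using B0 b1 Gamma_pos by (simp add: D_def)
  have Hoelder: "\<bar>(e \<circledast> g) t - (e \<circledast> g) (t - u)\<bar> \<le> D * u powr (1 - b)" if "t \<le> T" "0 \<le> u" for t u
    using convolution_Hoelder[OF B that] by (simp add: D_def mult.assoc)
  have Q0: "(e \<circledast> g) t = 0" if "t < 0" for t
    by (rule real_convolution_causal[OF causal_expD(2)[OF causal_exp_e] g_neg that])
  have Qb: "\<bar>(e \<circledast> g) t\<bar> \<le> B + 1" if "t \<le> T" for t
  proof (cases "t < 0")
    case False
    then have "(e \<circledast> g) t = g t - 1" using volterra[of t] by simp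
    then show ?thesis using B[OF that] by simp
  qed (use Q0 B0 in simp)
  \<comment> \<open>The Hoelder constant \<open>D\<close> covers steps up to 1; for longer steps the
    increment is at most twice the bound \<open>B + 1\<close> of
    \<open>e \<circledast> g = g - 1\<close>.\<close>
  define C where "C = max D (2 * (B + 1))"
  have C: "0 \<le> C" "D \<le> C" "2 * (B + 1) \<le> C" using D by (auto simp: C_def le_max_iff_disj)
  have "\<bar>marchaud_integrand t u\<bar> \<le> marchaud_bound C t u" if t: "0 < t" "t \<le> T" for t u
  proof (cases "0 < u")
    case u: True
    let ?w = "u powr (- b - 1)"
    have "g t - g (t - u) = (1 - indicator {0..} (t - u)) + ((e \<circledast> g) t - (e \<circledast> g) (t - u))"
      using volterra[of t] volterra[of "t - u"] t g_neg[of "t - u"] Q0[of "t - u"]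
      by (cases "u \<le> t") (auto simp: indicator_def)
    then have "\<bar>g t - g (t - u)\<bar> \<le> indicator {t..} u + \<bar>(e \<circledast> g) t - (e \<circledast> g) (t - u)\<bar>"
      by (auto simp: indicator_def)
    then have "\<bar>marchaud_integrand t u\<bar> \<le> (indicator {t..} u + \<bar>(e \<circledast> g) t - (e \<circledast> g) (t - u)\<bar>) * ?w"
      using u by (simp add: marchaud_integrand_def abs_mult mult_right_mono)
    moreover have "\<bar>(e \<circledast> g) t - (e \<circledast> g) (t - u)\<bar> * ?w
       \<le> C * (indicator {..1} u * pos_powr (- 2 * b) u + indicator {1..} u * pos_powr (- b - 1) u)"
    proof (cases "u \<le> 1")
      case True
      have "\<bar>(e \<circledast> g) t - (e \<circledast> g) (t - u)\<bar> * ?w \<le> (D * u powr (1 - b)) * ?w"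
        using Hoelder[of t u] t u by (intro mult_right_mono) auto
      also have "\<dots> = D * u powr (- 2 * b)" using u by (simp add: mult.assoc flip: powr_add)
      also have "\<dots> \<le> C * u powr (- 2 * b)" using C by (intro mult_right_mono) auto
      also have "\<dots> \<le> C * (indicator {..1} u * pos_powr (- 2 * b) u + indicator {1..} u * pos_powr (- b - 1) u)"
        using True u C by (intro mult_left_mono) auto
      finally show ?thesis .
    next
      case False
      have "\<bar>(e \<circledast> g) t - (e \<circledast> g) (t - u)\<bar> \<le> C"
      proof -
        have "\<bar>(e \<circledast> g) t\<bar> \<le> B + 1" "\<bar>(e \<circledast> g) (t - u)\<bar> \<le> B + 1"
          using t u by (auto intro: Qb)
        then have "\<bar>(e \<circledast> g) t - (e \<circledast> g) (t - u)\<bar> \<le> (B + 1) + (B + 1)"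
          by (rule order_trans[OF abs_triangle_ineq4 add_mono])
        then show ?thesis using C(3) by simp
      qed
      then have "\<bar>(e \<circledast> g) t - (e \<circledast> g) (t - u)\<bar> * ?w \<le> C * ?w" by (intro mult_right_mono) auto
      then show ?thesis using False by simp
    qed
    ultimately show ?thesis using u by (simp add: marchaud_bound_def distrib_right)
  next
    case False
    then show ?thesis by (simp add: marchaud_integrand_def marchaud_bound_def)
  qed
  then show ?thesis using C by blast
qed

lemma marchaud_bound_integral:
  assumes t: "0 < t"
  shows "has_bochner_integral lborel (marchaud_bound C t) (pos_powr (- b) t / b + C * (1 / (1 - 2 * b) + 1 / b))"
proof -
  have 1: "has_bochner_integral lborel (\<lambda>u. indicator {t..} u * pos_powr (- b - 1) u) (pos_powr (- b) t / b)"
    using has_bochner_integral_pos_powr_to_inf[of "- b - 1" t] t b by simp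
  have 2: "has_bochner_integral lborel (\<lambda>u. indicator {1..} u * pos_powr (- b - 1) u) (1 / b)"
    using has_bochner_integral_pos_powr_to_inf[of "- b - 1" 1] b by simp
  have 3: "has_bochner_integral lborel (\<lambda>u. indicator {..1} u * pos_powr (- 2 * b) u) (1 / (1 - 2 * b))"
    using has_bochner_integral_pos_powr_from_0[of "- 2 * b" 1] b by simp
  show ?thesis
    unfolding marchaud_bound_def
    by (intro has_bochner_integral_add has_bochner_integral_mult_right 1 2 3)
qed

lemma marchaud_integrand_integrable:
  assumes t: "0 < t"
  shows "integrable lborel (marchaud_integrand t)"
proof -
  obtain C where C: "\<And>u. \<bar>marchaud_integrand t u\<bar> \<le> marchaud_bound C t u"
    using marchaud_integrand_bound[of t] t by blast
  show ?thesis
    by (rule Bochner_Integration.integrable_bound[OF integrable.intros[OF marchaud_bound_integral[OF t, of C]]])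
       (use C order_trans[OF _ abs_ge_self] in auto)
qed

text \<open>Absolute integrability turns the limit of truncated integrals into one Lebesgue
  integral, which can be handled by Fubini.\<close>

lemma marchaud_derivative_eq:
  assumes t: "0 < t"
  shows "marchaud_derivative b g t = b / Gamma (1 - b) * (\<integral>u. marchaud_integrand t u \<partial>lborel)"
proof -
  have eq: "(LINT u:{\<delta><..}|lborel. (g t - g (t - u)) / u powr (1 + b))
      = (\<integral>u. indicator {\<delta><..} u * marchaud_integrand t u \<partial>lborel)"
    if "0 < \<delta>" for \<delta>
    unfolding set_lebesgue_integral_def
  proof (intro Bochner_Integration.integral_cong refl)
    fix u
    show "indicator {\<delta><..} u *\<^sub>R ((g t - g (t - u)) / u powr (1 + b)) = indicator {\<delta><..} u * marchaud_integrand t u"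
    proof (cases "\<delta> < u")
      case True
      have "- b - 1 = - (1 + b)" by simp
      then have "u powr (- b - 1) = inverse (u powr (1 + b))" by (simp only: powr_minus)
      then show ?thesis using True that by (simp add: marchaud_integrand_def divide_inverse)
    qed simp
  qed
  \<comment> \<open>The limit at 0 from the right is reparametrised by the reciprocal, so that
    dominated convergence at infinity applies to a continuous parameter.\<close>
  have "((\<lambda>n. \<integral>u. indicator {inverse n<..} u * marchaud_integrand t u \<partial>lborel)
     \<longlongrightarrow> (\<integral>u. marchaud_integrand t u \<partial>lborel)) at_top"
  proof (rule integral_dominated_convergence_at_top[where w="\<lambda>u. \<bar>marchaud_integrand t u\<bar>"])
    show "integrable lborel (\<lambda>u. \<bar>marchaud_integrand t u\<bar>)"
      by (intro integrable_abs marchaud_integrand_integrable t)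
    show "AE u in lborel. ((\<lambda>n. indicator {inverse n<..} u * marchaud_integrand t u) \<longlongrightarrow> marchaud_integrand t u) at_top"
    proof (rule AE_I2)
      fix u :: real
      show "((\<lambda>n. indicator {inverse n<..} u * marchaud_integrand t u) \<longlongrightarrow> marchaud_integrand t u) at_top"
      proof (cases "0 < u")
        case True
        have "\<forall>\<^sub>F n in at_top. indicator {inverse n<..} u * marchaud_integrand t u = marchaud_integrand t u"
          using eventually_gt_at_top[of "inverse u"]
        proof eventually_elim
          case (elim n)
          then have "inverse n < u" using True by (metis inverse_inverse_eq inverse_less_iff_less
              inverse_positive_iff_positive less_trans)
          then show ?case by simp
        qed
        then show ?thesis by (rule tendsto_eventually)
      qed (simp add: marchaud_integrand_def)
    qed
  qed (auto simp: indicator_def)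
  then have "((\<lambda>\<delta>. \<integral>u. indicator {\<delta><..} u * marchaud_integrand t u \<partial>lborel) \<longlongrightarrow> (\<integral>u. marchaud_integrand t u \<partial>lborel))
      (at_right 0)"
    by (simp add: filterlim_at_right_to_top)
  then have "((\<lambda>\<delta>. LINT u:{\<delta><..}|lborel. (g t - g (t - u)) / u powr (1
      + b)) \<longlongrightarrow> (\<integral>u. marchaud_integrand t u \<partial>lborel)) (at_right 0)"
  proof (rule Lim_transform_eventually)
    show "\<forall>\<^sub>F \<delta> in at_right 0. (\<integral>u. indicator {\<delta><..} u * marchaud_integrand t u \<partial>lborel)
        = (LINT u:{\<delta><..}|lborel. (g t - g (t - u)) / u powr (1 + b))"
      using eventually_at_right_less[of "0::real"] by eventually_elim (simp add: eq)
  qed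
  then show ?thesis
    using t unfolding marchaud_derivative_def by (simp add: tendsto_Lim)
qed

lemma marchaud_derivative_nonpos: "t \<le> 0 \<Longrightarrow> marchaud_derivative b g t = 0"
  by (simp add: marchaud_derivative_def)

lemma marchaud_derivative_measurable [measurable]: "marchaud_derivative b g \<in> borel_measurable borel"
proof -
  have "marchaud_derivative b g = (\<lambda>t. if t \<le> 0 then 0 else b / Gamma (1 - b) * (\<integral>u. marchaud_integrand t u \<partial>lborel))"
    by (auto simp: marchaud_derivative_eq marchaud_derivative_nonpos)
  then show ?thesis by simp
qed

text \<open>Integrated over \<open>u\<close>, the bound leaves \<open>t powr (- b) / b\<close> plus
  a constant, which is integrable in \<open>t\<close> up to any horizon.\<close>

lemma marchaud_integrand_pair_integrable:
  "integrable (lborel \<Otimes>\<^sub>M lborel) (\<lambda>(t, u). indicator {0<..T} t * marchaud_integrand t u)"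
proof -
  obtain C where C: "0 \<le> C" "\<And>t u. 0 < t \<Longrightarrow> t \<le> T \<Longrightarrow> \<bar>marchaud_integrand t u\<bar> \<le> marchaud_bound C t u"
    using marchaud_integrand_bound[of T] by blast
  show ?thesis
  proof (rule lborel_pair.Fubini_integrable)
    have "integrable lborel (\<lambda>t. \<integral>u. \<bar>indicator {0<..T} t * marchaud_integrand t u\<bar> \<partial>lborel)"
    proof (rule Bochner_Integration.integrable_bound)
      show "integrable lborel (\<lambda>t. (1 / b) * (indicator {..max T 0} t * pos_powr (- b) t)
          + (C * (1 / (1 - 2 * b) + 1 / b)) * indicator {0..max T 0} t)"
        using has_bochner_integral_pos_powr_from_0[of "- b" "max T 0"] b
        by (intro Bochner_Integration.integrable_add integrable_mult_right integrable_real_indicator)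
           (auto simp: has_bochner_integral_iff emeasure_lborel_Icc_eq)
      show "AE t in lborel. norm (\<integral>u. \<bar>indicator {0<..T} t * marchaud_integrand t u\<bar> \<partial>lborel)
         \<le> norm ((1 / b) * (indicator {..max T 0} t * pos_powr (- b) t)
          + (C * (1 / (1 - 2 * b) + 1 / b)) * indicator {0..max T 0} t)"
      proof (rule AE_I2)
        fix t :: real
        show "norm (\<integral>u. \<bar>indicator {0<..T} t * marchaud_integrand t u\<bar> \<partial>lborel)
         \<le> norm ((1 / b) * (indicator {..max T 0} t * pos_powr (- b) t)
          + (C * (1 / (1 - 2 * b) + 1 / b)) * indicator {0..max T 0} t)"
        proof (cases "0 < t \<and> t \<le> T")
          case True
          have "(\<integral>u. \<bar>marchaud_integrand t u\<bar> \<partial>lborel) \<le> (\<integral>u. marchaud_bound C t u \<partial>lborel)"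
            using True C(2) marchaud_bound_integral[of t C]
            by (intro integral_mono integrable_abs marchaud_integrand_integrable) (auto simp: has_bochner_integral_iff)
          also have "\<dots> = pos_powr (- b) t / b + C * (1 / (1 - 2 * b) + 1 / b)"
            using True by (intro has_bochner_integral_integral_eq marchaud_bound_integral) simp
          finally show ?thesis using True by simp
        qed auto
      qed
    qed measurable
    then show "integrable lborel (\<lambda>t. \<integral>u. norm (case (t, u) of (t, u) \<Rightarrow> indicator {0<..T} t
        * marchaud_integrand t u) \<partial>lborel)"
      by simp
    show "AE t in lborel. integrable lborel (\<lambda>u. case (t, u) of (t, u) \<Rightarrow> indicator {0<..T} t * marchaud_integrand t u)"
    proof (rule AE_I2)
      fix t :: real
      show "integrable lborel (\<lambda>u. case (t, u) of (t, u) \<Rightarrow> indicator {0<..T} t * marchaud_integrand t u)"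
        using marchaud_integrand_integrable[of t] by (cases "0 < t") auto
    qed
  qed measurable
qed

text \<open>Integrating the Marchaud derivative gives back the fractional integral: exchange the integrals
  and use \<open>\<integral>\<^bsub>u>T-y\<^esub> b u\<^sup>-\<^sup>b\<^sup>-\<^sup>1 du = (T-y)\<^sup>-\<^sup>b\<close>.\<close>

lemma marchaud_derivative_primitive:
  assumes T: "0 \<le> T"
  shows "integrable lborel (\<lambda>t. indicator {..T} t * marchaud_derivative b g t)"
    and "(\<integral>t. indicator {..T} t * marchaud_derivative b g t \<partial>lborel) = (pos_powr (- b) \<circledast> g) T / Gamma (1 - b)"
proof -
  let ?M = "\<lambda>t u. indicator {0<..T} t * marchaud_integrand t u"
  have eq: "indicator {..T} t * marchaud_derivative b g t = b / Gamma (1 - b) * (\<integral>u. ?M t u \<partial>lborel)" for t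
    by (cases "0 < t") (auto simp: marchaud_derivative_eq marchaud_derivative_nonpos indicator_def)
  note int = marchaud_integrand_pair_integrable[of T]
  show "integrable lborel (\<lambda>t. indicator {..T} t * marchaud_derivative b g t)"
    unfolding eq using lborel_pair.integrable_fst[OF int] by (intro integrable_mult_right)
  obtain B where B: "\<And>u. u \<le> T \<Longrightarrow> \<bar>g u\<bar> \<le> B"
    using continuous_on_nonneg_bounded[OF g_cont g_neg, of T] by blast
  have gi: "integrable lborel (\<lambda>y. indicator {a<..c} y * g y)" if "c \<le> T" for a c
  proof (rule Bochner_Integration.integrable_bound)
    show "integrable lborel (\<lambda>y. B * indicator {a<..c} y)"
    proof (intro integrable_mult_right integrable_real_indicator)
      show "emeasure lborel {a<..c} < \<infinity>"
        by (rule order_le_less_trans[OF emeasure_mono[of _ "{a..c}"]]) (auto simp: emeasure_lborel_Icc_eq)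
    qed simp
    show "AE y in lborel. norm (indicator {a<..c} y * g y) \<le> norm (B * indicator {a<..c} y)"
      using order_trans[OF B abs_ge_self] that by (intro AE_I2) (auto simp: indicator_def)
  qed measurable
  \<comment> \<open>The integrals of \<open>g t\<close> and \<open>g (t - u)\<close> over
    \<open>(0, T]\<close> cancel except for the last window of length \<open>u\<close>, since
    \<open>g\<close> vanishes before 0.\<close>
  have inner: "(\<integral>t. ?M t u \<partial>lborel) = pos_powr (- b - 1) u * (\<integral>y. indicator {T - u<..T} y * g y \<partial>lborel)" for u
  proof (cases "0 < u")
    case u: True
    have i2: "integrable lborel (\<lambda>t. indicator {0<..T} t * g (t - u))"
    proof -
      have "integrable lborel (\<lambda>t. indicator {0 - u<..T - u} (t - u) * g (t - u))"
        using gi[of "T - u" "0 - u"] u integrable_shift(3)[of "\<lambda>y. indicator {0 - u<..T - u} y * g y" u] by simp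
      moreover have "indicator {0 - u<..T - u} (t - u) = (indicator {0<..T} t :: real)" for t
          by (auto simp: indicator_def)
      ultimately show ?thesis by simp
    qed
    have "(\<integral>t. ?M t u \<partial>lborel) = (\<integral>t. pos_powr (- b - 1) u * (indicator {0<..T} t * g t - indicator {0<..T} t * g (t
        - u)) \<partial>lborel)"
      by (intro Bochner_Integration.integral_cong refl) (simp add: marchaud_integrand_def algebra_simps)
    also have "\<dots> = pos_powr (- b - 1) u * ((\<integral>t. indicator {0<..T} t * g t \<partial>lborel) - (\<integral>t. indicator {0<..T} t * g (t
        - u) \<partial>lborel))"
      using gi[of T 0] i2 by simp
    also have "(\<integral>t. indicator {0<..T} t * g (t - u) \<partial>lborel) = (\<integral>y. indicator {0 - u<..T - u} y * g y \<partial>lborel)"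
    proof -
      have "indicator {0<..T} t = (indicator {0 - u<..T - u} (t - u) :: real)" for t by (auto simp: indicator_def)
      then show ?thesis
        using integral_shift(3)[of "\<lambda>y. indicator {0 - u<..T - u} y * g y" u] by simp
    qed
    also have "(\<integral>t. indicator {0<..T} t * g t \<partial>lborel) - (\<integral>y. indicator {0 - u<..T - u} y * g y \<partial>lborel)
       = (\<integral>y. indicator {0<..T} y * g y - indicator {0 - u<..T - u} y * g y \<partial>lborel)"
      using gi[of T 0] gi[of "T - u" "0 - u"] u by simp
    also have "\<dots> = (\<integral>y. indicator {T - u<..T} y * g y \<partial>lborel)"
    proof (rule integral_cong_AE)
      have "AE y in lborel. y \<noteq> (0::real)" by (rule AE_lborel_singleton)
      then show "AE y in lborel. indicator {0<..T} y * g y - indicator {0 - u<..T - u} y * g y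
          = indicator {T - u<..T} y * g y"
      proof eventually_elim
        case (elim y)
        then show ?case using u g_neg[of y] by (cases "y < 0") (auto simp: indicator_def)
      qed
    qed measurable
    finally show ?thesis .
  qed (simp add: marchaud_integrand_def)
  let ?f = "\<lambda>y u. (indicator {..<T} y * g y) * (indicator {0..} (u - (T - y)) * (b * pos_powr (- b - 1) u))"
  have tail: "has_bochner_integral lborel (\<lambda>u. indicator {0..} (u - (T - y)) * (b * pos_powr (- b
      - 1) u)) (pos_powr (- b) (T - y))"
    if "y < T" for y
  proof -
    have "indicator {0..} (u - (T - y)) = (indicator {T - y..} u :: real)" for u by (auto simp: indicator_def)
    then show ?thesis using pos_powr_tail[of b "T - y"] b that by simp
  qed
  have gp: "integrable lborel (\<lambda>y. pos_powr (- b) (T - y) * g y)"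
    by (rule integrable_e_mult[of _ _ B]) (use B g_neg causal_exp_pos_powr[OF b1] in auto)
  have fy: "(\<integral>u. ?f y u \<partial>lborel) = pos_powr (- b) (T - y) * g y" for y
    using has_bochner_integral_integral_eq[OF tail[of y]] by (cases "y < T") auto
  have int2: "integrable (lborel \<Otimes>\<^sub>M lborel) (\<lambda>(y, u). ?f y u)"
  proof (rule lborel_pair.Fubini_integrable)
    have "(\<integral>u. norm (?f y u) \<partial>lborel) = \<bar>pos_powr (- b) (T - y) * g y\<bar>" for y
    proof -
      have nf: "norm (?f y u) = \<bar>indicator {..<T} y * g y\<bar> * (indicator {0..} (u - (T - y)) * (b * pos_powr (- b
          - 1) u))" for u
        using b by (simp add: abs_mult)
      have "(\<integral>u. norm (?f y u) \<partial>lborel) = \<bar>indicator {..<T} y * g y\<bar>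
          * (\<integral>u. indicator {0..} (u - (T - y)) * (b * pos_powr (- b - 1) u) \<partial>lborel)"
        unfolding nf by (rule integral_mult_right_zero)
      then show ?thesis
        using has_bochner_integral_integral_eq[OF tail[of y]] by (cases "y < T") (auto simp: abs_mult)
    qed
    then show "integrable lborel (\<lambda>y. \<integral>u. norm (case (y, u) of (y, u) \<Rightarrow> ?f y u) \<partial>lborel)"
      using integrable_abs[OF gp] by simp
    show "AE y in lborel. integrable lborel (\<lambda>u. case (y, u) of (y, u) \<Rightarrow> ?f y u)"
    proof (rule AE_I2)
      fix y
      show "integrable lborel (\<lambda>u. case (y, u) of (y, u) \<Rightarrow> ?f y u)"
        using tail[of y] by (cases "y < T") (auto simp: has_bochner_integral_iff)
    qed
  qed measurable
  have "(\<integral>t. indicator {..T} t * marchaud_derivative b g t \<partial>lborel)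
      = b / Gamma (1 - b) * (\<integral>t. (\<integral>u. ?M t u \<partial>lborel) \<partial>lborel)"
    unfolding eq by (rule integral_mult_right_zero)
  also have "(\<integral>t. (\<integral>u. ?M t u \<partial>lborel) \<partial>lborel) = (\<integral>u. (\<integral>t. ?M t u \<partial>lborel) \<partial>lborel)"
    using lborel_pair.Fubini_integral[OF int] by simp
  also have "b / Gamma (1 - b) * \<dots> = 1 / Gamma (1 - b) * (\<integral>u. b * (\<integral>t. ?M t u \<partial>lborel) \<partial>lborel)"
    by simp
  also have "(\<integral>u. b * (\<integral>t. ?M t u \<partial>lborel) \<partial>lborel) = (\<integral>u. (\<integral>y. ?f y u \<partial>lborel) \<partial>lborel)"
  proof (intro Bochner_Integration.integral_cong refl)
    fix u
    have "(\<integral>y. ?f y u \<partial>lborel) = (\<integral>y. b * pos_powr (- b - 1) u * (indicator {T - u<..T} y * g y) \<partial>lborel)"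
    proof (cases "0 < u")
      case u: True
      show ?thesis
      proof (rule integral_cong_AE)
        have "AE y in lborel. y \<noteq> T" "AE y in lborel. y \<noteq> T - u" by (rule AE_lborel_singleton)+
        then show "AE y in lborel. ?f y u = b * pos_powr (- b - 1) u * (indicator {T - u<..T} y * g y)"
          by eventually_elim (auto simp: indicator_def)
      qed measurable
    qed simp
    then show "b * (\<integral>t. ?M t u \<partial>lborel) = (\<integral>y. ?f y u \<partial>lborel)" by (simp add: inner)
  qed
  also have "\<dots> = (\<integral>y. (\<integral>u. ?f y u \<partial>lborel) \<partial>lborel)"
    using lborel_pair.Fubini_integral[OF int2] by simp
  also have "\<dots> = (pos_powr (- b) \<circledast> g) T"
    unfolding fy real_convolution_def ..
  finally show "(\<integral>t. indicator {..T} t * marchaud_derivative b g t \<partial>lborel) = (pos_powr (- b) \<circledast> g) T / Gamma (1 - b)"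
    by simp
qed

end

text \<open>The positive and the negative part of \<open>h\<close> are densities of two finite
  measures that agree on all rays \<open>{r<..}\<close>, hence coincide. Vanishing beyond
  \<open>T\<close> makes the total integral one of the given primitives, which passes from left to
  right rays.\<close>

lemma AE_eq_0_if_primitive_eq_0:
  fixes h :: "real \<Rightarrow> real"
  assumes h: "integrable lborel h" and z: "\<And>r. (\<integral>t. indicator {..r} t * h t \<partial>lborel) = 0"
    and T: "\<And>t. T < t \<Longrightarrow> h t = 0"
  shows "AE t in lborel. h t = 0"
proof -
  have [measurable]: "h \<in> borel_measurable borel" using h by simp
  have hi: "integrable lborel (\<lambda>t. indicator A t * h t)" if "A \<in> sets borel" for A
    using integrable_real_mult_indicator[of A lborel h] that h by (simp add: mult.commute)
  have tot: "(\<integral>t. h t \<partial>lborel) = 0"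
  proof -
    have eq: "indicator {..T} t * h t = h t" for t using T[of t] by (auto simp: indicator_def)
    show ?thesis using z[of T] unfolding eq .
  qed
  have up: "(\<integral>t. indicator {r<..} t * h t \<partial>lborel) = 0" for r
  proof -
    have "h t = indicator {..r} t * h t + indicator {r<..} t * h t" for t by (auto simp: indicator_def)
    then have "(\<integral>t. h t \<partial>lborel) = (\<integral>t. indicator {..r} t * h t + indicator {r<..} t * h t \<partial>lborel)"
      by simp
    also have "\<dots> = (\<integral>t. indicator {..r} t * h t \<partial>lborel) + (\<integral>t. indicator {r<..} t * h t \<partial>lborel)"
      by (intro Bochner_Integration.integral_add hi) auto
    finally show ?thesis using tot z[of r] by simp
  qed
  let ?p = "\<lambda>t. max (h t) 0" and ?n = "\<lambda>t. max (- h t) 0"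
  have ip: "integrable lborel ?p" "integrable lborel ?n" using h by auto
  have em: "emeasure (density lborel (\<lambda>t. ennreal (f t))) {r<..} = ennreal (\<integral>t. indicator {r<..} t * f t \<partial>lborel)"
    if f: "integrable lborel f" "\<And>t. 0 \<le> f t" for f :: "real \<Rightarrow> real" and r
  proof -
    have "emeasure (density lborel (\<lambda>t. ennreal (f t))) {r<..} = (\<integral>\<^sup>+t. ennreal (f t) * indicator {r<..} t \<partial>lborel)"
      using f by (subst emeasure_density) auto
    also have "\<dots> = (\<integral>\<^sup>+t. ennreal (indicator {r<..} t * f t) \<partial>lborel)"
      by (intro nn_integral_cong) (auto simp: indicator_def)
    also have "\<dots> = ennreal (\<integral>t. indicator {r<..} t * f t \<partial>lborel)"
      using integrable_real_mult_indicator[of "{r<..}" lborel f] f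
      by (intro nn_integral_eq_integral) (auto simp: mult.commute)
    finally show ?thesis .
  qed
  have "density lborel (\<lambda>t. ennreal (?p t)) = density lborel (\<lambda>t. ennreal (?n t))"
  proof (rule measure_eqI_lessThan)
    fix r
    show "emeasure (density lborel (\<lambda>t. ennreal (?p t))) {r<..} < \<infinity>"
      unfolding em[OF ip(1) max.cobounded2] by simp
    have "indicator {r<..} t * h t = indicator {r<..} t * ?p t - indicator {r<..} t * ?n t" for t
      by (auto simp: indicator_def max_def)
    then have "(\<integral>t. indicator {r<..} t * ?p t - indicator {r<..} t * ?n t \<partial>lborel) = 0"
      using up[of r] by simp
    then have "(\<integral>t. indicator {r<..} t * ?p t \<partial>lborel) = (\<integral>t. indicator {r<..} t * ?n t \<partial>lborel)"
      using integrable_real_mult_indicator[of "{r<..}" lborel ?p] integrable_real_mult_indicator[of "{r<..}" lborel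
          ?n] ip
      by (simp add: mult.commute)
    then show "emeasure (density lborel (\<lambda>t. ennreal (?p t))) {r<..}
        = emeasure (density lborel (\<lambda>t. ennreal (?n t))) {r<..}"
      unfolding em[OF ip(1) max.cobounded2] em[OF ip(2) max.cobounded2] by simp
  qed auto
  moreover have "(\<integral>\<^sup>+t. ennreal (?p t) \<partial>lborel) \<noteq> \<infinity>"
    using ip(1) by (subst nn_integral_eq_integral) auto
  ultimately have "AE t in lborel. ennreal (?p t) = ennreal (?n t)"
    by (subst (asm) finite_density_unique) auto
  then show ?thesis
  proof eventually_elim
    case (elim t)
    then have "?p t = ?n t" by (subst (asm) ennreal_inj) auto
    then show ?case by (auto simp: max_def split: if_splits)
  qed
qed

lemma right_derivative_indicator_eq:
  "right_derivative_indicator b s t u = (pos_powr (- b) (t - u) - pos_powr (- b) (s - u)) / Gamma (1 - b)"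
  by (simp add: right_derivative_indicator_def pos_powr_def)

lemma right_derivative_indicator_measurable [measurable (raw)]:
  assumes [measurable]: "f \<in> borel_measurable M" "g \<in> borel_measurable M" "h \<in> borel_measurable M"
  shows "(\<lambda>x. right_derivative_indicator b (f x) (g x) (h x)) \<in> borel_measurable M"
  unfolding right_derivative_indicator_eq by measurable

section \<open>The density of \<open>g\<close> as the resolvent of \<open>e\<close>\<close>

context sfdde_volterra
begin

abbreviation f where "f \<equiv> marchaud_derivative b g"

definition \<rho> :: "real \<Rightarrow> real" where
  "\<rho> u = (\<integral>v. f (u - v) \<partial>P) - (\<integral>v. f (u - v) \<partial>N)"

text \<open>Only local integrability of the derivative is at hand, hence the cut-off at
  \<open>T\<close>; a convolution evaluated up to time \<open>T\<close> does not notice it, since no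
  factor is used after \<open>T\<close>.\<close>

lemma causal_exp_f: "causal_exp (\<lambda>t. indicator {..T} t * f t)"
proof (cases "0 \<le> T")
  case True
  have "integrable lborel (\<lambda>u. exp (- u) * (indicator {..T} u * f u))"
  proof (rule Bochner_Integration.integrable_bound[OF marchaud_derivative_primitive(1)[OF True]])
    show "AE u in lborel. norm (exp (- u) * (indicator {..T} u * f u)) \<le> norm (indicator {..T} u * f u)"
    proof (rule AE_I2)
      fix u :: real
      show "norm (exp (- u) * (indicator {..T} u * f u)) \<le> norm (indicator {..T} u * f u)"
      proof (cases "u \<le> 0")
        case False
        then have "exp (- u) * \<bar>indicator {..T} u * f u\<bar> \<le> 1 * \<bar>indicator {..T} u * f u\<bar>"
          by (intro mult_right_mono) auto
        then show ?thesis by (simp add: abs_mult)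
      qed (simp add: marchaud_derivative_nonpos)
    qed
  qed measurable
  then show ?thesis by (auto simp: causal_exp_def marchaud_derivative_nonpos)
next
  case False
  then have eq: "indicator {..T} t * f t = 0" for t by (auto simp: indicator_def marchaud_derivative_nonpos)
  show ?thesis unfolding eq by (simp add: causal_exp_def)
qed

lemma measure_convolution_f:
  assumes "AE v in K. 0 \<le> v" "sets K = sets borel" "u \<le> T"
  shows "(\<integral>v. f (u - v) \<partial>K) = measure_convolution (\<lambda>t. indicator {..T} t * f t) K u"
  unfolding measure_convolution_def
proof (rule integral_cong_AE)
  note [measurable_cong] = assms(2)
  show "(\<lambda>v. f (u - v)) \<in> borel_measurable K" "(\<lambda>v. indicator {..T} (u - v) * f (u - v)) \<in> borel_measurable K"
    by measurable
  show "AE v in K. f (u - v) = indicator {..T} (u - v) * f (u - v)"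
    using assms(1) by eventually_elim (use assms(3) in auto)
qed

lemma \<rho>_measurable [measurable]: "\<rho> \<in> borel_measurable borel"
  using measure_convolution_measurable[OF P(1,2), of f] measure_convolution_measurable[OF N(1,2), of f]
  unfolding \<rho>_def[abs_def] measure_convolution_def by measurable

lemma \<rho>_indicator_eq:
  "indicator {..T} u * \<rho> u = indicator {..T} u * (measure_convolution (\<lambda>t. indicator {..T} t * f t) P u
     - measure_convolution (\<lambda>t. indicator {..T} t * f t) N u)"
  using measure_convolution_f[OF P(3,2), of u T] measure_convolution_f[OF N(3,2), of u T]
  by (auto simp: \<rho>_def indicator_def)

lemma causal_exp_\<rho>: "causal_exp (\<lambda>t. indicator {..T} t * \<rho> t)"
  unfolding \<rho>_indicator_eq
  by (intro causal_exp_indicator causal_exp_diff causal_exp_measure_convolution(1) causal_exp_f P N) simp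

lemma \<rho>_neg: "u < 0 \<Longrightarrow> \<rho> u = 0"
  using causal_expD(2)[OF causal_exp_\<rho>[of 0], of u] by simp

lemma indicator_exp_bound: "0 \<le> x \<Longrightarrow> \<bar>indicator {..r} x\<bar> \<le> exp r * exp (- x :: real)"
  by (auto simp: indicator_def simp flip: exp_add)

lemma integrable_\<rho>: "integrable lborel (\<lambda>u. indicator {..T} u * \<rho> u)"
proof -
  have "integrable lborel (\<lambda>u. (indicator {..T} u * \<rho> u) * indicator {..T} u)"
    by (rule causal_exp_mult_integrable(1)[OF causal_exp_\<rho> _ indicator_exp_bound]) auto
  moreover have "(indicator {..T} u * \<rho> u) * indicator {..T} u = indicator {..T} u * \<rho> u" for u
    by (simp add: indicator_def)
  ultimately show ?thesis by simp
qed

lemma g_reflect_bound: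
  obtains C where "\<And>x. 0 \<le> x \<Longrightarrow> \<bar>g (r - x)\<bar> \<le> C * exp (- x)"
proof -
  obtain B where "\<And>u. u \<le> r \<Longrightarrow> \<bar>g u\<bar> \<le> B" using continuous_on_nonneg_bounded[OF g_cont g_neg, of r] by blast
  then show thesis using causal_locally_bounded_exp[of g r B] g_neg that[of "B * exp r"] by blast
qed

text \<open>Integrating a delayed derivative up to \<open>r\<close> evaluates its primitive, the
  fractional integral of \<open>g\<close>, at \<open>r - v\<close>; averaging over the delays yields
  \<open>e \<circledast> g\<close>, which the Volterra equation identifies. So \<open>g\<close> is
  the distribution function of \<open>delta_0\<close> plus the density
  \<open>\<rho>\<close>.\<close>

lemma \<rho>_primitive:
  assumes r: "0 \<le> r"
  shows "(\<integral>u. indicator {..r} u * \<rho> u \<partial>lborel) = g r - 1"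
proof -
  let ?f = "\<lambda>t. indicator {..r} t * f t"
  obtain C where C: "\<And>x. 0 \<le> x \<Longrightarrow> \<bar>g (r - x)\<bar> \<le> C * exp (- x)" using g_reflect_bound by blast
  have gm: "(\<lambda>x. g (r - x)) \<in> borel_measurable borel" by measurable
  have K: "(\<integral>u. indicator {..r} u * measure_convolution ?f K u \<partial>lborel)
      = (\<integral>v. (\<integral>x. pos_powr (- b) x * g (r - (v + x)) \<partial>lborel) \<partial>K) / Gamma (1 - b)"
    if K: "finite_measure K" "sets K = sets borel" "AE v in K. 0 \<le> v" for K
  proof -
    interpret finite_measure K by fact
    note [measurable_cong] = K(2)
    have "(\<integral>u. indicator {..r} u * measure_convolution ?f K u \<partial>lborel)
        = (\<integral>u. measure_convolution ?f K u * indicator {..r} u \<partial>lborel)"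
      by (simp add: mult.commute)
    also have "\<dots> = (\<integral>v. (\<integral>x. ?f x * indicator {..r} (v + x) \<partial>lborel) \<partial>K)"
      by (rule causal_exp_measure_convolution(3)[OF causal_exp_f K _ indicator_exp_bound, symmetric]) auto
    also have "\<dots> = (\<integral>v. (\<integral>x. pos_powr (- b) x * g (r - (v + x)) \<partial>lborel) / Gamma (1 - b) \<partial>K)"
    proof (rule integral_cong_AE)
      show "AE v in K. (\<integral>x. ?f x * indicator {..r} (v + x) \<partial>lborel)
          = (\<integral>x. pos_powr (- b) x * g (r - (v + x)) \<partial>lborel) / Gamma (1 - b)"
        using K(3)
      proof eventually_elim
        case (elim v)
        have eq: "?f x * indicator {..r} (v + x) = indicator {..r - v} x * f x" for x
          using elim by (auto simp: indicator_def)
        have "(\<integral>x. ?f x * indicator {..r} (v + x) \<partial>lborel) = (\<integral>x. indicator {..r - v} x * f x \<partial>lborel)"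
          unfolding eq ..
        also have "\<dots> = (pos_powr (- b) \<circledast> g) (r - v) / Gamma (1 - b)"
        proof (cases "v \<le> r")
          case True
          then show ?thesis by (intro marchaud_derivative_primitive(2)) simp
        next
          case False
          then have z: "indicator {..r - v} x * f x = 0" for x by (auto simp: indicator_def marchaud_derivative_nonpos)
          have "(pos_powr (- b) \<circledast> g) (r - v) = 0"
            using False by (intro real_convolution_causal g_neg) auto
          then show ?thesis unfolding z by simp
        qed
        also have "(pos_powr (- b) \<circledast> g) (r - v) = (\<integral>x. pos_powr (- b) x * g (r - (v + x)) \<partial>lborel)"
          unfolding real_convolution_commute[of "pos_powr (- b)"]
          by (simp add: real_convolution_def diff_diff_eq mult.commute)
        finally show ?case .
      qed
    qed measurable
    finally show ?thesis by simp
  qed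
  have "(\<integral>u. indicator {..r} u * \<rho> u \<partial>lborel)
     = (\<integral>u. indicator {..r} u * measure_convolution ?f P u - indicator {..r} u * measure_convolution ?f N u \<partial>lborel)"
    unfolding \<rho>_indicator_eq right_diff_distrib ..
  also have "\<dots> = (\<integral>u. indicator {..r} u * measure_convolution ?f P u \<partial>lborel)
      - (\<integral>u. indicator {..r} u * measure_convolution ?f N u \<partial>lborel)"
    using causal_exp_mult_integrable(1)[OF causal_exp_measure_convolution(1)[OF causal_exp_f P] _ indicator_exp_bound]
      causal_exp_mult_integrable(1)[OF causal_exp_measure_convolution(1)[OF causal_exp_f N] _ indicator_exp_bound]
    by (intro Bochner_Integration.integral_diff) (auto simp: mult.commute)
  also have "\<dots> = (\<integral>z. e z * g (r - z) \<partial>lborel)"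
    unfolding K[OF P] K[OF N] using integral_e[OF gm C] by (simp add: diff_divide_distrib)
  also have "\<dots> = (e \<circledast> g) r"
    unfolding real_convolution_commute[of e] by (simp add: real_convolution_def mult.commute)
  finally show ?thesis using volterra[OF r] by simp
qed

text \<open>Compare primitives: that of \<open>\<rho>\<close> is \<open>g - 1\<close>, and that of
  \<open>e \<circledast> \<rho>\<close> is \<open>e\<close> convolved with \<open>g - 1\<close>,
  which is \<open>g - 1\<close> minus the primitive of \<open>e\<close>. The defect \<open>h\<close>
  thus has vanishing primitive up to \<open>T\<close> and is 0 almost everywhere; \<open>e\<close>
  itself is meaningful only up to null sets.\<close>

lemma resolvent_equation:
  "AE t in lborel. t \<le> T \<longrightarrow> \<rho> t = e t + (e \<circledast> (\<lambda>t. indicator {..T} t * \<rho> t)) t"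
proof -
  let ?\<rho> = "\<lambda>t. indicator {..T} t * \<rho> t"
  define h where "h t = ?\<rho> t - e t - (e \<circledast> ?\<rho>) t" for t
  have h: "causal_exp h"
    unfolding h_def by (intro causal_exp_diff causal_exp_real_convolution causal_exp_e causal_exp_\<rho>)
  have i: "integrable lborel (\<lambda>t. q t * indicator {..r} t)" if "causal_exp q" for q r
    by (rule causal_exp_mult_integrable(1)[OF that _ indicator_exp_bound]) auto
  have zero: "(\<integral>t. h t * indicator {..r} t \<partial>lborel) = 0" if rT: "r \<le> T" for r
  proof (cases "r < 0")
    case True
    then have eq: "h t * indicator {..r} t = 0" for t using causal_expD(2)[OF h, of t] by (auto simp: indicator_def)
    show ?thesis unfolding eq by simp
  next
    case False
    obtain C where C: "\<And>x. 0 \<le> x \<Longrightarrow> \<bar>g (r - x)\<bar> \<le> C * exp (- x)" using g_reflect_bound by blast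
    \<comment> \<open>The commuted form makes \<open>\<rho>\<close> the inner factor, whose
      primitive is known.\<close>
    have "(\<integral>t. (e \<circledast> ?\<rho>) t * indicator {..r} t \<partial>lborel) = (\<integral>t. (?\<rho> \<circledast> e) t * indicator {..r} t \<partial>lborel)"
      by (simp add: real_convolution_commute)
    also have "\<dots> = (\<integral>u. e u * (\<integral>z. ?\<rho> z * indicator {..r} (u + z) \<partial>lborel) \<partial>lborel)"
      by (rule causal_exp_convolution(3)[OF causal_exp_\<rho> causal_exp_e _ indicator_exp_bound, symmetric]) auto
    also have "\<dots> = (\<integral>u. e u * g (r - u) - e u * indicator {..r} u \<partial>lborel)"
    proof (intro Bochner_Integration.integral_cong refl)
      fix u
      show "e u * (\<integral>z. ?\<rho> z * indicator {..r} (u + z) \<partial>lborel) = e u * g (r - u) - e u * indicator {..r} u"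
      proof (cases "u < 0")
        case True
        then show ?thesis by (simp add: causal_expD(2)[OF causal_exp_e])
      next
        case u: False
        have eq: "?\<rho> z * indicator {..r} (u + z) = indicator {..r - u} z * \<rho> z" for z
          using u rT by (auto simp: indicator_def)
        show ?thesis
        proof (cases "u \<le> r")
          case True
          then show ?thesis unfolding eq using \<rho>_primitive[of "r - u"] by (simp add: right_diff_distrib)
        next
          case False
          then have z: "indicator {..r - u} z * \<rho> z = 0" for z using \<rho>_neg[of z] by (auto simp: indicator_def)
          show ?thesis unfolding eq z using False g_neg[of "r - u"] by simp
        qed
      qed
    qed
    also have "\<dots> = (\<integral>u. e u * g (r - u) \<partial>lborel) - (\<integral>u. e u * indicator {..r} u \<partial>lborel)"
      by (intro Bochner_Integration.integral_diff i causal_exp_e causal_exp_mult_integrable(1)[OF causal_exp_e _ C])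
          auto
    also have "(\<integral>u. e u * g (r - u) \<partial>lborel) = (e \<circledast> g) r"
      unfolding real_convolution_commute[of e] by (simp add: real_convolution_def mult.commute)
    finally have 1: "(\<integral>t. (e \<circledast> ?\<rho>) t * indicator {..r} t \<partial>lborel) = g r - 1 - (\<integral>u. e u * indicator {..r} u \<partial>lborel)"
      using volterra[of r] False by simp
    have eq: "?\<rho> t * indicator {..r} t = indicator {..r} t * \<rho> t" for t using rT by (auto simp: indicator_def)
    have 2: "(\<integral>t. ?\<rho> t * indicator {..r} t \<partial>lborel) = g r - 1"
      unfolding eq using \<rho>_primitive[of r] False by simp
    have "(\<integral>t. h t * indicator {..r} t \<partial>lborel) = (\<integral>t. ?\<rho> t * indicator {..r} t \<partial>lborel)
       - (\<integral>t. e t * indicator {..r} t \<partial>lborel) - (\<integral>t. (e \<circledast> ?\<rho>) t * indicator {..r} t \<partial>lborel)"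
      unfolding h_def left_diff_distrib
      using i[OF causal_exp_\<rho>[of T], of r] i[OF causal_exp_e, of r] i[OF causal_exp_real_convolution[OF causal_exp_e
          causal_exp_\<rho>[of T]], of r]
      by simp
    then show ?thesis using 1 2 by simp
  qed
  have "AE t in lborel. h t * indicator {..T} t = 0"
  proof (rule AE_eq_0_if_primitive_eq_0[of _ T])
    show "integrable lborel (\<lambda>t. h t * indicator {..T} t)" by (rule i[OF h])
    show "(\<integral>t. indicator {..r} t * (h t * indicator {..T} t) \<partial>lborel) = 0" for r
    proof -
      have eq: "indicator {..r} t * (h t * indicator {..T} t) = h t * indicator {..min r T} t" for t
        by (auto simp: indicator_def)
      show ?thesis unfolding eq by (rule zero) simp
    qed
  qed auto
  then show ?thesis by eventually_elim (auto simp: h_def)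
qed

end

section \<open>The prediction kernel\<close>

context sfdde_volterra
begin

text \<open>The inner integral over the delays in the prediction formula, with time \<open>s\<close>
  moved to the origin and \<open>c\<close> standing for \<open>t - u - s\<close>.\<close>

definition \<kappa> :: "real \<Rightarrow> real \<Rightarrow> real" where
  "\<kappa> c w = (\<integral>v. right_derivative_indicator b 0 c (v + w) \<partial>P) - (\<integral>v. right_derivative_indicator b 0 c (v + w) \<partial>N)"

lemma \<kappa>_measurable [measurable]: "(\<lambda>(c, w). \<kappa> c w) \<in> borel_measurable (borel \<Otimes>\<^sub>M borel)"
proof -
  interpret P: finite_measure P by (rule P)
  interpret N: finite_measure N by (rule N)
  note [measurable_cong] = P(2) N(2)
  show ?thesis unfolding \<kappa>_def by measurable
qed

text \<open>The integral of a difference splits only where both parts are integrable, which is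
  guaranteed for almost every \<open>w\<close>; hence the four exceptional null sets.\<close>

lemma \<kappa>_eq: "AE w in lborel. \<kappa> c w = e (c - w) - e (- w)"
proof -
  have ae: "AE w in lborel. integrable K (\<lambda>v. pos_powr (- b) (a - w - v))"
    if K: "finite_measure K" "sets K = sets borel" "AE v in K. 0 \<le> v" for K a
  proof -
    interpret finite_measure K by (rule K)
    note [measurable_cong] = K(2)
    have "AE w in lborel. integrable K (\<lambda>v. pos_powr (- b) (a + (- 1) * w - v))"
      by (rule AE_borel_affine[OF _ _ causal_exp_measure_convolution(2)[OF causal_exp_pos_powr[OF b1] K]]) auto
    then show ?thesis by simp
  qed
  show ?thesis
    using ae[OF P, of c] ae[OF P, of 0] ae[OF N, of c] ae[OF N, of 0]
  proof eventually_elim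
    case (elim w)
    have "(\<integral>v. right_derivative_indicator b 0 c (v + w) \<partial>K)
        = (measure_convolution (pos_powr (- b)) K (c - w) - measure_convolution (pos_powr (- b)) K (- w)) / Gamma (1
            - b)"
      if "integrable K (\<lambda>v. pos_powr (- b) (c - w - v))" "integrable K (\<lambda>v. pos_powr (- b) (0 - w - v))" for K
    proof -
      have "right_derivative_indicator b 0 c (v + w) = (pos_powr (- b) (c - w - v) - pos_powr (- b) (0 - w
          - v)) / Gamma (1 - b)" for v
      proof -
        have "c - (v + w) = c - w - v" "0 - (v + w) = 0 - w - v" by simp_all
        then show ?thesis unfolding right_derivative_indicator_eq by (simp only:)
      qed
      then show ?thesis using that by (simp add: measure_convolution_def)
    qed
    then show ?case using elim by (simp add: \<kappa>_def e_def diff_divide_distrib)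
  qed
qed

text \<open>Almost everywhere this is an increment of \<open>e\<close>, whose norm in mean grows
  like \<open>c powr (1 - b)\<close>. Uniformity in \<open>c\<close> is what permits integration
  over \<open>u\<close> with \<open>c = T - u\<close>.\<close>

lemma \<kappa>_L1: "\<exists>C. \<forall>c. 0 \<le> c \<longrightarrow> c \<le> T \<longrightarrow> (\<integral>\<^sup>+w. ennreal \<bar>\<kappa> c w\<bar> \<partial>lborel) \<le> ennreal C"
proof -
  let ?D = "(measure P UNIV + measure N UNIV) * (2 / (1 - b)) / Gamma (1 - b)"
  have D: "0 \<le> ?D" using b1 Gamma_pos by simp
  note [measurable] = causal_expD(1)[OF causal_exp_e]
  have "(\<integral>\<^sup>+w. ennreal \<bar>\<kappa> c w\<bar> \<partial>lborel) \<le> ennreal (?D * T powr (1 - b))" if c: "0 \<le> c" "c \<le> T" for c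
  proof -
    have "(\<integral>\<^sup>+w. ennreal \<bar>\<kappa> c w\<bar> \<partial>lborel) = (\<integral>\<^sup>+w. ennreal \<bar>e (0 - w + c) - e (0 - w)\<bar> \<partial>lborel)"
      by (rule nn_integral_cong_AE) (use \<kappa>_eq[of c] in eventually_elim, simp)
    also have "\<dots> = (\<integral>\<^sup>+z. ennreal \<bar>e (z + c) - e z\<bar> \<partial>lborel)"
      by (rule nn_integral_shift(4)[of "\<lambda>z. ennreal \<bar>e (z + c) - e z\<bar>" 0]) measurable
    also have "\<dots> \<le> ennreal (?D * c powr (1 - b))" by (rule e_shift_L1[OF c(1)])
    also have "\<dots> \<le> ennreal (?D * T powr (1 - b))"
      using c D b1 by (intro ennreal_leI mult_left_mono powr_mono2) auto
    finally show ?thesis .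
  qed
  then show ?thesis by blast
qed

text \<open>\<open>G\<close> is the kernel as seen from time \<open>x\<close> on. The integral
  collects the part of \<open>(e \<circledast> g) (c + x)\<close> coming from times up to
  \<open>x\<close>, less \<open>(e \<circledast> g) x\<close>; the missing part is
  \<open>(e \<circledast> G) c\<close>, and the Volterra equation at \<open>c + x\<close> and at
  \<open>x\<close> removes \<open>e \<circledast> g\<close>.\<close>

lemma \<kappa>_integral:
  assumes x: "0 \<le> x" and c: "0 \<le> c"
  defines "G \<equiv> \<lambda>y. indicator {0..} y * g (x + y)"
  shows "(\<integral>w. indicator {..0} w * \<kappa> c w * g (w + x) \<partial>lborel) = G c - g x - (e \<circledast> G) c"
proof -
  note [measurable] = causal_expD(1)[OF causal_exp_e]
  have i: "integrable lborel (\<lambda>y. e (s - y) * g y)" for s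
  proof -
    obtain B where "\<And>u. u \<le> s \<Longrightarrow> \<bar>g u\<bar> \<le> B" using continuous_on_nonneg_bounded[OF g_cont g_neg, of s] by blast
    then show ?thesis by (intro integrable_e_mult[of _ _ B]) (use g_neg causal_exp_e in auto)
  qed
  have i1: "integrable lborel (\<lambda>y. indicator A y * (e (s - y) * g y))" if "A \<in> sets borel" for A s
    using integrable_real_mult_indicator[of A lborel, OF _ i] that by (simp add: mult.commute)
  have "(\<integral>w. indicator {..0} w * \<kappa> c w * g (w + x) \<partial>lborel)
     = (\<integral>w. indicator {..x} (w + x) * (e (c + x - (w + x)) - e (x - (w + x))) * g (w + x) \<partial>lborel)"
  proof (rule integral_cong_AE)
    show "AE w in lborel. indicator {..0} w * \<kappa> c w * g (w + x)
        = indicator {..x} (w + x) * (e (c + x - (w + x)) - e (x - (w + x))) * g (w + x)"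
      using \<kappa>_eq[of c] by eventually_elim (auto simp: indicator_def)
  qed measurable
  also have "\<dots> = (\<integral>y. indicator {..x} y * (e (c + x - y) - e (x - y)) * g y \<partial>lborel)"
    by (rule integral_shift(1)[of "\<lambda>y. indicator {..x} y * (e (c + x - y) - e (x - y)) * g y"])
  also have "\<dots> = (\<integral>y. e (c + x - y) * g y - indicator {x<..} y * (e (c + x - y) * g y) - e (x - y) * g y \<partial>lborel)"
  proof (intro Bochner_Integration.integral_cong refl)
    fix y
    show "indicator {..x} y * (e (c + x - y) - e (x - y)) * g y
        = e (c + x - y) * g y - indicator {x<..} y * (e (c + x - y) * g y) - e (x - y) * g y"
      using causal_expD(2)[OF causal_exp_e, of "x - y"] by (auto simp: indicator_def algebra_simps)
  qed
  also have "\<dots> = (e \<circledast> g) (c + x) - (\<integral>y. indicator {x<..} y * (e (c + x - y) * g y) \<partial>lborel) - (e \<circledast> g) x"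
    unfolding real_convolution_def using i[of "c + x"] i[of x] i1[of "{x<..}" "c + x"] by simp
  also have "(\<integral>y. indicator {x<..} y * (e (c + x - y) * g y) \<partial>lborel)
      = (\<integral>y. indicator {x<..} (x + y) * (e (c + x - (x + y)) * g (x + y)) \<partial>lborel)"
    by (rule integral_shift(2)[symmetric])
  also have "\<dots> = (e \<circledast> G) c"
    unfolding real_convolution_def
  proof (rule integral_cong_AE)
    have "AE y in lborel. y \<noteq> (0::real)" by (rule AE_lborel_singleton)
    then show "AE y in lborel. indicator {x<..} (x + y) * (e (c + x - (x + y)) * g (x + y)) = e (c - y) * G y"
      by eventually_elim (auto simp: G_def indicator_def)
  qed (auto simp: G_def)
  finally show ?thesis using volterra[of x] volterra[of "c + x"] x c by (simp add: G_def add.commute)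
qed

text \<open>Integrate \<open>A c = G c - g x - (e \<circledast> G) c\<close> at
  \<open>c = T - u\<close> against \<open>delta_0\<close> plus \<open>\<rho>\<close>. By the
  resolvent equation the terms with \<open>e\<close> and \<open>\<rho>\<close> cancel and
  \<open>G T = g (x + T)\<close> remains, while the total mass \<open>g T\<close> of the measure
  turns \<open>- g x\<close> into \<open>- g T * g x\<close>, which the first term
  compensates.\<close>

lemma kernel_identity:
  assumes x: "0 \<le> x" and T: "0 < T"
  shows "g T * g x + (\<integral>w. indicator {..0} w * \<kappa> T w * g (w + x) \<partial>lborel)
     + (\<integral>u. indicator {0..<T} u * \<rho> u * (\<integral>w. indicator {..0} w * \<kappa> (T - u) w * g (w + x) \<partial>lborel) \<partial>lborel) = g (x + T)"
proof -
  define G where "G y = indicator {0..} y * g (x + y)" for y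
  let ?\<rho> = "\<lambda>t. indicator {..T} t * \<rho> t"
  note [measurable] = causal_expD(1)[OF causal_exp_e]
  have Gm[measurable]: "G \<in> borel_measurable borel" unfolding G_def[abs_def] by measurable
  obtain B where B: "\<And>u. u \<le> x + T \<Longrightarrow> \<bar>g u\<bar> \<le> B"
    using continuous_on_nonneg_bounded[OF g_cont g_neg, of "x + T"] by blast
  have GB: "\<bar>G (T - z)\<bar> \<le> (B * exp T) * exp (- z)" if "0 \<le> z" for z
  proof (rule causal_locally_bounded_exp[OF _ _ that])
    show "G u = 0" if "u < 0" for u using that by (simp add: G_def)
    show "\<bar>G u\<bar> \<le> B" if "u \<le> T" for u
      using B[of "x + u"] B[of "x + T"] that by (auto simp: G_def indicator_def intro: order_trans[OF abs_ge_zero])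
  qed
  have eGm: "(\<lambda>u. (e \<circledast> G) (T - u)) \<in> borel_measurable borel"
    by (rule measurable_compose[OF _ real_convolution_measurable[OF causal_expD(1)[OF causal_exp_e] Gm]]) simp
  have eRm: "(e \<circledast> ?\<rho>) \<in> borel_measurable borel"
    by (rule real_convolution_measurable[OF causal_expD(1)[OF causal_exp_e] causal_expD(1)[OF causal_exp_\<rho>]])
  have GTm: "(\<lambda>z. G (T - z)) \<in> borel_measurable borel" by measurable
  have A: "(\<integral>w. indicator {..0} w * \<kappa> c w * g (w + x) \<partial>lborel) = G c - g x - (e \<circledast> G) c" if "0 \<le> c" for c
    using \<kappa>_integral[OF x that] by (simp add: G_def[abs_def])
  have Gc: "(e \<circledast> G) (T - u) = (\<integral>z. e z * G (T - (u + z)) \<partial>lborel)" for u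
    unfolding real_convolution_commute[of e] by (simp add: real_convolution_def diff_diff_eq mult.commute)
  have i1: "integrable lborel (\<lambda>u. ?\<rho> u * G (T - u))"
    by (rule causal_exp_mult_integrable(1)[OF causal_exp_\<rho> GTm GB])
  have i2: "integrable lborel (\<lambda>u. ?\<rho> u * (e \<circledast> G) (T - u))"
  proof -
    have "integrable lborel (\<lambda>u. \<integral>t. ?\<rho> u * e (t - u) * G (T - t) \<partial>lborel)"
      using lborel_pair.integrable_fst[OF causal_exp_convolution(1)[OF causal_exp_e causal_exp_\<rho>[of T] GTm GB]] by simp
    moreover have "(\<integral>t. ?\<rho> u * e (t - u) * G (T - t) \<partial>lborel) = ?\<rho> u * (e \<circledast> G) (T - u)" for u
    proof -
      have "(\<integral>t. ?\<rho> u * e (t - u) * G (T - t) \<partial>lborel) = (\<integral>z. ?\<rho> u * (e z * G (T - (u + z))) \<partial>lborel)"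
        using integral_shift(2)[of "\<lambda>t. ?\<rho> u * e (t - u) * G (T - t)" u] by (auto simp: mult.assoc)
      then show ?thesis unfolding Gc by (simp only: integral_mult_right_zero)
    qed
    ultimately show ?thesis by simp
  qed
  \<comment> \<open>Apart from the null set \<open>u = T\<close>, the range
    \<open>0 \<le> u < T\<close> agrees with the cut-off at \<open>T\<close>, as
    \<open>\<rho>\<close> vanishes before 0.\<close>
  have "(\<integral>u. indicator {0..<T} u * \<rho> u * (\<integral>w. indicator {..0} w * \<kappa> (T - u) w * g (w + x) \<partial>lborel) \<partial>lborel)
     = (\<integral>u. ?\<rho> u * G (T - u) - g x * ?\<rho> u - ?\<rho> u * (e \<circledast> G) (T - u) \<partial>lborel)"
  proof (rule integral_cong_AE)
    have "AE u in lborel. u \<noteq> T" by (rule AE_lborel_singleton)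
    then show "AE u in lborel. indicator {0..<T} u * \<rho> u * (\<integral>w. indicator {..0} w * \<kappa> (T - u) w * g (w + x) \<partial>lborel)
       = ?\<rho> u * G (T - u) - g x * ?\<rho> u - ?\<rho> u * (e \<circledast> G) (T - u)"
    proof eventually_elim
      case (elim u)
      show ?case
      proof (cases "0 \<le> u \<and> u < T")
        case True
        have "T - u \<ge> 0" using True by simp
        from A[OF this] show ?thesis using True by (simp add: right_diff_distrib)
      next
        case False
        then have z: "indicator {0..<T} u * \<rho> u = 0" "?\<rho> u = 0" using elim \<rho>_neg[of u] by (auto simp: indicator_def)
        show ?thesis unfolding z by simp
      qed
    qed
    have "(\<lambda>c. \<integral>w. indicator {..0} w * \<kappa> c w * g (w + x) \<partial>lborel) \<in> borel_measurable borel" by measurable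
    from measurable_compose[OF _ this, of "\<lambda>u. T - u" borel]
    show "(\<lambda>u. indicator {0..<T} u * \<rho> u * (\<integral>w. indicator {..0} w * \<kappa> (T - u) w * g (w
        + x) \<partial>lborel)) \<in> borel_measurable lborel"
      by simp
    show "(\<lambda>u. ?\<rho> u * G (T - u) - g x * ?\<rho> u - ?\<rho> u * (e \<circledast> G) (T - u)) \<in> borel_measurable lborel"
      using eGm by simp
  qed
  also have "\<dots> = (\<integral>u. ?\<rho> u * G (T - u) \<partial>lborel) - g x * (g T - 1) - (\<integral>u. ?\<rho> u * (e \<circledast> G) (T - u) \<partial>lborel)"
    using i1 i2 integrable_\<rho>[of T] \<rho>_primitive[of T] T by simp
  also have "(\<integral>u. ?\<rho> u * (e \<circledast> G) (T - u) \<partial>lborel) = (\<integral>t. (e \<circledast> ?\<rho>) t * G (T - t) \<partial>lborel)"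
    unfolding Gc by (rule causal_exp_convolution(3)[OF causal_exp_e causal_exp_\<rho> GTm GB])
  finally have S: "(\<integral>u. indicator {0..<T} u * \<rho> u * (\<integral>w. indicator {..0} w * \<kappa> (T - u) w * g (w + x) \<partial>lborel) \<partial>lborel)
     = (\<integral>u. ?\<rho> u * G (T - u) \<partial>lborel) - g x * (g T - 1) - (\<integral>t. (e \<circledast> ?\<rho>) t * G (T - t) \<partial>lborel)" .
  have i3: "integrable lborel (\<lambda>t. (e \<circledast> ?\<rho>) t * G (T - t))"
    by (rule causal_exp_mult_integrable(1)[OF causal_exp_real_convolution[OF causal_exp_e causal_exp_\<rho>] GTm GB])
  have i4: "integrable lborel (\<lambda>t. e t * G (T - t))"
    by (rule causal_exp_mult_integrable(1)[OF causal_exp_e GTm GB])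
  have "(\<integral>u. ?\<rho> u * G (T - u) \<partial>lborel) = (\<integral>t. e t * G (T - t) + (e \<circledast> ?\<rho>) t * G (T - t) \<partial>lborel)"
  proof (rule integral_cong_AE)
    show "AE u in lborel. ?\<rho> u * G (T - u) = e u * G (T - u) + (e \<circledast> ?\<rho>) u * G (T - u)"
      using resolvent_equation[of T]
    proof eventually_elim
      case (elim u)
      show ?case
      proof (cases "u \<le> T")
        case True
        then have "?\<rho> u = e u + (e \<circledast> ?\<rho>) u" using elim by simp
        then show ?thesis by (simp only: distrib_right)
      qed (simp add: G_def)
    qed
  qed (use eRm in simp_all)
  also have "\<dots> = (\<integral>t. e t * G (T - t) \<partial>lborel) + (\<integral>t. (e \<circledast> ?\<rho>) t * G (T - t) \<partial>lborel)"
    using i3 i4 by simp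
  also have "(\<integral>t. e t * G (T - t) \<partial>lborel) = (e \<circledast> G) T" using Gc[of 0] by simp
  finally show ?thesis
    unfolding S using A[of T] T by (simp add: G_def algebra_simps)
qed

text \<open>Everything that multiplies \<open>X\<close> at time \<open>s + w\<close>, collected by
  exchanging the integrals over \<open>u\<close> and \<open>w\<close>. The double integral of the
  formula becomes a single mixture of past values of \<open>X\<close>.\<close>

definition prediction_kernel :: "real \<Rightarrow> real \<Rightarrow> real" where
  "prediction_kernel T w = indicator {..0} w * \<kappa> T w
     + (\<integral>u. indicator {0..<T} u * \<rho> u * (indicator {..0} w * \<kappa> (T - u) w) \<partial>lborel)"

text \<open>The norm in mean of \<open>\<kappa> (T - u)\<close> is bounded uniformly in
  \<open>u\<close>, so local integrability of \<open>\<rho>\<close> is enough.\<close>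

lemma prediction_kernel_pair_integrable:
  "integrable (lborel \<Otimes>\<^sub>M lborel) (\<lambda>(u, w). indicator {0..<T} u * \<rho> u * (indicator {..0} w * \<kappa> (T - u) w))"
  unfolding integrable_iff_bounded
proof
  obtain C where C: "\<And>c. 0 \<le> c \<Longrightarrow> c \<le> T \<Longrightarrow> (\<integral>\<^sup>+w. ennreal \<bar>\<kappa> c w\<bar> \<partial>lborel) \<le> ennreal C"
    using \<kappa>_L1 by blast
  have "(\<integral>\<^sup>+p. ennreal (norm (case p of (u, w) \<Rightarrow> indicator {0..<T} u * \<rho> u * (indicator {..0} w * \<kappa> (T
      - u) w))) \<partial>(lborel \<Otimes>\<^sub>M lborel))
     = (\<integral>\<^sup>+u. (\<integral>\<^sup>+w. ennreal \<bar>indicator {0..<T} u * \<rho> u * (indicator {..0} w * \<kappa> (T - u) w)\<bar> \<partial>lborel) \<partial>lborel)"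
    by (subst lborel.nn_integral_fst[symmetric]) auto
  also have "\<dots> \<le> (\<integral>\<^sup>+u. ennreal \<bar>indicator {..T} u * \<rho> u\<bar> * ennreal C \<partial>lborel)"
  proof (rule nn_integral_mono)
    fix u
    show "(\<integral>\<^sup>+w. ennreal \<bar>indicator {0..<T} u * \<rho> u * (indicator {..0} w * \<kappa> (T - u) w)\<bar> \<partial>lborel)
       \<le> ennreal \<bar>indicator {..T} u * \<rho> u\<bar> * ennreal C"
    proof (cases "0 \<le> u \<and> u < T")
      case True
      have "(\<integral>\<^sup>+w. ennreal \<bar>indicator {0..<T} u * \<rho> u * (indicator {..0} w * \<kappa> (T - u) w)\<bar> \<partial>lborel)
         \<le> (\<integral>\<^sup>+w. ennreal \<bar>\<rho> u\<bar> * ennreal \<bar>\<kappa> (T - u) w\<bar> \<partial>lborel)"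
        by (intro nn_integral_mono) (auto simp: abs_mult indicator_def ennreal_mult)
      also have "\<dots> = ennreal \<bar>\<rho> u\<bar> * (\<integral>\<^sup>+w. ennreal \<bar>\<kappa> (T - u) w\<bar> \<partial>lborel)"
        by (rule nn_integral_cmult) measurable
      also have "\<dots> \<le> ennreal \<bar>\<rho> u\<bar> * ennreal C" using True by (intro mult_left_mono C) auto
      finally show ?thesis using True by simp
    qed (auto simp: indicator_def)
  qed
  also have "\<dots> = (\<integral>\<^sup>+u. ennreal \<bar>indicator {..T} u * \<rho> u\<bar> \<partial>lborel) * ennreal C"
    by (rule nn_integral_multc) measurable
  also have "\<dots> < \<infinity>"
    using integrable_\<rho>[of T] by (simp add: integrable_iff_bounded ennreal_mult_less_top)
  finally show "(\<integral>\<^sup>+p. ennreal (norm (case p of (u, w) \<Rightarrow> indicator {0..<T} u * \<rho> u * (indicator {..0} w * \<kappa> (T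
      - u) w))) \<partial>(lborel \<Otimes>\<^sub>M lborel)) < \<infinity>" .
qed measurable

lemma \<kappa>_integrable: "0 \<le> T \<Longrightarrow> integrable lborel (\<lambda>w. indicator {..0} w * \<kappa> T w)"
proof -
  assume T: "0 \<le> T"
  obtain C where "(\<integral>\<^sup>+w. ennreal \<bar>\<kappa> T w\<bar> \<partial>lborel) \<le> ennreal C"
    using \<kappa>_L1[of T] T by blast
  then have "integrable lborel (\<kappa> T)"
    by (auto simp: integrable_iff_bounded intro: order_le_less_trans)
  then show ?thesis using integrable_real_mult_indicator[of "{..0}" lborel "\<kappa> T"] by (simp add: mult.commute)
qed

lemma prediction_kernel_integrable: "0 \<le> T \<Longrightarrow> integrable lborel (prediction_kernel T)"
  unfolding prediction_kernel_def
  using lborel_pair.integrable_snd[OF prediction_kernel_pair_integrable[of T]]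
  by (intro Bochner_Integration.integrable_add \<kappa>_integrable) auto

end

section \<open>L\'evy processes with finite variance\<close>

lemma (in prob_space) indep_var_commute:
  assumes "indep_var A X B Y" shows "indep_var B Y A X"
proof -
  have "indep_set T S" if S: "indep_set S T" for S T
    unfolding indep_sets2_eq
  proof (intro conjI ballI)
    fix x y assume "x \<in> T" "y \<in> S"
    then have "prob (y \<inter> x) = prob y * prob x" using S unfolding indep_sets2_eq by simp
    then show "prob (x \<inter> y) = prob x * prob y" by (simp only: Int_commute mult.commute)
  qed (use S in \<open>simp_all add: indep_sets2_eq\<close>)
  then show ?thesis using assms by (simp add: indep_var_eq)
qed

text \<open>On the product of the two laws, Fubini gives a value \<open>y\<close> for which
  \<open>X + y\<close> has a finite second moment; subtracting this constant recovers
  \<open>X\<close>.\<close>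

lemma (in prob_space) indep_var_square_integrable:
  fixes X Y :: "'a \<Rightarrow> real"
  assumes ind: "indep_var borel X borel Y" and sq: "square_integrable M (\<lambda>\<omega>. X \<omega> + Y \<omega>)"
  shows "square_integrable M X"
proof -
  have [measurable]: "X \<in> borel_measurable M" "Y \<in> borel_measurable M"
    using indep_var_rv1[OF ind] indep_var_rv2[OF ind] by auto
  interpret DX: prob_space "distr M borel X" by (rule prob_space_distr) simp
  interpret DY: prob_space "distr M borel Y" by (rule prob_space_distr) simp
  interpret D: pair_sigma_finite "distr M borel X" "distr M borel Y" ..
  have "(\<integral>\<^sup>+y. (\<integral>\<^sup>+x. ennreal ((x + y)\<^sup>2) \<partial>distr M borel X) \<partial>distr M borel Y)
     = (\<integral>\<^sup>+(x, y). ennreal ((x + y)\<^sup>2) \<partial>(distr M borel X \<Otimes>\<^sub>M distr M borel Y))"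
    using D.nn_integral_snd[of "\<lambda>(x, y). ennreal ((x + y)\<^sup>2)"] by simp
  also have "distr M borel X \<Otimes>\<^sub>M distr M borel Y = distr M (borel \<Otimes>\<^sub>M borel) (\<lambda>\<omega>. (X \<omega>, Y \<omega>))"
    using ind by (simp add: indep_var_distribution_eq)
  also have "(\<integral>\<^sup>+(x, y). ennreal ((x + y)\<^sup>2) \<partial>\<dots>) = (\<integral>\<^sup>+\<omega>. ennreal ((X \<omega> + Y \<omega>)\<^sup>2) \<partial>M)"
    by (subst nn_integral_distr) auto
  also have "\<dots> < \<infinity>"
    using sq by (simp add: square_integrable_def integrable_iff_bounded)
  finally have fin: "(\<integral>\<^sup>+y. (\<integral>\<^sup>+x. ennreal ((x + y)\<^sup>2) \<partial>distr M borel X) \<partial>distr M borel Y) < \<infinity>" .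
  have "AE y in distr M borel Y. (\<integral>\<^sup>+x. ennreal ((x + y)\<^sup>2) \<partial>distr M borel X) \<noteq> \<infinity>"
    using fin by (intro nn_integral_PInf_AE) auto
  then obtain y where y: "(\<integral>\<^sup>+x. ennreal ((x + y)\<^sup>2) \<partial>distr M borel X) \<noteq> \<infinity>"
    using DY.AE_E_prob by (metis (mono_tags, lifting) DY.AE_False eventually_mono)
  then have y': "(\<integral>\<^sup>+\<omega>. ennreal ((X \<omega> + y)\<^sup>2) \<partial>M) < \<infinity>"
    by (subst (asm) nn_integral_distr) (auto simp: less_top)
  have "square_integrable M (\<lambda>\<omega>. X \<omega> + y)"
    unfolding square_integrable_def integrable_iff_bounded using y' by simp
  moreover have "square_integrable M (\<lambda>\<omega>. y)" by (simp add: square_integrable_def)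
  ultimately have "square_integrable M (\<lambda>\<omega>. (X \<omega> + y) - y)" by (rule square_integrable_diff)
  then show ?thesis by simp
qed

lemma (in finite_measure) square_integrable_integrable:
  fixes X :: "'a \<Rightarrow> real"
  assumes "square_integrable M X" shows "integrable M X"
proof -
  have "square_integrable M (\<lambda>_. 1 :: real)" by (simp add: square_integrable_def)
  from square_integrable_mult[OF assms this] show ?thesis by simp
qed

lemma square_integrable_distr_cong:
  fixes X Y :: "'a \<Rightarrow> real"
  assumes "distr M borel X = distr M borel Y" and [measurable]: "X \<in> borel_measurable M" "Y \<in> borel_measurable M"
  shows "square_integrable M X \<longleftrightarrow> square_integrable M Y"
    and "(\<integral>\<omega>. X \<omega> \<partial>M) = (\<integral>\<omega>. Y \<omega> \<partial>M)" and "(\<integral>\<omega>. (X \<omega>)\<^sup>2 \<partial>M) = (\<integral>\<omega>. (Y \<omega>)\<^sup>2 \<partial>M)"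
proof -
  have "integrable (distr M borel Z) (\<lambda>x. (norm x)\<^sup>2) \<longleftrightarrow> integrable M (\<lambda>\<omega>. (norm (Z \<omega>))\<^sup>2)"
      if [measurable]: "Z \<in> borel_measurable M" for Z :: "'a \<Rightarrow> real"
    by (rule integrable_distr_eq) auto
  from this[of X] this[of Y] show "square_integrable M X \<longleftrightarrow> square_integrable M Y"
    using assms by (simp add: square_integrable_def)
  have "(\<integral>x. h x \<partial>distr M borel Z) = (\<integral>\<omega>. h (Z \<omega>) \<partial>M)" if [measurable]: "Z \<in> borel_measurable M" "h \<in>
      borel_measurable borel" for Z and h :: "real \<Rightarrow> real"
    by (rule integral_distr) auto
  from this[of X "\<lambda>x. x"] this[of Y "\<lambda>x. x"] this[of X "\<lambda>x. x\<^sup>2"] this[of Y "\<lambda>x. x\<^sup>2"]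
  show "(\<integral>\<omega>. X \<omega> \<partial>M) = (\<integral>\<omega>. Y \<omega> \<partial>M)" "(\<integral>\<omega>. (X \<omega>)\<^sup>2 \<partial>M) = (\<integral>\<omega>. (Y \<omega>)\<^sup>2 \<partial>M)"
    using assms by simp_all
qed

text \<open>Subtracting \<open>t f(1)\<close> leaves an additive, 1-periodic, hence bounded and therefore zero function.\<close>

lemma additive_bounded_linear:
  fixes f :: "real \<Rightarrow> real"
  assumes add: "\<And>s t. 0 \<le> s \<Longrightarrow> 0 \<le> t \<Longrightarrow> f (s + t) = f s + f t"
    and bd: "\<And>t. 0 \<le> t \<Longrightarrow> t \<le> 1 \<Longrightarrow> \<bar>f t\<bar> \<le> C" and t: "0 \<le> t"
  shows "f t = t * f 1"
proof -
  define h where "h t = f t - t * f 1" for t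
  have hadd: "h (s + t) = h s + h t" if "0 \<le> s" "0 \<le> t" for s t
    using add[OF that] by (simp add: h_def algebra_simps)
  have mult: "h (real n * s) = real n * h s" if "0 \<le> s" for n s
  proof (induction n)
    case 0 then show ?case using hadd[of 0 0] by simp
  next
    case (Suc n) then show ?case using hadd[of "real n * s" s] that by (simp add: algebra_simps)
  qed
  have h1: "h (real n) = 0" for n using mult[of 1 n] by (simp add: h_def)
  define K where "K = C + \<bar>f 1\<bar>"
  have hb: "\<bar>h s\<bar> \<le> K" if s: "0 \<le> s" for s
  proof -
    define r where "r = s - real (nat \<lfloor>s\<rfloor>)"
    have r: "0 \<le> r" "r \<le> 1" using s by (auto simp: r_def) linarith
    have "real (nat \<lfloor>s\<rfloor>) + r = s" by (simp add: r_def)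
    then have "h s = h (real (nat \<lfloor>s\<rfloor>)) + h r" using hadd[of "real (nat \<lfloor>s\<rfloor>)" r] r(1)
        by (simp only: of_nat_0_le_iff simp_thms)
    then have "h s = h r" by (simp only: h1 add_0)
    moreover have "\<bar>r * f 1\<bar> \<le> \<bar>f 1\<bar>" using r by (simp add: abs_mult mult_left_le_one_le)
    ultimately show ?thesis using bd[OF r] abs_triangle_ineq4[of "f r" "r * f 1"] by (simp add: h_def K_def)
  qed
  have "\<bar>h t\<bar> \<le> 0"
  proof (rule ccontr)
    assume "\<not> ?thesis"
    then have p: "0 < \<bar>h t\<bar>" by simp
    then obtain n where n: "K < real n * \<bar>h t\<bar>" using reals_Archimedean3 by blast
    have "real n * \<bar>h t\<bar> = \<bar>h (real n * t)\<bar>" by (simp add: mult[OF t] abs_mult)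
    also have "\<dots> \<le> K" using t by (intro hb) simp
    finally show False using n by simp
  qed
  then show ?thesis by (simp add: h_def)
qed

section \<open>Independence and moments of increments\<close>

context prob_space
begin

lemma levy_process_measurable: "levy_process M Z \<Longrightarrow> 0 \<le> t \<Longrightarrow> Z t \<in> borel_measurable M"
  by (simp add: levy_process_def)

lemma levy_increment_indep_grid:
  assumes Z: "levy_process M Z" and t: "0 \<le> t 0" "\<And>i. i < n \<Longrightarrow> t i \<le> t (Suc i)" and k: "k < n"
    and F: "F \<in> borel_measurable (PiM ({..<n} - {k}) (\<lambda>_. borel))"
  shows "indep_var borel (\<lambda>\<omega>. Z (t (Suc k)) \<omega> - Z (t k) \<omega>)
    borel (\<lambda>\<omega>. F (\<lambda>i\<in>{..<n} - {k}. Z (t (Suc i)) \<omega> - Z (t i) \<omega>) :: real)"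
proof -
  have "indep_vars (\<lambda>_. borel) (\<lambda>i \<omega>. Z (t (Suc i)) \<omega> - Z (t i) \<omega>) {..<n}"
    using Z t unfolding levy_process_def by blast
  then have "indep_var (PiM {k} (\<lambda>_. borel)) (\<lambda>\<omega>. restrict (\<lambda>i. Z (t (Suc i)) \<omega> - Z (t i) \<omega>) {k})
     (PiM ({..<n} - {k}) (\<lambda>_. borel)) (\<lambda>\<omega>. restrict (\<lambda>i. Z (t (Suc i)) \<omega> - Z (t i) \<omega>) ({..<n} - {k}))"
    by (rule indep_var_restrict) (use k in auto)
  from indep_var_compose[OF this _ F, of "\<lambda>x. x k" borel]
  show ?thesis by (simp add: comp_def)
qed

text \<open>Adding \<open>a\<close> and \<open>b\<close> to the points of \<open>J\<close> gives a
  time grid in which \<open>(a, b]\<close> is a single cell, because \<open>J\<close> lies entirely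
  on one side. Each \<open>Z j - Z p\<close> is then a difference of sums over other cells, and
  independence of the cells applies.\<close>

lemma levy_increment_indep:
  assumes Z: "levy_process M Z" and ab: "0 \<le> a" "a \<le> b" and J: "finite J" "p \<in> J"
    and side: "J \<subseteq> {0..a} \<or> J \<subseteq> {b..}" and F: "F \<in> borel_measurable (PiM J (\<lambda>_. borel))"
  shows "indep_var borel (\<lambda>\<omega>. Z b \<omega> - Z a \<omega>) borel (\<lambda>\<omega>. F (\<lambda>j\<in>J. Z j \<omega> - Z p \<omega>) :: real)"
proof -
  \<comment> \<open>The end of the interval that faces \<open>J\<close>: once it belongs to the
    sorted list, attaching the other end makes \<open>a\<close> and \<open>b\<close>
    neighbours.\<close>
  define c where "c = (if J \<subseteq> {0..a} then a else b)"
  define ys where "ys = sorted_list_of_set (insert c J)"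
  have ys: "sorted ys" "set ys = insert c J"
    using J sorted_sorted_list_of_set[of "insert c J"] set_sorted_list_of_set[of "insert c J"]
    unfolding ys_def by (simp_all del: sorted_list_of_set_insert_remove)
  define xs where "xs = (if J \<subseteq> {0..a} then ys @ [b] else a # ys)"
  define k where "k = (if J \<subseteq> {0..a} then length ys - 1 else 0)"
  define n where "n = length xs - 1"
  have len: "length xs = Suc (length ys)" "0 < length ys" "n = length ys"
    using ys(2) by (auto simp: xs_def n_def)
  have sorted: "sorted xs"
    using ys side ab by (auto simp: xs_def c_def sorted_append split: if_splits)
  have k: "k < n" using len by (auto simp: k_def)
  have nonneg: "0 \<le> xs ! 0"
  proof -
    have "xs ! 0 \<in> set xs" using len by (intro nth_mem) simp
    moreover have "set xs \<subseteq> {0..}" using ys side ab by (auto simp: xs_def c_def split: if_splits)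
    ultimately show ?thesis by auto
  qed
  have xk: "xs ! k = a" "xs ! Suc k = b"
  proof -
    have "xs ! k = a \<and> xs ! Suc k = b"
    proof (cases "J \<subseteq> {0..a}")
      case True
      have "last ys = a"
      proof (rule antisym)
        have "last ys \<in> set ys" using len by (intro last_in_set) auto
        then show "last ys \<le> a" using ys True by (auto simp: c_def)
        have "a \<in> set ys" using ys True by (simp add: c_def)
        then show "a \<le> last ys" using ys(1) sorted_nth_mono[of ys]
          by (metis One_nat_def Suc_pred diff_Suc_less diff_le_self in_set_conv_nth last_conv_nth len(2)
              length_greater_0_conv less_Suc_eq_le)
      qed
      then show ?thesis using True len(2) by (auto simp: xs_def k_def nth_append last_conv_nth)
    next
      case False
      then have Jb: "J \<subseteq> {b..}" using side by blast
      have "ys ! 0 = b"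
      proof (rule antisym)
        have "ys ! 0 \<in> set ys" using len by (intro nth_mem) auto
        then show "b \<le> ys ! 0" using ys False Jb by (auto simp: c_def)
        have "b \<in> set ys" using ys False by (simp add: c_def)
        then show "ys ! 0 \<le> b" using ys(1) by (metis in_set_conv_nth sorted_nth_mono zero_le)
      qed
      then show ?thesis using False by (simp add: xs_def k_def)
    qed
    then show "xs ! k = a" "xs ! Suc k = b" by auto
  qed
  \<comment> \<open>Position in \<open>xs\<close> at which \<open>ys\<close> begins: 1 if
    \<open>a\<close> was put in front, 0 if \<open>b\<close> was appended. Sums starting here never
    meet the cell \<open>k\<close>.\<close>
  define m where "m = (if J \<subseteq> {0..a} then 0 else 1 :: nat)"
  have idx: "\<exists>i. m \<le> i \<and> i < m + length ys \<and> xs ! i = j" if "j \<in> J" for j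
  proof -
    have "j \<in> set ys" using ys(2) that by simp
    then obtain l where "l < length ys" "ys ! l = j" by (auto simp: in_set_conv_nth)
    then show ?thesis by (intro exI[of _ "m + l"]) (auto simp: m_def xs_def nth_append)
  qed
  define ix where "ix j = (SOME i. m \<le> i \<and> i < m + length ys \<and> xs ! i = j)" for j
  have ix: "m \<le> ix j \<and> ix j < m + length ys \<and> xs ! ix j = j" if "j \<in> J" for j
    unfolding ix_def by (rule someI_ex[OF idx[OF that]])
  have tel: "(\<Sum>l\<in>{m..<i}. Z (xs ! Suc l) \<omega> - Z (xs ! l) \<omega>) = Z (xs ! i) \<omega> - Z (xs ! m) \<omega>" if "m \<le> i" for i \<omega>
    using sum_Suc_diff'[OF that, of "\<lambda>l. Z (xs ! l) \<omega>"] by simp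
  have sub: "{m..<ix j} \<subseteq> {..<n} - {k}" if "j \<in> J" for j
    using ix[OF that] len(3) by (auto simp: m_def k_def split: if_splits)
  \<comment> \<open>Recovers the differences \<open>Z j - Z p\<close> from the grid increments, with
    the common starting value cancelling.\<close>
  define \<Psi> where "\<Psi> x = (\<lambda>j\<in>J. (\<Sum>l\<in>{m..<ix j}. x l) - (\<Sum>l\<in>{m..<ix p}. x l) :: real)" for x :: "nat \<Rightarrow> real"
  have [measurable]: "\<Psi> \<in> PiM ({..<n} - {k}) (\<lambda>_. borel) \<rightarrow>\<^sub>M PiM J (\<lambda>_. borel)"
    unfolding \<Psi>_def
  proof (rule measurable_restrict)
    fix j assume j: "j \<in> J"
    have c: "(\<lambda>x. x l) \<in> borel_measurable (PiM ({..<n} - {k}) (\<lambda>_. borel :: real measure))"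
        if "l \<in> {m..<ix j'}" "j' \<in> J" for l j'
      using sub[OF that(2)] that(1) by (intro measurable_component_singleton) auto
    show "(\<lambda>x. (\<Sum>l\<in>{m..<ix j}. x l) - (\<Sum>l\<in>{m..<ix p}. x l)) \<in> borel_measurable (PiM ({..<n}
        - {k}) (\<lambda>_. borel :: real measure))"
      by (intro borel_measurable_diff borel_measurable_sum c[OF _ j] c[OF _ J(2)])
  qed
  have "indep_var borel (\<lambda>\<omega>. Z (xs ! Suc k) \<omega> - Z (xs ! k) \<omega>)
    borel (\<lambda>\<omega>. F (\<Psi> (\<lambda>i\<in>{..<n} - {k}. Z (xs ! Suc i) \<omega> - Z (xs ! i) \<omega>)))"
  proof (rule levy_increment_indep_grid[of Z "\<lambda>i. xs ! i" n k "\<lambda>x. F (\<Psi> x)", OF Z nonneg _ k])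
    show "xs ! i \<le> xs ! Suc i" if "i < n" for i
      using sorted len that by (intro sorted_nth_mono) auto
    show "(\<lambda>x. F (\<Psi> x)) \<in> borel_measurable (PiM ({..<n} - {k}) (\<lambda>_. borel))"
      by (rule measurable_compose[OF _ F]) measurable
  qed
  moreover have "\<Psi> (\<lambda>i\<in>{..<n} - {k}. Z (xs ! Suc i) \<omega> - Z (xs ! i) \<omega>) = (\<lambda>j\<in>J. Z j \<omega> - Z p \<omega>)" for \<omega>
  proof -
    have s: "(\<Sum>l\<in>{m..<ix j}. (\<lambda>i\<in>{..<n} - {k}. Z (xs ! Suc i) \<omega> - Z (xs ! i) \<omega>) l) = Z j \<omega> - Z (xs ! m) \<omega>"
        if "j \<in> J" for j
    proof -
      have "(\<Sum>l\<in>{m..<ix j}. (\<lambda>i\<in>{..<n} - {k}. Z (xs ! Suc i) \<omega> - Z (xs ! i) \<omega>) l)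
          = (\<Sum>l\<in>{m..<ix j}. Z (xs ! Suc l) \<omega> - Z (xs ! l) \<omega>)"
        using sub[OF that] by (intro sum.cong) auto
      then show ?thesis using tel[of "ix j" \<omega>] ix[OF that] by simp
    qed
    show ?thesis
      unfolding \<Psi>_def
    proof (rule restrict_ext)
      fix j assume "j \<in> J"
      from s[OF this] s[OF J(2)]
      show "(\<Sum>l\<in>{m..<ix j}. (\<lambda>i\<in>{..<n} - {k}. Z (xs ! Suc i) \<omega> - Z (xs ! i) \<omega>) l)
          - (\<Sum>l\<in>{m..<ix p}. (\<lambda>i\<in>{..<n} - {k}. Z (xs ! Suc i) \<omega> - Z (xs ! i) \<omega>) l) = Z j \<omega> - Z p \<omega>"
        by linarith
    qed
  qed
  ultimately show ?thesis by (simp add: xk)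
qed

text \<open>\<open>Z 0\<close> is subtracted because it vanishes only almost surely.\<close>

lemma levy_indep_past:
  assumes Z: "levy_process M Z" and ab: "0 \<le> a" "a \<le> b"
  shows "indep_var borel (\<lambda>\<omega>. Z a \<omega> - Z 0 \<omega>) borel (\<lambda>\<omega>. Z b \<omega> - Z a \<omega>)"
proof -
  have m: "(\<lambda>x. x a) \<in> borel_measurable (PiM {0, a} (\<lambda>_. borel :: real measure))"
    by (rule measurable_component_singleton) simp
  have "indep_var borel (\<lambda>\<omega>. Z b \<omega> - Z a \<omega>) borel (\<lambda>\<omega>. (\<lambda>j\<in>{0, a}. Z j \<omega> - Z 0 \<omega>) a)"
    by (rule levy_increment_indep[OF Z ab, of "{0, a}" 0 "\<lambda>x. x a"]) (use ab m in auto)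
  then have "indep_var borel (\<lambda>\<omega>. Z b \<omega> - Z a \<omega>) borel (\<lambda>\<omega>. Z a \<omega> - Z 0 \<omega>)" by simp
  then show ?thesis by (rule indep_var_commute)
qed

lemma levy_0: "levy_process M Z \<Longrightarrow> AE \<omega> in M. Z 0 \<omega> = 0"
  by (simp add: levy_process_def)

lemma levy_paths:
  "levy_process M Z \<Longrightarrow> AE \<omega> in M. (\<forall>t\<ge>0. ((\<lambda>r. Z r \<omega>) \<longlongrightarrow> Z t \<omega>) (at_right t)) \<and>
     (\<forall>t>0. \<exists>l. ((\<lambda>r. Z r \<omega>) \<longlongrightarrow> l) (at_left t))"
  unfolding levy_process_def by (elim conjE)

lemma levy_distr: "levy_process M Z \<Longrightarrow> 0 \<le> s \<Longrightarrow> 0 \<le> r \<Longrightarrow> distr M borel (\<lambda>\<omega>. Z (s + r) \<omega> - Z s \<omega>) = distr M borel (Z r)"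
  by (simp add: levy_process_def)

lemma square_integrable_cong_AE:
  fixes X Y :: "'a \<Rightarrow> real"
  assumes "X \<in> borel_measurable M" "Y \<in> borel_measurable M" "AE \<omega> in M. X \<omega> = Y \<omega>" "square_integrable M X"
  shows "square_integrable M Y"
proof -
  have "integrable M (\<lambda>\<omega>. (norm (X \<omega>))\<^sup>2) \<longleftrightarrow> integrable M (\<lambda>\<omega>. (norm (Y \<omega>))\<^sup>2)"
    using assms by (intro Bochner_Integration.integrable_cong_AE) auto
  then show ?thesis using assms by (simp add: square_integrable_def)
qed

text \<open>Integer times follow by adding unit increments. At an earlier time \<open>t\<close>, the
  variable is one summand of an independent sum that is already square integrable.\<close>

lemma levy_square_integrable:
  assumes Z: "levy_process M Z" and Z1: "square_integrable M (Z 1)" and t: "0 \<le> t"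
  shows "square_integrable M (Z t)"
proof -
  note m = levy_process_measurable[OF Z]
  have N: "square_integrable M (\<lambda>\<omega>. Z (real n) \<omega> - Z 0 \<omega>)" for n
  proof (induction n)
    case (Suc n)
    have "square_integrable M (\<lambda>\<omega>. Z (real n + 1) \<omega> - Z (real n) \<omega>)"
      using square_integrable_distr_cong(1)[OF levy_distr[OF Z, of "real n" 1]] Z1 m by simp
    from square_integrable_add[OF this Suc] show ?case by (simp add: add.commute)
  qed simp
  obtain n where n: "t \<le> real n" using real_arch_simple by blast
  have "square_integrable M (\<lambda>\<omega>. (Z t \<omega> - Z 0 \<omega>) + (Z (real n) \<omega> - Z t \<omega>))" using N[of n] by simp
  from indep_var_square_integrable[OF levy_indep_past[OF Z t n] this]
  show ?thesis
    by (rule square_integrable_cong_AE[rotated -1]) (use m t levy_0[OF Z] in auto)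
qed

text \<open>Stationarity and independence make mean and variance additive in time. The variance is
  nonnegative, hence monotone and bounded on the unit interval, hence linear. The mean has no sign,
  so its boundedness near 0 is extracted from right-continuity of the paths.\<close>

lemma levy_moments:
  assumes Z: "levy_process M Z" and Z1: "square_integrable M (Z 1)"
    and mean: "(\<integral>\<omega>. Z 1 \<omega> \<partial>M) = 0" and var: "(\<integral>\<omega>. (Z 1 \<omega>)\<^sup>2 \<partial>M) = 1" and t: "0 \<le> t"
  shows "(\<integral>\<omega>. Z t \<omega> \<partial>M) = 0" and "(\<integral>\<omega>. (Z t \<omega>)\<^sup>2 \<partial>M) = t"
proof -
  note m = levy_process_measurable[OF Z] and sq = levy_square_integrable[OF Z Z1]
  note int = square_integrable_integrable[OF sq]
  have sq2: "integrable M (\<lambda>\<omega>. (Z t \<omega>)\<^sup>2)" if "0 \<le> t" for t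
    using sq[OF that] by (simp add: square_integrable_def)
  define f where "f t = (\<integral>\<omega>. Z t \<omega> \<partial>M)" for t
  define V where "V t = (\<integral>\<omega>. (Z t \<omega>)\<^sup>2 \<partial>M) - (f t)\<^sup>2" for t
  have inc: "square_integrable M (\<lambda>\<omega>. Z (s + r) \<omega> - Z s \<omega>)" "(\<integral>\<omega>. Z (s + r) \<omega> - Z s \<omega> \<partial>M) = f r"
    "(\<integral>\<omega>. (Z (s + r) \<omega> - Z s \<omega>)\<^sup>2 \<partial>M) = (\<integral>\<omega>. (Z r \<omega>)\<^sup>2 \<partial>M)" if "0 \<le> s" "0 \<le> r" for s r
    using square_integrable_distr_cong[OF levy_distr[OF Z that]] sq[of r] m that by (auto simp: f_def)
  have fadd: "f (s + r) = f s + f r" if "0 \<le> s" "0 \<le> r" for s r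
    using inc(2)[OF that] int[of s] int[of "s + r"] that by (simp add: f_def)
  have cross: "(\<integral>\<omega>. Z s \<omega> * (Z (s + r) \<omega> - Z s \<omega>) \<partial>M) = f s * f r" if "0 \<le> s" "0 \<le> r" for s r
  proof -
    have "(\<integral>\<omega>. Z s \<omega> * (Z (s + r) \<omega> - Z s \<omega>) \<partial>M) = (\<integral>\<omega>. (Z s \<omega> - Z 0 \<omega>) * (Z (s + r) \<omega> - Z s \<omega>) \<partial>M)"
      using levy_0[OF Z] m that by (intro integral_cong_AE) auto
    also have "\<dots> = (\<integral>\<omega>. Z s \<omega> - Z 0 \<omega> \<partial>M) * (\<integral>\<omega>. Z (s + r) \<omega> - Z s \<omega> \<partial>M)"
      using that int by (intro indep_var_lebesgue_integral levy_indep_past[OF Z]) auto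
    also have "(\<integral>\<omega>. Z s \<omega> - Z 0 \<omega> \<partial>M) = f s"
      unfolding f_def using levy_0[OF Z] m that by (intro integral_cong_AE) auto
    finally show ?thesis using inc(2)[OF that] by simp
  qed
  have V: "V (s + r) = V s + V r" if "0 \<le> s" "0 \<le> r" for s r
  proof -
    have "(Z (s + r) \<omega>)\<^sup>2 = (Z s \<omega>)\<^sup>2 + 2 * (Z s \<omega> * (Z (s + r) \<omega> - Z s \<omega>)) + (Z (s + r) \<omega> - Z s \<omega>)\<^sup>2" for \<omega>
      by (simp add: power2_eq_square algebra_simps)
    moreover have "integrable M (\<lambda>\<omega>. Z s \<omega> * (Z (s + r) \<omega> - Z s \<omega>))"
      by (rule square_integrable_mult[OF sq inc(1)]) (use that in auto)
    moreover have "integrable M (\<lambda>\<omega>. (Z (s + r) \<omega> - Z s \<omega>)\<^sup>2)"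
      using inc(1)[OF that] by (simp add: square_integrable_def)
    ultimately have "(\<integral>\<omega>. (Z (s + r) \<omega>)\<^sup>2 \<partial>M) = (\<integral>\<omega>. (Z s \<omega>)\<^sup>2 \<partial>M) + 2 * (f s * f r) + (\<integral>\<omega>. (Z r \<omega>)\<^sup>2 \<partial>M)"
      using sq2[of s] cross[OF that] inc(3)[OF that] that by simp
    then show ?thesis using fadd[OF that] by (simp add: V_def power2_sum)
  qed
  have V0: "0 \<le> V t" if "0 \<le> t" for t
  proof -
    have "V t = (\<integral>\<omega>. (Z t \<omega> - f t)\<^sup>2 \<partial>M)"
      unfolding power2_diff V_def using sq2[OF that] int[OF that]
      by (simp add: f_def[symmetric] prob_space power2_eq_square)
    then show ?thesis by simp
  qed
  have Vlin: "V t = t" if "0 \<le> t" for t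
  proof -
    have "V t = t * V 1"
    proof (rule additive_bounded_linear[of V "V 1"])
      show "\<bar>V t\<bar> \<le> V 1" if "0 \<le> t" "t \<le> 1" for t
        using V[of t "1 - t"] V0[of t] V0[of "1 - t"] that by simp
    qed (use V that in auto)
    then show ?thesis using mean var by (simp add: V_def f_def)
  qed
  \<comment> \<open>Otherwise there are times tending to 0 with mean larger than 1 in absolute
    value. The variable itself tends to 0 by right-continuity, and it differs from its mean by a
    variance that tends to 0 as well, a contradiction.\<close>
  have bdd: "\<exists>d>0. \<forall>r. 0 < r \<longrightarrow> r < d \<longrightarrow> \<bar>f r\<bar> \<le> 1"
  proof (rule ccontr)
    assume neg: "\<not> ?thesis"
    have "\<exists>r. 0 < r \<and> r < 1 / real (Suc n) \<and> 1 < \<bar>f r\<bar>" for n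
      using neg by (metis not_le of_nat_0_less_iff zero_less_Suc zero_less_divide_1_iff)
    then obtain r where r: "\<And>n. 0 < r n" "\<And>n. r n < 1 / real (Suc n)" "\<And>n. 1 < \<bar>f (r n)\<bar>" by metis
    have r0: "r \<longlonglongrightarrow> 0"
      by (rule tendsto_sandwich[OF _ _ tendsto_const LIMSEQ_Suc[OF lim_1_over_n]])
         (use r in \<open>auto intro!: always_eventually less_imp_le simp del: of_nat_Suc\<close>)
    have rr: "filterlim r (at_right 0) sequentially"
    proof -
      have "\<forall>n. r n \<noteq> 0" using r(1) less_irrefl by metis
      then show ?thesis using r0 r(1) by (auto simp: filterlim_at intro!: always_eventually)
    qed
    have "AE \<omega> in M. (\<lambda>n. min 1 \<bar>Z (r n) \<omega>\<bar>) \<longlonglongrightarrow> 0"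
    proof -
      have "AE \<omega> in M. ((\<lambda>r. Z r \<omega>) \<longlongrightarrow> Z 0 \<omega>) (at_right 0)"
        using levy_paths[OF Z] by eventually_elim simp
      then show ?thesis using levy_0[OF Z]
      proof eventually_elim
        case (elim \<omega>)
        then have "(\<lambda>n. Z (r n) \<omega>) \<longlonglongrightarrow> 0" using filterlim_compose[OF _ rr] by auto
        from tendsto_min[OF tendsto_const tendsto_rabs[OF this], of 1] show ?case by simp
      qed
    qed
    then have "(\<lambda>n. \<integral>\<omega>. min 1 \<bar>Z (r n) \<omega>\<bar> \<partial>M) \<longlonglongrightarrow> (\<integral>\<omega>. 0 \<partial>M)"
      using m r(1) by (intro integral_dominated_convergence[where w="\<lambda>_. 1"]) (auto simp: less_imp_le)
    then have l1: "(\<lambda>n. \<integral>\<omega>. min 1 \<bar>Z (r n) \<omega>\<bar> \<partial>M) \<longlonglongrightarrow> 0" by simp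
    have l2: "(\<lambda>n. sqrt (r n)) \<longlonglongrightarrow> 0" using tendsto_real_sqrt[OF r0] by simp
    \<comment> \<open>As \<open>\<bar>f (r n)\<bar> > 1\<close>, either
      \<open>\<bar>Z (r n)\<bar> \<ge> 1\<close> or its sum with the distance to the mean exceeds 1.
      That distance has expectation at most the standard deviation
      \<open>sqrt (r n)\<close>.\<close>
    have "1 \<le> sqrt (r n) + (\<integral>\<omega>. min 1 \<bar>Z (r n) \<omega>\<bar> \<partial>M)" for n
    proof -
      have rn: "0 \<le> r n" using r(1)[of n] by simp
      have [measurable]: "Z (r n) \<in> borel_measurable M" by (rule m[OF rn])
      have s1: "square_integrable M (\<lambda>\<omega>. \<bar>Z (r n) \<omega> - f (r n)\<bar>)"
        using square_integrable_diff[OF sq[OF rn], of "\<lambda>_. f (r n)"] by (simp add: square_integrable_def)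
      have "(\<integral>\<omega>. \<bar>Z (r n) \<omega> - f (r n)\<bar> \<partial>M)\<^sup>2 \<le> (\<integral>\<omega>. (Z (r n) \<omega> - f (r n))\<^sup>2 \<partial>M)"
        using Cauchy_Schwarz_square_integrable[OF s1, of "\<lambda>_. 1"] by (simp add: square_integrable_def prob_space)
      also have "\<dots> = V (r n)"
        unfolding power2_diff V_def using sq2[OF rn] int[OF rn]
        by (simp add: f_def[symmetric] prob_space power2_eq_square)
      also have "\<dots> = r n" by (rule Vlin[OF rn])
      finally have 1: "(\<integral>\<omega>. \<bar>Z (r n) \<omega> - f (r n)\<bar> \<partial>M) \<le> sqrt (r n)" by (rule real_le_rsqrt)
      have im: "integrable M (\<lambda>\<omega>. min 1 \<bar>Z (r n) \<omega>\<bar>)"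
        using m[OF rn] by (intro integrable_const_bound[of _ 1]) auto
      have "(\<integral>\<omega>. 1 \<partial>M) \<le> (\<integral>\<omega>. \<bar>Z (r n) \<omega> - f (r n)\<bar> + min 1 \<bar>Z (r n) \<omega>\<bar> \<partial>M)"
        using r(3)[of n] im square_integrable_integrable[OF s1]
        by (intro integral_mono) (auto simp: min_def)
      also have "\<dots> = (\<integral>\<omega>. \<bar>Z (r n) \<omega> - f (r n)\<bar> \<partial>M) + (\<integral>\<omega>. min 1 \<bar>Z (r n) \<omega>\<bar> \<partial>M)"
        using im square_integrable_integrable[OF s1] by simp
      finally show ?thesis using 1 by (simp add: prob_space)
    qed
    then have "1 \<le> (0::real) + 0"
      by (intro LIMSEQ_le_const[OF tendsto_add[OF l2 l1]]) auto
    then show False by simp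
  qed
  then obtain d where d: "0 < d" "\<And>r. 0 < r \<Longrightarrow> r < d \<Longrightarrow> \<bar>f r\<bar> \<le> 1" by blast
  \<comment> \<open>Dividing the unit interval by \<open>k > 1 / d\<close> brings all its times
    below \<open>d\<close>; additivity then bounds \<open>f\<close> there by
    \<open>k\<close>.\<close>
  obtain k where k: "1 / d < real k" using reals_Archimedean2 by blast
  have k0: "0 < real k" using k d(1) by (smt (verit) zero_less_divide_1_iff)
  have f0: "f 0 = 0" using fadd[of 0 0] by simp
  have fmult: "f (real n * s) = real n * f s" if "0 \<le> s" for n s
  proof (induction n)
    case (Suc n) then show ?case using fadd[of "real n * s" s] that by (simp add: algebra_simps)
  qed (simp add: f0)
  have fb: "\<bar>f t\<bar> \<le> real k" if "0 \<le> t" "t \<le> 1" for t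
  proof (cases "t = 0")
    case False
    have "t / real k < d"
      using that k k0 d(1) by (smt (verit) divide_less_eq divide_right_mono mult.commute)
    then have "\<bar>f (t / real k)\<bar> \<le> 1" using False that k0 by (intro d(2)) auto
    then have "real k * \<bar>f (t / real k)\<bar> \<le> real k * 1" by (intro mult_left_mono) auto
    then show ?thesis using fmult[of "t / real k" k] that k0 by (simp add: abs_mult)
  qed (simp add: f0)
  have "f t = t * f 1" by (rule additive_bounded_linear[OF fadd fb t])
  then show "(\<integral>\<omega>. Z t \<omega> \<partial>M) = 0" using mean by (simp add: f_def)
  with Vlin[OF t] show "(\<integral>\<omega>. (Z t \<omega>)\<^sup>2 \<partial>M) = t" by (simp add: V_def f_def)
qed

lemma levy_increment_moments:
  assumes Z: "levy_process M Z" and Z1: "square_integrable M (Z 1)"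
    and mean: "(\<integral>\<omega>. Z 1 \<omega> \<partial>M) = 0" and var: "(\<integral>\<omega>. (Z 1 \<omega>)\<^sup>2 \<partial>M) = 1" and ab: "0 \<le> a" "a \<le> b"
  shows "square_integrable M (\<lambda>\<omega>. Z b \<omega> - Z a \<omega>)" "(\<integral>\<omega>. Z b \<omega> - Z a \<omega> \<partial>M) = 0"
    "(\<integral>\<omega>. (Z b \<omega> - Z a \<omega>)\<^sup>2 \<partial>M) = b - a"
proof -
  have "distr M borel (\<lambda>\<omega>. Z b \<omega> - Z a \<omega>) = distr M borel (Z (b - a))"
    using levy_distr[OF Z ab(1), of "b - a"] ab by simp
  then show "square_integrable M (\<lambda>\<omega>. Z b \<omega> - Z a \<omega>)" "(\<integral>\<omega>. Z b \<omega> - Z a \<omega> \<partial>M) = 0"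
    "(\<integral>\<omega>. (Z b \<omega> - Z a \<omega>)\<^sup>2 \<partial>M) = b - a"
    using square_integrable_distr_cong[of M "\<lambda>\<omega>. Z b \<omega> - Z a \<omega>" "Z (b - a)"] levy_process_measurable[OF Z] ab
      levy_moments[OF Z Z1 mean var, of "b - a"] levy_square_integrable[OF Z Z1, of "b - a"] by auto
qed

text \<open>There is no jump at a fixed time: along \<open>r n\<close> increasing to
  \<open>t\<close> the second moments \<open>t - r n\<close> tend to 0, so by Fatou the existing
  left limit equals the value. The two-sided process needs this because its negative half is built
  from left limits.\<close>

lemma levy_left_limit:
  assumes Z: "levy_process M Z" and Z1: "square_integrable M (Z 1)"
    and mean: "(\<integral>\<omega>. Z 1 \<omega> \<partial>M) = 0" and var: "(\<integral>\<omega>. (Z 1 \<omega>)\<^sup>2 \<partial>M) = 1" and t: "0 < t"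
  shows "AE \<omega> in M. Lim (at_left t) (\<lambda>r. Z r \<omega>) = Z t \<omega>"
proof -
  define r where "r n = t * (1 - 1 / real (Suc n))" for n
  have r: "0 \<le> r n" "r n < t" for n
  proof -
    have s: "0 \<le> 1 - 1 / real (Suc n)" "1 - 1 / real (Suc n) < 1" by (auto simp del: of_nat_Suc)
    show "0 \<le> r n" unfolding r_def using t s(1) by (intro mult_nonneg_nonneg) auto
    show "r n < t" unfolding r_def using mult_strict_left_mono[OF s(2) t] by simp
  qed
  have "(\<lambda>n. t * (1 - 1 / real (Suc n))) \<longlonglongrightarrow> t * (1 - 0)"
    by (intro tendsto_intros LIMSEQ_Suc[OF lim_1_over_n])
  then have rt: "r \<longlonglongrightarrow> t" by (simp add: r_def[abs_def])
  have rl: "filterlim r (at_left t) sequentially"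
    using rt r(2) by (auto simp: filterlim_at intro: always_eventually)
  have [measurable]: "Z t \<in> borel_measurable M" "Z (r n) \<in> borel_measurable M" for n
    using levy_process_measurable[OF Z] t r(1) by auto
  have e: "(\<integral>\<^sup>+\<omega>. ennreal ((Z t \<omega> - Z (r n) \<omega>)\<^sup>2) \<partial>M) = ennreal (t - r n)" for n
    using levy_increment_moments[OF Z Z1 mean var r(1) less_imp_le[OF r(2)], of n]
    by (subst nn_integral_eq_integral) (auto simp: square_integrable_def)
  have "(\<integral>\<^sup>+\<omega>. liminf (\<lambda>n. ennreal ((Z t \<omega> - Z (r n) \<omega>)\<^sup>2)) \<partial>M) \<le> liminf (\<lambda>n. ennreal (t - r n))"
    unfolding e[symmetric] by (rule nn_integral_liminf) measurable
  also have "(\<lambda>n. ennreal (t - r n)) \<longlonglongrightarrow> ennreal (t - t)"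
    by (intro tendsto_intros rt)
  then have "liminf (\<lambda>n. ennreal (t - r n)) = 0"
    using lim_imp_Liminf[OF sequentially_bot] by simp
  finally have "AE \<omega> in M. liminf (\<lambda>n. ennreal ((Z t \<omega> - Z (r n) \<omega>)\<^sup>2)) = 0"
    by (subst (asm) le_zero_eq, subst (asm) nn_integral_0_iff_AE) auto
  moreover have "AE \<omega> in M. \<exists>l. ((\<lambda>r. Z r \<omega>) \<longlongrightarrow> l) (at_left t)"
    using levy_paths[OF Z] by eventually_elim (use t in blast)
  ultimately show ?thesis
  proof eventually_elim
    case (elim \<omega>)
    then obtain l where l: "((\<lambda>r. Z r \<omega>) \<longlongrightarrow> l) (at_left t)" by blast
    have lim: "(\<lambda>n. ennreal ((Z t \<omega> - Z (r n) \<omega>)\<^sup>2)) \<longlonglongrightarrow> ennreal ((Z t \<omega> - l)\<^sup>2)"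
      by (intro tendsto_intros filterlim_compose[OF l rl])
    then have "ennreal ((Z t \<omega> - l)\<^sup>2) = 0"
      using lim_imp_Liminf[OF sequentially_bot lim] elim(1) by metis
    then have "l = Z t \<omega>" by simp
    then show ?case using tendsto_Lim[OF _ l] by simp
  qed
qed

end

section \<open>The isometry\<close>

text \<open>The two one-sided processes behind \<open>L\<close> are fixed here. Their equality in
  law is recorded only through the moments at time 1, which determine the covariance of
  increments.\<close>

locale two_sided_levy = prob_space M for M :: "'a measure" +
  fixes L1 L2 L :: "real \<Rightarrow> 'a \<Rightarrow> real"
  assumes levy1: "levy_process M L1" and levy2: "levy_process M L2"
    and ind: "indep_var path_space (path L1) path_space (path L2)"
    and moments1: "square_integrable M (L1 1)" "(\<integral>\<omega>. L1 1 \<omega> \<partial>M) = 0" "(\<integral>\<omega>. (L1 1 \<omega>)\<^sup>2 \<partial>M) = 1"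
    and moments2: "square_integrable M (L2 1)" "(\<integral>\<omega>. L2 1 \<omega> \<partial>M) = 0" "(\<integral>\<omega>. (L2 1 \<omega>)\<^sup>2 \<partial>M) = 1"
    and L_measurable [measurable]: "\<And>t. L t \<in> borel_measurable M"
    and L_eq: "AE \<omega> in M. \<forall>t. L t \<omega> = (if 0 \<le> t then L1 t \<omega> else - Lim (at_left (- t)) (\<lambda>r. L2 r \<omega>))"
begin

text \<open>A version that agrees with \<open>L\<close> almost surely at each fixed time, with
  values in place of left limits and exact value 0 at time 0. Its increments are pointwise functions
  of finitely many coordinates of the two one-sided paths, so independence can be applied to them
  directly.\<close>

definition L' :: "real \<Rightarrow> 'a \<Rightarrow> real" where
  "L' t \<omega> = (if 0 \<le> t then L1 t \<omega> - L1 0 \<omega> else L2 0 \<omega> - L2 (- t) \<omega>)"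

lemma L1_measurable [measurable]: "0 \<le> t \<Longrightarrow> L1 t \<in> borel_measurable M"
  and L2_measurable [measurable]: "0 \<le> t \<Longrightarrow> L2 t \<in> borel_measurable M"
  using levy_process_measurable[OF levy1] levy_process_measurable[OF levy2] by auto

lemma L'_measurable [measurable]: "L' t \<in> borel_measurable M"
  unfolding L'_def by (cases "0 \<le> t") auto

lemma L_eq_L': "AE \<omega> in M. L t \<omega> = L' t \<omega>"
proof (cases "0 \<le> t")
  case True
  show ?thesis using L_eq levy_0[OF levy1] by eventually_elim (use True in \<open>simp add: L'_def\<close>)
next
  case False
  have "AE \<omega> in M. Lim (at_left (- t)) (\<lambda>r. L2 r \<omega>) = L2 (- t) \<omega>"
    by (rule levy_left_limit[OF levy2 moments2]) (use False in simp)
  then show ?thesis using L_eq levy_0[OF levy2] by eventually_elim (use False in \<open>simp add: L'_def\<close>)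
qed

lemma path_indep:
  assumes "F \<in> borel_measurable path_space" "G \<in> borel_measurable path_space"
  shows "indep_var borel (\<lambda>\<omega>. F (path L1 \<omega>)) borel (\<lambda>\<omega>. G (path L2 \<omega>) :: real)"
  using indep_var_compose[OF ind assms] by (simp add: comp_def)

lemma path_apply [simp]: "0 \<le> t \<Longrightarrow> path Z \<omega> t = Z t \<omega>"
  by (simp add: path_def)

lemma path_diff_measurable:
  "0 \<le> s \<Longrightarrow> 0 \<le> t \<Longrightarrow> (\<lambda>x. x s - x t) \<in> borel_measurable path_space"
  by (intro borel_measurable_diff measurable_component_singleton) auto

lemma L'_increment_nonneg: "0 \<le> a \<Longrightarrow> 0 \<le> b \<Longrightarrow> L' b \<omega> - L' a \<omega> = L1 b \<omega> - L1 a \<omega>"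
  by (simp add: L'_def)

lemma L'_increment_nonpos: "a \<le> 0 \<Longrightarrow> b \<le> 0 \<Longrightarrow> L' b \<omega> - L' a \<omega> = L2 (- a) \<omega> - L2 (- b) \<omega>"
  by (cases "a = 0"; cases "b = 0") (auto simp: L'_def)

lemma L'_increment_moments:
  assumes "a \<le> b"
  shows "square_integrable M (\<lambda>\<omega>. L' b \<omega> - L' a \<omega>)" "(\<integral>\<omega>. L' b \<omega> - L' a \<omega> \<partial>M) = 0"
    "(\<integral>\<omega>. (L' b \<omega> - L' a \<omega>)\<^sup>2 \<partial>M) = b - a"
proof -
  note m1 = levy_increment_moments[OF levy1 moments1] and m2 = levy_increment_moments[OF levy2 moments2]
  consider "0 \<le> a" | "b \<le> 0" | "a < 0" "0 < b" by linarith
  then have "square_integrable M (\<lambda>\<omega>. L' b \<omega> - L' a \<omega>) \<and> (\<integral>\<omega>. L' b \<omega> - L' a \<omega> \<partial>M) = 0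
    \<and> (\<integral>\<omega>. (L' b \<omega> - L' a \<omega>)\<^sup>2 \<partial>M) = b - a"
  proof cases
    case 1
    then show ?thesis using m1[of a b] assms by (simp add: L'_increment_nonneg)
  next
    case 2
    then show ?thesis using m2[of "- b" "- a"] assms by (simp add: L'_increment_nonpos)
  next
    case 3
    \<comment> \<open>An interval around 0 splits into contributions of the two independent sides,
      with variances \<open>b\<close> and \<open>- a\<close>.\<close>
    define U where "U \<omega> = L1 b \<omega> - L1 0 \<omega>" for \<omega>
    define V where "V \<omega> = L2 (- a) \<omega> - L2 0 \<omega>" for \<omega>
    have eq: "L' b \<omega> - L' a \<omega> = U \<omega> + V \<omega>" for \<omega> using 3 by (simp add: L'_def U_def V_def)
    have U: "square_integrable M U" "(\<integral>\<omega>. U \<omega> \<partial>M) = 0" "(\<integral>\<omega>. (U \<omega>)\<^sup>2 \<partial>M) = b"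
      using m1[of 0 b] 3 by (auto simp: U_def[abs_def])
    have V: "square_integrable M V" "(\<integral>\<omega>. V \<omega> \<partial>M) = 0" "(\<integral>\<omega>. (V \<omega>)\<^sup>2 \<partial>M) = - a"
      using m2[of 0 "- a"] 3 by (auto simp: V_def[abs_def])
    have "indep_var borel (\<lambda>\<omega>. path L1 \<omega> b - path L1 \<omega> 0) borel (\<lambda>\<omega>. path L2 \<omega> (- a) - path L2 \<omega> 0)"
      by (rule path_indep[OF path_diff_measurable path_diff_measurable]) (use 3 in auto)
    then have iv: "indep_var borel U borel V" using 3 by (simp add: U_def[abs_def] V_def[abs_def])
    from indep_var_lebesgue_integral[OF iv square_integrable_integrable[OF U(1)] square_integrable_integrable[OF V(1)]]
    have UV: "(\<integral>\<omega>. U \<omega> * V \<omega> \<partial>M) = 0" using U V by simp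
    have "(\<integral>\<omega>. (U \<omega> + V \<omega>)\<^sup>2 \<partial>M) = (\<integral>\<omega>. (U \<omega>)\<^sup>2 + (V \<omega>)\<^sup>2 + 2 * (U \<omega> * V \<omega>) \<partial>M)"
      by (simp add: power2_sum mult.assoc)
    also have "\<dots> = b - a"
      using U V UV square_integrable_mult[OF U(1) V(1)] by (simp add: square_integrable_def)
    finally show ?thesis
      unfolding eq using U V square_integrable_add[OF U(1) V(1)] square_integrable_integrable[OF U(1)]
          square_integrable_integrable[OF V(1)]
      by simp
  qed
  then show "square_integrable M (\<lambda>\<omega>. L' b \<omega> - L' a \<omega>)" "(\<integral>\<omega>. L' b \<omega> - L' a \<omega> \<partial>M) = 0"
    "(\<integral>\<omega>. (L' b \<omega> - L' a \<omega>)\<^sup>2 \<partial>M) = b - a" by auto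
qed

lemma L_increment_moments:
  assumes "a \<le> b"
  shows "square_integrable M (\<lambda>\<omega>. L b \<omega> - L a \<omega>)" "(\<integral>\<omega>. L b \<omega> - L a \<omega> \<partial>M) = 0"
    "(\<integral>\<omega>. (L b \<omega> - L a \<omega>)\<^sup>2 \<partial>M) = b - a"
proof -
  have ae: "AE \<omega> in M. L' b \<omega> - L' a \<omega> = L b \<omega> - L a \<omega>"
    using L_eq_L'[of a] L_eq_L'[of b] by eventually_elim simp
  show "square_integrable M (\<lambda>\<omega>. L b \<omega> - L a \<omega>)"
    by (rule square_integrable_cong_AE[OF _ _ ae L'_increment_moments(1)[OF assms]]) auto
  have "(\<integral>\<omega>. L b \<omega> - L a \<omega> \<partial>M) = (\<integral>\<omega>. L' b \<omega> - L' a \<omega> \<partial>M)"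
    using ae by (intro integral_cong_AE) auto
  then show "(\<integral>\<omega>. L b \<omega> - L a \<omega> \<partial>M) = 0" by (simp add: L'_increment_moments(2)[OF assms])
  have "(\<integral>\<omega>. (L b \<omega> - L a \<omega>)\<^sup>2 \<partial>M) = (\<integral>\<omega>. (L' b \<omega> - L' a \<omega>)\<^sup>2 \<partial>M)"
    using ae by (intro integral_cong_AE) auto
  then show "(\<integral>\<omega>. (L b \<omega> - L a \<omega>)\<^sup>2 \<partial>M) = b - a" by (simp add: L'_increment_moments(3)[OF assms])
qed

lemma integral_indicator_Ioc_mult:
  assumes "a \<le> b" "c \<le> d"
  shows "(\<integral>u. indicator {a<..b} u * indicator {c<..d} u \<partial>lborel) = max 0 (min b d - max a c :: real)"
    and "integrable lborel (\<lambda>u. indicator {a<..b} u * indicator {c<..d} u :: real)"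
proof -
  have "(\<lambda>u. indicator {a<..b} u * indicator {c<..d} u :: real) = indicator {max a c<..min b d}"
    by (auto simp: fun_eq_iff indicator_def)
  moreover have "integrable lborel (indicator {max a c<..min b d} :: real \<Rightarrow> real)"
  proof (rule integrable_real_indicator)
    show "emeasure lborel {max a c<..min b d} < \<infinity>"
      by (rule order_le_less_trans[OF emeasure_mono[of _ "{max a c..min b d}"]]) (auto simp: emeasure_lborel_Icc_eq)
  qed simp
  moreover have "measure lborel {max a c<..min b d} = max 0 (min b d - max a c)"
    by (cases "max a c \<le> min b d") auto
  ultimately show "(\<integral>u. indicator {a<..b} u * indicator {c<..d} u \<partial>lborel) = max 0 (min b d - max a c :: real)"
    "integrable lborel (\<lambda>u. indicator {a<..b} u * indicator {c<..d} u :: real)"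
    by simp_all
qed

text \<open>Polarisation: the covariance only involves the second moments \<open>|t - s|\<close> of increments.\<close>

lemma increment_covariance:
  assumes ab: "a \<le> b" and cd: "c \<le> d"
  shows "(\<integral>\<omega>. (L b \<omega> - L a \<omega>) * (L d \<omega> - L c \<omega>) \<partial>M) = (\<integral>u. indicator {a<..b} u * indicator {c<..d} u \<partial>lborel)"
proof -
  have sq: "integrable M (\<lambda>\<omega>. (L t \<omega> - L s \<omega>)\<^sup>2) \<and> (\<integral>\<omega>. (L t \<omega> - L s \<omega>)\<^sup>2 \<partial>M) = \<bar>t - s\<bar>" for s t
  proof (cases "s \<le> t")
    case True then show ?thesis using L_increment_moments[OF True] by (simp add: square_integrable_def)
  next
    case False
    then show ?thesis using L_increment_moments[of t s] by (simp add: square_integrable_def power2_commute[of "L t _"])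
  qed
  have "(\<integral>\<omega>. (L b \<omega> - L a \<omega>) * (L d \<omega> - L c \<omega>) \<partial>M)
     = (\<integral>\<omega>. ((L b \<omega> - L c \<omega>)\<^sup>2 + (L a \<omega> - L d \<omega>)\<^sup>2 - (L b \<omega> - L d \<omega>)\<^sup>2 - (L a \<omega> - L c \<omega>)\<^sup>2) / 2 \<partial>M)"
    by (intro Bochner_Integration.integral_cong refl) (simp add: power2_eq_square algebra_simps)
  also have "\<dots> = (\<bar>b - c\<bar> + \<bar>a - d\<bar> - \<bar>b - d\<bar> - \<bar>a - c\<bar>) / 2"
    using sq by simp
  also have "\<dots> = max 0 (min b d - max a c)"
    using ab cd by (simp add: max_def min_def abs_if)
  finally show ?thesis using integral_indicator_Ioc_mult(1)[OF ab cd] by simp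
qed

definition valid_steps :: "(real \<times> real \<times> real) list \<Rightarrow> bool" where
  "valid_steps xs \<longleftrightarrow> (\<forall>(c, a, b)\<in>set xs. a \<le> b)"

lemma valid_steps_simps [simp]: "valid_steps []" "valid_steps ((c, a, b) # xs) \<longleftrightarrow> a \<le> b \<and> valid_steps xs"
  by (auto simp: valid_steps_def)

lemma step_simps [simp]:
  "step_fun [] u = 0" "step_fun ((c, a, b) # xs) u = c * indicator {a<..b} u + step_fun xs u"
  "step_integral L [] \<omega> = 0" "step_integral L ((c, a, b) # xs) \<omega> = c * (L b \<omega> - L a \<omega>) + step_integral L xs \<omega>"
  by (simp_all add: step_fun_def step_integral_def)

lemma square_integrable_indicator_Ioc: "a \<le> b \<Longrightarrow> square_integrable lborel (indicator {a<..b} :: real \<Rightarrow> real)"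
  using integral_indicator_Ioc_mult(2)[of a b a b] by (simp add: square_integrable_def power2_eq_square)

lemma step_fun_square_integrable: "valid_steps xs \<Longrightarrow> square_integrable lborel (step_fun xs)"
proof (induction xs)
  case Nil
  have "step_fun [] = (\<lambda>u. 0)" by auto
  then show ?case by simp
next
  case (Cons x xs)
  obtain c a b where x: "x = (c, a, b)" by (cases x)
  have "step_fun (x # xs) = (\<lambda>u. c * indicator {a<..b} u + step_fun xs u)" by (auto simp: x)
  then show ?case
    using Cons x by (auto intro!: square_integrable_add square_integrable_mult_left square_integrable_indicator_Ioc)
qed

lemma step_integral_square_integrable: "valid_steps xs \<Longrightarrow> square_integrable M (step_integral L xs)"
proof (induction xs)
  case Nil
  have "step_integral L [] = (\<lambda>u. 0)" by auto
  then show ?case by simp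
next
  case (Cons x xs)
  obtain c a b where x: "x = (c, a, b)" by (cases x)
  have "step_integral L (x # xs) = (\<lambda>\<omega>. c * (L b \<omega> - L a \<omega>) + step_integral L xs \<omega>)" by (auto simp: x)
  then show ?case
    using Cons x by (auto intro!: square_integrable_add square_integrable_mult_left L_increment_moments(1))
qed

lemma step_isometry:
  assumes xs: "valid_steps xs" and ys: "valid_steps ys"
  shows "(\<integral>\<omega>. step_integral L xs \<omega> * step_integral L ys \<omega> \<partial>M) = (\<integral>u. step_fun xs u * step_fun ys u \<partial>lborel)"
proof -
  have one: "(\<integral>\<omega>. (L b \<omega> - L a \<omega>) * step_integral L ys \<omega> \<partial>M) = (\<integral>u. indicator {a<..b} u * step_fun ys u \<partial>lborel)"
    if ab: "a \<le> b" and ys: "valid_steps ys" for a b ys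
    using ys
  proof (induction ys)
    case (Cons y ys)
    obtain c l r where y: "y = (c, l, r)" by (cases y)
    have lr: "l \<le> r" "valid_steps ys" using Cons.prems y by auto
    note i1 = square_integrable_mult[OF L_increment_moments(1)[OF ab] L_increment_moments(1)[OF lr(1)]]
      and i2 = square_integrable_mult[OF L_increment_moments(1)[OF ab] step_integral_square_integrable[OF lr(2)]]
      and j1 = integral_indicator_Ioc_mult(2)[OF ab lr(1)]
      and j2 = square_integrable_mult[OF square_integrable_indicator_Ioc[OF ab] step_fun_square_integrable[OF lr(2)]]
    have "(\<integral>\<omega>. (L b \<omega> - L a \<omega>) * step_integral L (y # ys) \<omega> \<partial>M)
       = (\<integral>\<omega>. c * ((L b \<omega> - L a \<omega>) * (L r \<omega> - L l \<omega>)) + (L b \<omega> - L a \<omega>) * step_integral L ys \<omega> \<partial>M)"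
      by (intro Bochner_Integration.integral_cong refl) (simp add: y algebra_simps)
    also have "\<dots> = c * (\<integral>\<omega>. (L b \<omega> - L a \<omega>) * (L r \<omega> - L l \<omega>) \<partial>M) + (\<integral>\<omega>. (L b \<omega> - L a \<omega>) * step_integral L ys \<omega> \<partial>M)"
      using i1 i2 by simp
    also have "\<dots> = c * (\<integral>u. indicator {a<..b} u * indicator {l<..r} u \<partial>lborel)
        + (\<integral>u. indicator {a<..b} u * step_fun ys u \<partial>lborel)"
      using increment_covariance[OF ab lr(1)] Cons.IH[OF lr(2)] by simp
    also have "\<dots> = (\<integral>u. c * (indicator {a<..b} u * indicator {l<..r} u) + indicator {a<..b} u * step_fun ys u \<partial>lborel)"
      using j1 j2 by simp
    also have "\<dots> = (\<integral>u. indicator {a<..b} u * step_fun (y # ys) u \<partial>lborel)"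
      by (intro Bochner_Integration.integral_cong refl) (simp add: y algebra_simps)
    finally show ?case .
  qed simp
  show ?thesis
    using xs
  proof (induction xs)
    case (Cons x xs)
    obtain c a b where x: "x = (c, a, b)" by (cases x)
    have ab: "a \<le> b" "valid_steps xs" using Cons.prems x by auto
    note i1 = square_integrable_mult[OF L_increment_moments(1)[OF ab(1)] step_integral_square_integrable[OF ys]]
      and i2 = square_integrable_mult[OF step_integral_square_integrable[OF ab(2)]
          step_integral_square_integrable[OF ys]]
      and j1 = square_integrable_mult[OF square_integrable_indicator_Ioc[OF ab(1)] step_fun_square_integrable[OF ys]]
      and j2 = square_integrable_mult[OF step_fun_square_integrable[OF ab(2)] step_fun_square_integrable[OF ys]]
    have "(\<integral>\<omega>. step_integral L (x # xs) \<omega> * step_integral L ys \<omega> \<partial>M)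
       = (\<integral>\<omega>. c * ((L b \<omega> - L a \<omega>) * step_integral L ys \<omega>) + step_integral L xs \<omega> * step_integral L ys \<omega> \<partial>M)"
      by (intro Bochner_Integration.integral_cong refl) (simp add: x algebra_simps)
    also have "\<dots> = c * (\<integral>\<omega>. (L b \<omega> - L a \<omega>) * step_integral L ys \<omega> \<partial>M)
        + (\<integral>\<omega>. step_integral L xs \<omega> * step_integral L ys \<omega> \<partial>M)"
      using i1 i2 by simp
    also have "\<dots> = c * (\<integral>u. indicator {a<..b} u * step_fun ys u \<partial>lborel) + (\<integral>u. step_fun xs u * step_fun ys u \<partial>lborel)"
      using one[OF ab(1) ys] Cons.IH[OF ab(2)] by simp
    also have "\<dots> = (\<integral>u. c * (indicator {a<..b} u * step_fun ys u) + step_fun xs u * step_fun ys u \<partial>lborel)"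
      using j1 j2 by simp
    also have "\<dots> = (\<integral>u. step_fun (x # xs) u * step_fun ys u \<partial>lborel)"
      by (intro Bochner_Integration.integral_cong refl) (simp add: x algebra_simps)
    finally show ?case .
  qed simp
qed

lemma levy_integral_step:
  assumes Y: "has_levy_integral M L f Y" and xs: "valid_steps xs"
  shows "(\<integral>\<omega>. Y \<omega> * step_integral L xs \<omega> \<partial>M) = (\<integral>u. f u * step_fun xs u \<partial>lborel)"
proof -
  obtain \<phi> where f: "square_integrable lborel f" "square_integrable M Y"
    and \<phi>: "\<And>n. valid_steps (\<phi> n)" "tendsto_L2 lborel (\<lambda>n. step_fun (\<phi> n)) f" "tendsto_L2 M (\<lambda>n. step_integral L (\<phi>
        n)) Y"
    using Y unfolding has_levy_integral_def valid_steps_def by blast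
  have "(\<lambda>n. \<integral>\<omega>. step_integral L (\<phi> n) \<omega> * step_integral L xs \<omega> \<partial>M) \<longlonglongrightarrow> (\<integral>\<omega>. Y \<omega> * step_integral L xs \<omega> \<partial>M)"
    by (intro tendsto_L2_integral_mult step_integral_square_integrable \<phi> f xs)
  moreover have "(\<lambda>n. \<integral>u. step_fun (\<phi> n) u * step_fun xs u \<partial>lborel) \<longlonglongrightarrow> (\<integral>u. f u * step_fun xs u \<partial>lborel)"
    by (intro tendsto_L2_integral_mult step_fun_square_integrable \<phi> f xs)
  ultimately show ?thesis
    using step_isometry[OF \<phi>(1) xs] LIMSEQ_unique by simp
qed

text \<open>Polarised form, by approximating one argument at a time: step integrals against
  \<open>Y'\<close> first, then the limit in the other factor.\<close>

lemma levy_integral_isometry: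
  assumes Y: "has_levy_integral M L f Y" and Y': "has_levy_integral M L f' Y'"
  shows "(\<integral>\<omega>. Y \<omega> * Y' \<omega> \<partial>M) = (\<integral>u. f u * f' u \<partial>lborel)"
proof -
  obtain \<phi> where f: "square_integrable lborel f" "square_integrable M Y"
    and \<phi>: "\<And>n. valid_steps (\<phi> n)" "tendsto_L2 lborel (\<lambda>n. step_fun (\<phi> n)) f" "tendsto_L2 M (\<lambda>n. step_integral L (\<phi>
        n)) Y"
    using Y unfolding has_levy_integral_def valid_steps_def by blast
  have f': "square_integrable lborel f'" "square_integrable M Y'" using Y' by (auto simp: has_levy_integral_def)
  have "(\<lambda>n. \<integral>\<omega>. step_integral L (\<phi> n) \<omega> * Y' \<omega> \<partial>M) \<longlonglongrightarrow> (\<integral>\<omega>. Y \<omega> * Y' \<omega> \<partial>M)"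
    by (intro tendsto_L2_integral_mult step_integral_square_integrable \<phi> f f')
  moreover have "(\<lambda>n. \<integral>u. step_fun (\<phi> n) u * f' u \<partial>lborel) \<longlonglongrightarrow> (\<integral>u. f u * f' u \<partial>lborel)"
    by (intro tendsto_L2_integral_mult step_fun_square_integrable \<phi> f f')
  moreover have "(\<integral>\<omega>. step_integral L (\<phi> n) \<omega> * Y' \<omega> \<partial>M) = (\<integral>u. step_fun (\<phi> n) u * f' u \<partial>lborel)" for n
    using levy_integral_step[OF Y' \<phi>(1)[of n]] by (simp add: mult.commute)
  ultimately show ?thesis using LIMSEQ_unique by simp
qed

end

section \<open>The past of the driving process\<close>

context prob_space begin

lemma levy_increment_orthogonal:
  assumes Z: "levy_process M Z" and Z1: "square_integrable M (Z 1)"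
    and mean: "(\<integral>\<omega>. Z 1 \<omega> \<partial>M) = 0" and var: "(\<integral>\<omega>. (Z 1 \<omega>)\<^sup>2 \<partial>M) = 1" and ab: "0 \<le> a" "a \<le> b"
    and J: "finite J" "p \<in> J" "J \<subseteq> {0..a} \<or> J \<subseteq> {b..}"
    and F: "F \<in> borel_measurable (PiM J (\<lambda>_. borel))" "\<And>x. \<bar>F x\<bar> \<le> 1"
  shows "integrable M (\<lambda>\<omega>. (Z b \<omega> - Z a \<omega>) * F (\<lambda>j\<in>J. Z j \<omega> - Z p \<omega>))"
    "(\<integral>\<omega>. (Z b \<omega> - Z a \<omega>) * F (\<lambda>j\<in>J. Z j \<omega> - Z p \<omega>) \<partial>M) = 0"
proof -
  note inc = levy_increment_moments[OF Z Z1 mean var ab]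
  note iv = levy_increment_indep[OF Z ab J F(1)]
  have m: "(\<lambda>\<omega>. F (\<lambda>j\<in>J. Z j \<omega> - Z p \<omega>)) \<in> borel_measurable M"
    by (rule indep_var_rv2[OF iv])
  have i: "integrable M (\<lambda>\<omega>. F (\<lambda>j\<in>J. Z j \<omega> - Z p \<omega>))"
    by (rule integrable_const_bound[where B = 1]) (use F(2) m in auto)
  show "integrable M (\<lambda>\<omega>. (Z b \<omega> - Z a \<omega>) * F (\<lambda>j\<in>J. Z j \<omega> - Z p \<omega>))"
    by (rule indep_var_integrable[OF iv square_integrable_integrable[OF inc(1)] i])
  show "(\<integral>\<omega>. (Z b \<omega> - Z a \<omega>) * F (\<lambda>j\<in>J. Z j \<omega> - Z p \<omega>) \<partial>M) = 0"
    using indep_var_lebesgue_integral[OF iv square_integrable_integrable[OF inc(1)] i] inc(2) by simp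
qed

end

lemma measurable_box_indicator [measurable]:
  assumes "finite J" "\<And>j. j \<in> J \<Longrightarrow> h j \<in> borel_measurable N" "\<And>j. j \<in> J \<Longrightarrow> A j \<in> sets borel"
  shows "(\<lambda>x. \<Prod>j\<in>J. indicator (A j) (h j x) :: real) \<in> borel_measurable N"
  by (rule borel_measurable_prod) (use assms in measurable)

lemma abs_box_indicator_le_1: "\<bar>\<Prod>j\<in>J. indicator (A j) (h j) :: real\<bar> \<le> 1"
  by (auto simp: abs_prod intro!: prod_le_1 split: split_indicator)

context two_sided_levy begin

text \<open>An interval that does not cross 0 has its increment on one side only. Past coordinates
  of the other side factor out by independence of the two sides, those of the same side by
  independence of increments. Boxes suffice as they generate the product sigma-algebra.\<close>

lemma box_orthogonal_same_sign:
  assumes J: "finite J" "J \<subseteq> {..s}" and A: "\<And>j. j \<in> J \<Longrightarrow> A j \<in> sets (borel :: real measure)"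
    and sab: "s \<le> a" "a \<le> b" and sgn: "0 \<le> a \<or> b \<le> 0"
  shows "(\<integral>\<omega>. (L' b \<omega> - L' a \<omega>) * (\<Prod>j\<in>J. indicator (A j) (L' j \<omega> - L' (min s 0) \<omega>)) \<partial>M) = 0"
proof -
  note orth1 = levy_increment_orthogonal[OF levy1 moments1] and orth2 = levy_increment_orthogonal[OF levy2 moments2]
  have L'0: "L' 0 \<omega> = 0" for \<omega> by (simp add: L'_def)
  show ?thesis
  proof (cases "0 \<le> a")
    case a: True
    define J1 where "J1 = {j\<in>J. 0 \<le> j}"
    define J2 where "J2 = {j\<in>J. j < 0}"
    have J': "finite J1" "finite J2" "J = J1 \<union> J2" "J1 \<inter> J2 = {}" "0 \<le> j \<Longrightarrow> j \<notin> J2" for j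
      using J by (auto simp: J1_def J2_def)
    show ?thesis
    proof (cases "0 \<le> s")
      case s: True
      define F where "F x = (\<Prod>j\<in>J1. indicator (A j) (x j) :: real)" for x :: "real \<Rightarrow> real"
      define U where "U x = (x b - x a) * (\<Prod>j\<in>J1. indicator (A j) (x j - x 0) :: real)" for x :: "real \<Rightarrow> real"
      define V where "V x = (\<Prod>j\<in>J2. indicator (A j) (x 0 - x (- j)) :: real)" for x :: "real \<Rightarrow> real"
      have F: "F \<in> borel_measurable (PiM (insert 0 J1) (\<lambda>_. borel))"
        unfolding F_def by (rule measurable_box_indicator) (use J'(1) A in \<open>auto simp: J1_def\<close>)
      have UF: "U (path L1 \<omega>) = (L1 b \<omega> - L1 a \<omega>) * F (\<lambda>j\<in>insert 0 J1. L1 j \<omega> - L1 0 \<omega>)" for \<omega>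
        unfolding U_def F_def using a sab by (auto simp: J1_def intro!: prod.cong)
      have U0: "integrable M (\<lambda>\<omega>. U (path L1 \<omega>))" "(\<integral>\<omega>. U (path L1 \<omega>) \<partial>M) = 0"
        unfolding UF
        by (intro orth1[OF a sab(2) _ _ _ F]; use J'(1) J s sab in \<open>auto simp: J1_def F_def intro:
            abs_box_indicator_le_1\<close>)+
      have Um: "U \<in> borel_measurable path_space"
        unfolding U_def
        by (intro borel_measurable_times path_diff_measurable measurable_box_indicator) (use J'(1) A a sab in \<open>auto
            simp: J1_def\<close>)
      have Vm: "V \<in> borel_measurable path_space"
        unfolding V_def
        by (intro path_diff_measurable measurable_box_indicator) (use J'(2) A in \<open>auto simp: J2_def\<close>)
      note iv = path_indep[OF Um Vm]
      have V1: "integrable M (\<lambda>\<omega>. V (path L2 \<omega>))"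
        by (rule integrable_const_bound[where B = 1]) (use indep_var_rv2[OF iv] in \<open>auto simp: V_def intro:
            abs_box_indicator_le_1\<close>)
      have "(\<integral>\<omega>. U (path L1 \<omega>) * V (path L2 \<omega>) \<partial>M) = 0"
        using indep_var_lebesgue_integral[OF iv U0(1) V1] U0(2) by simp
      moreover have "U (path L1 \<omega>) * V (path L2 \<omega>) = (L' b \<omega> - L' a \<omega>) * (\<Prod>j\<in>J. indicator (A j) (L' j \<omega>
          - L' (min s 0) \<omega>))" for \<omega>
      proof -
        have "(\<Prod>j\<in>J1. indicator (A j) (path L1 \<omega> j - path L1 \<omega> 0) :: real)
            = (\<Prod>j\<in>J1. indicator (A j) (L' j \<omega> - L' (min s 0) \<omega>))"
          by (rule prod.cong) (use s in \<open>auto simp: J1_def L'_def\<close>)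
        moreover have "V (path L2 \<omega>) = (\<Prod>j\<in>J2. indicator (A j) (L' j \<omega> - L' (min s 0) \<omega>))"
          unfolding V_def by (rule prod.cong) (use s in \<open>auto simp: J2_def L'_def\<close>)
        ultimately show ?thesis
          unfolding U_def J'(3) using a sab by (subst prod.union_disjoint[OF J'(1,2,4)]) (simp add: L'_def)
      qed
      ultimately show ?thesis by simp
    next
      case s: False
      define U where "U x = x b - x a" for x :: "real \<Rightarrow> real"
      define V where "V x = (\<Prod>j\<in>J. indicator (A j) (x (- s) - x (- j)) :: real)" for x :: "real \<Rightarrow> real"
      have Um: "U \<in> borel_measurable path_space"
        unfolding U_def by (intro path_diff_measurable) (use a sab in auto)
      have Vm: "V \<in> borel_measurable path_space"
        unfolding V_def
        by (intro path_diff_measurable measurable_box_indicator) (use J A s in auto)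
      note iv = path_indep[OF Um Vm]
      have UL: "U (path L1 \<omega>) = L1 b \<omega> - L1 a \<omega>" for \<omega> using a sab by (simp add: U_def)
      note m1 = levy_increment_moments[OF levy1 moments1 a sab(2)]
      have V1: "integrable M (\<lambda>\<omega>. V (path L2 \<omega>))"
        by (rule integrable_const_bound[where B = 1]) (use indep_var_rv2[OF iv] in \<open>auto simp: V_def intro:
            abs_box_indicator_le_1\<close>)
      have "(\<integral>\<omega>. U (path L1 \<omega>) * V (path L2 \<omega>) \<partial>M) = 0"
        using indep_var_lebesgue_integral[OF iv _ V1] square_integrable_integrable[OF m1(1)] m1(2) by (simp add: UL)
      moreover have "U (path L1 \<omega>) * V (path L2 \<omega>) = (L' b \<omega> - L' a \<omega>) * (\<Prod>j\<in>J. indicator (A j) (L' j \<omega>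
          - L' (min s 0) \<omega>))" for \<omega>
      proof -
        have "V (path L2 \<omega>) = (\<Prod>j\<in>J. indicator (A j) (L' j \<omega> - L' (min s 0) \<omega>))"
          unfolding V_def
        proof (rule prod.cong)
          fix j assume "j \<in> J"
          then have "j < 0" using J s by auto
          then show "indicator (A j) (path L2 \<omega> (- s) - path L2 \<omega> (- j))
              = (indicator (A j) (L' j \<omega> - L' (min s 0) \<omega>) :: real)"
            using s by (simp add: L'_def)
        qed simp
        then show ?thesis using a sab by (simp add: UL L'_def)
      qed
      ultimately show ?thesis by simp
    qed
  next
    case a: False
    \<comment> \<open>All times lie on the negative side, where \<open>L2\<close> runs backwards:
      the past up to \<open>s\<close> becomes the times from \<open>- s\<close> on, to the right of
      the reflected interval.\<close>
    then have b: "b \<le> 0" and s: "s < 0" using sgn sab by auto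
    define F where "F x = (\<Prod>j\<in>J. indicator (A j) (- x (- j)) :: real)" for x :: "real \<Rightarrow> real"
    define J' where "J' = insert (- s) (uminus ` J)"
    have F: "F \<in> borel_measurable (PiM J' (\<lambda>_. borel))"
      unfolding F_def by (rule measurable_box_indicator) (use J A in \<open>auto simp: J'_def\<close>)
    have "(\<integral>\<omega>. (L2 (- a) \<omega> - L2 (- b) \<omega>) * F (\<lambda>j\<in>J'. L2 j \<omega> - L2 (- s) \<omega>) \<partial>M) = 0"
      by (rule orth2(2)[OF _ _ _ _ _ F]) (use J a b sab in \<open>auto simp: J'_def F_def intro: abs_box_indicator_le_1\<close>)
    moreover have "F (\<lambda>j\<in>J'. L2 j \<omega> - L2 (- s) \<omega>) = (\<Prod>j\<in>J. indicator (A j) (L' j \<omega> - L' (min s 0) \<omega>))" for \<omega>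
      unfolding F_def
    proof (rule prod.cong)
      fix j assume "j \<in> J"
      then have "j < 0" "- j \<in> J'" using J s by (auto simp: J'_def)
      then show "indicator (A j) (- (\<lambda>j\<in>J'. L2 j \<omega> - L2 (- s) \<omega>) (- j))
          = (indicator (A j) (L' j \<omega> - L' (min s 0) \<omega>) :: real)"
        using s by (simp add: L'_def)
    qed simp
    ultimately show ?thesis using a b sab by (simp add: L'_increment_nonpos)
  qed
qed

lemma L'_integrable: "integrable M (\<lambda>\<omega>. L' b \<omega> - L' a \<omega>)"
proof (cases "a \<le> b")
  case True then show ?thesis by (intro square_integrable_integrable L'_increment_moments)
next
  case False
  then have "integrable M (\<lambda>\<omega>. - (L' a \<omega> - L' b \<omega>))"
    by (intro Bochner_Integration.integrable_minus square_integrable_integrable L'_increment_moments) auto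
  then show ?thesis by simp
qed

text \<open>By linearity in the increment, an interval across 0 is reduced to two intervals of
  constant sign.\<close>

lemma box_orthogonal:
  assumes J: "finite J" "J \<subseteq> {..s}" and A: "\<And>j. j \<in> J \<Longrightarrow> A j \<in> sets (borel :: real measure)"
    and sab: "s \<le> a" "a \<le> b"
  shows "(\<integral>\<omega>. (L' b \<omega> - L' a \<omega>) * (\<Prod>j\<in>J. indicator (A j) (L' j \<omega> - L' (min s 0) \<omega>)) \<partial>M) = 0"
proof -
  \<comment> \<open>The point of \<open>[a, b]\<close> closest to 0, so neither subinterval contains
    0 in its interior; one of them may be empty.\<close>
  define c where "c = max a (min b 0)"
  define D where "D \<omega> = (\<Prod>j\<in>J. indicator (A j) (L' j \<omega> - L' (min s 0) \<omega>) :: real)" for \<omega>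
  have D: "D \<in> borel_measurable M" "\<bar>D \<omega>\<bar> \<le> 1" for \<omega>
    unfolding D_def by (rule measurable_box_indicator[OF J(1) _ A], measurable) (rule abs_box_indicator_le_1)
  have i: "integrable M (\<lambda>\<omega>. (L' b \<omega> - L' a \<omega>) * D \<omega>)" for a b
    by (rule Bochner_Integration.integrable_bound[OF L'_integrable[of b a]])
      (use D mult_left_mono[OF D(2)] in \<open>auto simp: abs_mult\<close>)
  have "(\<integral>\<omega>. (L' b \<omega> - L' a \<omega>) * D \<omega> \<partial>M) = (\<integral>\<omega>. (L' b \<omega> - L' c \<omega>) * D \<omega> + (L' c \<omega> - L' a \<omega>) * D \<omega> \<partial>M)"
    by (simp add: algebra_simps)
  also have "\<dots> = (\<integral>\<omega>. (L' b \<omega> - L' c \<omega>) * D \<omega> \<partial>M) + (\<integral>\<omega>. (L' c \<omega> - L' a \<omega>) * D \<omega> \<partial>M)"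
    by (rule Bochner_Integration.integral_add[OF i i])
  also have "(\<integral>\<omega>. (L' b \<omega> - L' c \<omega>) * D \<omega> \<partial>M) = 0"
    unfolding D_def by (rule box_orthogonal_same_sign[OF J A]) (use sab in \<open>auto simp: c_def\<close>)
  also have "(\<integral>\<omega>. (L' c \<omega> - L' a \<omega>) * D \<omega> \<partial>M) = 0"
    unfolding D_def by (rule box_orthogonal_same_sign[OF J A]) (use sab in \<open>auto simp: c_def\<close>)
  finally show ?thesis by (simp add: D_def)
qed

text \<open>The base point must not lie after \<open>s\<close>. For negative \<open>s\<close> the
  value of \<open>L'\<close> itself contains the increment between \<open>s\<close> and 0, which
  belongs to the future; hence increments relative to \<open>min s 0\<close>.\<close>

definition past_map :: "real \<Rightarrow> 'a \<Rightarrow> real \<Rightarrow> real" where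
  "past_map s \<omega> = (\<lambda>j\<in>{..s}. L' j \<omega> - L' (min s 0) \<omega>)"

lemma past_map_measurable [measurable]: "past_map s \<in> measurable M (PiM {..s} (\<lambda>_. borel))"
  unfolding past_map_def by (rule measurable_restrict) measurable

text \<open>Weighting the probability with the positive and with the negative part of the increment
  gives two finite measures on the space of past paths. They agree on finite-dimensional boxes,
  hence everywhere.\<close>

lemma increment_past_orthogonal:
  assumes sab: "s \<le> a" "a \<le> b" and B: "B \<in> sets (PiM {..s} (\<lambda>_. borel))"
  shows "(\<integral>\<omega>. (L' b \<omega> - L' a \<omega>) * indicator B (past_map s \<omega>) \<partial>M) = 0"
proof -
  let ?P = "PiM {..s} (\<lambda>_. borel :: real measure)"
  define D where "D \<omega> = L' b \<omega> - L' a \<omega>" for \<omega>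
  have D: "integrable M D" and [measurable]: "D \<in> borel_measurable M"
    using L'_integrable[of b a] by (auto simp: D_def[abs_def])
  define \<mu> where "\<mu> h = distr (density M (\<lambda>\<omega>. ennreal (h \<omega>))) ?P (past_map s)" for h :: "'a \<Rightarrow> real"
  have \<mu>: "emeasure (\<mu> h) B = ennreal (\<integral>\<omega>. h \<omega> * indicator B (past_map s \<omega>) \<partial>M)"
    if h: "integrable M h" "\<And>\<omega>. 0 \<le> h \<omega>" and B: "B \<in> sets ?P" for h B
  proof -
    have [measurable]: "h \<in> borel_measurable M" using h by auto
    note [measurable] = B
    have "emeasure (\<mu> h) B = emeasure (density M (\<lambda>\<omega>. ennreal (h \<omega>))) (past_map s -` B \<inter> space M)"
      unfolding \<mu>_def by (subst emeasure_distr) auto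
    also have "\<dots> = (\<integral>\<^sup>+\<omega>. ennreal (h \<omega>) * indicator (past_map s -` B \<inter> space M) \<omega> \<partial>M)"
      by (rule emeasure_density) measurable
    also have "\<dots> = (\<integral>\<^sup>+\<omega>. ennreal (h \<omega> * indicator B (past_map s \<omega>)) \<partial>M)"
      by (rule nn_integral_cong) (auto split: split_indicator)
    also have "\<dots> = ennreal (\<integral>\<omega>. h \<omega> * indicator B (past_map s \<omega>) \<partial>M)"
    proof (rule nn_integral_eq_integral)
      show "integrable M (\<lambda>\<omega>. h \<omega> * indicator B (past_map s \<omega>))"
        by (rule Bochner_Integration.integrable_bound[OF h(1)]) (auto split: split_indicator)
    qed (use h in auto)
    finally show ?thesis .
  qed
  have Dp: "integrable M (\<lambda>\<omega>. max (D \<omega>) 0)" "integrable M (\<lambda>\<omega>. max (- D \<omega>) 0)" using D by auto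
  have bi: "integrable M (\<lambda>\<omega>. h \<omega> * indicator B (past_map s \<omega>))"
    if "integrable M h" "B \<in> sets ?P" for h :: "'a \<Rightarrow> real" and B
    by (rule Bochner_Integration.integrable_bound[OF that(1)]) (use that in \<open>auto split: split_indicator\<close>)
  have diff: "(\<integral>\<omega>. max (D \<omega>) 0 * indicator B (past_map s \<omega>) \<partial>M) - (\<integral>\<omega>. max (- D \<omega>) 0 * indicator B (past_map s \<omega>) \<partial>M)
    = (\<integral>\<omega>. D \<omega> * indicator B (past_map s \<omega>) \<partial>M)" if B: "B \<in> sets ?P" for B
  proof -
    have "(\<integral>\<omega>. max (D \<omega>) 0 * indicator B (past_map s \<omega>) \<partial>M) - (\<integral>\<omega>. max (- D \<omega>) 0 * indicator B (past_map s \<omega>) \<partial>M)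
      = (\<integral>\<omega>. max (D \<omega>) 0 * indicator B (past_map s \<omega>) - max (- D \<omega>) 0 * indicator B (past_map s \<omega>) \<partial>M)"
      using bi[OF Dp(1) B] bi[OF Dp(2) B] by simp
    also have "\<dots> = (\<integral>\<omega>. D \<omega> * indicator B (past_map s \<omega>) \<partial>M)"
      by (rule Bochner_Integration.integral_cong) (auto split: split_indicator)
    finally show ?thesis .
  qed
  have "\<mu> (\<lambda>\<omega>. max (D \<omega>) 0) = \<mu> (\<lambda>\<omega>. max (- D \<omega>) 0)"
  proof (rule measure_eqI_PiM_infinite)
    show "sets (\<mu> (\<lambda>\<omega>. max (D \<omega>) 0)) = sets ?P" "sets (\<mu> (\<lambda>\<omega>. max (- D \<omega>) 0)) = sets ?P"
      by (simp_all add: \<mu>_def)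
    show "finite_measure (\<mu> (\<lambda>\<omega>. max (D \<omega>) 0))"
    proof (rule finite_measureI)
      have "space (\<mu> (\<lambda>\<omega>. max (D \<omega>) 0)) = space ?P" by (simp add: \<mu>_def)
      then show "emeasure (\<mu> (\<lambda>\<omega>. max (D \<omega>) 0)) (space (\<mu> (\<lambda>\<omega>. max (D \<omega>) 0))) \<noteq> \<infinity>"
        using \<mu>[OF Dp(1), of "space ?P"] by simp
    qed
  next
    fix A :: "real \<Rightarrow> real set" and J
    assume J: "finite J" "J \<subseteq> {..s}" and A: "\<And>i. i \<in> J \<Longrightarrow> A i \<in> sets borel"
    let ?E = "prod_emb {..s} (\<lambda>_. borel :: real measure) J (Pi\<^sub>E J A)"
    have E: "?E \<in> sets ?P" by (rule sets_PiM_I[OF J]) (use A in auto)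
    have ind: "indicator ?E (past_map s \<omega>) = (\<Prod>j\<in>J. indicator (A j) (L' j \<omega> - L' (min s 0) \<omega>) :: real)" for \<omega>
    proof -
      have "(\<Prod>j\<in>J. indicator (A j) (L' j \<omega> - L' (min s 0) \<omega>) :: real)
        = (if \<forall>j\<in>J. L' j \<omega> - L' (min s 0) \<omega> \<in> A j then 1 else 0)"
        using J(1) by (auto simp: indicator_def intro!: prod_zero)
      moreover have "past_map s \<omega> \<in> ?E \<longleftrightarrow> (\<forall>j\<in>J. L' j \<omega> - L' (min s 0) \<omega> \<in> A j)"
        using J(2) by (auto simp: past_map_def prod_emb_def PiE_iff subset_iff)
      ultimately show ?thesis by (simp add: indicator_def)
    qed
    have "(\<integral>\<omega>. D \<omega> * indicator ?E (past_map s \<omega>) \<partial>M) = 0"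
      unfolding ind D_def by (rule box_orthogonal[OF J A sab])
    then show "emeasure (\<mu> (\<lambda>\<omega>. max (D \<omega>) 0)) ?E = emeasure (\<mu> (\<lambda>\<omega>. max (- D \<omega>) 0)) ?E"
      using \<mu>[OF Dp(1) _ E] \<mu>[OF Dp(2) _ E] diff[OF E] by simp
  qed
  then have "ennreal (\<integral>\<omega>. max (D \<omega>) 0 * indicator B (past_map s \<omega>) \<partial>M)
      = ennreal (\<integral>\<omega>. max (- D \<omega>) 0 * indicator B (past_map s \<omega>) \<partial>M)"
    using \<mu>[OF Dp(1) _ B] \<mu>[OF Dp(2) _ B] by simp
  then have "(\<integral>\<omega>. max (D \<omega>) 0 * indicator B (past_map s \<omega>) \<partial>M) = (\<integral>\<omega>. max (- D \<omega>) 0 * indicator B (past_map s \<omega>) \<partial>M)"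
    by (subst (asm) ennreal_inj) (auto intro!: integral_nonneg_AE)
  then show ?thesis using diff[OF B] by (simp add: D_def)
qed

end

section \<open>The sigma-algebra generated by past increments\<close>

context two_sided_levy begin

definition past_sigma :: "real \<Rightarrow> 'a measure" where
  "past_sigma s = vimage_algebra (space M) (past_map s) (PiM {..s} (\<lambda>_. borel))"

lemma space_past_sigma [simp]: "space (past_sigma s) = space M"
  by (simp add: past_sigma_def)

lemma past_map_in_space: "past_map s \<in> space M \<rightarrow> space (PiM {..s} (\<lambda>_. borel))"
  by (rule funcsetI, rule measurable_space[OF past_map_measurable])

lemma sets_past_sigma: "sets (past_sigma s) = {past_map s -` B \<inter> space M | B. B \<in> sets (PiM {..s} (\<lambda>_. borel))}"
  unfolding past_sigma_def by (rule sets_vimage_algebra2[OF past_map_in_space])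

lemma subalgebra_past_sigma: "subalgebra M (past_sigma s)"
  unfolding subalgebra_def sets_past_sigma by (auto intro: measurable_sets)

lemma L'_increment_past_sigma:
  assumes "u \<le> s" "v \<le> s"
  shows "(\<lambda>\<omega>. L' u \<omega> - L' v \<omega>) \<in> borel_measurable (past_sigma s)"
proof -
  have m: "past_map s \<in> measurable (past_sigma s) (PiM {..s} (\<lambda>_. borel))"
    unfolding past_sigma_def by (rule measurable_vimage_algebra1[OF past_map_in_space])
  have "(\<lambda>x. x u - x v) \<in> borel_measurable (PiM {..s} (\<lambda>_. borel :: real measure))"
    by (intro borel_measurable_diff measurable_component_singleton) (use assms in auto)
  from measurable_compose[OF m this] show ?thesis using assms by (simp add: past_map_def)
qed

lemma increment_orthogonal_past_sigma:
  assumes sab: "s \<le> a" "a \<le> b" and A: "A \<in> sets (past_sigma s)"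
  shows "(\<integral>\<omega>. (L b \<omega> - L a \<omega>) * indicator A \<omega> \<partial>M) = 0"
proof -
  obtain B where B: "B \<in> sets (PiM {..s} (\<lambda>_. borel))" "A = past_map s -` B \<inter> space M"
    using A unfolding sets_past_sigma by blast
  have [measurable]: "A \<in> sets M" using A subalgebra_past_sigma by (auto simp: subalgebra_def)
  note [measurable] = B(1)
  have "(\<integral>\<omega>. (L b \<omega> - L a \<omega>) * indicator A \<omega> \<partial>M) = (\<integral>\<omega>. (L' b \<omega> - L' a \<omega>) * indicator B (past_map s \<omega>) \<partial>M)"
  proof (rule integral_cong_AE)
    show "AE \<omega> in M. (L b \<omega> - L a \<omega>) * indicator A \<omega> = (L' b \<omega> - L' a \<omega>) * indicator B (past_map s \<omega>)"
      using L_eq_L'[of a] L_eq_L'[of b] AE_space by eventually_elim (auto simp: B(2) indicator_def)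
  qed measurable
  then show ?thesis using increment_past_orthogonal[OF sab B(1)] by simp
qed

text \<open>Cells beyond \<open>s\<close> collapse to the empty interval \<open>(s, s]\<close>, with
  indicator and increment equal to 0, so no case distinction or change of length occurs.\<close>

definition steps_before :: "real \<Rightarrow> (real \<times> real \<times> real) list \<Rightarrow> (real \<times> real \<times> real) list" where
  "steps_before s xs = map (\<lambda>(c, a, b). (c, min a s, min b s)) xs"

definition steps_after :: "real \<Rightarrow> (real \<times> real \<times> real) list \<Rightarrow> (real \<times> real \<times> real) list" where
  "steps_after s xs = map (\<lambda>(c, a, b). (c, max a s, max b s)) xs"

lemma steps_simps [simp]:
  "steps_before s [] = []" "steps_before s ((c, a, b) # xs) = (c, min a s, min b s) # steps_before s xs"
  "steps_after s [] = []" "steps_after s ((c, a, b) # xs) = (c, max a s, max b s) # steps_after s xs"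
  by (simp_all add: steps_before_def steps_after_def)

lemma valid_steps_before: "valid_steps xs \<Longrightarrow> valid_steps (steps_before s xs)"
  by (induction xs) auto

lemma step_fun_before: "step_fun (steps_before s xs) u = indicator {..s} u * step_fun xs u"
  by (induction xs) (auto simp: algebra_simps split: split_indicator)

lemma step_integral_split: "step_integral L xs \<omega> = step_integral L (steps_before s xs) \<omega>
    + step_integral L (steps_after s xs) \<omega>"
proof (induction xs)
  case (Cons x xs)
  obtain c a b where x: "x = (c, a, b)" by (cases x)
  have "L (min t s) \<omega> + L (max t s) \<omega> = L t \<omega> + L s \<omega>" for t by (cases "t \<le> s") (auto simp: min_def max_def)
  from this[of a] this[of b]
  have "L b \<omega> - L a \<omega> = (L (min b s) \<omega> - L (min a s) \<omega>) + (L (max b s) \<omega> - L (max a s) \<omega>)" by linarith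
  then show ?case using Cons by (simp add: x distrib_left)
qed simp

lemma steps_after_orthogonal:
  assumes A: "A \<in> sets (past_sigma s)" and xs: "valid_steps xs"
  shows "(\<integral>\<omega>. step_integral L (steps_after s xs) \<omega> * indicator A \<omega> \<partial>M) = 0"
    "integrable M (\<lambda>\<omega>. step_integral L (steps_after s xs) \<omega> * indicator A \<omega>)"
proof -
  have AM: "A \<in> sets M" using A subalgebra_past_sigma by (auto simp: subalgebra_def)
  have "(\<integral>\<omega>. step_integral L (steps_after s xs) \<omega> * indicator A \<omega> \<partial>M) = 0
    \<and> integrable M (\<lambda>\<omega>. step_integral L (steps_after s xs) \<omega> * indicator A \<omega>)"
    using xs
  proof (induction xs)
    case (Cons x xs)
    obtain c a b where x: "x = (c, a, b)" by (cases x)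
    have ab: "s \<le> max a s" "max a s \<le> max b s" "valid_steps xs" using Cons.prems x by auto
    have "integrable M (\<lambda>\<omega>. L (max b s) \<omega> - L (max a s) \<omega>)"
      by (rule square_integrable_integrable[OF L_increment_moments(1)[OF ab(2)]])
    then have i: "integrable M (\<lambda>\<omega>. c * ((L (max b s) \<omega> - L (max a s) \<omega>) * indicator A \<omega>))"
      using integrable_real_mult_indicator[OF AM] by simp
    have z: "(\<integral>\<omega>. c * ((L (max b s) \<omega> - L (max a s) \<omega>) * indicator A \<omega>) \<partial>M) = 0"
      using increment_orthogonal_past_sigma[OF ab(1,2) A] by simp
    have eq: "step_integral L (steps_after s (x # xs)) \<omega> * indicator A \<omega>
      = c * ((L (max b s) \<omega> - L (max a s) \<omega>) * indicator A \<omega>)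
          + step_integral L (steps_after s xs) \<omega> * indicator A \<omega>" for \<omega>
      by (simp add: x distrib_right)
    show ?case unfolding eq using i z Cons.IH[OF ab(3)] by simp
  qed simp
  then show "(\<integral>\<omega>. step_integral L (steps_after s xs) \<omega> * indicator A \<omega> \<partial>M) = 0"
    "integrable M (\<lambda>\<omega>. step_integral L (steps_after s xs) \<omega> * indicator A \<omega>)" by auto
qed

section \<open>Recognising stochastic integrals by their inner products\<close>

lemma nn_integral_square_eq:
  assumes "square_integrable N (p :: 'z \<Rightarrow> real)"
  shows "(\<integral>\<^sup>+x. ennreal ((norm (p x))\<^sup>2) \<partial>N) = ennreal (\<integral>x. (p x)\<^sup>2 \<partial>N)"
  using assms by (subst nn_integral_eq_integral) (auto simp: square_integrable_def)

lemma square_integrable_expand_diff: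
  fixes p q :: "'z \<Rightarrow> real"
  assumes p: "square_integrable N p" and q: "square_integrable N q"
  shows "(\<integral>x. (p x - q x)\<^sup>2 \<partial>N) = (\<integral>x. p x * p x \<partial>N) + (\<integral>x. q x * q x \<partial>N) - 2 * (\<integral>x. q x * p x \<partial>N)"
proof -
  note i = square_integrable_mult[OF p p] square_integrable_mult[OF q q] square_integrable_mult[OF q p]
  have eq: "(p x - q x)\<^sup>2 = p x * p x + q x * q x - 2 * (q x * p x)" for x
    by (simp add: power2_eq_square algebra_simps)
  show ?thesis unfolding eq using i by simp
qed

text \<open>A squared distance is determined by two norms and one inner product, and all three agree
  on the two sides.\<close>

lemma step_distance:
  assumes f: "square_integrable lborel f" and R: "square_integrable M R"
    and norm: "(\<integral>\<omega>. R \<omega> * R \<omega> \<partial>M) = (\<integral>u. f u * f u \<partial>lborel)"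
    and cross: "(\<integral>\<omega>. R \<omega> * step_integral L xs \<omega> \<partial>M) = (\<integral>u. f u * step_fun xs u \<partial>lborel)"
    and xs: "valid_steps xs"
  shows "(\<integral>\<^sup>+\<omega>. ennreal ((norm (step_integral L xs \<omega> - R \<omega>))\<^sup>2) \<partial>M)
      = (\<integral>\<^sup>+u. ennreal ((norm (step_fun xs u - f u))\<^sup>2) \<partial>lborel)"
proof -
  note s1 = step_fun_square_integrable[OF xs] and s2 = step_integral_square_integrable[OF xs]
  have "(\<integral>\<omega>. (step_integral L xs \<omega> - R \<omega>)\<^sup>2 \<partial>M) = (\<integral>u. (step_fun xs u - f u)\<^sup>2 \<partial>lborel)"
    using square_integrable_expand_diff[OF s1 f] square_integrable_expand_diff[OF s2 R]
      norm cross step_isometry[OF xs xs] by simp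
  then show ?thesis
    using nn_integral_square_eq[OF square_integrable_diff[OF s1 f]] nn_integral_square_eq[OF
        square_integrable_diff[OF s2 R]]
    by simp
qed

text \<open>A candidate with the norm of \<open>f\<close> and the correct inner products with all
  step integrals has the same distances to them as \<open>f\<close> to the step functions. Any
  sequence approximating \<open>f\<close> therefore approximates the candidate, which need not be
  constructed as a limit.\<close>

lemma levy_integral_criterion:
  assumes f: "square_integrable lborel f" and R: "square_integrable M R"
    and norm: "(\<integral>\<omega>. R \<omega> * R \<omega> \<partial>M) = (\<integral>u. f u * f u \<partial>lborel)"
    and cross: "\<And>xs. valid_steps xs \<Longrightarrow> (\<integral>\<omega>. R \<omega> * step_integral L xs \<omega> \<partial>M) = (\<integral>u. f u * step_fun xs u \<partial>lborel)"
    and \<phi>: "\<And>n. valid_steps (\<phi> n)" "tendsto_L2 lborel (\<lambda>n. step_fun (\<phi> n)) f"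
  shows "tendsto_L2 M (\<lambda>n. step_integral L (\<phi> n)) R" "has_levy_integral M L f R"
proof -
  show lim: "tendsto_L2 M (\<lambda>n. step_integral L (\<phi> n)) R"
    using \<phi>(2) unfolding tendsto_L2_def step_distance[OF f R norm cross[OF \<phi>(1)] \<phi>(1)] .
  have "\<forall>n. \<forall>(c, a, b)\<in>set (\<phi> n). a \<le> b" using \<phi>(1) by (simp add: valid_steps_def)
  then show "has_levy_integral M L f R"
    unfolding has_levy_integral_def using f R \<phi>(2) lim by blast
qed

lemma tendsto_L2_steps_before:
  assumes "tendsto_L2 lborel (\<lambda>n. step_fun (\<phi> n)) f"
  shows "tendsto_L2 lborel (\<lambda>n. step_fun (steps_before s (\<phi> n))) (\<lambda>u. indicator {..s} u * f u)"
  unfolding tendsto_L2_def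
proof (rule tendsto_sandwich[OF _ _ tendsto_const assms[unfolded tendsto_L2_def]])
  show "eventually (\<lambda>n. (\<integral>\<^sup>+u. ennreal ((norm (step_fun (steps_before s (\<phi> n)) u - indicator {..s} u * f u))\<^sup>2) \<partial>lborel)
    \<le> (\<integral>\<^sup>+u. ennreal ((norm (step_fun (\<phi> n) u - f u))\<^sup>2) \<partial>lborel)) sequentially"
    by (intro always_eventually allI nn_integral_mono) (auto simp: step_fun_before split: split_indicator)
qed simp

lemma levy_integral_approx:
  assumes Y: "has_levy_integral M L f Y" and \<phi>: "\<And>n. valid_steps (\<phi> n)" "tendsto_L2 lborel (\<lambda>n. step_fun (\<phi> n)) f"
  shows "tendsto_L2 M (\<lambda>n. step_integral L (\<phi> n)) Y"
  by (rule levy_integral_criterion(1)[OF _ _ levy_integral_isometry[OF Y Y] levy_integral_step[OF Y] \<phi>])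
    (use Y in \<open>auto simp: has_levy_integral_def\<close>)

lemma levy_integral_stepsE:
  assumes "has_levy_integral M L f Y"
  obtains \<phi> where "\<And>n. valid_steps (\<phi> n)" "tendsto_L2 lborel (\<lambda>n. step_fun (\<phi> n)) f"
    "tendsto_L2 M (\<lambda>n. step_integral L (\<phi> n)) Y"
  using assms unfolding has_levy_integral_def valid_steps_def by blast

lemma step_integral_before_past_sigma:
  "(\<lambda>\<omega>. step_integral L' (steps_before s xs) \<omega>) \<in> borel_measurable (past_sigma s)"
proof (induction xs)
  case (Cons x xs)
  obtain c a b where x: "x = (c, a, b)" by (cases x)
  have "(\<lambda>\<omega>. c * (L' (min b s) \<omega> - L' (min a s) \<omega>) + step_integral L' (steps_before s xs) \<omega>) \<in> borel_measurable
      (past_sigma s)"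
    by (intro borel_measurable_add borel_measurable_times borel_measurable_const L'_increment_past_sigma Cons.IH) auto
  then show ?case by (simp add: x step_integral_def)
qed (simp add: step_integral_def)

lemma AE_step_integral_L': "AE \<omega> in M. step_integral L xs \<omega> = step_integral L' xs \<omega>"
proof (induction xs)
  case (Cons x xs)
  obtain c a b where x: "x = (c, a, b)" by (cases x)
  show ?case using Cons.IH L_eq_L'[of a] L_eq_L'[of b]
    by eventually_elim (simp add: x step_integral_def)
qed (simp add: step_integral_def)

text \<open>The approximating steps may be truncated at \<open>s\<close>, since \<open>f\<close>
  vanishes afterwards. A subsequence converges almost surely, and with \<open>L'\<close> in place of
  \<open>L\<close> each of its members depends on past increments only.\<close>

lemma levy_integral_past_measurable:
  assumes Y: "has_levy_integral M L f Y" and f: "\<And>u. s < u \<Longrightarrow> f u = 0"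
  obtains Y' where "Y' \<in> borel_measurable (past_sigma s)" "AE \<omega> in M. Y \<omega> = Y' \<omega>"
proof -
  obtain \<phi> where \<phi>: "\<And>n. valid_steps (\<phi> n)" "tendsto_L2 lborel (\<lambda>n. step_fun (\<phi> n)) f"
    using levy_integral_stepsE[OF Y] by metis
  define \<psi> where "\<psi> n = steps_before s (\<phi> n)" for n
  have \<psi>: "valid_steps (\<psi> n)" for n unfolding \<psi>_def by (rule valid_steps_before[OF \<phi>(1)])
  have fs: "(\<lambda>u. indicator {..s} u * f u) = f" using f by (auto split: split_indicator)
  have "tendsto_L2 lborel (\<lambda>n. step_fun (\<psi> n)) f"
    using tendsto_L2_steps_before[OF \<phi>(2), of s] unfolding \<psi>_def fs .
  from levy_integral_approx[OF Y \<psi> this]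
  have lim: "tendsto_L2 M (\<lambda>n. step_integral L (\<psi> n)) Y" .
  have Y2: "square_integrable M Y" using Y by (simp add: has_levy_integral_def)
  note sq = square_integrable_diff[OF step_integral_square_integrable[OF \<psi>] Y2]
  have "(\<lambda>n. \<integral>\<omega>. norm ((step_integral L (\<psi> n) \<omega> - Y \<omega>)\<^sup>2) \<partial>M) \<longlonglongrightarrow> 0"
  proof -
    have "(\<lambda>n. ennreal (\<integral>\<omega>. (step_integral L (\<psi> n) \<omega> - Y \<omega>)\<^sup>2 \<partial>M)) \<longlonglongrightarrow> ennreal 0"
      using lim unfolding tendsto_L2_def nn_integral_square_eq[OF sq] by simp
    then have "(\<lambda>n. (\<integral>\<omega>. (step_integral L (\<psi> n) \<omega> - Y \<omega>)\<^sup>2 \<partial>M)) \<longlonglongrightarrow> 0"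
      by (subst (asm) tendsto_ennreal_iff) auto
    then show ?thesis by simp
  qed
  moreover have "integrable M (\<lambda>\<omega>. (step_integral L (\<psi> n) \<omega> - Y \<omega>)\<^sup>2)" for n
    using sq[of n] by (simp add: square_integrable_def)
  ultimately obtain r :: "nat \<Rightarrow> nat" where r: "AE \<omega> in M. (\<lambda>n. (step_integral L (\<psi> (r n)) \<omega> - Y \<omega>)\<^sup>2) \<longlonglongrightarrow> 0"
    using tendsto_L1_AE_subseq[of M "\<lambda>n \<omega>. (step_integral L (\<psi> n) \<omega> - Y \<omega>)\<^sup>2"] by blast
  \<comment> \<open>\<open>lim\<close> is a measurable function even on the null set where the
    sequence diverges, so \<open>Y'\<close> is exactly measurable and only its equality with
    \<open>Y\<close> is almost sure.\<close>
  define Y' where "Y' \<omega> = lim (\<lambda>n. step_integral L' (\<psi> (r n)) \<omega>)" for \<omega>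
  show ?thesis
  proof
    show "Y' \<in> borel_measurable (past_sigma s)"
      unfolding Y'_def \<psi>_def by (rule borel_measurable_lim_metric[OF step_integral_before_past_sigma])
    have "AE \<omega> in M. \<forall>n. step_integral L (\<psi> (r n)) \<omega> = step_integral L' (\<psi> (r n)) \<omega>"
      using AE_step_integral_L' by (subst AE_all_countable) blast
    with r show "AE \<omega> in M. Y \<omega> = Y' \<omega>"
    proof eventually_elim
      case (elim \<omega>)
      then have "(\<lambda>n. (step_integral L' (\<psi> (r n)) \<omega> - Y \<omega>)\<^sup>2) \<longlonglongrightarrow> 0" by simp
      then have "(\<lambda>n. step_integral L' (\<psi> (r n)) \<omega> - Y \<omega>) \<longlonglongrightarrow> 0"
        using tendsto_real_sqrt tendsto_rabs_zero_cancel by force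
      then have "(\<lambda>n. step_integral L' (\<psi> (r n)) \<omega>) \<longlonglongrightarrow> Y \<omega>" by (simp add: LIM_zero_iff)
      then show ?case unfolding Y'_def by (simp add: limI)
    qed
  qed
qed

text \<open>Each \<open>X u\<close> is only almost surely equal to a variable measurable for past
  increments, so the inclusion of the sigma-algebras holds modulo null sets. Being almost everywhere
  equal to a set of \<open>past_sigma s\<close> is stable under complements and countable unions,
  which carries the property from the generators to all sets.\<close>

lemma past_algebra_past_sigma:
  assumes X: "\<And>u. u \<le> s \<Longrightarrow> has_levy_integral M L (G u) (X u)" "\<And>u v. u \<le> s \<Longrightarrow> u < v \<Longrightarrow> G u v = 0"
    and A: "A \<in> sets (past_algebra M X s)"
  obtains B where "B \<in> sets (past_sigma s)" "AE \<omega> in M. \<omega> \<in> A \<longleftrightarrow> \<omega> \<in> B"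
proof -
  have "A \<in> sigma_sets (space M) (\<Union>u\<in>{..s}. {X u -` A \<inter> space M | A. A \<in> sets borel})"
    using A unfolding past_algebra_def by (subst (asm) sets_measure_of) auto
  then have "\<exists>B\<in>sets (past_sigma s). AE \<omega> in M. \<omega> \<in> A \<longleftrightarrow> \<omega> \<in> B"
  proof (induction rule: sigma_sets.induct)
    case (Basic A)
    then obtain u C where u: "u \<le> s" "A = X u -` C \<inter> space M" "C \<in> sets borel" by blast
    have "G u v = 0" if "s < v" for v using that u(1) by (intro X(2)) auto
    from levy_integral_past_measurable[OF X(1)[OF u(1)] this]
    obtain Y where Y: "Y \<in> borel_measurable (past_sigma s)" "AE \<omega> in M. X u \<omega> = Y \<omega>" by metis
    have "Y -` C \<inter> space M \<in> sets (past_sigma s)" using measurable_sets[OF Y(1) u(3)] by simp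
    moreover have "AE \<omega> in M. \<omega> \<in> A \<longleftrightarrow> \<omega> \<in> Y -` C \<inter> space M"
      using Y(2) AE_space by eventually_elim (simp add: u(2))
    ultimately show ?case by blast
  next
    case Empty
    show ?case by (rule bexI[of _ "{}"]) auto
  next
    case (Compl A)
    then obtain B where B: "B \<in> sets (past_sigma s)" "AE \<omega> in M. \<omega> \<in> A \<longleftrightarrow> \<omega> \<in> B" by blast
    have "space M - B \<in> sets (past_sigma s)" using sets.compl_sets[OF B(1)] by simp
    moreover have "AE \<omega> in M. \<omega> \<in> space M - A \<longleftrightarrow> \<omega> \<in> space M - B"
      using B(2) by eventually_elim simp
    ultimately show ?case by blast
  next
    case (Union A)
    then have "\<forall>i. \<exists>B. B \<in> sets (past_sigma s) \<and> (AE \<omega> in M. \<omega> \<in> A i \<longleftrightarrow> \<omega> \<in> B)" by blast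
    then obtain B where B: "\<And>i. B i \<in> sets (past_sigma s)" "\<And>i. AE \<omega> in M. \<omega> \<in> A i \<longleftrightarrow> \<omega> \<in> B i" by metis
    have "AE \<omega> in M. \<forall>i::nat. \<omega> \<in> A i \<longleftrightarrow> \<omega> \<in> B i" using B(2) by (subst AE_all_countable) blast
    then have "AE \<omega> in M. \<omega> \<in> (\<Union>i. A i) \<longleftrightarrow> \<omega> \<in> (\<Union>i. B i)" by eventually_elim auto
    moreover have "(\<Union>i. B i) \<in> sets (past_sigma s)" using B(1) by blast
    ultimately show ?case by blast
  qed
  then show ?thesis using that by blast
qed

text \<open>On approximating step functions the two integrals differ by increments after
  \<open>s\<close>, which are orthogonal to every event of the past; the limit keeps this.\<close>

lemma levy_integral_projection:
  assumes Y: "has_levy_integral M L f Y" and R: "has_levy_integral M L (\<lambda>u. indicator {..s} u * f u) R"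
    and A: "A \<in> sets (past_sigma s)"
  shows "(\<integral>\<omega>. Y \<omega> * indicator A \<omega> \<partial>M) = (\<integral>\<omega>. R \<omega> * indicator A \<omega> \<partial>M)"
proof -
  obtain \<phi> where \<phi>: "\<And>n. valid_steps (\<phi> n)" "tendsto_L2 lborel (\<lambda>n. step_fun (\<phi> n)) f"
    "tendsto_L2 M (\<lambda>n. step_integral L (\<phi> n)) Y"
    using levy_integral_stepsE[OF Y] by metis
  define \<psi> where "\<psi> n = steps_before s (\<phi> n)" for n
  have \<psi>: "valid_steps (\<psi> n)" for n unfolding \<psi>_def by (rule valid_steps_before[OF \<phi>(1)])
  have lim: "tendsto_L2 M (\<lambda>n. step_integral L (\<psi> n)) R"
    by (rule levy_integral_approx[OF R \<psi>]) (simp add: \<psi>_def tendsto_L2_steps_before[OF \<phi>(2)])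
  have AM [measurable]: "A \<in> sets M" using A subalgebra_past_sigma by (auto simp: subalgebra_def)
  have A2: "square_integrable M (indicator A :: 'a \<Rightarrow> real)"
    unfolding square_integrable_def by (auto intro!: integrable_const_bound[where B = 1] split: split_indicator)
  have sq: "square_integrable M Y" "square_integrable M R" using Y R by (auto simp: has_levy_integral_def)
  have "(\<lambda>n. \<integral>\<omega>. step_integral L (\<phi> n) \<omega> * indicator A \<omega> \<partial>M) \<longlonglongrightarrow> (\<integral>\<omega>. Y \<omega> * indicator A \<omega> \<partial>M)"
    by (intro tendsto_L2_integral_mult step_integral_square_integrable \<phi> sq A2)
  moreover have "(\<lambda>n. \<integral>\<omega>. step_integral L (\<psi> n) \<omega> * indicator A \<omega> \<partial>M) \<longlonglongrightarrow> (\<integral>\<omega>. R \<omega> * indicator A \<omega> \<partial>M)"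
    by (intro tendsto_L2_integral_mult step_integral_square_integrable \<psi> lim sq A2)
  moreover have "(\<integral>\<omega>. step_integral L (\<phi> n) \<omega> * indicator A \<omega> \<partial>M)
      = (\<integral>\<omega>. step_integral L (\<psi> n) \<omega> * indicator A \<omega> \<partial>M)" for n
  proof -
    note o = steps_after_orthogonal[OF A \<phi>(1)[of n]]
    have eq: "step_integral L (\<phi> n) \<omega> * indicator A \<omega>
      = step_integral L (\<psi> n) \<omega> * indicator A \<omega> + step_integral L (steps_after s (\<phi> n)) \<omega> * indicator A \<omega>" for \<omega>
      unfolding \<psi>_def by (subst step_integral_split[of _ _ s]) (simp add: distrib_right)
    show ?thesis
      unfolding eq using o square_integrable_mult[OF step_integral_square_integrable[OF \<psi>] A2] by simp
  qed
  ultimately show ?thesis using LIMSEQ_unique by simp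
qed

text \<open>A stochastic Fubini theorem obtained from the isometry: Fubini expresses the inner
  products of the mixture by those of the \<open>X w\<close>, and the same formula holds for the
  mixture of the kernels \<open>G w\<close>, so the criterion by inner products applies.\<close>

lemma levy_integral_mixture:
  fixes G :: "real \<Rightarrow> real \<Rightarrow> real"
  assumes X: "\<And>w. has_levy_integral M L (G w) (X w)"
    and Xm: "(\<lambda>(w, \<omega>). X w \<omega>) \<in> borel_measurable (borel \<Otimes>\<^sub>M M)"
    and Gm: "(\<lambda>(w, u). G w u) \<in> borel_measurable (borel \<Otimes>\<^sub>M lborel)"
    and B: "\<And>w. (\<integral>u. G w u * G w u \<partial>lborel) \<le> B"
    and K: "integrable lborel K"
    and f: "\<And>u. f u = c * G r u + (\<integral>w. G w u * K w \<partial>lborel)"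
    and \<phi>: "\<And>n. valid_steps (\<phi> n)" "tendsto_L2 lborel (\<lambda>n. step_fun (\<phi> n)) f"
  shows "has_levy_integral M L f (\<lambda>\<omega>. c * X r \<omega> + (\<integral>w. X w \<omega> * K w \<partial>lborel))"
proof -
  let ?R = "\<lambda>\<omega>. c * X r \<omega> + (\<integral>w. X w \<omega> * K w \<partial>lborel)"
  have feq: "f = (\<lambda>u. c * G r u + (\<integral>w. G w u * K w \<partial>lborel))" using f by blast
  have sq: "square_integrable lborel (G w)" "square_integrable M (X w)" for w
    using X[of w] by (auto simp: has_levy_integral_def)
  have iso: "(\<integral>\<omega>. X w \<omega> * X v \<omega> \<partial>M) = (\<integral>u. G w u * G v u \<partial>lborel)" for w v
    by (rule levy_integral_isometry[OF X X])
  have GB: "(\<integral>\<^sup>+u. ennreal ((G w u)\<^sup>2) \<partial>lborel) \<le> ennreal B" for w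
    using nn_integral_square_eq[OF sq(1), of w] B[of w] by (simp add: power2_eq_square ennreal_leI)
  have XB: "(\<integral>\<^sup>+\<omega>. ennreal ((X w \<omega>)\<^sup>2) \<partial>M) \<le> ennreal B" for w
    using nn_integral_square_eq[OF sq(2), of w] B[of w] iso[of w w] by (simp add: power2_eq_square ennreal_leI)
  note mM = square_integrable_integral_bound[OF sigma_finite_measure_axioms Xm XB K]
    and mL = square_integrable_integral_bound[OF lborel.sigma_finite_measure_axioms Gm GB K]
  have R: "square_integrable M ?R"
    by (intro square_integrable_add square_integrable_mult_left sq mM(1)[OF sq(2)])
  have f2: "square_integrable lborel f"
    unfolding feq by (intro square_integrable_add square_integrable_mult_left sq mL(1)[OF sq(1)])
  have key: "(\<integral>\<omega>. ?R \<omega> * Z \<omega> \<partial>M) = (\<integral>u. f u * z u \<partial>lborel)"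
    if Z: "square_integrable M Z" "square_integrable lborel z"
      and eq: "\<And>w. (\<integral>\<omega>. X w \<omega> * Z \<omega> \<partial>M) = (\<integral>u. G w u * z u \<partial>lborel)" for Z z
  proof -
    have "(\<integral>\<omega>. ?R \<omega> * Z \<omega> \<partial>M) = (\<integral>\<omega>. c * (X r \<omega> * Z \<omega>) + (\<integral>w. X w \<omega> * K w \<partial>lborel) * Z \<omega> \<partial>M)"
      by (simp add: distrib_right mult.assoc)
    also have "\<dots> = c * (\<integral>\<omega>. X r \<omega> * Z \<omega> \<partial>M) + (\<integral>\<omega>. (\<integral>w. X w \<omega> * K w \<partial>lborel) * Z \<omega> \<partial>M)"
      using square_integrable_mult[OF sq(2)[of r] Z(1)] square_integrable_mult[OF mM(1)[OF Z(1)] Z(1)] by simp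
    also have "\<dots> = c * (\<integral>u. G r u * z u \<partial>lborel) + (\<integral>u. (\<integral>w. G w u * K w \<partial>lborel) * z u \<partial>lborel)"
      unfolding mM(2)[OF Z(1)] mL(2)[OF Z(2)] eq ..
    also have "\<dots> = (\<integral>u. c * (G r u * z u) + (\<integral>w. G w u * K w \<partial>lborel) * z u \<partial>lborel)"
      using square_integrable_mult[OF sq(1)[of r] Z(2)] square_integrable_mult[OF mL(1)[OF Z(2)] Z(2)] by simp
    also have "\<dots> = (\<integral>u. f u * z u \<partial>lborel)"
      by (simp add: f distrib_right mult.assoc)
    finally show ?thesis .
  qed
  \<comment> \<open>Inner products with the single \<open>X w\<close> come first: they are the
    hypothesis for testing the mixture against itself, which yields its norm.\<close>
  have RX: "(\<integral>\<omega>. ?R \<omega> * X w \<omega> \<partial>M) = (\<integral>u. f u * G w u \<partial>lborel)" for w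
    by (rule key[OF sq(2,1) iso])
  have "(\<integral>\<omega>. ?R \<omega> * ?R \<omega> \<partial>M) = (\<integral>u. f u * f u \<partial>lborel)"
    by (rule key[OF R f2]) (subst (1 2) mult.commute, rule RX)
  then show ?thesis
    by (rule levy_integral_criterion(2)[OF f2 R _ _ \<phi>])
      (rule key[OF step_integral_square_integrable step_fun_square_integrable levy_integral_step[OF X]])
qed

end

section \<open>The conditional expectation\<close>

context sfdde_volterra begin

definition \<Lambda> :: "real \<Rightarrow> real \<Rightarrow> real \<Rightarrow> real" where
  "\<Lambda> T w u = indicator {0..<T} u * \<rho> u * (indicator {..0} w * \<kappa> (T - u) w)"

lemma \<Lambda>_integrable: "integrable (lborel \<Otimes>\<^sub>M lborel) (\<lambda>(w, u). \<Lambda> T w u)"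
  using lborel_pair.integrable_product_swap[OF prediction_kernel_pair_integrable[of T]]
  by (simp add: \<Lambda>_def)

lemma prediction_kernel_\<Lambda>: "prediction_kernel T w = indicator {..0} w * \<kappa> T w + (\<integral>u. \<Lambda> T w u \<partial>lborel)"
  by (simp add: prediction_kernel_def \<Lambda>_def)

lemma \<Lambda>_majorant_integrable: "integrable lborel (\<lambda>w. \<integral>u. \<bar>\<Lambda> T w u\<bar> \<partial>lborel)"
  using lborel_pair.integrable_fst'[OF integrable_abs[OF \<Lambda>_integrable[of T]]] by simp

text \<open>\<open>h\<close> is left general because it becomes a translate of \<open>g\<close> for
  the kernel identity and a path of \<open>X\<close> for the formula itself. A path need not be
  bounded, so integrability against the majorant is a hypothesis.\<close>

lemma prediction_kernel_fubini:
  assumes h: "h \<in> borel_measurable borel"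
    and h1: "integrable lborel (\<lambda>w. h w * (indicator {..0} w * \<kappa> T w))"
    and h2: "integrable lborel (\<lambda>w. h w * (\<integral>u. \<bar>\<Lambda> T w u\<bar> \<partial>lborel))"
  shows "(\<integral>w. h w * prediction_kernel T w \<partial>lborel) = (\<integral>w. h w * (indicator {..0} w * \<kappa> T w) \<partial>lborel)
    + (\<integral>u. indicator {0..<T} u * \<rho> u * (\<integral>w. h w * (indicator {..0} w * \<kappa> (T - u) w) \<partial>lborel) \<partial>lborel)"
proof -
  note [measurable] = h
  have \<Lambda>m [measurable]: "(\<lambda>(w, u). \<Lambda> T w u) \<in> borel_measurable (borel \<Otimes>\<^sub>M borel)"
    using borel_measurable_integrable[OF \<Lambda>_integrable[of T]] by measurable
  have int: "integrable (lborel \<Otimes>\<^sub>M lborel) (\<lambda>(w, u). h w * \<Lambda> T w u)"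
  proof (rule lborel_pair.Fubini_integrable)
    have "AE w in lborel. integrable lborel (\<lambda>u. \<Lambda> T w u)"
      using lborel_pair.AE_integrable_fst'[OF \<Lambda>_integrable[of T]] by simp
    then show "AE w in lborel. integrable lborel (\<lambda>u. case (w, u) of (w, u) \<Rightarrow> h w * \<Lambda> T w u)"
      by eventually_elim simp
    have eq: "(\<integral>u. norm (case (w, u) of (w, u) \<Rightarrow> h w * \<Lambda> T w u) \<partial>lborel) = norm (h w * (\<integral>u. \<bar>\<Lambda> T w u\<bar> \<partial>lborel))" for w
      by (simp add: abs_mult)
    show "integrable lborel (\<lambda>w. \<integral>u. norm (case (w, u) of (w, u) \<Rightarrow> h w * \<Lambda> T w u) \<partial>lborel)"
      unfolding eq by (rule integrable_norm[OF h2])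
  qed measurable
  have i: "integrable lborel (\<lambda>w. h w * (\<integral>u. \<Lambda> T w u \<partial>lborel))"
    using lborel_pair.integrable_fst'[OF int] by simp
  have "(\<integral>w. h w * prediction_kernel T w \<partial>lborel)
    = (\<integral>w. h w * (indicator {..0} w * \<kappa> T w) + h w * (\<integral>u. \<Lambda> T w u \<partial>lborel) \<partial>lborel)"
    unfolding prediction_kernel_\<Lambda> distrib_left ..
  also have "\<dots> = (\<integral>w. h w * (indicator {..0} w * \<kappa> T w) \<partial>lborel) + (\<integral>w. h w * (\<integral>u. \<Lambda> T w u \<partial>lborel) \<partial>lborel)"
    by (rule Bochner_Integration.integral_add[OF h1 i])
  also have "(\<integral>w. h w * (\<integral>u. \<Lambda> T w u \<partial>lborel) \<partial>lborel) = (\<integral>w. (\<integral>u. h w * \<Lambda> T w u \<partial>lborel) \<partial>lborel)"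
    by simp
  also have "\<dots> = (\<integral>u. (\<integral>w. h w * \<Lambda> T w u \<partial>lborel) \<partial>lborel)"
    using lborel_pair.Fubini_integral[OF int] by simp
  also have "\<dots> = (\<integral>u. indicator {0..<T} u * \<rho> u * (\<integral>w. h w * (indicator {..0} w * \<kappa> (T - u) w) \<partial>lborel) \<partial>lborel)"
    unfolding \<Lambda>_def mult.left_commute[of "h _" "indicator _ _ * \<rho> _"] by simp
  finally show ?thesis .
qed

lemma prediction_kernel_identity:
  assumes x: "0 \<le> x" and T: "0 < T"
  shows "g T * g x + (\<integral>w. g (w + x) * prediction_kernel T w \<partial>lborel) = g (x + T)"
proof -
  obtain C where C: "\<And>y. 0 \<le> y \<Longrightarrow> y \<le> x \<Longrightarrow> \<bar>g y\<bar> \<le> C"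
    using continuous_on_nonneg_bounded[OF g_cont g_neg, of x] by metis
  have C0: "0 \<le> C" using C[of 0] x by simp
  \<comment> \<open>The prediction kernel lives on \<open>w \<le> 0\<close>, where only values of
    \<open>g\<close> up to \<open>x\<close> occur.\<close>
  have bound: "\<bar>g (w + x)\<bar> \<le> C" if "w \<le> 0" for w
    using C[of "w + x"] g_neg[of "w + x"] C0 that by (cases "w + x < 0") auto
  have gb: "integrable lborel (\<lambda>w. g (w + x) * K w)"
    if K: "integrable lborel K" "\<And>w. 0 < w \<Longrightarrow> K w = 0" for K
  proof (rule Bochner_Integration.integrable_bound)
    show "integrable lborel (\<lambda>w. C * K w)" using K(1) by simp
    show "AE w in lborel. norm (g (w + x) * K w) \<le> norm (C * K w)"
    proof (rule AE_I2)
      fix w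
      show "norm (g (w + x) * K w) \<le> norm (C * K w)"
        using bound[of w] K(2)[of w] C0 by (cases "w \<le> 0") (auto simp: abs_mult intro: mult_right_mono)
    qed
    have [measurable]: "K \<in> borel_measurable borel" using K(1) by simp
    show "(\<lambda>w. g (w + x) * K w) \<in> borel_measurable lborel" by measurable
  qed
  have "(\<integral>w. g (w + x) * prediction_kernel T w \<partial>lborel) = (\<integral>w. g (w + x) * (indicator {..0} w * \<kappa> T w) \<partial>lborel)
    + (\<integral>u. indicator {0..<T} u * \<rho> u * (\<integral>w. g (w + x) * (indicator {..0} w * \<kappa> (T - u) w) \<partial>lborel) \<partial>lborel)"
  proof (rule prediction_kernel_fubini)
    show "(\<lambda>w. g (w + x)) \<in> borel_measurable borel" by measurable
    show "integrable lborel (\<lambda>w. g (w + x) * (indicator {..0} w * \<kappa> T w))"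
      by (rule gb[OF \<kappa>_integrable]) (use T in auto)
    show "integrable lborel (\<lambda>w. g (w + x) * (\<integral>u. \<bar>\<Lambda> T w u\<bar> \<partial>lborel))"
      by (rule gb[OF \<Lambda>_majorant_integrable]) (simp add: \<Lambda>_def)
  qed
  moreover have "(\<integral>w. g (w + x) * (indicator {..0} w * \<kappa> c w) \<partial>lborel)
      = (\<integral>w. indicator {..0} w * \<kappa> c w * g (w + x) \<partial>lborel)" for c
    by (simp add: mult.commute)
  ultimately show ?thesis using kernel_identity[OF x T] by simp
qed

lemma prediction_kernel_pos: "0 < w \<Longrightarrow> prediction_kernel T w = 0"
  by (simp add: prediction_kernel_def)

end

lemma signed_integral_right_derivative:
  assumes rep: "\<And>f. f \<in> borel_measurable borel \<Longrightarrow> signed_integral borel_nonneg \<eta> f = (\<integral>v. f v \<partial>P) - (\<integral>v. f v \<partial>N :: real)"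
  shows "signed_integral borel_nonneg \<eta> (\<lambda>v. right_derivative_indicator b s t (v + w))
    = (\<integral>v. right_derivative_indicator b 0 (t - s) (v + (w - s)) \<partial>P)
    - (\<integral>v. right_derivative_indicator b 0 (t - s) (v + (w - s)) \<partial>N)"
proof -
  have "right_derivative_indicator b s t (v + w) = right_derivative_indicator b 0 (t - s) (v + (w - s))" for v
    by (simp add: right_derivative_indicator_def algebra_simps)
  then show ?thesis using rep[of "\<lambda>v. right_derivative_indicator b s t (v + w)"] by simp
qed

section \<open>Integrals against the measure induced by the kernel\<close>

context sfdde_volterra begin

context
  fixes \<eta> :: "real set \<Rightarrow> real"
  assumes rep: "\<And>f. f \<in> borel_measurable borel \<Longrightarrow> signed_integral borel_nonneg \<eta> f = (\<integral>v. f v \<partial>P) - (\<integral>v. f v \<partial>N :: real)"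
begin

lemma convolution_f: "convolution f \<eta> u = \<rho> u"
proof -
  have "(\<lambda>v. f (u - v)) \<in> borel_measurable borel" by measurable
  then show ?thesis using rep by (simp add: convolution_def \<rho>_def)
qed

text \<open>The atom contributes 1 and the density its primitive \<open>g r - 1\<close>, which
  justifies calling the measure the one induced by \<open>g\<close>.\<close>

lemma kernel_integral_one:
  assumes r: "0 \<le> r"
  shows "kernel_integral b \<eta> g {0..r} (\<lambda>_. 1) = g r"
proof -
  have eq: "indicator {0..r} u *\<^sub>R (1 * \<rho> u) = indicator {..r} u * \<rho> u" for u
    using \<rho>_neg[of u] by (auto simp: indicator_def)
  have "(LINT u:{0..r}|lborel. 1 * convolution f \<eta> u) = g r - 1"
    unfolding convolution_f set_lebesgue_integral_def eq by (rule \<rho>_primitive[OF r])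
  moreover have "(LINT u:{0..r}|return borel 0. (1 :: real)) = 1"
    unfolding set_lebesgue_integral_def by (subst integral_return) (use r in auto)
  ultimately show ?thesis by (simp add: kernel_integral_def)
qed

text \<open>The atom at \<open>u = 0\<close> produces the first term of the prediction kernel, the
  density \<open>\<rho>\<close> the second. A path of \<open>X\<close> enters as \<open>h\<close>,
  shifted so that \<open>s\<close> becomes the origin.\<close>

lemma kernel_integral_prediction:
  assumes h: "h \<in> borel_measurable borel"
    and h1: "integrable lborel (\<lambda>w. h w * (indicator {..0} w * \<kappa> T w))"
    and h2: "integrable lborel (\<lambda>w. h w * (\<integral>u. \<bar>\<Lambda> T w u\<bar> \<partial>lborel))"
    and T: "0 < T"
  shows "kernel_integral b \<eta> g {0..<T} (\<lambda>u. LINT w:{..s}|lborel. h (w - s) *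
      signed_integral borel_nonneg \<eta> (\<lambda>v. right_derivative_indicator b s (s + T - u) (v + w)))
    = (\<integral>w. h w * prediction_kernel T w \<partial>lborel)"
proof -
  note [measurable] = h
  define H where "H u = (\<integral>w. h w * (indicator {..0} w * \<kappa> (T - u) w) \<partial>lborel)" for u
  have Hm: "H \<in> borel_measurable borel" unfolding H_def by measurable
  have eq: "(LINT w:{..s}|lborel. h (w - s) *
      signed_integral borel_nonneg \<eta> (\<lambda>v. right_derivative_indicator b s (s + T - u) (v + w))) = H u" for u
  proof -
    have e1: "indicator {..s} w *\<^sub>R (h (w - s) * signed_integral borel_nonneg \<eta> (\<lambda>v. right_derivative_indicator b s
        (s + T - u) (v + w)))
      = h (w - s) * (indicator {..0} (w - s) * \<kappa> (T - u) (w - s))" for w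
      using signed_integral_right_derivative[OF rep, of b s "s + T - u" w]
      by (simp add: \<kappa>_def indicator_def)
    show ?thesis
      unfolding set_lebesgue_integral_def e1 H_def
      by (rule integral_shift(3)[of "\<lambda>w. h w * (indicator {..0} w * \<kappa> (T - u) w)"])
  qed
  have r1: "(LINT u:{0..<T}|return borel 0. H u) = H 0"
    unfolding set_lebesgue_integral_def by (subst integral_return) (use T Hm in auto)
  have r2: "(LINT u:{0..<T}|lborel. H u * convolution f \<eta> u) = (\<integral>u. indicator {0..<T} u * \<rho> u * H u \<partial>lborel)"
    by (simp add: set_lebesgue_integral_def convolution_f mult.commute mult.left_commute)
  show ?thesis
    unfolding kernel_integral_def eq r1 r2 prediction_kernel_fubini[OF h h1 h2] by (simp add: H_def)
qed

end

end

section \<open>Conditional expectations of square-integrable variables\<close>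

context prob_space begin

text \<open>The last hypothesis says that \<open>R\<close> lies in the closed span of the \<open>Y\<^sub>i\<close>. For an integral of the form
  \<open>\<integral> X\<^sub>w K(w) dw\<close> this replaces measurability with respect to \<open>G\<close>, which would require \<open>X\<close> to be jointly
  measurable with respect to \<open>G\<close>.\<close>

lemma cond_exp_eq_self:
  assumes G: "subalgebra M G" and R: "square_integrable M R"
    and Y: "\<And>i. i \<in> I \<Longrightarrow> Y i \<in> borel_measurable G" "\<And>i. i \<in> I \<Longrightarrow> square_integrable M (Y i)"
    and orth: "\<And>Z. square_integrable M Z \<Longrightarrow> (\<And>i. i \<in> I \<Longrightarrow> (\<integral>\<omega>. Y i \<omega> * Z \<omega> \<partial>M) = 0) \<Longrightarrow> (\<integral>\<omega>. R \<omega> * Z \<omega> \<partial>M) = (0::real)"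
  shows "AE \<omega> in M. real_cond_exp M G R \<omega> = R \<omega>"
proof -
  interpret G: finite_measure_subalgebra M G by unfold_locales (rule G)
  define E where "E = real_cond_exp M G R"
  have Ri: "integrable M R" by (rule square_integrable_integrable[OF R])
  have EG [measurable]: "E \<in> borel_measurable G" unfolding E_def by simp
  have EM [measurable]: "E \<in> borel_measurable M" by (rule measurable_from_subalg[OF G EG])
  have "integrable M (\<lambda>\<omega>. (E \<omega>)\<^sup>2)"
    unfolding E_def
    by (rule G.integrable_convex_cond_exp[OF Ri, where I = UNIV and q = "\<lambda>x. x\<^sup>2"])
      (use R convex_power2 emeasure_space_1 in \<open>auto simp: square_integrable_def\<close>)
  then have E: "square_integrable M E" by (simp add: square_integrable_def)
  \<comment> \<open>The residual is orthogonal to everything square integrable and measurable for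
    \<open>G\<close>: to \<open>E\<close>, and to the \<open>Y i\<close>, hence by hypothesis to
    \<open>R\<close>. So it is orthogonal to itself.\<close>
  define Z where "Z \<omega> = R \<omega> - E \<omega>" for \<omega>
  have Z: "square_integrable M Z" unfolding Z_def[abs_def] by (rule square_integrable_diff[OF R E])
  have orthG: "(\<integral>\<omega>. V \<omega> * Z \<omega> \<partial>M) = 0" if V: "V \<in> borel_measurable G" "square_integrable M V" for V
  proof -
    have "(\<integral>\<omega>. V \<omega> * E \<omega> \<partial>M) = (\<integral>\<omega>. V \<omega> * R \<omega> \<partial>M)"
      unfolding E_def using R by (intro G.real_cond_exp_intg(2) square_integrable_mult V) (auto simp:
          square_integrable_def)
    then show ?thesis
      using square_integrable_mult[OF V(2) R] square_integrable_mult[OF V(2) E] by (simp add: Z_def right_diff_distrib)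
  qed
  have "(\<integral>\<omega>. R \<omega> * Z \<omega> \<partial>M) = 0" by (rule orth[OF Z]) (intro orthG Y)
  moreover have "(\<integral>\<omega>. E \<omega> * Z \<omega> \<partial>M) = 0" by (rule orthG[OF EG E])
  ultimately have "(\<integral>\<omega>. Z \<omega> * Z \<omega> \<partial>M) = 0"
    using square_integrable_mult[OF R Z] square_integrable_mult[OF E Z] by (simp add: Z_def[of "_"] left_diff_distrib)
  then have "AE \<omega> in M. Z \<omega> * Z \<omega> = 0"
    by (subst (asm) integral_nonneg_eq_0_iff_AE[OF square_integrable_mult[OF Z Z]]) auto
  then show ?thesis by eventually_elim (simp add: Z_def E_def)
qed

lemma two_sided_levyI:
  assumes L: "two_sided_levy_process M L" and L2: "square_integrable M (L 1)"
    and mean: "(\<integral>\<omega>. L 1 \<omega> \<partial>M) = 0" and var: "(\<integral>\<omega>. (L 1 \<omega>)\<^sup>2 \<partial>M) = 1"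
  obtains L1 L2 where "two_sided_levy M L1 L2 L"
proof -
  obtain L1 L2 where l: "levy_process M L1" "levy_process M L2"
    and ind: "indep_var path_space (path L1) path_space (path L2)"
    and d: "distr M path_space (path L1) = distr M path_space (path L2)"
    and eq: "AE \<omega> in M. \<forall>t. L t \<omega> = (if 0 \<le> t then L1 t \<omega> else - Lim (at_left (- t)) (\<lambda>r. L2 r \<omega>))"
    and Lm: "\<And>t. L t \<in> borel_measurable M"
    using L unfolding two_sided_levy_process_def by blast
  have m: "L1 1 \<in> borel_measurable M" "L2 1 \<in> borel_measurable M"
    using levy_process_measurable[OF l(1)] levy_process_measurable[OF l(2)] by auto
  have ae: "AE \<omega> in M. L 1 \<omega> = L1 1 \<omega>" using eq by eventually_elim simp
  have s1: "square_integrable M (L1 1)" by (rule square_integrable_cong_AE[OF Lm m(1) ae L2])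
  have e1: "(\<integral>\<omega>. L1 1 \<omega> \<partial>M) = 0"
    using mean integral_cong_AE[OF Lm m(1) ae] by simp
  have "AE \<omega> in M. (L 1 \<omega>)\<^sup>2 = (L1 1 \<omega>)\<^sup>2" using ae by eventually_elim simp
  then have v1: "(\<integral>\<omega>. (L1 1 \<omega>)\<^sup>2 \<partial>M) = 1"
    using var integral_cong_AE[of "\<lambda>\<omega>. (L 1 \<omega>)\<^sup>2" M "\<lambda>\<omega>. (L1 1 \<omega>)\<^sup>2"] Lm m by simp
  have c: "(\<lambda>x. x 1) \<in> borel_measurable path_space" by (rule measurable_component_singleton) simp
  have p: "path L1 \<in> measurable M path_space" "path L2 \<in> measurable M path_space"
    using ind by (auto dest: indep_var_rv1 indep_var_rv2)
  have "distr (distr M path_space (path L1)) borel (\<lambda>x. x 1) = distr (distr M path_space (path L2)) borel (\<lambda>x. x 1)"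
    by (simp only: d)
  then have "distr M borel (L1 1) = distr M borel (L2 1)"
    by (simp add: distr_distr[OF c p(1)] distr_distr[OF c p(2)] comp_def path_def)
  note dc = square_integrable_distr_cong[OF this m]
  show ?thesis
    by (rule that[of L1 L2], unfold_locales) (use l ind s1 e1 v1 dc Lm eq in auto)
qed

end

lemma subalgebra_past_algebra:
  assumes "\<And>u. X u \<in> borel_measurable M"
  shows "subalgebra M (past_algebra M X s)"
  unfolding subalgebra_def past_algebra_def
  using assms by (auto intro!: sets.sigma_sets_subset measurable_sets simp: space_measure_of_conv sets_measure_of_conv)

lemma past_algebra_measurable:
  assumes "u \<le> s"
  shows "X u \<in> borel_measurable (past_algebra M X s)"
proof (rule measurableI)
  have sub: "(\<Union>u\<in>{..s}. {X u -` A \<inter> space M | A. A \<in> sets borel}) \<subseteq> Pow (space M)" by auto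
  have sp: "space (past_algebra M X s) = space M" unfolding past_algebra_def by (simp add: space_measure_of_conv)
  fix A :: "real set" assume "A \<in> sets borel"
  then show "X u -` A \<inter> space (past_algebra M X s) \<in> sets (past_algebra M X s)"
    unfolding sp unfolding past_algebra_def sets_measure_of[OF sub]
    by (intro sigma_sets.Basic) (use assms in blast)
qed simp

context two_sided_levy begin

text \<open>The mixture \<open>R\<close> is the stochastic integral of \<open>f\<close> cut off at
  \<open>s\<close>. As \<open>K\<close> vanishes after \<open>s\<close>, it lies in the closed span
  of the observed values and is its own conditional expectation, while \<open>Y - R\<close>
  integrates to 0 over every event of the past.\<close>

lemma cond_exp_levy_mixture:
  fixes G :: "real \<Rightarrow> real \<Rightarrow> real"
  assumes X: "\<And>w. has_levy_integral M L (G w) (X w)"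
    and Xm: "(\<lambda>(w, \<omega>). X w \<omega>) \<in> borel_measurable (borel \<Otimes>\<^sub>M M)"
    and Gm: "(\<lambda>(w, u). G w u) \<in> borel_measurable (borel \<Otimes>\<^sub>M lborel)"
    and G0: "\<And>u v. u < v \<Longrightarrow> G u v = 0"
    and B: "\<And>w. (\<integral>u. G w u * G w u \<partial>lborel) \<le> B"
    and K: "integrable lborel K" "\<And>w. s < w \<Longrightarrow> K w = 0"
    and Y: "has_levy_integral M L f Y"
    and f: "\<And>u. indicator {..s} u * f u = c * G s u + (\<integral>w. G w u * K w \<partial>lborel)"
  shows "AE \<omega> in M. real_cond_exp M (past_algebra M X s) Y \<omega> = c * X s \<omega> + (\<integral>w. X w \<omega> * K w \<partial>lborel)"
proof -
  let ?G = "past_algebra M X s"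
  define R where "R \<omega> = c * X s \<omega> + (\<integral>w. X w \<omega> * K w \<partial>lborel)" for \<omega>
  have sq: "square_integrable M (X w)" for w using X[of w] by (simp add: has_levy_integral_def)
  have G: "subalgebra M ?G"
    by (rule subalgebra_past_algebra) (use sq in \<open>simp add: square_integrable_def\<close>)
  interpret G: finite_measure_subalgebra M ?G by unfold_locales (rule G)
  obtain \<phi> where \<phi>: "\<And>n. valid_steps (\<phi> n)" "tendsto_L2 lborel (\<lambda>n. step_fun (\<phi> n)) f"
    using levy_integral_stepsE[OF Y] by metis
  have R: "has_levy_integral M L (\<lambda>u. indicator {..s} u * f u) R"
    unfolding R_def[abs_def]
    by (rule levy_integral_mixture[OF X Xm Gm B K(1) f valid_steps_before[OF \<phi>(1)] tendsto_L2_steps_before[OF \<phi>(2)]])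
  have R2: "square_integrable M R" and Y2: "square_integrable M Y" using R Y by (auto simp: has_levy_integral_def)
  have XB: "(\<integral>\<^sup>+\<omega>. ennreal ((X w \<omega>)\<^sup>2) \<partial>M) \<le> ennreal B" for w
    using nn_integral_square_eq[OF sq, of w] B[of w] levy_integral_isometry[OF X X, of w w]
    by (simp add: power2_eq_square ennreal_leI)
  \<comment> \<open>A variable orthogonal to all \<open>X w\<close> with \<open>w \<le> s\<close> is
    orthogonal to the mixture by Fubini, which is the span condition of
    \<open>cond_exp_eq_self\<close>.\<close>
  have RR: "AE \<omega> in M. real_cond_exp M ?G R \<omega> = R \<omega>"
  proof (rule cond_exp_eq_self[OF G R2, where I = "{..s}" and Y = X])
    fix Z :: "'a \<Rightarrow> real"
    assume Z: "square_integrable M Z" and o: "\<And>w. w \<in> {..s} \<Longrightarrow> (\<integral>\<omega>. X w \<omega> * Z \<omega> \<partial>M) = 0"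
    note b = square_integrable_integral_bound[OF sigma_finite_measure_axioms Xm XB K(1)]
    have "(\<integral>\<omega>. R \<omega> * Z \<omega> \<partial>M) = (\<integral>\<omega>. c * (X s \<omega> * Z \<omega>) + (\<integral>w. X w \<omega> * K w \<partial>lborel) * Z \<omega> \<partial>M)"
      by (simp add: R_def distrib_right mult.assoc)
    also have "\<dots> = c * (\<integral>\<omega>. X s \<omega> * Z \<omega> \<partial>M) + (\<integral>\<omega>. (\<integral>w. X w \<omega> * K w \<partial>lborel) * Z \<omega> \<partial>M)"
      using square_integrable_mult[OF sq[of s] Z] square_integrable_mult[OF b(1)[OF Z] Z] by simp
    also have "\<dots> = (\<integral>w. (\<integral>\<omega>. X w \<omega> * Z \<omega> \<partial>M) * K w \<partial>lborel)"
      using o[of s] b(2)[OF Z] by simp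
    also have "(\<lambda>w. (\<integral>\<omega>. X w \<omega> * Z \<omega> \<partial>M) * K w) = (\<lambda>w. 0)"
      using o K(2) by (metis atMost_iff mult_eq_0_iff not_le)
    finally show "(\<integral>\<omega>. R \<omega> * Z \<omega> \<partial>M) = 0" by simp
  qed (use sq past_algebra_measurable in auto)
  note Ri = square_integrable_integrable[OF R2] and Yi = square_integrable_integrable[OF Y2]
  have "AE \<omega> in M. real_cond_exp M ?G Y \<omega> = real_cond_exp M ?G R \<omega>"
  proof (rule G.real_cond_exp_charact[OF _ Yi G.real_cond_exp_int(1)[OF Ri] borel_measurable_cond_exp])
    fix A assume A: "A \<in> sets ?G"
    \<comment> \<open>Projection is known on past increments; replacing \<open>A\<close> by an
      almost everywhere equal set of that kind transfers it to the past of \<open>X\<close>.\<close>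
    obtain C where C: "C \<in> sets (past_sigma s)" "AE \<omega> in M. \<omega> \<in> A \<longleftrightarrow> \<omega> \<in> C"
      using past_algebra_past_sigma[OF X G0 A] by blast
    have [measurable]: "A \<in> sets M" "C \<in> sets M"
      using A C(1) G subalgebra_past_sigma[of s] by (auto simp: subalgebra_def)
    have AC: "(\<integral>\<omega>\<in>A. V \<omega> \<partial>M) = (\<integral>\<omega>. V \<omega> * indicator C \<omega> \<partial>M)" if [measurable]: "V \<in> borel_measurable M"
        for V :: "'a \<Rightarrow> real"
      unfolding set_lebesgue_integral_def
    proof (rule integral_cong_AE)
      show "AE \<omega> in M. indicator A \<omega> *\<^sub>R V \<omega> = V \<omega> * indicator C \<omega>"
        using C(2) by eventually_elim (simp add: indicator_def)
    qed measurable
    have "(\<integral>\<omega>\<in>A. Y \<omega> \<partial>M) = (\<integral>\<omega>\<in>A. R \<omega> \<partial>M)"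
      using levy_integral_projection[OF Y R C(1)] Ri Yi by (simp add: AC)
    also have "\<dots> = (\<integral>\<omega>\<in>A. real_cond_exp M ?G R \<omega> \<partial>M)"
      by (rule G.real_cond_exp_intA[OF Ri A])
    finally show "(\<integral>\<omega>\<in>A. Y \<omega> \<partial>M) = (\<integral>\<omega>\<in>A. real_cond_exp M ?G R \<omega> \<partial>M)" .
  qed
  with RR show ?thesis by eventually_elim (simp add: R_def)
qed

end

theorem proposition3p11:
  fixes M :: "'a measure" and L X :: "real \<Rightarrow> 'a \<Rightarrow> real"
    and \<beta> :: real and \<eta> :: "real set \<Rightarrow> real" and g :: "real \<Rightarrow> real"
  assumes beta: "0 < \<beta>" "\<beta> < 1 / 2"
    and M: "prob_space M"
    and L: "two_sided_levy_process M L"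
    and L_integrable: "integrable M (L 1)" "integrable M (\<lambda>\<omega>. (L 1 \<omega>)\<^sup>2)"
    and L_mean: "(\<integral>\<omega>. L 1 \<omega> \<partial>M) = 0"
    and L_var: "(\<integral>\<omega>. (L 1 \<omega>)\<^sup>2 \<partial>M) = 1"
    and eta: "finite_signed_measure borel_nonneg \<eta>"
    and eta_moment: "(\<integral>\<^sup>+u. ennreal u \<partial>total_variation borel_nonneg \<eta>) < \<infinity>"
    and h: "\<And>z. Re z \<le> 0 \<Longrightarrow> sfdde_h \<beta> \<eta> z \<noteq> 0"
    and g: "sfdde_kernel \<beta> \<eta> g"
    and X: "\<And>t. has_levy_integral M L (\<lambda>u. indicator {..t} u * g (t - u)) (X t)"
    and X_measurable: "(\<lambda>(w, \<omega>). X w \<omega>) \<in> borel_measurable (borel \<Otimes>\<^sub>M M)"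
  shows "(\<forall>r\<ge>0. g r = kernel_integral \<beta> \<eta> g {0..r} (\<lambda>_. 1)) \<and>
    (\<forall>s t. s < t \<longrightarrow>
      (AE \<omega> in M. real_cond_exp M (past_algebra M X s) (X t) \<omega> =
         g (t - s) * X s \<omega> +
         kernel_integral \<beta> \<eta> g {0..<t - s}
           (\<lambda>u. LINT w:{..s}|lborel. X w \<omega> *
              signed_integral borel_nonneg \<eta> (\<lambda>v. right_derivative_indicator \<beta> s (t - u) (v + w)))))"
proof -
  interpret prob_space M by (rule M)
  obtain P N :: "real measure" where PN: "finite_measure P" "finite_measure N" "sets P = sets borel" "sets N
      = sets borel"
    "AE v in P. 0 \<le> v" "AE v in N. 0 \<le> v"
    and rep: "\<And>f :: real \<Rightarrow> real. f \<in> borel_measurable borel \<Longrightarrow>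
       signed_integral borel_nonneg \<eta> f = (\<integral>v. f v \<partial>P) - (\<integral>v. f v \<partial>N)"
    and repc: "\<And>f :: real \<Rightarrow> complex. f \<in> borel_measurable borel \<Longrightarrow>
       signed_integral borel_nonneg \<eta> f = (\<integral>v. f v \<partial>P) - (\<integral>v. f v \<partial>N)"
    using signed_integral_borel_nonneg[OF eta] by blast
  have g': "square_integrable lborel g" "\<And>u. u < 0 \<Longrightarrow> g u = 0" "continuous_on {0..} g"
    and gF: "has_L2_fourier (\<lambda>u. complex_of_real (g u))
       (\<lambda>y. (- (\<i> * of_real y)) powr of_real (- \<beta>) / sfdde_h \<beta> \<eta> (\<i> * of_real y))"
    using g by (auto simp: sfdde_kernel_def)
  interpret sfdde_kernel_fun \<beta> P N g
    by (intro sfdde_kernel_fun.intro sfdde_measures.intro sfdde_kernel_fun_axioms.intro) (fact beta PN g')+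
  have "g t = 1 + (e \<circledast> g) t" if "0 \<le> t" for t
  proof (rule Volterra_fourier[OF gF _ that])
    fix y :: real
    have m: "(\<lambda>v. exp (\<i> * of_real y * of_real v) :: complex) \<in> borel_measurable borel" by measurable
    have "sfdde_h \<beta> \<eta> (\<i> * of_real y) = (- (\<i> * of_real y)) powr (of_real (1 - \<beta>))
       - ((\<integral>v. exp (\<i> * of_real (y * v)) \<partial>P) - (\<integral>v. exp (\<i> * of_real (y * v)) \<partial>N))"
      unfolding sfdde_h_def repc[OF m] by (simp add: mult.assoc)
    \<comment> \<open>Nonvanishing of the denominator at the boundary point \<open>\<i> * y\<close>
      lets it cancel.\<close>
    then show "(- (\<i> * of_real y)) powr of_real (- \<beta>) / sfdde_h \<beta> \<eta> (\<i> * of_real y) *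
       ((- (\<i> * of_real y)) powr (of_real (1 - \<beta>))
       - ((\<integral>v. exp (\<i> * of_real (y * v)) \<partial>P) - (\<integral>v. exp (\<i> * of_real (y * v)) \<partial>N)))
       = (- (\<i> * of_real y)) powr (- of_real \<beta>)"
      using h[of "\<i> * of_real y"] by simp
  qed
  then interpret sfdde_volterra \<beta> P N g by unfold_locales
  obtain L1 L2 where "two_sided_levy M L1 L2 L"
    using two_sided_levyI[OF L _ L_mean L_var] L_integrable by (auto simp: square_integrable_def)
  then interpret two_sided_levy M L1 L2 L .
  have G: "indicator {..t} u * g (t - u) = g (t - u)" for t u
    using g_neg[of "t - u"] by (auto simp: indicator_def)
  note X = X[unfolded G]
  define B where "B = (\<integral>u. g u * g u \<partial>lborel)"
  have GB: "(\<integral>u. g (w - u) * g (w - u) \<partial>lborel) = B" for w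
    unfolding B_def by (rule integral_shift(4)[of "\<lambda>u. g u * g u" w])
  have Gm: "(\<lambda>(w, u). g (w - u)) \<in> borel_measurable (borel \<Otimes>\<^sub>M lborel)" by measurable
  \<comment> \<open>By the isometry and translation invariance all \<open>X w\<close> share the
    second moment \<open>B\<close>, the uniform bound required for mixtures.\<close>
  have XB: "(\<integral>\<^sup>+\<omega>. ennreal ((X w \<omega>)\<^sup>2) \<partial>M) \<le> ennreal B" for w
  proof -
    have "square_integrable M (X w)" using X unfolding has_levy_integral_def by blast
    from nn_integral_square_eq[OF this] show ?thesis
      using GB[of w] levy_integral_isometry[OF X X, of w w] by (simp add: power2_eq_square)
  qed
  have one: "square_integrable M (\<lambda>_. 1 :: real)" by (simp add: square_integrable_def)
  note Xint = square_integrable_integral_bound(3)[OF sigma_finite_measure_axioms X_measurable XB _ one]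
  have Xsec: "(\<lambda>w. X w \<omega>) \<in> borel_measurable borel" if "\<omega> \<in> space M" for \<omega>
    using measurable_compose[OF measurable_Pair2'[OF that] X_measurable] by simp
  show ?thesis
  proof (intro conjI allI impI)
    fix r :: real assume "0 \<le> r"
    from kernel_integral_one[OF rep this] show "g r = kernel_integral \<beta> \<eta> g {0..r} (\<lambda>_. 1)" by simp
  next
    fix s t :: real assume st: "s < t"
    define T where "T = t - s"
    have T: "0 < T" using st by (simp add: T_def)
    let ?K = "\<lambda>w. prediction_kernel T (w - s)"
    \<comment> \<open>The truncated kernel is a mixture of the kernels of the observed values. For
      \<open>u > s\<close> both sides vanish: \<open>g (w - u)\<close> is 0 when
      \<open>w \<le> s\<close>, and the prediction kernel is 0 when \<open>w > s\<close>.\<close>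
    have f: "indicator {..s} u * g (t - u) = g T * g (s - u) + (\<integral>w. g (w - u) * ?K w \<partial>lborel)" for u
    proof (cases "u \<le> s")
      case True
      have "(\<integral>w. g (w - u) * ?K w \<partial>lborel) = (\<integral>w. g (w + (s - u)) * prediction_kernel T w \<partial>lborel)"
        using integral_shift(1)[of "\<lambda>w. g (w - u) * ?K w" s] by (simp add: algebra_simps)
      then show ?thesis using prediction_kernel_identity[of "s - u" T] True T by (simp add: T_def)
    next
      case False
      have z: "g (w - u) * ?K w = 0" for w
        using False g_neg[of "w - u"] prediction_kernel_pos[of "w - s" T] by (cases "w \<le> s") auto
      show ?thesis unfolding z using False g_neg[of "s - u"] by simp
    qed
    have cond: "AE \<omega> in M. real_cond_exp M (past_algebra M X s) (X t) \<omega> = g T * X s \<omega> + (\<integral>w. X w \<omega> * ?K w \<partial>lborel)"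
    proof (rule cond_exp_levy_mixture[OF X X_measurable Gm _ _ _ _ X f])
      show "integrable lborel ?K"
        using integrable_shift(3)[of "prediction_kernel T" s] prediction_kernel_integrable[of T] T by simp
    qed (use g_neg GB prediction_kernel_pos in auto)
    \<comment> \<open>Unfolding the single integral into the double one of the claim needs Fubini
      for a path of \<open>X\<close>; the two integrability conditions hold for almost every outcome
      because the \<open>X w\<close> are bounded in mean square.\<close>
    have "integrable lborel (\<lambda>w. indicator {..0} (w - s) * \<kappa> T (w - s))"
      using integrable_shift(3)[of "\<lambda>w. indicator {..0} w * \<kappa> T w" s] \<kappa>_integrable[of T] T by simp
    note i1 = Xint[OF this]
    have "integrable lborel (\<lambda>w. \<integral>u. \<bar>\<Lambda> T (w - s) u\<bar> \<partial>lborel)"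
      using integrable_shift(3)[of "\<lambda>w. \<integral>u. \<bar>\<Lambda> T w u\<bar> \<partial>lborel" s] \<Lambda>_majorant_integrable[of T] by simp
    note i2 = Xint[OF this]
    show "AE \<omega> in M. real_cond_exp M (past_algebra M X s) (X t) \<omega> =
         g (t - s) * X s \<omega> +
         kernel_integral \<beta> \<eta> g {0..<t - s}
           (\<lambda>u. LINT w:{..s}|lborel. X w \<omega> *
              signed_integral borel_nonneg \<eta> (\<lambda>v. right_derivative_indicator \<beta> s (t - u) (v + w)))"
      using cond i1 i2 AE_space
    proof eventually_elim
      case (elim \<omega>)
      let ?h = "\<lambda>w. X (w + s) \<omega>"
      have hm: "?h \<in> borel_measurable borel"
        by (rule measurable_compose[OF _ Xsec[OF elim(4)]]) measurable
      have h1: "integrable lborel (\<lambda>w. ?h w * (indicator {..0} w * \<kappa> T w))"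
        using elim(2) integrable_shift(1)[of "\<lambda>w. X w \<omega> * (indicator {..0} (w - s) * \<kappa> T (w - s))" s] by simp
      have h2: "integrable lborel (\<lambda>w. ?h w * (\<integral>u. \<bar>\<Lambda> T w u\<bar> \<partial>lborel))"
        using elim(3) integrable_shift(1)[of "\<lambda>w. X w \<omega> * (\<integral>u. \<bar>\<Lambda> T (w - s) u\<bar> \<partial>lborel)" s] by simp
      have "(\<integral>w. X w \<omega> * ?K w \<partial>lborel) = (\<integral>w. ?h w * prediction_kernel T w \<partial>lborel)"
        using integral_shift(1)[of "\<lambda>w. X w \<omega> * ?K w" s] by simp
      also have "\<dots> = kernel_integral \<beta> \<eta> g {0..<t - s}
           (\<lambda>u. LINT w:{..s}|lborel. X w \<omega> *
              signed_integral borel_nonneg \<eta> (\<lambda>v. right_derivative_indicator \<beta> s (t - u) (v + w)))"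
        using kernel_integral_prediction[OF rep hm h1 h2 T, of s] by (simp add: T_def)
      finally show ?case using elim(1) by (simp add: T_def)
    qed
  qed
qed

end
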